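(* The dg operad $\mathcal{BV}_\infty^{com}$ is formal with cohomology operad $H^\bullet(\mathcal{BV}_\infty^{com})$ isomorphic to the operad $\mathcal{BV}$ of Batalin–Vilkovisky algebras; i.e. there is a canonical surjective quasi-isomorphism of operads $$\pi:\mathcal{BV}_\infty^{com}\longrightarrow\mathcal{BV}$$ which sends to zero all the generators $\Delta_a$ with $a\ge2$ (and sends the multiplication to the multiplication and $\Delta_1$ to the BV operator).
   Context: The ground field has characteristic $0$. Order of an operator. For a graded commutative algebra $V$ and a linear map $D:V\to V$ put $F_1^D=D$ and $$F^D_{n+1}(v_1,\dots,v_{n+1})=F_n^D(v_1,\dots,v_{n-1},v_nv_{n+1})-F_n^D(v_1,\dots,v_n)v_{n+1}-(-1)^{|v_n||v_{n+1}|}F_n^D(v_1,\dots,v_{n-1},v_{n+1})v_n .$$ $D$ has order $\le n$ if $F^D_{n+1}=0$. A Batalin–Vilkovisky algebra is a graded commutative algebra $V$ with an operator $\Delta:V\to V$ of degree $-1$ and order $\le2$ such that $\Delta^2=0$. $\mathcal{BV}$ is the operad governing these; it is regarded as a dg operad with zero differential. A $\mathcal{BV}_\infty^{com}$-algebra is a dg graded commutative algebra $(V,d)$ with linear maps $\Delta_a:V\to V$, $a\ge1$, of degree $1-2a$ and order $\le a+1$, such that $\sum_{a=0}^n\Delta_a\circ\Delta_{n-a}=0$ for all $n\ge0$, where $\Delta_0:=-d$. $\mathcal{BV}_\infty^{com}$ is the dg operad governing these: it is generated by a degree $0$ commutative associative multiplication $\mu$ and unary operations $\Delta_a$, $a\ge1$,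 of degree $1-2a$, modulo the relations saying that $\Delta_a$ has order $\le a+1$ with respect to $\mu$, with differential $\delta\mu=0$, $\delta\Delta_a=\sum_{b+c=a,\ b,c\ge1}\Delta_b\circ\Delta_c$. *)

theory Defs
  imports
    "HOL-Algebra.Algebraic_Closure_Type"
    "HOL-Algebra.AbelCoset"
    "HOL-Algebra.Module"
    "HOL-Library.Poly_Mapping"
    "HOL-Combinatorics.Permutations"
begin

section \<open>Vector spaces over a ground field given by a type\<close>

text \<open>
  The ground field is a type \<open>'k\<close> of class field; \<open>ring_of_type_algebra\<close> turns it into a ring
  in the sense of HOL-Algebra, so that vector spaces are HOL-Algebra modules over it.
  The ring multiplication fields of module records play no role here.
\<close>

abbreviation vect :: "('k::field, 'a) module \<Rightarrow> bool" where
  "vect M \<equiv> module (ring_of_type_algebra :: 'k ring) M"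

definition lin_map :: "('k::field, 'a) module \<Rightarrow> ('k, 'b) module \<Rightarrow> ('a \<Rightarrow> 'b) \<Rightarrow> bool" where
  "lin_map M N f \<longleftrightarrow>
     f \<in> carrier M \<rightarrow> carrier N \<and>
     (\<forall>x\<in>carrier M. \<forall>y\<in>carrier M. f (x \<oplus>\<^bsub>M\<^esub> y) = f x \<oplus>\<^bsub>N\<^esub> f y) \<and>
     (\<forall>c. \<forall>x\<in>carrier M. f (c \<odot>\<^bsub>M\<^esub> x) = c \<odot>\<^bsub>N\<^esub> f x)"

text \<open>The quotient space \<open>M / N\<close>, whose elements are the cosets of \<open>N\<close> in \<open>M\<close>.\<close>

definition quot_module :: "('k::field, 'a) module \<Rightarrow> 'a set \<Rightarrow> ('k, 'a set) module" where
  "quot_module M N =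
     \<lparr> carrier = a_rcosets\<^bsub>M\<^esub> N, monoid.mult = (\<lambda>_ _. undefined), one = undefined,
       zero = N, add = set_add M,
       module.smult = (\<lambda>c C. \<Union>x\<in>C. N +>\<^bsub>M\<^esub> (c \<odot>\<^bsub>M\<^esub> x)) \<rparr>"


section \<open>Dg operads\<close>

text \<open>
  A (symmetric) dg operad \<open>P\<close> over \<open>'k\<close>. The vector space of elements of arity \<open>n\<close> and
  cohomological degree \<open>d\<close> is \<open>space P n d\<close>. As these spaces need not be disjoint, every operation
  takes the arities and degrees of its arguments as parameters:
  \<open>circ P m d n e i x y\<close> is the partial composition of \<open>x\<close> of arity \<open>m\<close> and degree \<open>d\<close> with \<open>y\<close> of
  arity \<open>n\<close> and degree \<open>e\<close>, inserting \<open>y\<close> into the \<open>i\<close>-th input of \<open>x\<close>, where \<open>1 \<le> i \<le> m\<close>;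
  \<open>act P n d \<sigma> x\<close> is the right action of the permutation \<open>\<sigma>\<close> of \<open>{1..n}\<close>;
  \<open>dif P n d\<close> is the differential from degree \<open>d\<close> to degree \<open>d + 1\<close>.
\<close>

record ('k, 'a) operad =
  space :: "nat \<Rightarrow> int \<Rightarrow> ('k, 'a) module"
  ident :: 'a
  circ :: "nat \<Rightarrow> int \<Rightarrow> nat \<Rightarrow> int \<Rightarrow> nat \<Rightarrow> 'a \<Rightarrow> 'a \<Rightarrow> 'a"
  act :: "nat \<Rightarrow> int \<Rightarrow> (nat \<Rightarrow> nat) \<Rightarrow> 'a \<Rightarrow> 'a"
  dif :: "nat \<Rightarrow> int \<Rightarrow> 'a \<Rightarrow> 'a"

abbreviation elts :: "('k, 'a) operad \<Rightarrow> nat \<Rightarrow> int \<Rightarrow> 'a set" where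
  "elts P n d \<equiv> carrier (space P n d)"

text \<open>
  The permutation of the \<open>m + n - 1\<close> inputs with
  \<open>(x \<cdot> \<sigma>) \<circ>\<^sub>i (y \<cdot> \<tau>) = (x \<circ>\<^bsub>\<sigma> i\<^esub> y) \<cdot> perm_circ n i \<sigma> \<tau>\<close> for \<open>y\<close> of arity \<open>n\<close>: the block \<open>i, \<dots>, i + n - 1\<close>
  is permuted by \<open>\<tau>\<close> inside the block starting at \<open>\<sigma> i\<close>, and the other inputs are permuted by \<open>\<sigma>\<close>.
\<close>

definition perm_circ :: "nat \<Rightarrow> nat \<Rightarrow> (nat \<Rightarrow> nat) \<Rightarrow> (nat \<Rightarrow> nat) \<Rightarrow> nat \<Rightarrow> nat" where
  "perm_circ n i \<sigma> \<tau> k =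
     (let shift = (\<lambda>p. if p < \<sigma> i then p else p + n - 1)
      in if k < i then shift (\<sigma> k)
         else if k < i + n then \<sigma> i + \<tau> (k - i + 1) - 1
         else shift (\<sigma> (k - n + 1)))"

locale dg_operad =
  fixes P :: "('k::field, 'a) operad"
  assumes vect_space: "vect (space P n d)"
    and ident_closed: "ident P \<in> elts P 1 0"
    and circ_linear_left:
      "\<lbrakk>i \<in> {1..m}; y \<in> elts P n e\<rbrakk> \<Longrightarrow>
        lin_map (space P m d) (space P (m + n - 1) (d + e)) (\<lambda>x. circ P m d n e i x y)"
    and circ_linear_right:
      "\<lbrakk>i \<in> {1..m}; x \<in> elts P m d\<rbrakk> \<Longrightarrow>
        lin_map (space P n e) (space P (m + n - 1) (d + e)) (\<lambda>y. circ P m d n e i x y)"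
    and ident_circ: "x \<in> elts P n d \<Longrightarrow> circ P 1 0 n d 1 (ident P) x = x"
    and circ_ident: "\<lbrakk>x \<in> elts P n d; i \<in> {1..n}\<rbrakk> \<Longrightarrow> circ P n d 1 0 i x (ident P) = x"
    and circ_sequential:
      "\<lbrakk>x \<in> elts P l d; y \<in> elts P m e; z \<in> elts P n f; i \<in> {1..l}; j \<in> {1..m}\<rbrakk> \<Longrightarrow>
        circ P (l + m - 1) (d + e) n f (i + j - 1) (circ P l d m e i x y) z =
        circ P l d (m + n - 1) (e + f) i x (circ P m e n f j y z)"
    and circ_parallel:
      "\<lbrakk>x \<in> elts P l d; y \<in> elts P m e; z \<in> elts P n f; i \<in> {1..l}; k \<in> {1..l}; i < k\<rbrakk> \<Longrightarrow>
        circ P (l + m - 1) (d + e) n f (k + m - 1) (circ P l d m e i x y) z =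
        ((-1) powi (e * f)) \<odot>\<^bsub>space P (l + m - 1 + n - 1) (d + e + f)\<^esub>
          circ P (l + n - 1) (d + f) m e i (circ P l d n f k x z) y"
    and act_linear: "\<sigma> permutes {1..n} \<Longrightarrow> lin_map (space P n d) (space P n d) (act P n d \<sigma>)"
    and act_id: "x \<in> elts P n d \<Longrightarrow> act P n d id x = x"
    and act_comp:
      "\<lbrakk>x \<in> elts P n d; \<sigma> permutes {1..n}; \<tau> permutes {1..n}\<rbrakk> \<Longrightarrow>
        act P n d \<tau> (act P n d \<sigma> x) = act P n d (\<sigma> \<circ> \<tau>) x"
    and circ_equivariant:
      "\<lbrakk>x \<in> elts P m d; y \<in> elts P n e; i \<in> {1..m}; \<sigma> permutes {1..m}; \<tau> permutes {1..n}\<rbrakk> \<Longrightarrow>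
        circ P m d n e i (act P m d \<sigma> x) (act P n e \<tau> y) =
        act P (m + n - 1) (d + e) (perm_circ n i \<sigma> \<tau>) (circ P m d n e (\<sigma> i) x y)"
    and dif_linear: "lin_map (space P n d) (space P n (d + 1)) (dif P n d)"
    and dif_dif: "x \<in> elts P n d \<Longrightarrow> dif P n (d + 1) (dif P n d x) = \<zero>\<^bsub>space P n (d + 2)\<^esub>"
    and dif_act:
      "\<lbrakk>x \<in> elts P n d; \<sigma> permutes {1..n}\<rbrakk> \<Longrightarrow>
        dif P n d (act P n d \<sigma> x) = act P n (d + 1) \<sigma> (dif P n d x)"
    and dif_circ:
      "\<lbrakk>x \<in> elts P m d; y \<in> elts P n e; i \<in> {1..m}\<rbrakk> \<Longrightarrow>
        dif P (m + n - 1) (d + e) (circ P m d n e i x y) =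
        circ P m (d + 1) n e i (dif P m d x) y \<oplus>\<^bsub>space P (m + n - 1) (d + e + 1)\<^esub>
        ((-1) powi d) \<odot>\<^bsub>space P (m + n - 1) (d + e + 1)\<^esub>
          circ P m d n (e + 1) i x (dif P n e y)"

locale dg_operad_hom = P: dg_operad P + Q: dg_operad Q
  for P :: "('k::field, 'a) operad" and Q :: "('k, 'b) operad" +
  fixes \<phi> :: "nat \<Rightarrow> int \<Rightarrow> 'a \<Rightarrow> 'b"
  assumes hom_linear: "lin_map (space P n d) (space Q n d) (\<phi> n d)"
    and hom_ident: "\<phi> 1 0 (ident P) = ident Q"
    and hom_circ:
      "\<lbrakk>x \<in> elts P m d; y \<in> elts P n e; i \<in> {1..m}\<rbrakk> \<Longrightarrow>
        \<phi> (m + n - 1) (d + e) (circ P m d n e i x y) = circ Q m d n e i (\<phi> m d x) (\<phi> n e y)"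
    and hom_act:
      "\<lbrakk>x \<in> elts P n d; \<sigma> permutes {1..n}\<rbrakk> \<Longrightarrow> \<phi> n d (act P n d \<sigma> x) = act Q n d \<sigma> (\<phi> n d x)"
    and hom_dif: "x \<in> elts P n d \<Longrightarrow> \<phi> n (d + 1) (dif P n d x) = dif Q n d (\<phi> n d x)"

definition surjective_hom ::
  "('k::field, 'a) operad \<Rightarrow> ('k, 'b) operad \<Rightarrow> (nat \<Rightarrow> int \<Rightarrow> 'a \<Rightarrow> 'b) \<Rightarrow> bool" where
  "surjective_hom P Q \<phi> \<longleftrightarrow> dg_operad_hom P Q \<phi> \<and> (\<forall>n d. \<phi> n d ` elts P n d = elts Q n d)"

definition operad_iso ::
  "('k::field, 'a) operad \<Rightarrow> ('k, 'b) operad \<Rightarrow> (nat \<Rightarrow> int \<Rightarrow> 'a \<Rightarrow> 'b) \<Rightarrow> bool" where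
  "operad_iso P Q \<phi> \<longleftrightarrow>
     dg_operad_hom P Q \<phi> \<and> (\<forall>n d. bij_betw (\<phi> n d) (elts P n d) (elts Q n d))"


section \<open>Quotients, cohomology and formality\<close>

text \<open>
  \<open>J n d\<close> is meant to be the part of arity \<open>n\<close> and degree \<open>d\<close> of a dg operadic ideal of \<open>P\<close>; the
  operations of the quotient are then those induced on cosets.
\<close>

definition coset :: "('k, 'a) operad \<Rightarrow> (nat \<Rightarrow> int \<Rightarrow> 'a set) \<Rightarrow> nat \<Rightarrow> int \<Rightarrow> 'a \<Rightarrow> 'a set" where
  "coset P J n d x = J n d +>\<^bsub>space P n d\<^esub> x"

definition quot_operad ::
  "('k::field, 'a) operad \<Rightarrow> (nat \<Rightarrow> int \<Rightarrow> 'a set) \<Rightarrow> ('k, 'a set) operad" where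
  "quot_operad P J =
     \<lparr> space = (\<lambda>n d. quot_module (space P n d) (J n d)),
       ident = coset P J 1 0 (ident P),
       circ = (\<lambda>m d n e i C D.
         \<Union>x\<in>C. \<Union>y\<in>D. coset P J (m + n - 1) (d + e) (circ P m d n e i x y)),
       act = (\<lambda>n d \<sigma> C. \<Union>x\<in>C. coset P J n d (act P n d \<sigma> x)),
       dif = (\<lambda>n d C. \<Union>x\<in>C. coset P J n (d + 1) (dif P n d x)) \<rparr>"

definition cycles :: "('k, 'a) operad \<Rightarrow> ('k, 'a) operad" where
  "cycles P = P\<lparr> space := \<lambda>n d. (space P n d)
     \<lparr> carrier := {x \<in> elts P n d. dif P n d x = \<zero>\<^bsub>space P n (d + 1)\<^esub>} \<rparr> \<rparr>"

definition boundaries :: "('k, 'a) operad \<Rightarrow> nat \<Rightarrow> int \<Rightarrow> 'a set" where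
  "boundaries P n d = dif P n (d - 1) ` elts P n (d - 1)"

text \<open>The differential of the cohomology operad is induced by that of the cycles, hence is zero.\<close>

definition cohomology :: "('k::field, 'a) operad \<Rightarrow> ('k, 'a set) operad" where
  "cohomology P = quot_operad (cycles P) (boundaries P)"

definition cohomology_map ::
  "('k, 'b) operad \<Rightarrow> (nat \<Rightarrow> int \<Rightarrow> 'a \<Rightarrow> 'b) \<Rightarrow> nat \<Rightarrow> int \<Rightarrow> 'a set \<Rightarrow> 'b set" where
  "cohomology_map Q \<phi> n d C = (\<Union>x\<in>C. coset (cycles Q) (boundaries Q) n d (\<phi> n d x))"

definition quasi_iso ::
  "('k::field, 'a) operad \<Rightarrow> ('k, 'b) operad \<Rightarrow> (nat \<Rightarrow> int \<Rightarrow> 'a \<Rightarrow> 'b) \<Rightarrow> bool" where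
  "quasi_iso P Q \<phi> \<longleftrightarrow> dg_operad_hom P Q \<phi> \<and>
     (\<forall>n d. bij_betw (cohomology_map Q \<phi> n d) (elts (cohomology P) n d) (elts (cohomology Q) n d))"

text \<open>
  Formality: \<open>P\<close> is connected to its cohomology by a zigzag of quasi-isomorphisms of dg operads.
  A HOL relation lives on one type, so all members of the zigzag but \<open>cohomology P\<close> have
  elements in the type of \<open>P\<close>, and the last arrow points to \<open>cohomology P\<close>. This is no loss, since
  \<open>cohomology P\<close> has an isomorphic copy (choose representatives) with elements in the type of \<open>P\<close>.
\<close>

definition formal :: "('k::field, 'a) operad \<Rightarrow> bool" where
  "formal P \<longleftrightarrow>
     (\<exists>Q :: ('k, 'a) operad. equivclp (\<lambda>A B. \<exists>\<phi>. quasi_iso A B \<phi>) P Q \<and>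
        (\<exists>\<phi>. quasi_iso Q (cohomology P) \<phi>))"

text \<open>The operadic ideal generated by a set \<open>R\<close> of triples (arity, degree, element).\<close>

inductive op_ideal ::
  "('k::field, 'a) operad \<Rightarrow> (nat \<times> int \<times> 'a) set \<Rightarrow> nat \<Rightarrow> int \<Rightarrow> 'a \<Rightarrow> bool"
  for P R where
  gen: "(n, d, r) \<in> R \<Longrightarrow> op_ideal P R n d r"
| zero: "op_ideal P R n d \<zero>\<^bsub>space P n d\<^esub>"
| add: "\<lbrakk>op_ideal P R n d x; op_ideal P R n d y\<rbrakk> \<Longrightarrow> op_ideal P R n d (x \<oplus>\<^bsub>space P n d\<^esub> y)"
| smult: "op_ideal P R n d x \<Longrightarrow> op_ideal P R n d (c \<odot>\<^bsub>space P n d\<^esub> x)"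
| act: "\<lbrakk>op_ideal P R n d x; \<sigma> permutes {1..n}\<rbrakk> \<Longrightarrow> op_ideal P R n d (act P n d \<sigma> x)"
| circ_left: "\<lbrakk>op_ideal P R m d x; y \<in> elts P n e; i \<in> {1..m}\<rbrakk> \<Longrightarrow>
    op_ideal P R (m + n - 1) (d + e) (circ P m d n e i x y)"
| circ_right: "\<lbrakk>x \<in> elts P m d; op_ideal P R n e y; i \<in> {1..m}\<rbrakk> \<Longrightarrow>
    op_ideal P R (m + n - 1) (d + e) (circ P m d n e i x y)"

definition ideal_gen ::
  "('k::field, 'a) operad \<Rightarrow> (nat \<times> int \<times> 'a) set \<Rightarrow> nat \<Rightarrow> int \<Rightarrow> 'a set" where
  "ideal_gen P R n d = {x. op_ideal P R n d x}"


section \<open>The free operad on a binary operation and unary operations\<close>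

text \<open>
  Planar trees with vertices \<open>\<mu>\<close> (binary, degree \<open>0\<close>) and \<open>\<Delta>\<^sub>a\<close> (unary, degree \<open>1 - 2a\<close>) and with
  labelled leaves. A tree whose leaves are labelled by \<open>1, \<dots>, n\<close>, once each, is the operation of
  arity \<open>n\<close> whose \<open>j\<close>-th input is the leaf labelled \<open>j\<close>; \<open>Mul s t\<close> stands for \<open>\<mu> \<circ> (s \<otimes> t)\<close>
  and \<open>Del a t\<close> for \<open>\<Delta>\<^sub>a \<circ> t\<close>. These trees form a basis of the free operad.
\<close>

datatype 'l tree = Leaf 'l | Mul "'l tree" "'l tree" | Del nat "'l tree"

primrec leaves :: "'l tree \<Rightarrow> 'l list" where
  "leaves (Leaf j) = [j]"
| "leaves (Mul s t) = leaves s @ leaves t"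
| "leaves (Del a t) = leaves t"

primrec deltas :: "'l tree \<Rightarrow> nat set" where
  "deltas (Leaf j) = {}"
| "deltas (Mul s t) = deltas s \<union> deltas t"
| "deltas (Del a t) = insert a (deltas t)"

primrec tdeg :: "'l tree \<Rightarrow> int" where
  "tdeg (Leaf j) = 0"
| "tdeg (Mul s t) = tdeg s + tdeg t"
| "tdeg (Del a t) = 1 - 2 * int a + tdeg t"

text \<open>\<open>A\<close> is the set of those \<open>a\<close> for which there is a generator \<open>\<Delta>\<^sub>a\<close>.\<close>

definition trees :: "nat set \<Rightarrow> nat \<Rightarrow> int \<Rightarrow> nat tree set" where
  "trees A n d =
     {t. distinct (leaves t) \<and> set (leaves t) = {1..n} \<and> deltas t \<subseteq> A \<and> tdeg t = d}"

primrec subst :: "('l \<Rightarrow> 'm tree) \<Rightarrow> 'l tree \<Rightarrow> 'm tree" where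
  "subst f (Leaf j) = f j"
| "subst f (Mul s t) = Mul (subst f s) (subst f t)"
| "subst f (Del a t) = Del a (subst f t)"

definition graft :: "nat \<Rightarrow> nat tree \<Rightarrow> nat tree \<Rightarrow> nat tree" where
  "graft i s t =
     subst (\<lambda>j. if j < i then Leaf j
                else if j = i then map_tree (\<lambda>l. i + l - 1) t
                else Leaf (j + length (leaves t) - 1)) s"

text \<open>
  The total degree of the vertices to the right of the leaf \<open>i\<close>. An operation grafted onto the leaf
  \<open>i\<close> has to move past these, by \<open>(s \<otimes> t) \<circ> (y \<otimes> 1) = (-1)\<^bsup>|t||y|\<^esup> (s \<circ> y) \<otimes> t\<close>.
\<close>

primrec deg_right :: "nat \<Rightarrow> nat tree \<Rightarrow> int" where
  "deg_right i (Leaf j) = 0"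
| "deg_right i (Mul s t) =
     (if i \<in> set (leaves s) then deg_right i s + tdeg t else deg_right i t)"
| "deg_right i (Del a t) = deg_right i t"

type_synonym 'k comb = "nat tree \<Rightarrow>\<^sub>0 'k"

abbreviation basis :: "nat tree \<Rightarrow> 'k::field comb" where
  "basis t \<equiv> Poly_Mapping.single t 1"

definition scale :: "'k::field \<Rightarrow> 'k comb \<Rightarrow> 'k comb" where
  "scale c = Poly_Mapping.map ((*) c)"

definition lin_ext :: "(nat tree \<Rightarrow> 'k::field comb) \<Rightarrow> 'k comb \<Rightarrow> 'k comb" where
  "lin_ext f x = (\<Sum>t\<in>Poly_Mapping.keys x. scale (Poly_Mapping.lookup x t) (f t))"

definition free_circ :: "nat \<Rightarrow> 'k::field comb \<Rightarrow> 'k comb \<Rightarrow> 'k comb" where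
  "free_circ i x y =
     lin_ext (\<lambda>s. lin_ext (\<lambda>t. scale ((-1) powi (deg_right i s * tdeg t)) (basis (graft i s t))) y) x"

text \<open>
  Right action: in \<open>x \<cdot> \<sigma>\<close> the variable \<open>j\<close> is put into the input \<open>\<sigma> j\<close> of \<open>x\<close>, so that the leaf
  with label \<open>\<sigma> j\<close> gets the label \<open>j\<close>.
\<close>

definition free_act :: "(nat \<Rightarrow> nat) \<Rightarrow> 'k::field comb \<Rightarrow> 'k comb" where
  "free_act \<sigma> = lin_ext (\<lambda>t. basis (map_tree (inv_into UNIV \<sigma>) t))"

definition free_space :: "nat set \<Rightarrow> nat \<Rightarrow> int \<Rightarrow> ('k::field, 'k comb) module" where
  "free_space A n d =
     \<lparr> carrier = {x. Poly_Mapping.keys x \<subseteq> trees A n d},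
       monoid.mult = (\<lambda>_ _. undefined), one = undefined,
       zero = 0, add = (+), module.smult = scale \<rparr>"

definition free_operad :: "nat set \<Rightarrow> ('k comb \<Rightarrow> 'k comb) \<Rightarrow> ('k::field, 'k comb) operad" where
  "free_operad A D =
     \<lparr> space = free_space A,
       ident = basis (Leaf 1),
       circ = (\<lambda>m d n e i. free_circ i),
       act = (\<lambda>n d. free_act),
       dif = (\<lambda>n d. D) \<rparr>"


section \<open>The operads \<open>BV\<close> and \<open>BV\<^sub>\<infinity>\<^sup>c\<^sup>o\<^sup>m\<close>\<close>

definition mu :: "'k::field comb" where
  "mu = basis (Mul (Leaf 1) (Leaf 2))"

definition Delta :: "nat \<Rightarrow> 'k::field comb" where
  "Delta a = basis (Del a (Leaf 1))"

text \<open>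
  \<open>order_op D n\<close> is the \<open>n\<close>-ary operation \<open>F\<^sub>n\<^sup>D\<close>, for \<open>n \<ge> 1\<close>. The signs
  \<open>(-1)\<^bsup>|v\<^sub>n||v\<^sub>n\<^sub>+\<^sub>1|\<^esup>\<close> appearing in its evaluation on elements \<open>v\<^sub>1, \<dots>, v\<^sub>n\<^sub>+\<^sub>1\<close> of an algebra come from the
  action of the transposition of \<open>n\<close> and \<open>n + 1\<close>.
\<close>

fun order_op :: "'k::field comb \<Rightarrow> nat \<Rightarrow> 'k comb" where
  "order_op D 0 = 0"
| "order_op D (Suc 0) = D"
| "order_op D (Suc (Suc k)) =
     (let n = Suc k; F = order_op D n; G = free_circ 1 mu F
      in free_circ n F mu - G - free_act (transpose n (n + 1)) G)"

definition com_relations :: "(nat \<times> int \<times> 'k::field comb) set" where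
  "com_relations =
     {(2, 0, free_act (transpose 1 2) mu - mu),
      (3, 0, free_circ 1 mu mu - free_circ 2 mu mu)}"

text \<open>\<open>\<Delta>\<^sub>a\<close> has order at most \<open>a + 1\<close>.\<close>

definition order_relation :: "nat \<Rightarrow> nat \<times> int \<times> 'k::field comb" where
  "order_relation a = (a + 2, 1 - 2 * int a, order_op (Delta a) (a + 2))"

definition BV_free :: "('k::field, 'k comb) operad" where
  "BV_free = free_operad {1} (\<lambda>_. 0)"

definition BV_ideal :: "nat \<Rightarrow> int \<Rightarrow> 'k::field comb set" where
  "BV_ideal = ideal_gen BV_free
     (com_relations \<union> {order_relation 1, (1, -2, free_circ 1 (Delta 1) (Delta 1))})"

definition BV :: "('k::field, 'k comb set) operad" where
  "BV = quot_operad BV_free BV_ideal"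

text \<open>
  The value on trees of the derivation \<open>\<delta>\<close> of the free operad with \<open>\<delta> \<mu> = 0\<close> and
  \<open>\<delta> \<Delta>\<^sub>a = \<Sum> \<Delta>\<^sub>b \<circ> \<Delta>\<^sub>c\<close>, summed over \<open>b + c = a\<close> with \<open>b, c \<ge> 1\<close>. Note that \<open>\<Delta>\<^sub>a\<close> has odd degree.
\<close>

primrec tree_delta :: "nat tree \<Rightarrow> 'k::field comb" where
  "tree_delta (Leaf j) = 0"
| "tree_delta (Mul s t) =
     lin_ext (\<lambda>s'. basis (Mul s' t)) (tree_delta s) +
     scale ((-1) powi tdeg s) (lin_ext (\<lambda>t'. basis (Mul s t')) (tree_delta t))"
| "tree_delta (Del a t) =
     (\<Sum>b\<in>{1..<a}. basis (Del b (Del (a - b) t))) -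
     lin_ext (\<lambda>t'. basis (Del a t')) (tree_delta t)"

definition BV_inf_free :: "('k::field, 'k comb) operad" where
  "BV_inf_free = free_operad {1..} (lin_ext tree_delta)"

definition BV_inf_ideal :: "nat \<Rightarrow> int \<Rightarrow> 'k::field comb set" where
  "BV_inf_ideal = ideal_gen BV_inf_free (com_relations \<union> order_relation ` {1..})"

definition BV_inf_com :: "('k::field, 'k comb set) operad" where
  "BV_inf_com = quot_operad BV_inf_free BV_inf_ideal"

definition BV_mu :: "'k::field comb set" where
  "BV_mu = coset BV_free BV_ideal 2 0 mu"

definition BV_Delta :: "'k::field comb set" where
  "BV_Delta = coset BV_free BV_ideal 1 (-1) (Delta 1)"

definition BV_inf_mu :: "'k::field comb set" where
  "BV_inf_mu = coset BV_inf_free BV_inf_ideal 2 0 mu"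

definition BV_inf_Delta :: "nat \<Rightarrow> 'k::field comb set" where
  "BV_inf_Delta a = coset BV_inf_free BV_inf_ideal 1 (1 - 2 * int a) (Delta a)"

definition canonical_on_generators ::
  "(nat \<Rightarrow> int \<Rightarrow> 'k::field comb set \<Rightarrow> 'k comb set) \<Rightarrow> bool" where
  "canonical_on_generators \<phi> \<longleftrightarrow>
     \<phi> 2 0 BV_inf_mu = BV_mu \<and>
     \<phi> 1 (-1) (BV_inf_Delta 1) = BV_Delta \<and>
     (\<forall>a\<ge>2. \<phi> 1 (1 - 2 * int a) (BV_inf_Delta a)
        = \<zero>\<^bsub>space (BV :: ('k, 'k comb set) operad) 1 (1 - 2 * int a)\<^esub>)"

end

theory Submission
  imports Defs "HOL-Library.Countable" "HOL-Library.FSet"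
begin

text \<open>
  The free graded commutative algebra on the inputs with its brackets (the operations \<open>F\<^sub>k\<close> of
  \<open>\<Delta>\<^sub>a\<close>, for \<open>1 \<le> k \<le> a + 1\<close>) has a basis of forests: a monomial is a set of trees with leaves the inputs, and a
  node with label \<open>a\<close> and at most \<open>a + 1\<close> children is a bracket of \<open>\<Delta>\<^sub>a\<close>. Evaluating operations on these
  forests identifies \<open>BV\<^sub>\<infinity>\<^sup>c\<^sup>o\<^sup>m\<close> with the complex spanned by the forests. Indeed the commutativity, associativity
  and order relations reduce every tree of operations to normal forms with distinct shapes, and a normal
  form evaluates to its shape plus forests of smaller measure.

  The differential splits a node of label \<open>a\<close> into two nodes whose labels add up to \<open>a\<close>. An acyclic matching
  pairs forests in such a way that every unmatched one has only the label \<open>1\<close>: along the path to the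
  least leaf, a node of label \<open>a \<ge> 2\<close> is matched with the result of splitting off its other children. Hence
  every cycle is homologous to a cycle \<open>c\<close> involving only \<open>\<mu>\<close> and \<open>\<Delta>\<^sub>1\<close>. If \<open>c\<close> vanishes in \<open>BV\<close>, it is a
  boundary, because the relation \<open>\<Delta>\<^sub>1 \<circ> \<Delta>\<^sub>1 = 0\<close> of \<open>BV\<close> is \<open>\<delta> \<Delta>\<^sub>2\<close> and the other relations hold already in
  \<open>BV\<^sub>\<infinity>\<^sup>c\<^sup>o\<^sup>m\<close>. So \<open>\<pi>\<close> is injective on cohomology; it is onto since every operation of \<open>BV\<close> lifts to a cycle.
\<close>

section \<open>Linear extension\<close>

text \<open>That the ideal is stable under the differential, so that the quotient is a dg operad at
  all, is not checked on the order relations. It follows from the model: evaluation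
  \<open>EE\<close> intertwines \<open>delta\<close> with \<open>dN\<close>, and its kernel is
  exactly the ideal. An obstacle is showing that the ideal evaluates to zero: arguments are taken
  even to avoid Koszul signs, but a composition may feed an odd value into an input. Multiplying
  that value by an adjoined odd scalar repairs this. Only multilinear values are needed, hence
  monomials are sets of trees, and products with common labels are zero. Acyclicity rests on two
  kinds of matched pairs. A node with several children is split beside the path to the least leaf,
  which keeps the number of nodes on that path; a node with one child is split on the path itself.
  Along pairs of the first kind the number of nodes on the path grows strictly while the degree
  bounds it; a pair of the second kind ends a gradient path. Characteristic 0 enters through a
  division by 2 in \<open>dN_DD\<close>, where a sum equal to its own negative has to
  vanish.\<close>

abbreviation lkp :: "('a \<Rightarrow>\<^sub>0 'k::zero) \<Rightarrow> 'a \<Rightarrow> 'k" where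
  "lkp \<equiv> Poly_Mapping.lookup"

abbreviation keys :: "('a \<Rightarrow>\<^sub>0 'k::zero) \<Rightarrow> 'a set" where
  "keys \<equiv> Poly_Mapping.keys"

abbreviation bs :: "'a \<Rightarrow> ('a \<Rightarrow>\<^sub>0 'k::field)" where
  "bs t \<equiv> Poly_Mapping.single t 1"

definition psc :: "'k::field \<Rightarrow> ('a \<Rightarrow>\<^sub>0 'k) \<Rightarrow> ('a \<Rightarrow>\<^sub>0 'k)" where
  "psc c = Poly_Mapping.map ((*) c)"

text \<open>The same formula as \<open>lin_ext\<close> for arbitrary bases, because combinations of
  forests are needed besides combinations of trees.\<close>

definition lin :: "('a \<Rightarrow> ('b \<Rightarrow>\<^sub>0 'k::field)) \<Rightarrow> ('a \<Rightarrow>\<^sub>0 'k) \<Rightarrow> ('b \<Rightarrow>\<^sub>0 'k)" where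
  "lin f x = (\<Sum>t\<in>keys x. psc (lkp x t) (f t))"

definition plinear :: "(('a \<Rightarrow>\<^sub>0 'k::field) \<Rightarrow> ('b \<Rightarrow>\<^sub>0 'k)) \<Rightarrow> bool" where
  "plinear f \<longleftrightarrow> (\<forall>x y. f (x + y) = f x + f y) \<and> (\<forall>c x. f (psc c x) = psc c (f x))"

lemma scale_psc: "scale = psc"
  by (simp add: fun_eq_iff scale_def psc_def)

lemma lin_ext_lin: "lin_ext = lin"
  by (simp add: fun_eq_iff lin_ext_def lin_def scale_psc)

lemma lkp_psc [simp]: "lkp (psc c x) t = c * lkp x t"
  by (simp add: psc_def Poly_Mapping.map.rep_eq when_def)

lemma psc_add: "psc c (x + y) = psc c x + psc c y"
  by (rule poly_mapping_eqI) (simp add: lookup_add algebra_simps)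

lemma psc_add_left: "psc (c + d) x = psc c x + psc d x"
  by (rule poly_mapping_eqI) (simp add: lookup_add algebra_simps)

lemma psc_psc [simp]: "psc c (psc d x) = psc (c * d) x"
  by (rule poly_mapping_eqI) (simp add: algebra_simps)

lemma psc_1 [simp]: "psc 1 x = x"
  by (rule poly_mapping_eqI) simp

lemma psc_0 [simp]: "psc 0 x = 0"
  by (rule poly_mapping_eqI) simp

lemma psc_zero [simp]: "psc c 0 = 0"
  by (rule poly_mapping_eqI) simp

lemma psc_minus_1: "psc (- 1) x = - x"
  by (rule poly_mapping_eqI) simp

lemma psc_uminus: "psc (- c) x = - psc c x"
  by (rule poly_mapping_eqI) simp

lemma psc_minus: "psc c (- x) = - psc c x"
  by (rule poly_mapping_eqI) simp

lemma psc_diff: "psc c (x - y) = psc c x - psc c y"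
  by (rule poly_mapping_eqI) (simp add: lookup_minus algebra_simps)

lemma psc_sum: "psc c (sum f S) = (\<Sum>s\<in>S. psc c (f s))"
  by (induction S rule: infinite_finite_induct) (auto simp: psc_add)

lemma keys_psc: "keys (psc c x) \<subseteq> keys x"
  by (auto simp: in_keys_iff)

lemma lin_superset: "finite S \<Longrightarrow> keys x \<subseteq> S \<Longrightarrow> lin f x = (\<Sum>t\<in>S. psc (lkp x t) (f t))"
  unfolding lin_def by (rule sum.mono_neutral_left) (auto simp: in_keys_iff)

lemma lin_add: "lin f (x + y) = lin f x + lin f y"
proof -
  let ?S = "keys x \<union> keys y"
  have "lin f (x + y) = (\<Sum>t\<in>?S. psc (lkp (x + y) t) (f t))"
    by (rule lin_superset) (use keys_add[of x y] in auto)
  also have "\<dots> = (\<Sum>t\<in>?S. psc (lkp x t) (f t)) + (\<Sum>t\<in>?S. psc (lkp y t) (f t))"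
    by (simp add: lookup_add psc_add_left sum.distrib)
  finally show ?thesis
    by (simp add: lin_superset[of ?S])
qed

lemma lin_psc: "lin f (psc c x) = psc c (lin f x)"
  using lin_superset[of "keys x" "psc c x" f] keys_psc[of c x]
  by (simp add: lin_def psc_sum)

lemma lin_bs [simp]: "lin f (bs t) = f t"
  by (simp add: lin_def)

lemma lin_zero [simp]: "lin f 0 = 0"
  by (simp add: lin_def)

named_theorems plinear_intros

lemma plinear_lin [plinear_intros]: "plinear (lin f)"
  by (simp add: plinear_def lin_add lin_psc)

lemma plinear_add: "plinear f \<Longrightarrow> f (x + y) = f x + f y"
  by (simp add: plinear_def)

lemma plinear_psc: "plinear f \<Longrightarrow> f (psc c x) = psc c (f x)"
  by (simp add: plinear_def)

lemma plinear_zero: "plinear f \<Longrightarrow> f 0 = 0"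
  using plinear_psc[of f 0 0] by simp

lemma plinear_uminus: "plinear f \<Longrightarrow> f (- x) = - f x"
  using plinear_psc[of f "- 1" x] by (simp add: psc_minus_1)

lemma plinear_diff: "plinear f \<Longrightarrow> f (x - y) = f x - f y"
  using plinear_add[of f x "- y"] plinear_uminus[of f y] by simp

lemma plinear_sum: "plinear f \<Longrightarrow> f (sum g S) = (\<Sum>s\<in>S. f (g s))"
  by (induction S rule: infinite_finite_induct) (auto simp: plinear_add plinear_zero)

lemma poly_mapping_expand: "x = (\<Sum>t\<in>keys x. psc (lkp x t) (bs t))"
proof (rule poly_mapping_eqI)
  fix s
  have "(\<Sum>t\<in>keys x. lkp (psc (lkp x t) (bs t)) s) = (\<Sum>t\<in>keys x. if t = s then lkp x s else 0)"
    by (intro sum.cong) (auto simp: lookup_single)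
  also have "\<dots> = lkp x s"
    by (auto simp: in_keys_iff)
  finally show "lkp x s = lkp (\<Sum>t\<in>keys x. psc (lkp x t) (bs t)) s"
    by (simp add: lookup_sum)
qed

lemma plinear_eq_lin: "plinear f \<Longrightarrow> f x = lin (\<lambda>t. f (bs t)) x"
  using arg_cong[OF poly_mapping_expand[of x], of f] by (simp add: plinear_sum plinear_psc lin_def)

text \<open>The test is restricted to the support of \<open>x\<close>, so that identities valid only
  for trees of a given arity and degree can still be checked on basis elements.\<close>

lemma plinear_eqI:
  "plinear f \<Longrightarrow> plinear g \<Longrightarrow> (\<And>t. t \<in> keys x \<Longrightarrow> f (bs t) = g (bs t)) \<Longrightarrow> f x = g x"
  unfolding plinear_eq_lin[of f x] plinear_eq_lin[of g x] lin_def by (rule sum.cong) auto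

lemma lin_cong: "x = y \<Longrightarrow> (\<And>t. t \<in> keys y \<Longrightarrow> f t = g t) \<Longrightarrow> lin f x = lin g y"
  by (simp add: lin_def)

lemma plinear_id [plinear_intros]: "plinear (\<lambda>x. x)"
  by (simp add: plinear_def)

lemma plinear_const0 [plinear_intros]: "plinear (\<lambda>x. 0)"
  by (simp add: plinear_def)

lemma plinear_compose [plinear_intros]: "plinear f \<Longrightarrow> plinear (\<lambda>x. lin g (f x))"
  by (simp add: plinear_def lin_add lin_psc)

lemma plinear_comp: "plinear g \<Longrightarrow> plinear f \<Longrightarrow> plinear (\<lambda>x. g (f x))"
  by (simp add: plinear_def)

lemma plinear_plus [plinear_intros]: "plinear f \<Longrightarrow> plinear g \<Longrightarrow> plinear (\<lambda>x. f x + g x)"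
  by (simp add: plinear_def psc_add algebra_simps)

lemma plinear_minus [plinear_intros]: "plinear f \<Longrightarrow> plinear g \<Longrightarrow> plinear (\<lambda>x. f x - g x)"
  by (simp add: plinear_def psc_diff algebra_simps)

lemma plinear_neg [plinear_intros]: "plinear f \<Longrightarrow> plinear (\<lambda>x. - f x)"
  by (simp add: plinear_def psc_minus algebra_simps)

lemma plinear_scale [plinear_intros]: "plinear f \<Longrightarrow> plinear (\<lambda>x. psc c (f x))"
  by (simp add: plinear_def psc_add algebra_simps)

lemma plinear_Sum [plinear_intros]: "(\<And>s. s \<in> S \<Longrightarrow> plinear (f s)) \<Longrightarrow> plinear (\<lambda>x. \<Sum>s\<in>S. f s x)"
  by (simp add: plinear_def sum.distrib psc_sum)

lemma plinear_lin_param [plinear_intros]: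
  "(\<And>t. plinear (\<lambda>x. f x t)) \<Longrightarrow> plinear (\<lambda>x. lin (f x) y)"
  by (simp add: plinear_def lin_def sum.distrib psc_sum psc_add algebra_simps)

lemma lin_lin: "lin f (lin g x) = lin (\<lambda>t. lin f (g t)) x"
  by (rule plinear_eqI[where f = "\<lambda>x. lin f (lin g x)" and g = "lin (\<lambda>t. lin f (g t))"])
    (simp_all add: plinear_lin plinear_compose)

lemma lin_swap: "lin (\<lambda>s. lin (\<lambda>t. f s t) y) x = lin (\<lambda>t. lin (\<lambda>s. f s t) x) y"
  by (rule plinear_eqI[where f = "lin (\<lambda>s. lin (\<lambda>t. f s t) y)" and g = "\<lambda>x. lin (\<lambda>t. lin (\<lambda>s. f s t) x) y"])
    (simp_all add: plinear_lin plinear_lin_param)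

lemma lin_psc_fun: "lin (\<lambda>t. psc c (f t)) x = psc c (lin f x)"
  by (simp add: lin_def psc_sum mult.commute)

lemma lin_plus_fun: "lin (\<lambda>t. f t + g t) x = lin f x + lin g x"
  by (simp add: lin_def psc_add sum.distrib)

lemma lin_zero_fun [simp]: "lin (\<lambda>t. 0) x = 0"
  by (simp add: lin_def)

lemma lin_id [simp]: "lin bs x = x"
  using poly_mapping_expand[of x] by (simp add: lin_def)

lemma lin_sum: "lin f (sum g S) = (\<Sum>s\<in>S. lin f (g s))"
  by (rule plinear_sum) (rule plinear_lin)

lemma lin_diff: "lin f (x - y) = lin f x - lin f y"
  by (rule plinear_diff) (rule plinear_lin)

lemma keys_lin: "keys (lin f x) \<subseteq> (\<Union>t\<in>keys x. keys (f t))"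
  unfolding lin_def by (rule subset_trans[OF keys_sum UN_mono]) (auto simp: keys_psc)

lemma in_keys_linE:
  assumes "s \<in> keys (lin f x)"
  obtains t where "t \<in> keys x" "s \<in> keys (f t)"
  using subsetD[OF keys_lin assms] by auto

lemma keys_plusE: "s \<in> keys (x + y) \<Longrightarrow> s \<in> keys x \<or> s \<in> keys y"
  using keys_add[of x y] by auto

lemma keys_minusE: "s \<in> keys (x - y) \<Longrightarrow> s \<in> keys x \<or> s \<in> keys y"
  by (auto simp: in_keys_iff lookup_minus)

lemma keys_sumE: 
  assumes "s \<in> keys (sum f S)" 
  obtains t where "t \<in> S" "s \<in> keys (f t)"
  using subsetD[OF keys_sum assms] by auto

lemma keys_bs [simp]: "keys (bs t :: 'a \<Rightarrow>\<^sub>0 'k::field) = {t}"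
  by simp

text \<open>A parity test in place of an integer power: comparing two signs becomes a divisibility
  question, which \<open>ep_cong\<close> isolates.\<close>

definition ep :: "int \<Rightarrow> 'k::field" where
  "ep k = (if even k then 1 else - 1)"

lemma powi_ep: "(- 1) powi k = (ep k :: 'k::field)"
  by (simp add: ep_def power_int_minus_left)

lemma ep_add: "ep (a + b) = ep a * ep b"
  by (simp add: ep_def)

lemma ep_diff: "ep (a - b) = ep a * ep b"
  by (simp add: ep_def)

lemma ep_0 [simp]: "ep 0 = 1"
  by (simp add: ep_def)

lemma ep_1 [simp]: "ep 1 = - 1"
  by (simp add: ep_def)

lemma ep_square [simp]: "ep a * ep a = 1"
  by (simp add: ep_def)

lemma ep_square_left [simp]: "ep a * (ep a * x) = x"
  by (simp add: ep_def)

lemma ep_nonzero [simp]: "ep a \<noteq> 0"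
  by (simp add: ep_def)

lemma ep_cong: "even (a - b) \<Longrightarrow> ep a = ep b"
  by (simp add: ep_def)

section \<open>Trees\<close>

abbreviation lset :: "'l tree \<Rightarrow> 'l set" where
  "lset t \<equiv> set (leaves t)"

definition trees_on :: "nat set \<Rightarrow> nat set \<Rightarrow> int \<Rightarrow> nat tree set" where
  "trees_on A V d =
     {t. distinct (leaves t) \<and> lset t = V \<and> deltas t \<subseteq> A \<and> tdeg t = d}"

lemma trees_trees_on: "trees A n d = trees_on A {1..n} d"
  by (simp add: trees_def trees_on_def)

lemma leaves_nonempty [simp]: "leaves t \<noteq> []"
  by (induction t) auto

lemma leaves_map_tree [simp]: "leaves (map_tree g t) = map g (leaves t)"
  by (induction t) auto

lemma deltas_map_tree [simp]: "deltas (map_tree g t) = deltas t"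
  by (induction t) auto

lemma tdeg_map_tree [simp]: "tdeg (map_tree g t) = tdeg t"
  by (induction t) auto

lemma map_tree_subst: "map_tree g t = subst (\<lambda>j. Leaf (g j)) t"
  by (induction t) auto

lemma subst_subst: "subst f (subst g t) = subst (\<lambda>j. subst f (g j)) t"
  by (induction t) auto

lemma subst_cong: "(\<And>j. j \<in> lset t \<Longrightarrow> f j = g j) \<Longrightarrow> subst f t = subst g t"
  by (induction t) auto

lemma subst_Leaf: "subst Leaf t = t"
  by (induction t) auto

lemma subst_map_tree: "subst f (map_tree g t) = subst (\<lambda>j. f (g j)) t"
  by (simp add: map_tree_subst subst_subst)

lemma map_tree_subst': "map_tree g (subst f t) = subst (\<lambda>j. map_tree g (f j)) t"
  by (simp add: map_tree_subst subst_subst)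

lemma map_tree_cong': "(\<And>j. j \<in> lset t \<Longrightarrow> f j = g j) \<Longrightarrow> map_tree f t = map_tree g t"
  by (simp add: map_tree_subst cong: subst_cong)

lemma map_tree_map_tree: "map_tree f (map_tree g t) = map_tree (\<lambda>j. f (g j)) t"
  by (simp add: tree.map_comp comp_def)

lemma map_tree_ident': "(\<And>j. j \<in> lset t \<Longrightarrow> f j = j) \<Longrightarrow> map_tree f t = t"
  using map_tree_cong'[of t f "\<lambda>j. j"] by (simp add: tree.map_ident)

lemma set_leaves_subst: "lset (subst f t) = (\<Union>j\<in>lset t. lset (f j))"
  by (induction t) auto

lemma deltas_subst: "deltas (subst f t) = deltas t \<union> (\<Union>j\<in>lset t. deltas (f j))"
  by (induction t) auto

lemma tdeg_subst: "distinct (leaves t) \<Longrightarrow> tdeg (subst f t) = tdeg t + (\<Sum>j\<in>lset t. tdeg (f j))"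
  by (induction t) (auto simp: sum.union_disjoint)

lemma distinct_leaves_subst:
  assumes "distinct (leaves t)" "\<And>j. j \<in> lset t \<Longrightarrow> distinct (leaves (f j))"
    "\<And>j k. \<lbrakk>j \<in> lset t; k \<in> lset t; j \<noteq> k\<rbrakk> \<Longrightarrow>
      lset (f j) \<inter> lset (f k) = {}"
  shows "distinct (leaves (subst f t))"
  using assms
proof (induction t)
  case (Mul s t)
  have "lset (subst f s) \<inter> lset (subst f t) = {}"
    using Mul.prems(1,3) by (fastforce simp: set_leaves_subst)
  with Mul show ?case
    by simp
qed auto

lemma subst_in_trees_on:
  assumes "t \<in> trees_on A V d" "\<And>j. j \<in> V \<Longrightarrow> f j \<in> trees_on A (Y j) (e j)"
    "\<And>j k. \<lbrakk>j \<in> V; k \<in> V; j \<noteq> k\<rbrakk> \<Longrightarrow> Y j \<inter> Y k = {}"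
  shows "subst f t \<in> trees_on A (\<Union>j\<in>V. Y j) (d + (\<Sum>j\<in>V. e j))"
proof -
  have "distinct (leaves (subst f t))"
    using assms by (intro distinct_leaves_subst) (simp_all add: trees_on_def)
  then show ?thesis
    using assms(1,2) by (auto simp: trees_on_def set_leaves_subst deltas_subst tdeg_subst)
qed

lemma trees_on_finite: "t \<in> trees_on A V d \<Longrightarrow> finite V"
  by (auto simp: trees_on_def)

lemma trees_on_nonempty: "t \<in> trees_on A V d \<Longrightarrow> V \<noteq> {}"
  using leaves_nonempty by (auto simp: trees_on_def)

lemma length_leaves: "t \<in> trees A n d \<Longrightarrow> length (leaves t) = n"
  by (auto simp: trees_def dest: distinct_card)

lemma trees_pos: "t \<in> trees A n d \<Longrightarrow> 1 \<le> n"
  using trees_on_nonempty by (force simp: trees_trees_on)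

lemma map_tree_in_trees_on:
  "t \<in> trees_on A V d \<Longrightarrow> inj_on g V \<Longrightarrow> map_tree g t \<in> trees_on A (g ` V) d"
  by (auto simp: trees_on_def distinct_map)

section \<open>Grafting of trees\<close>

lemma graft_subst:
  "t \<in> trees A n e \<Longrightarrow> graft i s t =
     subst (\<lambda>j. if j < i then Leaf j else if j = i then map_tree (\<lambda>l. i + l - 1) t
                else Leaf (j + n - 1)) s"
  unfolding graft_def by (subst length_leaves, assumption) (rule refl)

lemma inj_on_block: "inj_on (\<lambda>l. i + l - 1) {1..n::nat}"
  by (auto simp: inj_on_def)

lemma image_block: "1 \<le> i \<Longrightarrow> (\<lambda>l::nat. i + l - 1) ` {1..n} = {i..<i + n}"
proof (intro equalityI subsetI)
  fix k assume "1 \<le> i" "k \<in> {i..<i + n}"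
  then show "k \<in> (\<lambda>l. i + l - 1) ` {1..n}"
    by (intro image_eqI[of _ _ "k - i + 1"]) auto
qed auto

lemma graft_in_trees:
  assumes s: "s \<in> trees A m d" and t: "t \<in> trees A n e" and i: "i \<in> {1..m}"
  shows "graft i s t \<in> trees A (m + n - 1) (d + e)"
proof -
  let ?Y = "\<lambda>j. if j < i then {j} else if j = i then {i..<i + n} else {j + n - 1}"
  have n: "1 \<le> n"
    using trees_pos t by blast
  have "map_tree (\<lambda>l. i + l - 1) t \<in> trees_on A {i..<i + n} e"
    using map_tree_in_trees_on[OF t[unfolded trees_trees_on] inj_on_block[of i]] image_block[of i n] i
    by simp
  then have "graft i s t \<in> trees_on A (\<Union>j\<in>{1..m}. ?Y j) (d + (\<Sum>j\<in>{1..m}. if j = i then e else 0))"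
    unfolding graft_subst[OF t]
    by (intro subst_in_trees_on) (use s n in \<open>auto simp: trees_trees_on trees_on_def split: if_splits\<close>)
  moreover have "(\<Union>j\<in>{1..m}. ?Y j) = {1..m + n - 1}"
  proof (intro equalityI subsetI)
    fix k assume k: "k \<in> {1..m + n - 1}"
    consider "k < i" | "k \<in> {i..<i + n}" | "i + n \<le> k"
      by fastforce
    then show "k \<in> (\<Union>j\<in>{1..m}. ?Y j)"
    proof cases
      case 3
      then have "k - n + 1 \<in> {1..m}" "k \<in> ?Y (k - n + 1)"
        using k n i by auto
      then show ?thesis
        by blast
    qed (use k i in \<open>auto intro: bexI[of _ k] bexI[of _ i]\<close>)
  qed (use i n in \<open>auto split: if_splits\<close>)
  ultimately show ?thesis
    using i by (simp add: trees_trees_on)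
qed

text \<open>The leaf \<open>i\<close> lies to the right of the leaf \<open>j\<close>.\<close>

primrec right_of :: "nat \<Rightarrow> nat \<Rightarrow> nat tree \<Rightarrow> bool" where
  "right_of j i (Leaf k) = False"
| "right_of j i (Mul s t) =
     (if j \<in> lset s then i \<in> lset t \<or> right_of j i s else right_of j i t)"
| "right_of j i (Del a t) = right_of j i t"

lemma right_of_leaf: "right_of j i s \<Longrightarrow> i \<in> lset s"
  by (induction s) (auto split: if_splits)

text \<open>Leaves of a planar tree are linearly ordered. In a parallel composition exactly one of
  the two orders of insertion therefore moves one inserted operation past the other, and this is the
  origin of the sign in that axiom.\<close>

lemma right_of_swap:
  "\<lbrakk>distinct (leaves s); i \<in> lset s; j \<in> lset s; i \<noteq> j\<rbrakk> \<Longrightarrow>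
    right_of j i s \<longleftrightarrow> \<not> right_of i j s"
  by (induction s) (auto dest: right_of_leaf)

lemma deg_right_notin: "i \<notin> lset s \<Longrightarrow> deg_right i s = 0"
  by (induction s) auto

lemma deg_right_map_tree:
  "\<lbrakk>inj_on g (lset s); i \<in> lset s\<rbrakk> \<Longrightarrow> deg_right (g i) (map_tree g s) = deg_right i s"
proof (induction s)
  case (Mul s t)
  then have "inj_on g (lset s)" "inj_on g (lset t)"
    by (auto simp: inj_on_Un)
  moreover have "g i \<in> g ` lset s \<longleftrightarrow> i \<in> lset s"
    using Mul.prems by (auto simp: inj_on_def)
  ultimately show ?case
    using Mul by auto
qed auto

lemma tdeg_subst_one:
  assumes "distinct (leaves s)" "\<And>j. j \<in> lset s \<Longrightarrow> j \<noteq> i \<Longrightarrow> f j = Leaf (g j)"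
  shows "tdeg (subst f s) = tdeg s + (if i \<in> lset s then tdeg (f i) else 0)"
proof -
  have "(\<Sum>j\<in>lset s. tdeg (f j)) = (\<Sum>j\<in>lset s. if j = i then tdeg (f i) else 0)"
    using assms(2) by (intro sum.cong) auto
  then show ?thesis
    using assms(1) by (simp add: tdeg_subst)
qed

text \<open>The vertices to the right of a leaf of the inserted tree are those to its right inside
  that tree, together with those to the right of the insertion point in \<open>s\<close>. This
  additivity gives the sign in the sequential composition axiom.\<close>

lemma deg_right_subst_in:
  assumes "distinct (leaves s)" "i \<in> lset s" "k \<in> lset (f i)"
    "\<And>j. j \<in> lset s \<Longrightarrow> j \<noteq> i \<Longrightarrow> f j = Leaf (g j) \<and> g j \<notin> lset (f i)"
  shows "deg_right k (subst f s) = deg_right k (f i) + deg_right i s"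
  using assms
proof (induction s)
  case (Mul s t)
  show ?case
  proof (cases "i \<in> lset s")
    case True
    then have "i \<notin> lset t"
      using Mul.prems by auto
    then have "tdeg (subst f t) = tdeg t"
      using tdeg_subst_one[where s = t and i = i and f = f and g = g] Mul.prems by auto
    moreover have "k \<in> lset (subst f s)"
      using True Mul.prems by (auto simp: set_leaves_subst)
    ultimately show ?thesis
      using True Mul by simp
  next
    case False
    have "k \<notin> lset (subst f s)"
    proof
      assume "k \<in> lset (subst f s)"
      then obtain j where "j \<in> lset s" "k \<in> lset (f j)"
        by (auto simp: set_leaves_subst)
      then show False
        using False Mul.prems(3) Mul.prems(4)[of j] by fastforce
    qed
    then show ?thesis
      using False Mul by simp
  qed
qed auto

text \<open>An inserted tree contributes its whole degree to the right of leaf \<open>j\<close> or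
  nothing at all, depending on the side of \<open>j\<close> on which it is inserted.\<close>

lemma deg_right_subst_out:
  assumes "distinct (leaves s)" "j \<in> lset s" "j \<noteq> i"
    "\<And>j. j \<in> lset s \<Longrightarrow> j \<noteq> i \<Longrightarrow> f j = Leaf (g j)"
    "\<And>k. k \<in> lset s \<Longrightarrow> k \<noteq> j \<Longrightarrow> g j \<notin> lset (f k)"
  shows "deg_right (g j) (subst f s) = deg_right j s + (if right_of j i s then tdeg (f i) else 0)"
  using assms
proof (induction s)
  case (Mul s t)
  show ?case
  proof (cases "j \<in> lset s")
    case True
    have "f j = Leaf (g j)"
      using Mul.prems(2-4) by blast
    then have "g j \<in> lset (subst f s)"
      using True by (auto simp: set_leaves_subst intro!: bexI[of _ j])
    moreover have "tdeg (subst f t) = tdeg t + (if i \<in> lset t then tdeg (f i) else 0)"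
      using tdeg_subst_one[where s = t and i = i and f = f and g = g] Mul.prems by auto
    moreover have "i \<in> lset t \<Longrightarrow> \<not> right_of j i s"
      using Mul.prems(1) by (auto dest: right_of_leaf)
    ultimately show ?thesis
      using True Mul by simp
  next
    case False
    have "g j \<notin> lset (subst f s)"
    proof
      assume "g j \<in> lset (subst f s)"
      then obtain k where k: "k \<in> lset s" "g j \<in> lset (f k)"
        by (auto simp: set_leaves_subst)
      then have "k \<noteq> j"
        using False by auto
      then show False
        using k Mul.prems(5)[of k] by simp
    qed
    then show ?thesis
      using False Mul by simp
  qed
qed auto

section \<open>Associativity and equivariance of grafting\<close>

lemma graft_graft_seq:
  assumes s: "s \<in> trees A l d" and t: "t \<in> trees A m e" and u: "u \<in> trees A n f"
    and i: "i \<in> {1..l}" and j: "j \<in> {1..m}"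
  shows "graft (i + j - 1) (graft i s t) u = graft i s (graft j t u)"
proof -
  have gu: "graft j t u \<in> trees A (m + n - 1) (e + f)"
    using graft_in_trees[OF t u j] .
  have n: "1 \<le> n"
    using trees_pos u by blast
  show ?thesis
    unfolding graft_subst[OF gu] unfolding graft_subst[OF t] graft_subst[OF u] subst_subst
  proof (rule subst_cong, goal_cases)
    case (1 k)
    then have k: "k \<in> {1..l}"
      using s by (simp add: trees_def)
    consider "k < i" | "k = i" | "k > i"
      by linarith
    then show ?case
    proof cases
      case 2
      then show ?thesis
        using t j i n
        by (auto simp: subst_map_tree map_tree_subst' trees_def map_tree_map_tree
            intro!: subst_cong map_tree_cong' arg_cong[where f = Leaf])
    qed (use i j n in auto)
  qed
qed

lemma graft_graft_par:
  assumes s: "s \<in> trees A l d" and t: "t \<in> trees A m e" and u: "u \<in> trees A n f"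
    and i: "i \<in> {1..l}" and k: "k \<in> {1..l}" and ik: "i < k"
  shows "graft (k + m - 1) (graft i s t) u = graft i (graft k s u) t"
proof -
  have n: "1 \<le> n" "1 \<le> m"
    using trees_pos u t by blast+
  show ?thesis
    unfolding graft_subst[OF t] graft_subst[OF u] subst_subst
  proof (rule subst_cong, goal_cases)
    case (1 j)
    then have j: "j \<in> {1..l}"
      using s by (simp add: trees_def)
    consider "j < i" | "j = i" | "i < j" "j < k" | "j = k" | "k < j"
      by linarith
    then show ?case
    proof cases
      case 2
      then show ?thesis
        using t i n ik
        by (auto simp: map_tree_subst subst_subst trees_def intro!: subst_cong)
    next
      case 4
      then show ?thesis
        using u i n ik
        by (auto simp: map_tree_subst subst_subst trees_def intro!: subst_cong)
    qed (use ik i n k j in auto)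
  qed
qed

lemma perm_circ_permutes:
  assumes i: "i \<in> {1..m}" and \<sigma>: "\<sigma> permutes {1..m}" and \<tau>: "\<tau> permutes {1..n}"
  shows "perm_circ n i \<sigma> \<tau> permutes {1..m + n - 1}"
proof -
  let ?r = "perm_circ n i \<sigma> \<tau>"
  have \<sigma>i: "\<sigma> i \<in> {1..m}"
    using permutes_in_image[OF \<sigma>] i by blast
  have \<sigma>mem: "k \<in> {1..m} \<Longrightarrow> \<sigma> k \<in> {1..m}" for k
    using permutes_in_image[OF \<sigma>] by blast
  have \<tau>mem: "k \<in> {1..n} \<Longrightarrow> \<tau> k \<in> {1..n}" for k
    using permutes_in_image[OF \<tau>] by blast
  have \<sigma>inj: "\<sigma> a = \<sigma> b \<Longrightarrow> a = b" and \<tau>inj: "\<tau> a = \<tau> b \<Longrightarrow> a = b" for a b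
    using permutes_inj[OF \<sigma>] permutes_inj[OF \<tau>] by (auto dest: injD)
  define sh where "sh p = (if p < \<sigma> i then p else p + n - 1)" for p
  have r: "?r k = (if k < i then sh (\<sigma> k) else if k < i + n then \<sigma> i + \<tau> (k - i + 1) - 1
       else sh (\<sigma> (k - n + 1)))" for k
    by (simp add: perm_circ_def sh_def Let_def)
  have sh_notin: "p \<noteq> \<sigma> i \<Longrightarrow> sh p < \<sigma> i \<or> \<sigma> i + n \<le> sh p" for p
    by (auto simp: sh_def)
  have sh_inj: "\<lbrakk>sh p = sh q; p \<noteq> \<sigma> i; q \<noteq> \<sigma> i\<rbrakk> \<Longrightarrow> p = q" for p q
    by (auto simp: sh_def split: if_splits)
  have sh_mem: "p \<in> {1..m} \<Longrightarrow> p \<noteq> \<sigma> i \<Longrightarrow> sh p \<in> {1..m + n - 1}" for p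
    using \<sigma>i by (auto simp: sh_def)
  have out: "?r k = k" if "k \<notin> {1..m + n - 1}" for k
  proof (cases "k = 0")
    case True
    then show ?thesis
      using permutes_not_in[OF \<sigma>, of 0] i \<sigma>i by (auto simp: r sh_def)
  next
    case False
    then have k: "m + n \<le> k"
      using that i by auto
    then have "\<sigma> (k - n + 1) = k - n + 1"
      by (intro permutes_not_in[OF \<sigma>]) auto
    then show ?thesis
      using k i \<sigma>i by (auto simp: r sh_def)
  qed
  have into: "?r k \<in> {1..m + n - 1}" if k: "k \<in> {1..m + n - 1}" for k
  proof -
    consider "k < i" | "i \<le> k" "k < i + n" | "i + n \<le> k"
      by linarith
    then show ?thesis
    proof cases
      case 1
      then have "\<sigma> k \<noteq> \<sigma> i"
        using \<sigma>inj by blast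
      then show ?thesis
        using 1 sh_mem[OF \<sigma>mem, of k] k i by (simp add: r)
    next
      case 2
      then show ?thesis
        using \<tau>mem[of "k - i + 1"] \<sigma>i k by (simp add: r) arith
    next
      case 3
      then have "k - n + 1 \<noteq> i"
        by auto
      then have "\<sigma> (k - n + 1) \<noteq> \<sigma> i"
        using \<sigma>inj by blast
      then show ?thesis
        using 3 sh_mem[OF \<sigma>mem, of "k - n + 1"] k i by (auto simp: r)
    qed
  qed
  \<comment> \<open>The block starting at \<open>i\<close> corresponds to the block starting at
    \<sigma> \<open>i\<close>. Injectivity can then be checked inside and outside the block
    separately.\<close>
  have blk: "\<sigma> i \<le> ?r k \<and> ?r k < \<sigma> i + n \<longleftrightarrow> i \<le> k \<and> k < i + n" if k: "k \<in> {1..m + n - 1}" for k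
  proof -
    consider "k < i" | "i \<le> k" "k < i + n" | "i + n \<le> k"
      by linarith
    then show ?thesis
    proof cases
      case 1
      then have "\<sigma> k \<noteq> \<sigma> i"
        using \<sigma>inj by blast
      then show ?thesis
        using 1 sh_notin[of "\<sigma> k"] by (auto simp: r)
    next
      case 2
      then show ?thesis
        using \<tau>mem[of "k - i + 1"] by (simp add: r) arith
    next
      case 3
      then have "k - n + 1 \<noteq> i"
        by auto
      then have "\<sigma> (k - n + 1) \<noteq> \<sigma> i"
        using \<sigma>inj by blast
      then show ?thesis
        using 3 sh_notin[of "\<sigma> (k - n + 1)"] by (auto simp: r)
    qed
  qed
  have inj: "inj_on ?r {1..m + n - 1}"
  proof (rule inj_onI)
    fix a b assume a: "a \<in> {1..m + n - 1}" and b: "b \<in> {1..m + n - 1}" and ab: "?r a = ?r b"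
    have bl: "i \<le> a \<and> a < i + n \<longleftrightarrow> i \<le> b \<and> b < i + n"
      using blk[OF a] blk[OF b] ab by simp
    show "a = b"
    proof (cases "i \<le> a \<and> a < i + n")
      case True
      then have "\<tau> (a - i + 1) = \<tau> (b - i + 1)"
        using ab bl \<sigma>i \<tau>mem[of "a - i + 1"] \<tau>mem[of "b - i + 1"] by (auto simp: r)
      then show ?thesis
        using \<tau>inj True bl by fastforce
    next
      case False
      \<comment> \<open>Undoes the shift past the block: the input of the outer operation that sits
        at position \<open>k\<close>.\<close>
      define o' where "o' k = (if k < i then k else k - n + 1)" for k
      have ra: "?r a = sh (\<sigma> (o' a))" "?r b = sh (\<sigma> (o' b))"
        using False bl by (auto simp: r o'_def)
      have "o' a \<noteq> i" "o' b \<noteq> i"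
        using False bl by (auto simp: o'_def)
      then have "o' a = o' b"
        using ra ab sh_inj \<sigma>inj by metis
      then show ?thesis
        using False bl by (auto simp: o'_def split: if_splits)
    qed
  qed
  have "?r ` {1..m + n - 1} = {1..m + n - 1}"
    by (rule endo_inj_surj) (use into inj in auto)
  then show ?thesis
    using inj out by (intro bij_imp_permutes) (auto simp: bij_betw_def)
qed

lemma graft_act:
  assumes s: "s \<in> trees A m d" and t: "t \<in> trees A n e" and i: "i \<in> {1..m}"
    and \<sigma>: "\<sigma> permutes {1..m}" and \<tau>: "\<tau> permutes {1..n}"
  shows "graft i (map_tree (inv_into UNIV \<sigma>) s) (map_tree (inv_into UNIV \<tau>) t) =
    map_tree (inv_into UNIV (perm_circ n i \<sigma> \<tau>)) (graft (\<sigma> i) s t)" (is "?l = map_tree (inv_into UNIV ?r) ?g")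
proof -
  have n: "1 \<le> n"
    using trees_pos t by blast
  have t': "map_tree (inv_into UNIV \<tau>) t \<in> trees A n e"
    using map_tree_in_trees_on[OF t[unfolded trees_trees_on], of "inv_into UNIV \<tau>"] permutes_inv[OF \<tau>]
    by (simp add: trees_trees_on permutes_inj_on permutes_image)
  have perm: "?r permutes {1..m + n - 1}"
    using perm_circ_permutes[OF i \<sigma> \<tau>] .
  \<comment> \<open>Applying the permutation itself removes the inverse on the right-hand side, so
    that both sides become substitutions into \<open>s\<close> and can be compared leaf by
    leaf.\<close>
  have "map_tree ?r ?l = ?g"
    unfolding graft_subst[OF t] graft_subst[OF t'] subst_map_tree map_tree_subst'
  proof (rule subst_cong, goal_cases)
    case (1 k)
    then have k: "k \<in> {1..m}"
      using s by (simp add: trees_def)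
    define j where "j = inv_into UNIV \<sigma> k"
    have kj: "k = \<sigma> j"
      using permutes_inverses[OF \<sigma>] by (simp add: j_def)
    have j: "j \<in> {1..m}"
      using k permutes_in_image[OF permutes_inv[OF \<sigma>], of k] by (simp add: j_def)
    have jk: "inv_into UNIV \<sigma> (\<sigma> j) = j" for j
      using permutes_inverses[OF \<sigma>] by simp
    have inj: "\<sigma> a = \<sigma> b \<longleftrightarrow> a = b" for a b
      using permutes_inj[OF \<sigma>] by (auto dest: injD)
    consider "j < i" | "j = i" | "i < j"
      by linarith
    then show ?case
    proof cases
      case 1
      then show ?thesis
        using inj[of j i] unfolding kj jk by (auto simp: perm_circ_def Let_def)
    next
      case 2
      have "map_tree ?r (map_tree (\<lambda>l. i + l - 1) (map_tree (inv_into UNIV \<tau>) t)) = map_tree (\<lambda>l. \<sigma> i + l - 1) t"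
        unfolding map_tree_map_tree
      proof (rule map_tree_cong', goal_cases)
        case (1 l)
        then have l: "l \<in> {1..n}"
          using t by (simp add: trees_def)
        then have "inv_into UNIV \<tau> l \<in> {1..n}"
          using permutes_in_image[OF permutes_inv[OF \<tau>], of l] by simp
        then show ?case
          using permutes_inverses[OF \<tau>] i by (auto simp: perm_circ_def Let_def)
      qed
      then show ?thesis
        using 2 unfolding kj jk by simp
    next
      case 3
      then have "j + n - 1 - n + 1 = j"
        by auto
      then show ?thesis
        using 3 inj[of j i] n unfolding kj jk by (auto simp: perm_circ_def Let_def)
    qed
  qed
  then have "map_tree (inv_into UNIV ?r) ?g = map_tree (inv_into UNIV ?r) (map_tree ?r ?l)"
    by simp
  also have "\<dots> = ?l"
    by (simp add: map_tree_map_tree permutes_inverses[OF perm] tree.map_ident)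
  finally show ?thesis ..
qed

section \<open>The free operad\<close>

lemma vectI:
  fixes M :: "('k::field, 'a) module"
  assumes "\<zero>\<^bsub>M\<^esub> \<in> carrier M"
    "\<And>x y. \<lbrakk>x \<in> carrier M; y \<in> carrier M\<rbrakk> \<Longrightarrow> x \<oplus>\<^bsub>M\<^esub> y \<in> carrier M"
    "\<And>x y z. \<lbrakk>x \<in> carrier M; y \<in> carrier M; z \<in> carrier M\<rbrakk> \<Longrightarrow>
      (x \<oplus>\<^bsub>M\<^esub> y) \<oplus>\<^bsub>M\<^esub> z = x \<oplus>\<^bsub>M\<^esub> (y \<oplus>\<^bsub>M\<^esub> z)"
    "\<And>x y. \<lbrakk>x \<in> carrier M; y \<in> carrier M\<rbrakk> \<Longrightarrow> x \<oplus>\<^bsub>M\<^esub> y = y \<oplus>\<^bsub>M\<^esub> x"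
    "\<And>x. x \<in> carrier M \<Longrightarrow> \<zero>\<^bsub>M\<^esub> \<oplus>\<^bsub>M\<^esub> x = x"
    "\<And>x. x \<in> carrier M \<Longrightarrow> \<exists>y\<in>carrier M. y \<oplus>\<^bsub>M\<^esub> x = \<zero>\<^bsub>M\<^esub>"
    "\<And>c x. x \<in> carrier M \<Longrightarrow> c \<odot>\<^bsub>M\<^esub> x \<in> carrier M"
    "\<And>c d x. x \<in> carrier M \<Longrightarrow> (c + d) \<odot>\<^bsub>M\<^esub> x = c \<odot>\<^bsub>M\<^esub> x \<oplus>\<^bsub>M\<^esub> d \<odot>\<^bsub>M\<^esub> x"
    "\<And>c x y. \<lbrakk>x \<in> carrier M; y \<in> carrier M\<rbrakk> \<Longrightarrow>
      c \<odot>\<^bsub>M\<^esub> (x \<oplus>\<^bsub>M\<^esub> y) = c \<odot>\<^bsub>M\<^esub> x \<oplus>\<^bsub>M\<^esub> c \<odot>\<^bsub>M\<^esub> y"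
    "\<And>c d x. x \<in> carrier M \<Longrightarrow> (c * d) \<odot>\<^bsub>M\<^esub> x = c \<odot>\<^bsub>M\<^esub> (d \<odot>\<^bsub>M\<^esub> x)"
    "\<And>x. x \<in> carrier M \<Longrightarrow> 1 \<odot>\<^bsub>M\<^esub> x = x"
  shows "vect M"
proof (rule moduleI)
  show "cring (ring_of_type_algebra :: 'k ring)"
    by (rule cring_from_type_algebra)
  show "abelian_group M"
    by (rule abelian_groupI) (fact assms)+
qed (simp_all add: ring_of_type_algebra_def assms)

lemma free_space_simps [simp]:
  "carrier (free_space A n d) = {x. keys x \<subseteq> trees A n d}"
  "\<zero>\<^bsub>free_space A n d\<^esub> = 0"
  "x \<oplus>\<^bsub>free_space A n d\<^esub> y = x + y"
  "c \<odot>\<^bsub>free_space A n d\<^esub> x = psc c x"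
  by (simp_all add: free_space_def scale_psc)

lemma free_operad_simps [simp]:
  "space (free_operad A D) = free_space A"
  "ident (free_operad A D) = bs (Leaf 1)"
  "circ (free_operad A D) m d n e i = free_circ i"
  "act (free_operad A D) n d = free_act"
  "dif (free_operad A D) n d = D"
  by (simp_all add: free_operad_def fun_eq_iff)

lemma vect_free_space: "vect (free_space A n d)"
proof (rule vectI, goal_cases)
  case (6 x)
  then show ?case
    by (intro bexI[of _ "- x"]) auto
next
  case 2
  then show ?case
    by (auto dest!: keys_plusE)
next
  case 7
  then show ?case
    using keys_psc by fastforce
qed (auto simp: psc_add psc_add_left algebra_simps)

lemma lin_map_free:
  assumes "plinear f" "\<And>t. t \<in> trees A n d \<Longrightarrow> keys (f (bs t)) \<subseteq> trees B m e"
  shows "lin_map (free_space A n d) (free_space B m e) f"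
proof -
  have "keys (f x) \<subseteq> trees B m e" if "keys x \<subseteq> trees A n d" for x
    unfolding plinear_eq_lin[OF assms(1), of x] using assms(2) that keys_lin by fast
  then show ?thesis
    using assms(1) by (auto simp: lin_map_def plinear_def)
qed

lemma free_circ_lin: "free_circ i x y =
   lin (\<lambda>s. lin (\<lambda>t. psc (ep (deg_right i s * tdeg t)) (bs (graft i s t))) y) x"
  by (simp add: free_circ_def lin_ext_lin scale_psc powi_ep)

lemma free_act_lin: "free_act \<sigma> = lin (\<lambda>t. bs (map_tree (inv_into UNIV \<sigma>) t))"
  by (simp add: free_act_def lin_ext_lin)

lemma free_circ_bs: "free_circ i (bs s) (bs t) = psc (ep (deg_right i s * tdeg t)) (bs (graft i s t))"
  by (simp add: free_circ_lin)

lemma free_act_bs: "free_act \<sigma> (bs t) = bs (map_tree (inv_into UNIV \<sigma>) t)"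
  by (simp add: free_act_lin)

lemma plinear_free_circ_left [plinear_intros]: "plinear f \<Longrightarrow> plinear (\<lambda>x. free_circ i (f x) y)"
  unfolding free_circ_lin by (rule plinear_compose)

lemma plinear_free_circ_right [plinear_intros]: "plinear f \<Longrightarrow> plinear (\<lambda>y. free_circ i x (f y))"
  unfolding free_circ_lin by (rule plinear_lin_param) (rule plinear_compose)

lemma plinear_free_act [plinear_intros]: "plinear f \<Longrightarrow> plinear (\<lambda>x. free_act \<sigma> (f x))"
  unfolding free_act_lin by (rule plinear_compose)

lemmas pl_circ_left = plinear_free_circ_left[OF plinear_id]
lemmas pl_circ_right = plinear_free_circ_right[OF plinear_id]
lemmas pl_act = plinear_free_act[OF plinear_id]

lemma plinear2_eqI:
  assumes "\<And>y. plinear (\<lambda>x. f x y)" "\<And>x. plinear (f x)" "\<And>y. plinear (\<lambda>x. g x y)" "\<And>x. plinear (g x)"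
    "\<And>s t. \<lbrakk>s \<in> keys x; t \<in> keys y\<rbrakk> \<Longrightarrow> f (bs s) (bs t) = g (bs s) (bs t)"
  shows "f x y = g x y"
proof (rule plinear_eqI[OF assms(1,3)])
  show "f (bs t) y = g (bs t) y" if "t \<in> keys x" for t
    by (rule plinear_eqI[OF assms(2,4)]) (use assms(5) that in auto)
qed

lemma plinear3_eqI:
  assumes "\<And>y z. plinear (\<lambda>x. f x y z)" "\<And>x z. plinear (\<lambda>y. f x y z)" "\<And>x y. plinear (f x y)"
    "\<And>y z. plinear (\<lambda>x. g x y z)" "\<And>x z. plinear (\<lambda>y. g x y z)" "\<And>x y. plinear (g x y)"
    "\<And>s t u. \<lbrakk>s \<in> keys x; t \<in> keys y; u \<in> keys z\<rbrakk> \<Longrightarrow> f (bs s) (bs t) (bs u) = g (bs s) (bs t) (bs u)"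
  shows "f x y z = g x y z"
proof (rule plinear_eqI[OF assms(1,4)])
  show "f (bs t) y z = g (bs t) y z" if "t \<in> keys x" for t
    by (rule plinear2_eqI[where f = "f (bs t)" and g = "g (bs t)"]) (use assms that in auto)
qed

lemma trees_tdeg: "t \<in> trees A n d \<Longrightarrow> tdeg t = d"
  by (simp add: trees_def)

lemma deg_right_graft_in:
  assumes "s \<in> trees A m d" "t \<in> trees A n e" "i \<in> {1..m}" "j \<in> {1..n}"
  shows "deg_right (i + j - 1) (graft i s t) = deg_right j t + deg_right i s"
proof -
  let ?f = "\<lambda>j. if j < i then Leaf j else if j = i then map_tree (\<lambda>l. i + l - 1) t else Leaf (j + n - 1)"
  have "deg_right (i + j - 1) (subst ?f s) = deg_right (i + j - 1) (?f i) + deg_right i s"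
    using assms by (intro deg_right_subst_in[where g = "\<lambda>j. if j < i then j else j + n - 1"])
      (auto simp: trees_def)
  moreover have "deg_right (i + j - 1) (?f i) = deg_right j t"
    using deg_right_map_tree[of "\<lambda>l. i + l - 1" t j] inj_on_block[of i n] assms by (simp add: trees_def)
  ultimately show ?thesis
    by (simp add: graft_subst[OF assms(2)])
qed

lemma deg_right_graft_out:
  assumes "s \<in> trees A m d" "t \<in> trees A n e" "i \<in> {1..m}" "j \<in> {1..m}" "j \<noteq> i"
  shows "deg_right (if j < i then j else j + n - 1) (graft i s t) =
    deg_right j s + (if right_of j i s then e else 0)"
proof -
  let ?g = "\<lambda>j. if j < i then j else j + n - 1"
  let ?f = "\<lambda>j. if j < i then Leaf j else if j = i then map_tree (\<lambda>l. i + l - 1) t else Leaf (j + n - 1)"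
  have "1 \<le> n"
    using assms(2) trees_pos by blast
  then have "deg_right (?g j) (subst ?f s) = deg_right j s + (if right_of j i s then tdeg (?f i) else 0)"
    using assms by (intro deg_right_subst_out) (auto simp: trees_def)
  then show ?thesis
    using assms by (simp add: graft_subst[OF assms(2)] trees_tdeg[OF assms(2)])
qed

lemma free_circ_closed:
  "\<lbrakk>keys x \<subseteq> trees A m d; keys y \<subseteq> trees A n e; i \<in> {1..m}\<rbrakk> \<Longrightarrow>
    keys (free_circ i x y) \<subseteq> trees A (m + n - 1) (d + e)"
proof
  fix u assume x: "keys x \<subseteq> trees A m d" and y: "keys y \<subseteq> trees A n e" and i: "i \<in> {1..m}"
    and u: "u \<in> keys (free_circ i x y)"
  obtain s t where "s \<in> keys x" "t \<in> keys y" "u \<in> keys (psc (ep (deg_right i s * tdeg t)) (bs (graft i s t) :: 'a comb))"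
    using u unfolding free_circ_lin by (auto elim!: in_keys_linE)
  then show "u \<in> trees A (m + n - 1) (d + e)"
    using keys_psc x y graft_in_trees[OF _ _ i] by fastforce
qed

lemma map_tree_permutes:
  "t \<in> trees A n d \<Longrightarrow> \<sigma> permutes {1..n} \<Longrightarrow> map_tree (inv_into UNIV \<sigma>) t \<in> trees A n d"
  using map_tree_in_trees_on[of t A "{1..n}" d "inv_into UNIV \<sigma>"] permutes_inv[of \<sigma> "{1..n}"]
  by (simp add: trees_trees_on permutes_inj_on permutes_image)

text \<open>All axioms without differential hold for any free operad, and by multilinearity
  everything about \<open>D\<close> needs checking on trees only. The lemma serves both the zero
  differential of the free operad for BV and \<open>delta\<close>.\<close>

lemma dg_operad_free:
  fixes D :: "'k::field comb \<Rightarrow> 'k comb"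
  assumes D: "plinear D"
    and D_closed: "\<And>n d t. t \<in> trees A n d \<Longrightarrow> keys (D (bs t)) \<subseteq> trees A n (d + 1)"
    and D_D: "\<And>n d t. t \<in> trees A n d \<Longrightarrow> D (D (bs t)) = 0"
    and D_act: "\<And>n d t \<sigma>. \<lbrakk>t \<in> trees A n d; \<sigma> permutes {1..n}\<rbrakk> \<Longrightarrow>
      D (free_act \<sigma> (bs t)) = free_act \<sigma> (D (bs t))"
    and D_circ: "\<And>m n d e i s t. \<lbrakk>s \<in> trees A m d; t \<in> trees A n e; i \<in> {1..m}\<rbrakk> \<Longrightarrow>
      D (free_circ i (bs s) (bs t)) = free_circ i (D (bs s)) (bs t) + psc (ep d) (free_circ i (bs s) (D (bs t)))"
  shows "dg_operad (free_operad A D)"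
proof (rule dg_operad.intro, unfold free_operad_simps free_space_simps mem_Collect_eq powi_ep, goal_cases)
  case (1 n d)
  show ?case by (rule vect_free_space)
next
  case 2
  show ?case by (simp add: trees_def)
next
  case (3 i m y n e d)
  then show ?case
    by (intro lin_map_free plinear_intros free_circ_closed) auto
next
  case (4 i m x d n e)
  then show ?case
    by (intro lin_map_free plinear_intros free_circ_closed) auto
next
  case (5 x n d)
  have "free_circ 1 (bs (Leaf 1)) (bs t) = (bs t :: 'k comb)" for t
    by (simp add: free_circ_bs graft_def map_tree_ident')
  then show ?case
    using plinear_eqI[where f = "free_circ 1 (bs (Leaf 1))" and g = "\<lambda>x. x" and x = x]
    by (simp add: plinear_intros)
next
  case (6 x n d i)
  have "free_circ i (bs t) (bs (Leaf 1)) = (bs t :: 'k comb)" for t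
  proof -
    have "graft i t (Leaf 1) = subst Leaf t"
      unfolding graft_def by (rule subst_cong) auto
    then show ?thesis
      by (simp add: free_circ_bs subst_Leaf)
  qed
  then show ?case
    using plinear_eqI[where f = "\<lambda>x. free_circ i x (bs (Leaf 1))" and g = "\<lambda>x. x" and x = x]
    by (simp add: plinear_intros)
next
  case (7 x l d y m e z n f i j)
  show ?case
  proof (rule plinear3_eqI[where f = "\<lambda>x y z. free_circ (i + j - 1) (free_circ i x y) z"
        and g = "\<lambda>x y z. free_circ i x (free_circ j y z)"])
    fix s t u assume "s \<in> keys x" "t \<in> keys y" "u \<in> keys z"
    then have s: "s \<in> trees A l d" and t: "t \<in> trees A m e" and u: "u \<in> trees A n f"
      using 7 by auto
    have "tdeg (graft j t u) = e + f"
      using graft_in_trees[OF t u 7(5)] trees_tdeg by blast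
    then show "free_circ (i + j - 1) (free_circ i (bs s) (bs t)) (bs u) =
        (free_circ i (bs s) (free_circ j (bs t) (bs u)) :: 'k comb)"
      using 7 by (simp add: free_circ_bs plinear_psc[OF pl_circ_left]
          plinear_psc[OF pl_circ_right] deg_right_graft_in[OF s t 7(4,5)]
          graft_graft_seq[OF s t u 7(4,5)] trees_tdeg[OF t] trees_tdeg[OF u] algebra_simps
          del: One_nat_def flip: ep_add)
  qed (intro plinear_intros)+
next
  case (8 x l d y m e z n f i k)
  show ?case
  proof (rule plinear3_eqI[where f = "\<lambda>x y z. free_circ (k + m - 1) (free_circ i x y) z"
        and g = "\<lambda>x y z. psc (ep (e * f)) (free_circ i (free_circ k x z) y)"])
    fix s t u assume "s \<in> keys x" "t \<in> keys y" "u \<in> keys z"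
    then have s: "s \<in> trees A l d" and t: "t \<in> trees A m e" and u: "u \<in> trees A n f"
      using 8 by auto
    have 1: "deg_right (k + m - 1) (graft i s t) = deg_right k s + (if right_of k i s then e else 0)"
      using deg_right_graft_out[OF s t 8(4,5)] 8(6) by simp
    have 2: "deg_right i (graft k s u) = deg_right i s + (if right_of i k s then f else 0)"
      using deg_right_graft_out[OF s u 8(5,4)] 8(6) by simp
    have 3: "right_of k i s \<longleftrightarrow> \<not> right_of i k s"
      using right_of_swap[of s i k] s 8 by (auto simp: trees_def)
    show "free_circ (k + m - 1) (free_circ i (bs s) (bs t)) (bs u) =
        (psc (ep (e * f)) (free_circ i (free_circ k (bs s) (bs u)) (bs t)) :: 'k comb)"
      by (auto simp: free_circ_bs plinear_psc[OF pl_circ_left]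
          plinear_psc[OF pl_circ_right] 1 2 3
          graft_graft_par[OF s t u 8(4,5,6)] trees_tdeg[OF t] trees_tdeg[OF u] algebra_simps
          simp del: One_nat_def simp flip: ep_add intro!: arg_cong2[where f = psc] ep_cong)
  qed (intro plinear_intros)+
next
  case (9 \<sigma> n d)
  then show ?case
    by (intro lin_map_free plinear_intros) (auto simp: free_act_bs map_tree_permutes)
next
  case (10 x n d)
  then show ?case
    by (simp add: free_act_lin map_tree_ident' inv_id)
next
  case (11 x n d \<sigma> \<tau>)
  have "inv_into UNIV (\<sigma> \<circ> \<tau>) = inv_into UNIV \<tau> \<circ> inv_into UNIV \<sigma>"
    using 11 by (intro o_inv_distrib) (auto intro: permutes_bij)
  then show ?case
    by (simp add: free_act_lin lin_lin map_tree_map_tree comp_def)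
next
  case (12 x m d y n e i \<sigma> \<tau>)
  show ?case
  proof (rule plinear2_eqI[where f = "\<lambda>x y. free_circ i (free_act \<sigma> x) (free_act \<tau> y)"
        and g = "\<lambda>x y. free_act (perm_circ n i \<sigma> \<tau>) (free_circ (\<sigma> i) x y)"])
    fix s t assume "s \<in> keys x" "t \<in> keys y"
    then have s: "s \<in> trees A m d" and t: "t \<in> trees A n e"
      using 12 by auto
    have "inv_into UNIV \<sigma> (\<sigma> i) = i"
      using permutes_inverses[OF 12(4)] by simp
    moreover have "\<sigma> i \<in> lset s"
      using permutes_in_image[OF 12(4)] 12(3) s by (simp add: trees_def)
    ultimately have "deg_right i (map_tree (inv_into UNIV \<sigma>) s) = deg_right (\<sigma> i) s"
      using deg_right_map_tree[of "inv_into UNIV \<sigma>" s "\<sigma> i"] permutes_inj_on[OF permutes_inv[OF 12(4)]]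
      by simp
    then show "free_circ i (free_act \<sigma> (bs s)) (free_act \<tau> (bs t)) =
        (free_act (perm_circ n i \<sigma> \<tau>) (free_circ (\<sigma> i) (bs s) (bs t)) :: 'k comb)"
      by (simp add: free_act_bs free_circ_bs plinear_psc[OF pl_act]
          graft_act[OF s t 12(3,4,5)])
  qed (intro plinear_intros)+
next
  case (13 n d)
  then show ?case
    by (intro lin_map_free D D_closed)
next
  case (14 x n d)
  show ?case
    by (rule plinear_eqI[where f = "\<lambda>x. D (D x)" and g = "\<lambda>x. 0"]) 
      (use 14 in \<open>auto intro: plinear_const0 plinear_comp D D_D\<close>)
next
  case (15 x n d \<sigma>)
  show ?case
    by (rule plinear_eqI[where f = "\<lambda>x. D (free_act \<sigma> x)" and g = "\<lambda>x. free_act \<sigma> (D x)"])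
      (use 15 in \<open>auto intro!: plinear_free_act plinear_comp[OF D] plinear_id D D_act\<close>)
next
  case (16 x m d y n e i)
  show ?case
    by (rule plinear2_eqI[where f = "\<lambda>x y. D (free_circ i x y)"
        and g = "\<lambda>x y. free_circ i (D x) y + psc (ep d) (free_circ i x (D y))"])
      (use 16 in \<open>auto intro!: plinear_free_circ_left plinear_free_circ_right plinear_id plinear_plus plinear_scale plinear_comp[OF D] D D_circ\<close>)
qed

lemma dg_operad_BV_free: "dg_operad (BV_free :: ('k::field, 'k comb) operad)"
  unfolding BV_free_def
  by (rule dg_operad_free)
    (auto simp: plinear_zero[OF pl_act] plinear_zero[OF pl_circ_left]
      plinear_zero[OF pl_circ_right] intro: plinear_intros)

section \<open>The differential\<close>

lemma plinear_of_lin: "plinear h \<Longrightarrow> h (lin f x) = lin (\<lambda>t. h (f t)) x"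
  by (simp add: lin_def plinear_sum plinear_psc)

definition mulc :: "'k::field comb \<Rightarrow> 'k comb \<Rightarrow> 'k comb" where
  "mulc x y = lin (\<lambda>s. lin (\<lambda>t. bs (Mul s t)) y) x"

definition delc :: "nat \<Rightarrow> 'k::field comb \<Rightarrow> 'k comb" where
  "delc a = lin (\<lambda>t. bs (Del a t))"

text \<open>Arbitrary relabellings are allowed, not only permutations of an initial segment:
  subtrees and inserted trees carry labels from arbitrary finite sets.\<close>

definition relc :: "(nat \<Rightarrow> nat) \<Rightarrow> 'k::field comb \<Rightarrow> 'k comb" where
  "relc g = lin (\<lambda>t. bs (map_tree g t))"

abbreviation delta :: "'k::field comb \<Rightarrow> 'k comb" where
  "delta \<equiv> lin tree_delta"

lemma mulc_bs [simp]: "mulc (bs s) (bs t) = bs (Mul s t)"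
  by (simp add: mulc_def)

lemma delc_bs [simp]: "delc a (bs t) = bs (Del a t)"
  by (simp add: delc_def)

lemma relc_bs [simp]: "relc g (bs t) = bs (map_tree g t)"
  by (simp add: relc_def)

lemma plinear_mulc_left [plinear_intros]: "plinear f \<Longrightarrow> plinear (\<lambda>x. mulc (f x) y)"
  unfolding mulc_def by (rule plinear_compose)

lemma plinear_mulc_right [plinear_intros]: "plinear f \<Longrightarrow> plinear (\<lambda>x. mulc y (f x))"
  unfolding mulc_def by (rule plinear_lin_param) (rule plinear_compose)

lemma plinear_delc [plinear_intros]: "plinear f \<Longrightarrow> plinear (\<lambda>x. delc a (f x))"
  unfolding delc_def by (rule plinear_compose)

lemma plinear_relc [plinear_intros]: "plinear f \<Longrightarrow> plinear (\<lambda>x. relc g (f x))"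
  unfolding relc_def by (rule plinear_compose)

lemmas pl_mulc_left = plinear_mulc_left[OF plinear_id]
lemmas pl_mulc_right = plinear_mulc_right[OF plinear_id]
lemmas pl_delc = plinear_delc[OF plinear_id]
lemmas pl_relc = plinear_relc[OF plinear_id]

lemma free_act_relc: "free_act \<sigma> = relc (inv_into UNIV \<sigma>)"
  by (simp add: free_act_lin relc_def)

lemma tree_delta_Mul:
  "tree_delta (Mul s t) = mulc (tree_delta s) (bs t) + psc (ep (tdeg s)) (mulc (bs s) (tree_delta t))"
  by (simp add: mulc_def lin_ext_lin scale_psc powi_ep)

lemma tree_delta_Del:
  "tree_delta (Del a t) = (\<Sum>b\<in>{1..<a}. bs (Del b (Del (a - b) t))) - delc a (tree_delta t)"
  by (simp add: delc_def lin_ext_lin)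

declare tree_delta.simps(2,3) [simp del]

lemma keys_mulc: "keys (mulc x y) \<subseteq> {Mul s t |s t. s \<in> keys x \<and> t \<in> keys y}"
  unfolding mulc_def by (auto elim!: in_keys_linE)

lemma keys_delc: "keys (delc a x) \<subseteq> Del a ` keys x"
  unfolding delc_def by (auto elim!: in_keys_linE)

lemma keys_relc: "keys (relc g x) \<subseteq> map_tree g ` keys x"
  unfolding relc_def by (auto elim!: in_keys_linE)

lemma tree_delta_keys:
  "t' \<in> keys (tree_delta t :: 'k::field comb) \<Longrightarrow>
    leaves t' = leaves t \<and> tdeg t' = tdeg t + 1 \<and> deltas t' \<subseteq> deltas t \<union> {1..}"
proof (induction t arbitrary: t')
  case (Mul s t)
  have "t' \<in> keys (mulc (tree_delta s) (bs t) :: 'k comb) \<or> t' \<in> keys (mulc (bs s) (tree_delta t) :: 'k comb)"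
    using keys_plusE[OF Mul.prems[unfolded tree_delta_Mul]] keys_psc by fastforce
  then consider s' where "t' = Mul s' t" "s' \<in> keys (tree_delta s :: 'k comb)"
    | u where "t' = Mul s u" "u \<in> keys (tree_delta t :: 'k comb)"
    by (auto dest!: subsetD[OF keys_mulc])
  then show ?case
    using Mul.IH by cases fastforce+
next
  case (Del a t)
  have "t' \<in> keys (\<Sum>b\<in>{1..<a}. bs (Del b (Del (a - b) t)) :: 'k comb) \<or>
      t' \<in> keys (delc a (tree_delta t) :: 'k comb)"
    using keys_minusE[OF Del.prems[unfolded tree_delta_Del]] .
  then consider b where "b \<in> {1..<a}" "t' = Del b (Del (a - b) t)"
    | u where "u \<in> keys (tree_delta t :: 'k comb)" "t' = Del a u"
    by (auto elim!: keys_sumE dest!: subsetD[OF keys_delc])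
  then show ?case
    using Del.IH by cases fastforce+
qed simp

lemma delta_mulc:
  assumes "\<And>s. s \<in> keys x \<Longrightarrow> tdeg s = p"
  shows "delta (mulc x y) = mulc (delta x) y + psc (ep p) (mulc x (delta y))"
  by (rule plinear2_eqI[where f = "\<lambda>x y. delta (mulc x y)"
        and g = "\<lambda>x y. mulc (delta x) y + psc (ep p) (mulc x (delta y))"])
    (use assms in \<open>auto intro!: plinear_intros simp: tree_delta_Mul\<close>)

lemma delta_delc: "delta (delc a x) = (\<Sum>b\<in>{1..<a}. delc b (delc (a - b) x)) - delc a (delta x)"
  by (rule plinear_eqI[where f = "\<lambda>x. delta (delc a x)"
        and g = "\<lambda>x. (\<Sum>b\<in>{1..<a}. delc b (delc (a - b) x)) - delc a (delta x)"])
    (auto intro!: plinear_intros simp: tree_delta_Del)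

lemma relc_mulc: "relc g (mulc x y) = mulc (relc g x) (relc g y)"
  by (rule plinear2_eqI[where f = "\<lambda>x y. relc g (mulc x y)" and g = "\<lambda>x y. mulc (relc g x) (relc g y)"])
    (auto intro!: plinear_intros)

lemma relc_delc: "relc g (delc a x) = delc a (relc g x)"
  by (rule plinear_eqI[where f = "\<lambda>x. relc g (delc a x)" and g = "\<lambda>x. delc a (relc g x)"])
    (auto intro!: plinear_intros)

lemma tree_delta_map_tree: "tree_delta (map_tree g t) = relc g (tree_delta t)"
  by (induction t)
    (simp_all add: tree_delta_Mul tree_delta_Del relc_mulc relc_delc plinear_zero[OF pl_relc]
      plinear_add[OF pl_relc] plinear_psc[OF pl_relc] plinear_diff[OF pl_relc] plinear_sum[OF pl_relc])

lemma delta_relc: "delta (relc g x) = relc g (delta x)"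
  by (rule plinear_eqI[where f = "\<lambda>x. delta (relc g x)" and g = "\<lambda>x. relc g (delta x)"])
    (auto intro!: plinear_intros simp: tree_delta_map_tree)

text \<open>Both sides run over the ordered decompositions of \<open>a\<close> into three positive
  summands. This is the cancellation that makes \<open>delta\<close> square to zero on Delta_a:
  splitting the left or the right factor again gives the same triples with opposite signs.\<close>

lemma sum_triangle_reindex:
  fixes a :: nat
  shows "(\<Sum>b\<in>{1..<a}. \<Sum>c\<in>{1..<b}. f c (b - c) (a - b)) = (\<Sum>b\<in>{1..<a}. \<Sum>c\<in>{1..<a - b}. f b c (a - b - c))"
  by (simp add: sum.Sigma)
    (rule sum.reindex_bij_witness[where i = "\<lambda>(b, c). (b + c, b)" and j = "\<lambda>(b, c). (c, b - c)"], auto)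

lemma delta_tree_delta: "delta (tree_delta t) = (0 :: 'k::field comb)"
proof (induction t)
  case (Mul s t)
  have *: "\<And>s'. s' \<in> keys (tree_delta s :: 'k comb) \<Longrightarrow> tdeg s' = tdeg s + 1" for s
    using tree_delta_keys by blast
  have "delta (mulc (bs s) y) = mulc (tree_delta s) y + psc (ep (tdeg s)) (mulc (bs s) (delta y))" for y :: "'k comb"
    using delta_mulc[of "bs s" "tdeg s" y] by simp
  then show ?case
    using Mul by (simp add: tree_delta_Mul lin_add lin_psc delta_mulc[OF *]
        plinear_zero[OF pl_mulc_left] plinear_zero[OF pl_mulc_right] ep_add psc_add psc_uminus)
next
  case (Del a t)
  have "delta (tree_delta (Del a t) :: 'k comb) =
      (\<Sum>b\<in>{1..<a}. (\<Sum>c\<in>{1..<b}. bs (Del c (Del (b - c) (Del (a - b) t)))) - delc b (tree_delta (Del (a - b) t)))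
       - (\<Sum>b\<in>{1..<a}. delc b (delc (a - b) (tree_delta t)))"
    using Del by (simp add: tree_delta_Del lin_diff lin_sum delta_delc plinear_zero[OF pl_delc])
  also have "\<dots> = (\<Sum>b\<in>{1..<a}. \<Sum>c\<in>{1..<b}. bs (Del c (Del (b - c) (Del (a - b) t)))) -
       (\<Sum>b\<in>{1..<a}. \<Sum>c\<in>{1..<a - b}. bs (Del b (Del c (Del (a - b - c) t))))"
    by (simp add: tree_delta_Del plinear_diff[OF pl_delc] plinear_sum[OF pl_delc] sum_subtractf)
  also have "\<dots> = 0"
    using sum_triangle_reindex[where f = "\<lambda>b c d. bs (Del b (Del c (Del d t)))" and a = a] by simp
  finally show ?case .
qed simp

lemma delta_delta: "delta (delta x) = 0"
  by (simp add: lin_lin delta_tree_delta)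

text \<open>Partial composition freed from the relabelling conventions of \<open>graft\<close>: the
  inserted element is already relabelled, and the other leaves are renamed by a fixed map. In this
  form it is compatible with passing to the subtrees of \<open>s\<close>, which an induction over
  \<open>s\<close> needs.\<close>

definition sig_subst :: "(nat \<Rightarrow> nat) \<Rightarrow> nat \<Rightarrow> nat tree \<Rightarrow> 'k::field comb \<Rightarrow> 'k comb" where
  "sig_subst g i s = lin (\<lambda>t. psc (ep (deg_right i s * tdeg t))
     (bs (subst (\<lambda>j. if j = i then t else Leaf (g j)) s)))"

lemma subst_notin: "i \<notin> lset s \<Longrightarrow> subst (\<lambda>j. if j = i then t else Leaf (g j)) s = map_tree g s"
  unfolding map_tree_subst by (rule subst_cong) auto

lemma sig_subst_Leaf: "sig_subst g i (Leaf i) y = y"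
  by (simp add: sig_subst_def)

lemma sig_subst_Del: "sig_subst g i (Del a s) y = delc a (sig_subst g i s y)"
  unfolding sig_subst_def plinear_of_lin[OF pl_delc] by (simp add: plinear_psc[OF pl_delc])

lemma sig_subst_Mul_left:
  assumes "i \<in> lset s" "i \<notin> lset t" "\<And>u. u \<in> keys y \<Longrightarrow> tdeg u = e"
  shows "sig_subst g i (Mul s t) y = psc (ep (tdeg t * e)) (mulc (sig_subst g i s y) (bs (map_tree g t)))"
  unfolding sig_subst_def plinear_of_lin[OF pl_mulc_left] lin_psc_fun[symmetric]
  using assms
  by (intro lin_cong) (auto simp: subst_notin plinear_psc[OF pl_mulc_left] algebra_simps simp flip: ep_add)

lemma sig_subst_Mul_right:
  assumes "i \<notin> lset s"
  shows "sig_subst g i (Mul s t) y = mulc (bs (map_tree g s)) (sig_subst g i t y)"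
  unfolding sig_subst_def plinear_of_lin[OF pl_mulc_right]
  using assms by (intro lin_cong) (auto simp: subst_notin plinear_psc[OF pl_mulc_right])

lemma sig_subst_tdeg:
  assumes "distinct (leaves s)" "i \<in> lset s" "\<And>u. u \<in> keys y \<Longrightarrow> tdeg u = e"
    "t \<in> keys (sig_subst g i s y)"
  shows "tdeg t = tdeg s + e"
proof -
  obtain u where "u \<in> keys y" "t = subst (\<lambda>j. if j = i then u else Leaf (g j)) s"
    using assms(4) keys_psc unfolding sig_subst_def by (fastforce elim!: in_keys_linE)
  then show ?thesis
    using tdeg_subst_one[of s i "\<lambda>j. if j = i then u else Leaf (g j)" g] assms by simp
qed

text \<open>The Leibniz rule by induction over \<open>s\<close>. If the insertion takes place in the
  left factor of a product, the inserted element moves past the right factor \<open>t\<close> with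
  sign \<open>ep (tdeg t * e)\<close>; differentiating \<open>t\<close> or \<open>y\<close> raises
  one of the two degrees, and the change of this sign matches the signs of the rule for
  products.\<close>

lemma delta_sig_subst:
  assumes "distinct (leaves s)" "i \<in> lset s" "\<And>u. u \<in> keys y \<Longrightarrow> tdeg u = e"
  shows "delta (sig_subst g i s y) =
    lin (\<lambda>s'. sig_subst g i s' y) (tree_delta s) + psc (ep (tdeg s)) (sig_subst g i s (delta y))"
  using assms(1,2)
proof (induction s)
  case (Leaf j)
  then show ?case
    by (simp add: sig_subst_Leaf)
next
  case (Mul s t)
  have dy: "tdeg u = e + 1" if "u \<in> keys (delta y)" for u
    using that assms(3) tree_delta_keys by (auto elim!: in_keys_linE)
  show ?case
  proof (cases "i \<in> lset s")
    case True
    then have t: "i \<notin> lset t"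
      using Mul.prems by auto
    have 1: "lin (\<lambda>s'. sig_subst g i (Mul s' t) y) (tree_delta s) =
        psc (ep (tdeg t * e)) (mulc (lin (\<lambda>s'. sig_subst g i s' y) (tree_delta s)) (bs (map_tree g t)))"
      unfolding plinear_of_lin[OF pl_mulc_left] lin_psc_fun[symmetric]
      using True t assms(3) by (intro lin_cong refl sig_subst_Mul_left) (auto dest: tree_delta_keys)
    have 2: "lin (\<lambda>t'. sig_subst g i (Mul s t') y) (tree_delta t) =
        psc (ep ((tdeg t + 1) * e)) (mulc (sig_subst g i s y) (relc g (tree_delta t)))"
    proof -
      have "lin (\<lambda>t'. sig_subst g i (Mul s t') y) (tree_delta t) =
          lin (\<lambda>t'. psc (ep (tdeg t' * e)) (mulc (sig_subst g i s y) (bs (map_tree g t')))) (tree_delta t)"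
        using True t assms(3) by (intro lin_cong refl sig_subst_Mul_left) (auto dest: tree_delta_keys)
      also have "\<dots> = lin (\<lambda>t'. psc (ep ((tdeg t + 1) * e)) (mulc (sig_subst g i s y) (bs (map_tree g t')))) (tree_delta t)"
        by (intro lin_cong refl) (auto dest: tree_delta_keys)
      finally show ?thesis
        by (simp add: lin_psc_fun relc_def plinear_of_lin[OF pl_mulc_right])
    qed
    have 3: "lin (\<lambda>s'. sig_subst g i s' y) (mulc (tree_delta s) (bs t)) = lin (\<lambda>s'. sig_subst g i (Mul s' t) y) (tree_delta s)"
      by (simp add: mulc_def lin_lin)
    have 4: "lin (\<lambda>s'. sig_subst g i s' y) (mulc (bs s) (tree_delta t)) = lin (\<lambda>t'. sig_subst g i (Mul s t') y) (tree_delta t)"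
      by (simp add: mulc_def lin_lin)
    have IH: "delta (sig_subst g i s y) =
      lin (\<lambda>s'. sig_subst g i s' y) (tree_delta s) + psc (ep (tdeg s)) (sig_subst g i s (delta y))"
      using Mul True by simp
    have 5: "delta (mulc (sig_subst g i s y) (bs (map_tree g t))) =
      mulc (delta (sig_subst g i s y)) (bs (map_tree g t)) +
      psc (ep (tdeg s + e)) (mulc (sig_subst g i s y) (relc g (tree_delta t)))"
      using delta_mulc[of "sig_subst g i s y" "tdeg s + e" "bs (map_tree g t)"]
        sig_subst_tdeg[where s = s and i = i and y = y and e = e] True Mul.prems assms(3) 
      by (simp add: tree_delta_map_tree)
    have 6: "sig_subst g i (Mul s t) y =
        psc (ep (tdeg t * e)) (mulc (sig_subst g i s y) (bs (map_tree g t)))"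
      by (rule sig_subst_Mul_left[OF True t]) (rule assms(3))
    have 7: "sig_subst g i (Mul s t) (delta y) =
        psc (ep (tdeg t * (e + 1))) (mulc (sig_subst g i s (delta y)) (bs (map_tree g t)))"
      by (rule sig_subst_Mul_left[OF True t]) (rule dy)
    show ?thesis
      unfolding 6 7 tree_delta_Mul lin_add lin_psc 1 2 3 4 5 IH
      by (simp add: plinear_add[OF pl_mulc_left] plinear_psc[OF pl_mulc_left] psc_add ep_add algebra_simps)
  next
    case False
    then have t: "i \<in> lset t"
      using Mul.prems by auto
    have 1: "lin (\<lambda>s'. sig_subst g i (Mul s' t) y) (tree_delta s) =
        mulc (relc g (tree_delta s)) (sig_subst g i t y)"
    proof -
      have "lin (\<lambda>s'. sig_subst g i (Mul s' t) y) (tree_delta s) =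
          lin (\<lambda>s'. mulc (bs (map_tree g s')) (sig_subst g i t y)) (tree_delta s)"
        using False by (intro lin_cong refl sig_subst_Mul_right) (auto dest: tree_delta_keys)
      then show ?thesis
        by (simp add: relc_def plinear_of_lin[OF pl_mulc_left])
    qed
    have 2: "lin (\<lambda>t'. sig_subst g i (Mul s t') y) (tree_delta t) =
        mulc (bs (map_tree g s)) (lin (\<lambda>t'. sig_subst g i t' y) (tree_delta t))"
      unfolding plinear_of_lin[OF pl_mulc_right] using False
      by (intro lin_cong refl sig_subst_Mul_right)
    have 3: "lin (\<lambda>s'. sig_subst g i s' y) (mulc (tree_delta s) (bs t)) = lin (\<lambda>s'. sig_subst g i (Mul s' t) y) (tree_delta s)"
      by (simp add: mulc_def lin_lin)
    have 4: "lin (\<lambda>s'. sig_subst g i s' y) (mulc (bs s) (tree_delta t)) = lin (\<lambda>t'. sig_subst g i (Mul s t') y) (tree_delta t)"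
      by (simp add: mulc_def lin_lin)
    have IH: "delta (sig_subst g i t y) =
      lin (\<lambda>s'. sig_subst g i s' y) (tree_delta t) + psc (ep (tdeg t)) (sig_subst g i t (delta y))"
      using Mul t by simp
    show ?thesis
      unfolding sig_subst_Mul_right[OF False] tree_delta_Mul lin_add lin_psc 1 2 3 4
      using delta_mulc[of "bs (map_tree g s)" "tdeg s" "sig_subst g i t y"]
      by (simp add: IH plinear_add[OF pl_mulc_right] plinear_psc[OF pl_mulc_right] psc_add ep_add
          plinear_of_lin[OF pl_mulc_right] algebra_simps tree_delta_map_tree)
  qed
next
  case (Del a s)
  have "lin (\<lambda>s'. sig_subst g i s' y) (tree_delta (Del a s)) =
      (\<Sum>b\<in>{1..<a}. delc b (delc (a - b) (sig_subst g i s y))) -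
      delc a (lin (\<lambda>s'. sig_subst g i s' y) (tree_delta s))"
    by (simp add: tree_delta_Del lin_diff lin_sum delc_def lin_lin sig_subst_Del[unfolded delc_def])
  then show ?case
    using Del by (simp add: sig_subst_Del delta_delc plinear_add[OF pl_delc] plinear_psc[OF pl_delc]
        ep_add ep_diff ep_def psc_minus psc_uminus)
qed

lemma free_circ_sig_subst:
  assumes "keys y \<subseteq> trees A n e"
  shows "free_circ i (bs s) y =
    sig_subst (\<lambda>j. if j < i then j else j + n - 1) i s (relc (\<lambda>l. i + l - 1) y)"
proof -
  have "graft i s t = subst (\<lambda>j. if j = i then map_tree (\<lambda>l. i + l - 1) t
      else Leaf (if j < i then j else j + n - 1)) s" if "t \<in> keys y" for t
    using assms that by (subst graft_subst[of t A n e]) (auto intro!: subst_cong)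
  then show ?thesis
    unfolding free_circ_lin sig_subst_def relc_def lin_lin lin_bs by (intro lin_cong refl) simp
qed

lemma dg_operad_BV_inf_free: "dg_operad (BV_inf_free :: ('k::field, 'k comb) operad)"
  unfolding BV_inf_free_def lin_ext_lin
proof (rule dg_operad_free)
  show "plinear delta"
    by (rule plinear_lin)
  show "keys (delta (bs t) :: 'k comb) \<subseteq> trees {1..} n (d + 1)" if "t \<in> trees {1..} n d" for n d t
    using that by (auto dest!: tree_delta_keys simp: trees_def)
  show "delta (delta (bs t)) = 0" for t
    by (rule delta_delta)
  show "delta (free_act \<sigma> (bs t)) = free_act \<sigma> (delta (bs t))" for \<sigma> t
    by (simp add: free_act_relc delta_relc tree_delta_map_tree)
  fix m n d e i s t
  assume s: "s \<in> trees {1..} m d" and t: "t \<in> trees {1..} n e" and i: "i \<in> {1..m}"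
  let ?g = "\<lambda>j. if j < i then j else j + n - 1"
  have s': "distinct (leaves s)" "i \<in> lset s" "tdeg s = d"
    using s i by (auto simp: trees_def)
  have "keys (tree_delta t :: 'k comb) \<subseteq> trees {1..} n (e + 1)"
    using t by (auto dest!: tree_delta_keys simp: trees_def)
  note 1 = free_circ_sig_subst[OF this]
  have "keys (bs t :: 'k comb) \<subseteq> trees {1..} n e"
    using t by simp
  note 2 = free_circ_sig_subst[OF this]
  have 3: "free_circ i (tree_delta s) (bs t) = lin (\<lambda>s. free_circ i (bs s) (bs t)) (tree_delta s :: 'k comb)"
    by (simp add: free_circ_lin)
  have "delta (sig_subst ?g i s (relc (\<lambda>l. i + l - 1) (bs t :: 'k comb))) =
    lin (\<lambda>s'. sig_subst ?g i s' (relc (\<lambda>l. i + l - 1) (bs t))) (tree_delta s) +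
    psc (ep (tdeg s)) (sig_subst ?g i s (delta (relc (\<lambda>l. i + l - 1) (bs t))))"
    using s' t by (intro delta_sig_subst[where e = e]) (auto simp: trees_def)
  then show "delta (free_circ i (bs s) (bs t)) =
     free_circ i (delta (bs s)) (bs t) + psc (ep d) (free_circ i (bs s) (delta (bs t)) :: 'k comb)"
    by (simp only: lin_bs 1 2 3 s'(3) delta_relc)
qed

section \<open>Images, quotients and cohomology of dg operads\<close>

lemma ring_of_type_simps [simp]:
  "carrier (ring_of_type_algebra :: 'k::field ring) = UNIV"
  "\<zero>\<^bsub>ring_of_type_algebra :: 'k ring\<^esub> = 0"
  "\<one>\<^bsub>ring_of_type_algebra :: 'k ring\<^esub> = 1"
  "c \<oplus>\<^bsub>ring_of_type_algebra :: 'k ring\<^esub> d = c + d"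
  "c \<otimes>\<^bsub>ring_of_type_algebra :: 'k ring\<^esub> d = c * d"
  by (simp_all add: ring_of_type_algebra_def)

lemma lin_mapD:
  assumes "lin_map M N f"
  shows "x \<in> carrier M \<Longrightarrow> f x \<in> carrier N"
    "\<lbrakk>x \<in> carrier M; y \<in> carrier M\<rbrakk> \<Longrightarrow> f (x \<oplus>\<^bsub>M\<^esub> y) = f x \<oplus>\<^bsub>N\<^esub> f y"
    "x \<in> carrier M \<Longrightarrow> f (c \<odot>\<^bsub>M\<^esub> x) = c \<odot>\<^bsub>N\<^esub> f x"
  using assms by (auto simp: lin_map_def)

lemma lin_mapI:
  assumes "\<And>x. x \<in> carrier M \<Longrightarrow> f x \<in> carrier N"
    "\<And>x y. \<lbrakk>x \<in> carrier M; y \<in> carrier M\<rbrakk> \<Longrightarrow> f (x \<oplus>\<^bsub>M\<^esub> y) = f x \<oplus>\<^bsub>N\<^esub> f y"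
    "\<And>c x. x \<in> carrier M \<Longrightarrow> f (c \<odot>\<^bsub>M\<^esub> x) = c \<odot>\<^bsub>N\<^esub> f x"
  shows "lin_map M N f"
  using assms by (auto simp: lin_map_def)

context
  fixes M :: "('k::field, 'a) module"
  assumes M: "vect M"
begin

interpretation module "ring_of_type_algebra :: 'k ring" M
  by (rule M)

lemma vect_facts:
  shows vect_zero: "\<zero>\<^bsub>M\<^esub> \<in> carrier M"
    and vect_add: "\<lbrakk>x \<in> carrier M; y \<in> carrier M\<rbrakk> \<Longrightarrow> x \<oplus>\<^bsub>M\<^esub> y \<in> carrier M"
    and vect_assoc: "\<lbrakk>x \<in> carrier M; y \<in> carrier M; z \<in> carrier M\<rbrakk> \<Longrightarrow>
      (x \<oplus>\<^bsub>M\<^esub> y) \<oplus>\<^bsub>M\<^esub> z = x \<oplus>\<^bsub>M\<^esub> (y \<oplus>\<^bsub>M\<^esub> z)"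
    and vect_comm: "\<lbrakk>x \<in> carrier M; y \<in> carrier M\<rbrakk> \<Longrightarrow> x \<oplus>\<^bsub>M\<^esub> y = y \<oplus>\<^bsub>M\<^esub> x"
    and vect_lcomm: "\<lbrakk>x \<in> carrier M; y \<in> carrier M; z \<in> carrier M\<rbrakk> \<Longrightarrow>
      x \<oplus>\<^bsub>M\<^esub> (y \<oplus>\<^bsub>M\<^esub> z) = y \<oplus>\<^bsub>M\<^esub> (x \<oplus>\<^bsub>M\<^esub> z)"
    and vect_lzero: "x \<in> carrier M \<Longrightarrow> \<zero>\<^bsub>M\<^esub> \<oplus>\<^bsub>M\<^esub> x = x"
    and vect_rzero: "x \<in> carrier M \<Longrightarrow> x \<oplus>\<^bsub>M\<^esub> \<zero>\<^bsub>M\<^esub> = x"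
    and vect_smult: "x \<in> carrier M \<Longrightarrow> c \<odot>\<^bsub>M\<^esub> x \<in> carrier M"
    and vect_distl: "x \<in> carrier M \<Longrightarrow> (c + d) \<odot>\<^bsub>M\<^esub> x = c \<odot>\<^bsub>M\<^esub> x \<oplus>\<^bsub>M\<^esub> d \<odot>\<^bsub>M\<^esub> x"
    and vect_distr: "\<lbrakk>x \<in> carrier M; y \<in> carrier M\<rbrakk> \<Longrightarrow>
      c \<odot>\<^bsub>M\<^esub> (x \<oplus>\<^bsub>M\<^esub> y) = c \<odot>\<^bsub>M\<^esub> x \<oplus>\<^bsub>M\<^esub> c \<odot>\<^bsub>M\<^esub> y"
    and vect_smult_assoc: "x \<in> carrier M \<Longrightarrow> (c * d) \<odot>\<^bsub>M\<^esub> x = c \<odot>\<^bsub>M\<^esub> (d \<odot>\<^bsub>M\<^esub> x)"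
    and vect_smult_one: "x \<in> carrier M \<Longrightarrow> 1 \<odot>\<^bsub>M\<^esub> x = x"
    and vect_smult_0: "x \<in> carrier M \<Longrightarrow> 0 \<odot>\<^bsub>M\<^esub> x = \<zero>\<^bsub>M\<^esub>"
    and vect_smult_zero: "c \<odot>\<^bsub>M\<^esub> \<zero>\<^bsub>M\<^esub> = \<zero>\<^bsub>M\<^esub>"
    and vect_neg: "x \<in> carrier M \<Longrightarrow> x \<oplus>\<^bsub>M\<^esub> (- 1) \<odot>\<^bsub>M\<^esub> x = \<zero>\<^bsub>M\<^esub>"
  using smult_l_distr[of 1 "- 1" x]
  by (simp_all add: M.a_ac smult_l_distr[simplified] smult_r_distr[simplified] smult_assoc1[simplified]
      smult_one[simplified] smult_l_null[simplified] smult_r_null[simplified])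

end

context dg_operad
begin

lemma circ_closed: "\<lbrakk>x \<in> elts P m d; y \<in> elts P n e; i \<in> {1..m}\<rbrakk> \<Longrightarrow>
    circ P m d n e i x y \<in> elts P (m + n - 1) (d + e)"
  using lin_mapD(1)[OF circ_linear_left] by blast

lemma act_closed: "\<lbrakk>x \<in> elts P n d; \<sigma> permutes {1..n}\<rbrakk> \<Longrightarrow> act P n d \<sigma> x \<in> elts P n d"
  using lin_mapD(1)[OF act_linear] by blast

lemma dif_closed: "x \<in> elts P n d \<Longrightarrow> dif P n d x \<in> elts P n (d + 1)"
  using lin_mapD(1)[OF dif_linear] by blast

lemmas closed = circ_closed act_closed dif_closed vect_smult[OF vect_space] vect_add[OF vect_space]

end

lemma lin_map_zero:
  assumes "vect M" "vect N" "lin_map M N f"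
  shows "f \<zero>\<^bsub>M\<^esub> = \<zero>\<^bsub>N\<^esub>"
  using lin_mapD(3)[OF assms(3), of "\<zero>\<^bsub>M\<^esub>" 0] lin_mapD(1)[OF assms(3), of "\<zero>\<^bsub>M\<^esub>"] assms(1,2)
  by (simp add: vect_zero vect_smult_0)

section \<open>Structures covered by a dg operad\<close>

lemma vect_image:
  fixes M :: "('k::field, 'a) module" and N :: "('k, 'b) module"
  assumes M: "vect M" and surj: "f ` carrier M = carrier N"
    and add: "\<And>x y. \<lbrakk>x \<in> carrier M; y \<in> carrier M\<rbrakk> \<Longrightarrow> f (x \<oplus>\<^bsub>M\<^esub> y) = f x \<oplus>\<^bsub>N\<^esub> f y"
    and smult: "\<And>c x. x \<in> carrier M \<Longrightarrow> f (c \<odot>\<^bsub>M\<^esub> x) = c \<odot>\<^bsub>N\<^esub> f x"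
    and zero: "f \<zero>\<^bsub>M\<^esub> = \<zero>\<^bsub>N\<^esub>"
  shows "vect N"
proof -
  note [simp] = vect_facts[OF M] add[symmetric] smult[symmetric] zero[symmetric]
  have neg: "\<exists>y\<in>carrier M. y \<oplus>\<^bsub>M\<^esub> x = \<zero>\<^bsub>M\<^esub>" if "x \<in> carrier M" for x
    using vect_neg[OF M that] vect_smult[OF M that, of "- 1"] vect_comm[OF M that vect_smult[OF M that, of "- 1"]]
    by metis
  show ?thesis
  proof (rule vectI, unfold surj[symmetric], goal_cases)
    case (6 x)
    then show ?case
      using neg by (force simp del: vect_comm[OF M] vect_lcomm[OF M])
  next
    case (4 x y)
    then show ?case
      using vect_comm[OF M] by (auto simp del: vect_comm[OF M] vect_lcomm[OF M])
  qed (auto simp del: vect_comm[OF M] vect_lcomm[OF M])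
qed

text \<open>Elements of \<open>Q\<close> have preimages, so each axiom of \<open>Q\<close> is the
  image of the same axiom of \<open>P\<close>. It yields that quotients are dg operads and that the
  inverse of an isomorphism is a homomorphism.\<close>

lemma dg_operad_hom_image:
  fixes P :: "('k::field, 'a) operad" and Q :: "('k, 'b) operad"
  assumes P: "dg_operad P" and surj: "\<And>n d. \<phi> n d ` elts P n d = elts Q n d"
    and add: "\<And>n d x y. \<lbrakk>x \<in> elts P n d; y \<in> elts P n d\<rbrakk> \<Longrightarrow>
      \<phi> n d (x \<oplus>\<^bsub>space P n d\<^esub> y) = \<phi> n d x \<oplus>\<^bsub>space Q n d\<^esub> \<phi> n d y"
    and smult: "\<And>n d c x. x \<in> elts P n d \<Longrightarrow> \<phi> n d (c \<odot>\<^bsub>space P n d\<^esub> x) = c \<odot>\<^bsub>space Q n d\<^esub> \<phi> n d x"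
    and zero: "\<And>n d. \<phi> n d \<zero>\<^bsub>space P n d\<^esub> = \<zero>\<^bsub>space Q n d\<^esub>"
    and ident: "\<phi> 1 0 (ident P) = ident Q"
    and circ: "\<And>m d n e i x y. \<lbrakk>x \<in> elts P m d; y \<in> elts P n e; i \<in> {1..m}\<rbrakk> \<Longrightarrow>
      \<phi> (m + n - 1) (d + e) (circ P m d n e i x y) = circ Q m d n e i (\<phi> m d x) (\<phi> n e y)"
    and act: "\<And>n d \<sigma> x. \<lbrakk>x \<in> elts P n d; \<sigma> permutes {1..n}\<rbrakk> \<Longrightarrow>
      \<phi> n d (act P n d \<sigma> x) = act Q n d \<sigma> (\<phi> n d x)"
    and dif: "\<And>n d x. x \<in> elts P n d \<Longrightarrow> \<phi> n (d + 1) (dif P n d x) = dif Q n d (\<phi> n d x)"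
  shows "dg_operad_hom P Q \<phi>"
proof -
  note One_nat_def [simp del]
  interpret P: dg_operad P
    by (rule P)
  have lift: "\<exists>x\<in>elts P n d. y = \<phi> n d x" if "y \<in> elts Q n d" for n d y
    using that surj[of n d] by auto
  have mem: "x \<in> elts P n d \<Longrightarrow> \<phi> n d x \<in> elts Q n d" for n d x
    using surj[of n d] by auto
  have vQ: "vect (space Q n d)" for n d
    by (rule vect_image[OF P.vect_space surj add smult zero])
  have lin: "lin_map (space P n d) (space Q n d) (\<phi> n d)" for n d
    by (rule lin_mapI) (auto simp: mem add smult)
  have "dg_operad Q"
  proof (rule dg_operad.intro, goal_cases)
    case (1 n d)
    show ?case by (rule vQ)
  next
    case 2
    show ?case
      using mem[OF P.ident_closed] ident by simp
  next
    case (3 i m y n e d)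
    then obtain y' where y': "y' \<in> elts P n e" "y = \<phi> n e y'"
      using lift by blast
    show ?case
      by (rule lin_mapI; (drule lift)+; clarsimp simp: y' P.closed mem circ[OF _ y'(1) 3(1), symmetric]
          add[symmetric] smult[symmetric] lin_mapD[OF P.circ_linear_left[OF 3(1) y'(1)]])
  next
    case (4 i m x d n e)
    then obtain x' where x': "x' \<in> elts P m d" "x = \<phi> m d x'"
      using lift by blast
    show ?case
      by (rule lin_mapI; (drule lift)+; clarsimp simp: x' P.closed mem circ[OF x'(1) _ 4(1), symmetric]
          add[symmetric] smult[symmetric] lin_mapD[OF P.circ_linear_right[OF 4(1) x'(1)]])
  next
    case (5 x n d)
    then obtain x' where x': "x' \<in> elts P n d" "x = \<phi> n d x'"
      using lift by blast
    show ?case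
      using circ[OF P.ident_closed x'(1), of 1] P.ident_circ[OF x'(1)] by (simp add: x' ident)
  next
    case (6 x n d i)
    then obtain x' where x': "x' \<in> elts P n d" "x = \<phi> n d x'"
      using lift by blast
    show ?case
      using circ[OF x'(1) P.ident_closed 6(2)] P.circ_ident[OF x'(1) 6(2)] by (simp add: x' ident)
  next
    case (7 x l d y m e z n f i j)
    then obtain x' y' z' where x': "x' \<in> elts P l d" "x = \<phi> l d x'" and y': "y' \<in> elts P m e" "y = \<phi> m e y'"
      and z': "z' \<in> elts P n f" "z = \<phi> n f z'"
      using lift by metis
    have ij: "i + j - 1 \<in> {1..l + m - 1}"
      using 7(4,5) by auto
    show ?case
      using P.circ_sequential[OF x'(1) y'(1) z'(1) 7(4,5)]
        circ[OF P.circ_closed[OF x'(1) y'(1) 7(4)] z'(1) ij]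
        circ[OF x'(1) P.circ_closed[OF y'(1) z'(1) 7(5)] 7(4)]
        circ[OF x'(1) y'(1) 7(4)] circ[OF y'(1) z'(1) 7(5)] 7(4,5)
      by (simp add: x' y' z' add.assoc)
  next
    case (8 x l d y m e z n f i k)
    then obtain x' y' z' where x': "x' \<in> elts P l d" "x = \<phi> l d x'" and y': "y' \<in> elts P m e" "y = \<phi> m e y'"
      and z': "z' \<in> elts P n f" "z = \<phi> n f z'"
      using lift by metis
    have ik: "k + m - 1 \<in> {1..l + m - 1}" "i \<in> {1..l + n - 1}"
      using 8(4-6) by auto
    \<comment> \<open>The subtractions are truncated; the two arities agree because \<open>l\<close>
      is at least 1.\<close>
    have e: "l + n - 1 + m - 1 = l + m - 1 + n - 1" "d + f + e = d + e + f"
      using 8(4) by auto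
    note xz = P.circ_closed[OF x'(1) z'(1) 8(5)]
    note 1 = lin_mapD(1)[OF P.circ_linear_left[OF ik(2) y'(1)] xz, unfolded e]
    note 2 = circ[OF xz y'(1) ik(2), unfolded e]
    show ?case
      using P.circ_parallel[OF x'(1) y'(1) z'(1) 8(4-6)]
        circ[OF P.circ_closed[OF x'(1) y'(1) 8(4)] z'(1) ik(1)]
        smult[OF 1, of "(- 1) powi (e * f)"] 2
        circ[OF x'(1) y'(1) 8(4)] circ[OF x'(1) z'(1) 8(5)]
      by (simp add: x' y' z')
  next
    case (9 \<sigma> n d)
    show ?case
      by (rule lin_mapI; (drule lift)+; clarsimp simp: P.closed 9 mem act[OF _ 9, symmetric]
          add[symmetric] smult[symmetric] lin_mapD[OF P.act_linear[OF 9]])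
  next
    case (10 x n d)
    then obtain x' where x': "x' \<in> elts P n d" "x = \<phi> n d x'"
      using lift by blast
    show ?case
      using act[OF x'(1), of id] P.act_id[OF x'(1)] by (simp add: x' permutes_id)
  next
    case (11 x n d \<sigma> \<tau>)
    then obtain x' where x': "x' \<in> elts P n d" "x = \<phi> n d x'"
      using lift by blast
    show ?case
      using act[OF x'(1) 11(2)] P.act_comp[OF x'(1) 11(2,3)] act[OF x'(1), of "\<sigma> \<circ> \<tau>"]
        act[OF P.act_closed[OF x'(1) 11(2)] 11(3)] 11
      by (simp add: x' permutes_compose)
  next
    case (12 x m d y n e i \<sigma> \<tau>)
    then obtain x' y' where x': "x' \<in> elts P m d" "x = \<phi> m d x'" and y': "y' \<in> elts P n e" "y = \<phi> n e y'"
      using lift by metis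
    have \<sigma>i: "\<sigma> i \<in> {1..m}"
      using 12(3,4) permutes_in_image[OF 12(4), of i] by blast
    have lhs: "circ Q m d n e i (act Q m d \<sigma> x) (act Q n e \<tau> y) =
        \<phi> (m + n - 1) (d + e) (circ P m d n e i (act P m d \<sigma> x') (act P n e \<tau> y'))"
      using circ[OF P.act_closed[OF x'(1) 12(4)] P.act_closed[OF y'(1) 12(5)] 12(3)]
        act[OF x'(1) 12(4)] act[OF y'(1) 12(5)] by (simp add: x' y')
    show ?case
      unfolding lhs P.circ_equivariant[OF x'(1) y'(1) 12(3,4,5)]
      unfolding x'(2) y'(2)
      using act[OF P.circ_closed[OF x'(1) y'(1) \<sigma>i] perm_circ_permutes[OF 12(3,4,5)]]
        circ[OF x'(1) y'(1) \<sigma>i] by simp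
  next
    case (13 n d)
    show ?case
      by (rule lin_mapI; (drule lift)+; clarsimp simp: P.closed mem dif[symmetric]
          add[symmetric] smult[symmetric] lin_mapD[OF P.dif_linear])
  next
    case (14 x n d)
    then obtain x' where x': "x' \<in> elts P n d" "x = \<phi> n d x'"
      using lift by blast
    show ?case
      using dif[OF x'(1)] dif[OF P.dif_closed[OF x'(1)]] P.dif_dif[OF x'(1)] zero[of n "d + 2"]
      by (simp add: x' add.assoc)
  next
    case (15 x n d \<sigma>)
    then obtain x' where x': "x' \<in> elts P n d" "x = \<phi> n d x'"
      using lift by blast
    show ?case
      using dif[OF x'(1)] act[OF x'(1) 15(2)] P.dif_act[OF x'(1) 15(2)]
        dif[OF P.act_closed[OF x'(1) 15(2)]] act[OF P.dif_closed[OF x'(1)] 15(2)]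
      by (simp add: x')
  next
    case (16 x m d y n e i)
    then obtain x' y' where x': "x' \<in> elts P m d" "x = \<phi> m d x'" and y': "y' \<in> elts P n e" "y = \<phi> n e y'"
      using lift by metis
    note dx = P.dif_closed[OF x'(1)] and dy = P.dif_closed[OF y'(1)]
    have 1: "circ P m (d + 1) n e i (dif P m d x') y' \<in> elts P (m + n - 1) (d + e + 1)"
      using P.circ_closed[OF dx y'(1) 16(3)] by (simp add: algebra_simps)
    have 2: "circ P m d n (e + 1) i x' (dif P n e y') \<in> elts P (m + n - 1) (d + e + 1)"
      using P.circ_closed[OF x'(1) dy 16(3)] by (simp add: algebra_simps)
    have 3: "\<phi> (m + n - 1) (d + e + 1) (circ P m (d + 1) n e i (dif P m d x') y') =
        circ Q m (d + 1) n e i (\<phi> m (d + 1) (dif P m d x')) (\<phi> n e y')"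
      using circ[OF dx y'(1) 16(3)] by (simp add: algebra_simps)
    have 4: "\<phi> (m + n - 1) (d + e + 1) (circ P m d n (e + 1) i x' (dif P n e y')) =
        circ Q m d n (e + 1) i (\<phi> m d x') (\<phi> n (e + 1) (dif P n e y'))"
      using circ[OF x'(1) dy 16(3)] by (simp add: algebra_simps)
    show ?case
      using P.dif_circ[OF x'(1) y'(1) 16(3)] dif[OF P.circ_closed[OF x'(1) y'(1) 16(3)]]
        circ[OF x'(1) y'(1) 16(3)] dif[OF x'(1)] dif[OF y'(1)] 1 2 3 4 
      by (simp add: x' y' add smult vect_smult[OF P.vect_space])
  qed
  then show ?thesis
    by (intro dg_operad_hom.intro dg_operad_hom_axioms.intro P lin ident circ act dif)
qed

section \<open>Cosets of a subspace\<close>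

definition vsub :: "('k::field, 'a) module \<Rightarrow> 'a set \<Rightarrow> bool" where
  "vsub M N \<longleftrightarrow> N \<subseteq> carrier M \<and> \<zero>\<^bsub>M\<^esub> \<in> N \<and> (\<forall>x\<in>N. \<forall>y\<in>N. x \<oplus>\<^bsub>M\<^esub> y \<in> N) \<and>
     (\<forall>c. \<forall>x\<in>N. c \<odot>\<^bsub>M\<^esub> x \<in> N)"

lemma mem_rcos: "y \<in> N +>\<^bsub>M\<^esub> x \<longleftrightarrow> (\<exists>h\<in>N. y = h \<oplus>\<^bsub>M\<^esub> x)"
  by (auto simp: a_r_coset_def')

context
  fixes M :: "('k::field, 'a) module" and N :: "'a set"
  assumes M: "vect M" and N: "vsub M N"
begin

lemma vsub_carrier: "x \<in> N \<Longrightarrow> x \<in> carrier M"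
  using N by (auto simp: vsub_def)

lemma rcos_self: "x \<in> carrier M \<Longrightarrow> x \<in> N +>\<^bsub>M\<^esub> x"
  using N by (auto simp: vsub_def mem_rcos vect_lzero[OF M] intro!: bexI[of _ "\<zero>\<^bsub>M\<^esub>"])

lemma rcos_absorb:
  assumes x: "x \<in> carrier M" and h: "h \<in> N"
  shows "N +>\<^bsub>M\<^esub> (h \<oplus>\<^bsub>M\<^esub> x) = N +>\<^bsub>M\<^esub> x"
proof (intro equalityI subsetI)
  fix y assume "y \<in> N +>\<^bsub>M\<^esub> (h \<oplus>\<^bsub>M\<^esub> x)"
  then obtain k where "k \<in> N" "y = k \<oplus>\<^bsub>M\<^esub> (h \<oplus>\<^bsub>M\<^esub> x)"
    by (auto simp: mem_rcos)
  then show "y \<in> N +>\<^bsub>M\<^esub> x"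
    using N x h vsub_carrier by (auto simp: mem_rcos vsub_def vect_assoc[OF M] intro!: bexI[of _ "k \<oplus>\<^bsub>M\<^esub> h"])
next
  fix y assume "y \<in> N +>\<^bsub>M\<^esub> x"
  then obtain k where k: "k \<in> N" "y = k \<oplus>\<^bsub>M\<^esub> x"
    by (auto simp: mem_rcos)
  have mh: "(- 1) \<odot>\<^bsub>M\<^esub> h \<in> N" "(- 1) \<odot>\<^bsub>M\<^esub> h \<oplus>\<^bsub>M\<^esub> h = \<zero>\<^bsub>M\<^esub>"
    using N h vect_neg[OF M, of h] vect_comm[OF M, of h] vsub_carrier by (auto simp: vsub_def)
  have "(k \<oplus>\<^bsub>M\<^esub> (- 1) \<odot>\<^bsub>M\<^esub> h) \<oplus>\<^bsub>M\<^esub> (h \<oplus>\<^bsub>M\<^esub> x) = k \<oplus>\<^bsub>M\<^esub> (((- 1) \<odot>\<^bsub>M\<^esub> h \<oplus>\<^bsub>M\<^esub> h) \<oplus>\<^bsub>M\<^esub> x)"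
    using k x h mh(1) vsub_carrier by (simp add: vect_assoc[OF M] vect_add[OF M])
  then have "(k \<oplus>\<^bsub>M\<^esub> (- 1) \<odot>\<^bsub>M\<^esub> h) \<oplus>\<^bsub>M\<^esub> (h \<oplus>\<^bsub>M\<^esub> x) = y"
    using k x by (simp add: mh vect_lzero[OF M])
  moreover have "k \<oplus>\<^bsub>M\<^esub> (- 1) \<odot>\<^bsub>M\<^esub> h \<in> N"
    using N k mh by (simp add: vsub_def)
  ultimately show "y \<in> N +>\<^bsub>M\<^esub> (h \<oplus>\<^bsub>M\<^esub> x)"
    by (force simp: mem_rcos)
qed

lemma rcos_eq_iff:
  "\<lbrakk>x \<in> carrier M; y \<in> carrier M\<rbrakk> \<Longrightarrow> N +>\<^bsub>M\<^esub> x = N +>\<^bsub>M\<^esub> y \<longleftrightarrow> (\<exists>h\<in>N. x = h \<oplus>\<^bsub>M\<^esub> y)"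
  using rcos_self rcos_absorb by (auto simp flip: mem_rcos) (metis mem_rcos)+

text \<open>The operations of a quotient are defined as unions over all representatives. If all
  representatives give the same coset, the union is that coset; this turns well-definedness into an
  equation.\<close>

lemma UN_rcos:
  assumes "x \<in> carrier M" "\<And>h. h \<in> N \<Longrightarrow> g (h \<oplus>\<^bsub>M\<^esub> x) = C"
  shows "(\<Union>z\<in>N +>\<^bsub>M\<^esub> x. g z) = C"
proof -
  have "g z = C" if "z \<in> N +>\<^bsub>M\<^esub> x" for z
    using that assms(2) by (auto simp: mem_rcos)
  then show ?thesis
    using rcos_self[OF assms(1)] by auto
qed

lemma rcos_zero_iff: "x \<in> carrier M \<Longrightarrow> N +>\<^bsub>M\<^esub> x = N \<longleftrightarrow> x \<in> N"
proof -
  assume x: "x \<in> carrier M"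
  have "N +>\<^bsub>M\<^esub> \<zero>\<^bsub>M\<^esub> = N"
    using vsub_carrier by (auto simp: mem_rcos vect_rzero[OF M])
  then show ?thesis
    using rcos_eq_iff[OF x vect_zero[OF M]] x vsub_carrier by (auto simp: vect_rzero[OF M])
qed

lemma quot_module_simps:
  "carrier (quot_module M N) = (\<lambda>x. N +>\<^bsub>M\<^esub> x) ` carrier M"
  "\<zero>\<^bsub>quot_module M N\<^esub> = N"
  "\<lbrakk>x \<in> carrier M; y \<in> carrier M\<rbrakk> \<Longrightarrow>
    (N +>\<^bsub>M\<^esub> x) \<oplus>\<^bsub>quot_module M N\<^esub> (N +>\<^bsub>M\<^esub> y) = N +>\<^bsub>M\<^esub> (x \<oplus>\<^bsub>M\<^esub> y)"
  "x \<in> carrier M \<Longrightarrow> c \<odot>\<^bsub>quot_module M N\<^esub> (N +>\<^bsub>M\<^esub> x) = N +>\<^bsub>M\<^esub> (c \<odot>\<^bsub>M\<^esub> x)"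
proof -
  show "carrier (quot_module M N) = (\<lambda>x. N +>\<^bsub>M\<^esub> x) ` carrier M"
    by (auto simp: quot_module_def A_RCOSETS_def')
  show "\<zero>\<^bsub>quot_module M N\<^esub> = N"
    by (simp add: quot_module_def)
  show "c \<odot>\<^bsub>quot_module M N\<^esub> (N +>\<^bsub>M\<^esub> x) = N +>\<^bsub>M\<^esub> (c \<odot>\<^bsub>M\<^esub> x)" if x: "x \<in> carrier M"
  proof -
    have "(\<Union>z\<in>N +>\<^bsub>M\<^esub> x. N +>\<^bsub>M\<^esub> (c \<odot>\<^bsub>M\<^esub> z)) = N +>\<^bsub>M\<^esub> (c \<odot>\<^bsub>M\<^esub> x)"
      using x N vsub_carrier
      by (intro UN_rcos) (auto simp: vsub_def vect_distr[OF M] vect_smult[OF M] intro!: rcos_absorb)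
    then show ?thesis
      by (simp add: quot_module_def)
  qed
  show "(N +>\<^bsub>M\<^esub> x) \<oplus>\<^bsub>quot_module M N\<^esub> (N +>\<^bsub>M\<^esub> y) = N +>\<^bsub>M\<^esub> (x \<oplus>\<^bsub>M\<^esub> y)"
    if x: "x \<in> carrier M" and y: "y \<in> carrier M"
  proof -
    have "set_add M (N +>\<^bsub>M\<^esub> x) (N +>\<^bsub>M\<^esub> y) = N +>\<^bsub>M\<^esub> (x \<oplus>\<^bsub>M\<^esub> y)"
    proof (intro equalityI subsetI)
      fix z assume "z \<in> set_add M (N +>\<^bsub>M\<^esub> x) (N +>\<^bsub>M\<^esub> y)"
      then obtain h k where "h \<in> N" "k \<in> N" "z = (h \<oplus>\<^bsub>M\<^esub> x) \<oplus>\<^bsub>M\<^esub> (k \<oplus>\<^bsub>M\<^esub> y)"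
        by (auto simp: set_add_def' mem_rcos)
      then show "z \<in> N +>\<^bsub>M\<^esub> (x \<oplus>\<^bsub>M\<^esub> y)"
        using x y N vsub_carrier by (auto simp: vsub_def mem_rcos intro!: bexI[of _ "h \<oplus>\<^bsub>M\<^esub> k"])
          (simp add: vect_assoc[OF M] vect_lcomm[OF M] vect_add[OF M])
    next
      fix z assume "z \<in> N +>\<^bsub>M\<^esub> (x \<oplus>\<^bsub>M\<^esub> y)"
      then obtain h where "h \<in> N" "z = h \<oplus>\<^bsub>M\<^esub> (x \<oplus>\<^bsub>M\<^esub> y)"
        by (auto simp: mem_rcos)
      then have "z = (h \<oplus>\<^bsub>M\<^esub> x) \<oplus>\<^bsub>M\<^esub> y" "h \<oplus>\<^bsub>M\<^esub> x \<in> N +>\<^bsub>M\<^esub> x"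
        using x y vsub_carrier by (auto simp: vect_assoc[OF M] mem_rcos)
      then show "z \<in> set_add M (N +>\<^bsub>M\<^esub> x) (N +>\<^bsub>M\<^esub> y)"
        using rcos_self[OF y] by (auto simp: set_add_def')
    qed
    then show ?thesis
      by (simp add: quot_module_def)
  qed
qed

end

section \<open>Quotients by dg operadic ideals\<close>

locale dg_operad_ideal = dg_operad P for P :: "('k::field, 'a) operad" +
  fixes J :: "nat \<Rightarrow> int \<Rightarrow> 'a set"
  assumes vsub_J: "vsub (space P n d) (J n d)"
    and act_J: "\<lbrakk>x \<in> J n d; \<sigma> permutes {1..n}\<rbrakk> \<Longrightarrow> act P n d \<sigma> x \<in> J n d"
    and circ_left_J: "\<lbrakk>x \<in> J m d; y \<in> elts P n e; i \<in> {1..m}\<rbrakk> \<Longrightarrow>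
      circ P m d n e i x y \<in> J (m + n - 1) (d + e)"
    and circ_right_J: "\<lbrakk>x \<in> elts P m d; y \<in> J n e; i \<in> {1..m}\<rbrakk> \<Longrightarrow>
      circ P m d n e i x y \<in> J (m + n - 1) (d + e)"
    and dif_J: "x \<in> J n d \<Longrightarrow> dif P n d x \<in> J n (d + 1)"
begin

lemma J_elts: "x \<in> J n d \<Longrightarrow> x \<in> elts P n d"
  using vsub_J[of n d] by (auto simp: vsub_def)

lemma coset_eq_iff:
  "\<lbrakk>x \<in> elts P n d; y \<in> elts P n d\<rbrakk> \<Longrightarrow>
    coset P J n d x = coset P J n d y \<longleftrightarrow> (\<exists>h\<in>J n d. x = h \<oplus>\<^bsub>space P n d\<^esub> y)"
  unfolding coset_def by (rule rcos_eq_iff[OF vect_space vsub_J])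

lemma coset_absorb:
  "\<lbrakk>x \<in> elts P n d; h \<in> J n d\<rbrakk> \<Longrightarrow> coset P J n d (h \<oplus>\<^bsub>space P n d\<^esub> x) = coset P J n d x"
  unfolding coset_def by (rule rcos_absorb[OF vect_space vsub_J])

lemma coset_self: "x \<in> elts P n d \<Longrightarrow> x \<in> coset P J n d x"
  unfolding coset_def by (rule rcos_self[OF vect_space vsub_J])

lemma UN_coset:
  "x \<in> elts P n d \<Longrightarrow> (\<And>h. h \<in> J n d \<Longrightarrow> g (h \<oplus>\<^bsub>space P n d\<^esub> x) = C) \<Longrightarrow>
    (\<Union>z\<in>coset P J n d x. g z) = C"
  unfolding coset_def by (rule UN_rcos[OF vect_space vsub_J])

lemma coset_zero_iff: "x \<in> elts P n d \<Longrightarrow> coset P J n d x = \<zero>\<^bsub>space (quot_operad P J) n d\<^esub> \<longleftrightarrow> x \<in> J n d"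
  unfolding coset_def using rcos_zero_iff[OF vect_space vsub_J]
  by (simp add: quot_operad_def quot_module_def)

lemma elts_quot: "elts (quot_operad P J) n d = coset P J n d ` elts P n d"
  using quot_module_simps(1)[OF vect_space vsub_J] by (simp add: quot_operad_def coset_def[abs_def])

lemma quot_hom: "dg_operad_hom P (quot_operad P J) (coset P J)"
proof (rule dg_operad_hom_image[OF dg_operad_axioms], goal_cases)
  case (1 n d)
  show ?case
    by (rule elts_quot[symmetric])
next
  case (2 n d x y)
  then show ?case
    using quot_module_simps(3)[OF vect_space vsub_J] by (simp add: quot_operad_def coset_def)
next
  case (3 n d c x)
  then show ?case
    using quot_module_simps(4)[OF vect_space vsub_J] by (simp add: quot_operad_def coset_def)
next
  case (4 n d)
  show ?case
    using vsub_J[of n d] by (subst coset_zero_iff) (auto simp: vsub_def vect_zero[OF vect_space])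
next
  case 5
  show ?case
    by (simp add: quot_operad_def)
next
  case (6 m d n e i x y)
  let ?c = "\<lambda>x y. coset P J (m + n - 1) (d + e) (circ P m d n e i x y)"
  have 1: "?c (h \<oplus>\<^bsub>space P m d\<^esub> x) (k \<oplus>\<^bsub>space P n e\<^esub> y) = ?c x y" if h: "h \<in> J m d" and k: "k \<in> J n e" for h k
  proof -
    have ky: "k \<oplus>\<^bsub>space P n e\<^esub> y \<in> elts P n e"
      using 6 k J_elts vect_add[OF vect_space] by blast
    have "?c (h \<oplus>\<^bsub>space P m d\<^esub> x) (k \<oplus>\<^bsub>space P n e\<^esub> y) = ?c x (k \<oplus>\<^bsub>space P n e\<^esub> y)"
      unfolding lin_mapD(2)[OF circ_linear_left[OF 6(3) ky] J_elts[OF h] 6(1)]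
      by (intro coset_absorb circ_left_J[OF h ky 6(3)] circ_closed[OF 6(1) ky 6(3)])
    also have "\<dots> = ?c x y"
      unfolding lin_mapD(2)[OF circ_linear_right[OF 6(3) 6(1)] J_elts[OF k] 6(2)]
      by (intro coset_absorb circ_right_J[OF 6(1) k 6(3)] lin_mapD(1)[OF circ_linear_right[OF 6(3,1)] 6(2)])
    finally show ?thesis .
  qed
  have "(\<Union>x'\<in>coset P J m d x. \<Union>y'\<in>coset P J n e y. ?c x' y') = ?c x y"
    by (intro UN_coset 6 1)
  then show ?case
    by (simp add: quot_operad_def)
next
  case (7 n d \<sigma> x)
  have "coset P J n d (act P n d \<sigma> (h \<oplus>\<^bsub>space P n d\<^esub> x)) = coset P J n d (act P n d \<sigma> x)"
    if h: "h \<in> J n d" for h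
    unfolding lin_mapD(2)[OF act_linear[OF 7(2)] J_elts[OF h] 7(1)]
    by (intro coset_absorb act_J[OF h 7(2)] act_closed[OF 7(1) 7(2)])
  then have "(\<Union>x'\<in>coset P J n d x. coset P J n d (act P n d \<sigma> x')) = coset P J n d (act P n d \<sigma> x)"
    by (intro UN_coset 7)
  then show ?case
    by (simp add: quot_operad_def)
next
  case (8 n d x)
  have "coset P J n (d + 1) (dif P n d (h \<oplus>\<^bsub>space P n d\<^esub> x)) = coset P J n (d + 1) (dif P n d x)"
    if h: "h \<in> J n d" for h
    unfolding lin_mapD(2)[OF dif_linear J_elts[OF h] 8]
    by (intro coset_absorb dif_J[OF h] dif_closed[OF 8])
  then have "(\<Union>x'\<in>coset P J n d x. coset P J n (d + 1) (dif P n d x')) = coset P J n (d + 1) (dif P n d x)"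
    by (intro UN_coset 8)
  then show ?case
    by (simp add: quot_operad_def)
qed

lemma dg_operad_quot: "dg_operad (quot_operad P J)"
  using quot_hom by (simp add: dg_operad_hom_def)

end

text \<open>The value at an arbitrarily chosen representative. By \<open>induced_coset\<close> it
  does not depend on the choice as soon as the homomorphism vanishes on the ideal.\<close>

definition induced :: "(nat \<Rightarrow> int \<Rightarrow> 'a \<Rightarrow> 'b) \<Rightarrow> nat \<Rightarrow> int \<Rightarrow> 'a set \<Rightarrow> 'b" where
  "induced \<phi> n d C = \<phi> n d (SOME x. x \<in> C)"


lemma (in dg_operad_hom) hom_closed: "x \<in> elts P n d \<Longrightarrow> \<phi> n d x \<in> elts Q n d"
  by (rule lin_mapD(1)[OF hom_linear])

lemma (in dg_operad_hom) hom_zero: "\<phi> n d \<zero>\<^bsub>space P n d\<^esub> = \<zero>\<^bsub>space Q n d\<^esub>"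
  by (rule lin_map_zero[OF P.vect_space Q.vect_space hom_linear])

lemma induced_coset:
  assumes "dg_operad_ideal P J" "dg_operad_hom P Q \<phi>"
    "\<And>n d x. x \<in> J n d \<Longrightarrow> \<phi> n d x = \<zero>\<^bsub>space Q n d\<^esub>" "x \<in> elts P n d"
  shows "induced \<phi> n d (coset P J n d x) = \<phi> n d x"
proof -
  interpret J: dg_operad_ideal P J
    by (rule assms)
  interpret h: dg_operad_hom P Q \<phi>
    by (rule assms)
  have "\<phi> n d y = \<phi> n d x" if y: "y \<in> coset P J n d x" for y
  proof -
    obtain k where "k \<in> J n d" "y = k \<oplus>\<^bsub>space P n d\<^esub> x"
      using y by (auto simp: coset_def mem_rcos)
    then show ?thesis
      using assms(3,4) J.J_elts h.hom_closed
      by (simp add: lin_mapD(2)[OF h.hom_linear] vect_lzero[OF h.Q.vect_space])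
  qed
  then show ?thesis
    unfolding induced_def using J.coset_self[OF assms(4)] by (metis someI_ex)
qed

lemma induced_hom:
  assumes "dg_operad_ideal P J" "dg_operad_hom P Q \<phi>"
    "\<And>n d x. x \<in> J n d \<Longrightarrow> \<phi> n d x = \<zero>\<^bsub>space Q n d\<^esub>"
  shows "dg_operad_hom (quot_operad P J) Q (induced \<phi>)"
proof -
  interpret J: dg_operad_ideal P J
    by (rule assms)
  interpret h: dg_operad_hom P Q \<phi>
    by (rule assms)
  interpret c: dg_operad_hom P "quot_operad P J" "coset P J"
    by (rule J.quot_hom)
  note One_nat_def [simp del]
  have ind: "x \<in> elts P n d \<Longrightarrow> induced \<phi> n d (coset P J n d x) = \<phi> n d x" for n d x
    by (rule induced_coset[OF assms(1,2)]) (use assms(3) in auto)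
  show ?thesis
  proof (intro dg_operad_hom.intro dg_operad_hom_axioms.intro J.dg_operad_quot h.Q.dg_operad_axioms,
      goal_cases)
    case (1 n d)
    show ?case
      by (rule lin_mapI; unfold J.elts_quot; clarsimp simp: ind h.hom_closed J.closed
          lin_mapD(2,3)[OF c.hom_linear, symmetric] lin_mapD(2,3)[OF h.hom_linear])
  next
    case 2
    show ?case
      using ind[OF J.ident_closed] by (simp add: c.hom_ident h.hom_ident)
  next
    case (3 x m d y n e i)
    then obtain x' y' where x': "x' \<in> elts P m d" "x = coset P J m d x'"
      and y': "y' \<in> elts P n e" "y = coset P J n e y'"
      by (auto simp: J.elts_quot)
    show ?case
      using 3(3) J.circ_closed[OF x'(1) y'(1) 3(3)]
      by (simp add: x' y' c.hom_circ[symmetric] ind h.hom_circ)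
  next
    case (4 x n d \<sigma>)
    then show ?case
      by (auto simp: J.elts_quot c.hom_act[symmetric] ind J.closed h.hom_act)
  next
    case (5 x n d)
    then show ?case
      by (auto simp: J.elts_quot c.hom_dif[symmetric] ind J.closed h.hom_dif)
  qed
qed

section \<open>Cycles, boundaries and the cohomology operad\<close>

lemma cycles_simps [simp]:
  "elts (cycles P) n d = {x \<in> elts P n d. dif P n d x = \<zero>\<^bsub>space P n (d + 1)\<^esub>}"
  "\<zero>\<^bsub>space (cycles P) n d\<^esub> = \<zero>\<^bsub>space P n d\<^esub>"
  "x \<oplus>\<^bsub>space (cycles P) n d\<^esub> y = x \<oplus>\<^bsub>space P n d\<^esub> y"
  "c \<odot>\<^bsub>space (cycles P) n d\<^esub> x = c \<odot>\<^bsub>space P n d\<^esub> x"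
  "ident (cycles P) = ident P"
  "circ (cycles P) = circ P"
  "act (cycles P) = act P"
  "dif (cycles P) = dif P"
  by (simp_all add: cycles_def)

context dg_operad
begin

abbreviation Zs :: "nat \<Rightarrow> int \<Rightarrow> 'a set" where
  "Zs n d \<equiv> {x \<in> elts P n d. dif P n d x = \<zero>\<^bsub>space P n (d + 1)\<^esub>}"

lemma circ_zero_left: "\<lbrakk>i \<in> {1..m}; y \<in> elts P n e\<rbrakk> \<Longrightarrow>
    circ P m d n e i \<zero>\<^bsub>space P m d\<^esub> y = \<zero>\<^bsub>space P (m + n - 1) (d + e)\<^esub>"
  by (rule lin_map_zero[OF vect_space vect_space circ_linear_left])

lemma circ_zero_right: "\<lbrakk>i \<in> {1..m}; x \<in> elts P m d\<rbrakk> \<Longrightarrow>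
    circ P m d n e i x \<zero>\<^bsub>space P n e\<^esub> = \<zero>\<^bsub>space P (m + n - 1) (d + e)\<^esub>"
  by (rule lin_map_zero[OF vect_space vect_space circ_linear_right])

lemma act_zero: "\<sigma> permutes {1..n} \<Longrightarrow> act P n d \<sigma> \<zero>\<^bsub>space P n d\<^esub> = \<zero>\<^bsub>space P n d\<^esub>"
  by (rule lin_map_zero[OF vect_space vect_space act_linear])

lemma dif_zero: "dif P n d \<zero>\<^bsub>space P n d\<^esub> = \<zero>\<^bsub>space P n (d + 1)\<^esub>"
  by (rule lin_map_zero[OF vect_space vect_space dif_linear])

lemma circ_cycle:
  assumes "x \<in> Zs m d" "y \<in> Zs n e" "i \<in> {1..m}"
  shows "circ P m d n e i x y \<in> Zs (m + n - 1) (d + e)"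
proof -
  have "circ P m (d + 1) n e i (dif P m d x) y = \<zero>\<^bsub>space P (m + n - 1) (d + e + 1)\<^esub>"
    using circ_zero_left[of i m y n e "d + 1"] assms by (simp add: algebra_simps)
  moreover have "circ P m d n (e + 1) i x (dif P n e y) = \<zero>\<^bsub>space P (m + n - 1) (d + e + 1)\<^esub>"
    using circ_zero_right[of i m x d n "e + 1"] assms by (simp add: algebra_simps)
  ultimately show ?thesis
    using assms dif_circ[of x m d y n e i] circ_closed
    by (simp add: vect_smult_zero[OF vect_space] vect_lzero[OF vect_space] vect_zero[OF vect_space])
qed

lemma act_cycle: "\<lbrakk>x \<in> Zs n d; \<sigma> permutes {1..n}\<rbrakk> \<Longrightarrow> act P n d \<sigma> x \<in> Zs n d"
  by (simp add: act_closed dif_act act_zero)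

lemma vsub_Zs: "vsub (space P n d) (Zs n d)"
  by (auto simp: vsub_def vect_facts[OF vect_space] dif_zero lin_mapD[OF dif_linear])

lemma vect_cycles: "vect (space (cycles P) n d)"
proof (rule vectI, unfold cycles_simps, goal_cases)
  case (6 x)
  then have "(- 1) \<odot>\<^bsub>space P n d\<^esub> x \<in> Zs n d"
    using vsub_Zs[of n d] by (auto simp: vsub_def)
  then show ?case
    using 6 vect_neg[OF vect_space, of x n d] vect_comm[OF vect_space, of x n d]
    by (intro bexI[of _ "(- 1) \<odot>\<^bsub>space P n d\<^esub> x"]) auto
next
  case (4 x y)
  then show ?case
    using vect_comm[OF vect_space] by blast
qed (use vsub_Zs[of n d] in \<open>auto simp: vsub_def vect_assoc[OF vect_space] vect_lzero[OF vect_space]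
    vect_distl[OF vect_space] vect_distr[OF vect_space] vect_smult_assoc[OF vect_space] vect_smult_one[OF vect_space]\<close>)

lemma dg_operad_cycles: "dg_operad (cycles P)"
proof (rule dg_operad.intro, unfold cycles_simps(2-), goal_cases)
  case (1 n d)
  show ?case by (rule vect_cycles)
next
  case 2
  \<comment> \<open>The identity is a cycle: by the Leibniz rule its differential, computed from the
    composite of the identity with itself, equals its own double.\<close>
  have "dif P 1 0 (circ P 1 0 1 0 1 (ident P) (ident P)) =
      dif P 1 0 (ident P) \<oplus>\<^bsub>space P 1 1\<^esub> dif P 1 0 (ident P)"
    using dif_circ[OF ident_closed ident_closed, of 1] ident_circ[OF dif_closed[OF ident_closed]]
      circ_ident[OF dif_closed[OF ident_closed], of 1]
    by (simp add: vect_smult_one[OF vect_space] dif_closed[OF ident_closed, simplified])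
  then have e: "dif P 1 0 (ident P) = dif P 1 0 (ident P) \<oplus>\<^bsub>space P 1 1\<^esub> dif P 1 0 (ident P)"
    using ident_circ[OF ident_closed] by simp
  define u where "u = dif P 1 0 (ident P)"
  have u: "u \<in> elts P 1 1"
    using dif_closed[OF ident_closed] by (simp add: u_def)
  have "\<zero>\<^bsub>space P 1 1\<^esub> = (u \<oplus>\<^bsub>space P 1 1\<^esub> u) \<oplus>\<^bsub>space P 1 1\<^esub> (- 1) \<odot>\<^bsub>space P 1 1\<^esub> u"
    using e u vect_neg[OF vect_space] by (simp add: u_def)
  also have "\<dots> = u"
    using u by (simp add: vect_assoc[OF vect_space] vect_smult[OF vect_space] vect_neg[OF vect_space] vect_rzero[OF vect_space])
  finally show ?case
    using ident_closed by (simp add: u_def)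
next
  case (3 i m y n e d)
  then show ?case
    using circ_cycle by (intro lin_mapI) (auto simp: lin_mapD[OF circ_linear_left])
next
  case (4 i m x d n e)
  then show ?case
    using circ_cycle by (intro lin_mapI) (auto simp: lin_mapD[OF circ_linear_right])
next
  case (9 \<sigma> n d)
  then show ?case
    using act_cycle by (intro lin_mapI) (auto simp: lin_mapD[OF act_linear])
next
  case (13 n d)
  then show ?case
    using dif_closed dif_dif by (intro lin_mapI) (auto simp: lin_mapD[OF dif_linear] dif_zero vect_zero[OF vect_space])
qed (unfold cycles_simps, (elim CollectE conjE, rule ident_circ circ_ident circ_sequential circ_parallel act_id
    act_comp circ_equivariant dif_dif dif_act dif_circ; assumption)+)

text \<open>By the Leibniz rule the composite of a boundary with a cycle is, up to sign, the
  boundary of the composite with a primitive. When the boundary is the inner argument the sign is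
  (-1) to the degree of the outer one, and the primitive is rescaled by it.\<close>

lemma boundaries_ideal: "dg_operad_ideal (cycles P) (boundaries P)"
proof (intro dg_operad_ideal.intro dg_operad_cycles dg_operad_ideal_axioms.intro, goal_cases)
  case (1 n d)
  have "dif P n (d - 1) z \<in> Zs n d" if "z \<in> elts P n (d - 1)" for z
    using dif_closed[OF that] dif_dif[OF that] by (simp add: add.commute)
  moreover have "\<zero>\<^bsub>space P n d\<^esub> \<in> boundaries P n d"
    using dif_zero[of n "d - 1"] vect_zero[OF vect_space, of n "d - 1"] by (force simp: boundaries_def)
  moreover have "x \<oplus>\<^bsub>space P n d\<^esub> y \<in> boundaries P n d" if "x \<in> boundaries P n d" "y \<in> boundaries P n d" for x y
    using that lin_mapD(2)[OF dif_linear, of _ n "d - 1"] vect_add[OF vect_space, of _ n "d - 1"]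
    by (auto simp: boundaries_def) (metis image_eqI)
  moreover have "c \<odot>\<^bsub>space P n d\<^esub> x \<in> boundaries P n d" if "x \<in> boundaries P n d" for c x
    using that lin_mapD(3)[OF dif_linear, of _ n "d - 1"] vect_smult[OF vect_space, of _ n "d - 1"]
    by (auto simp: boundaries_def) (metis image_eqI)
  ultimately show ?case
    by (auto simp: vsub_def) (auto simp: boundaries_def)
next
  case (2 x n d \<sigma>)
  then show ?case
    using dif_act[of _ n "d - 1" \<sigma>] act_closed[of _ n "d - 1" \<sigma>] by (auto simp: boundaries_def) (metis image_eqI)
next
  case (3 x m d y n e i)
  then obtain a where a: "a \<in> elts P m (d - 1)" "x = dif P m (d - 1) a"
    by (auto simp: boundaries_def)
  have y: "y \<in> elts P n e" "dif P n e y = \<zero>\<^bsub>space P n (e + 1)\<^esub>"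
    using 3 by auto
  have dd: "d - 1 + e + 1 = d + e" "d - 1 + (e + 1) = d + e" "d - 1 + e = d + e - 1"
    by auto
  have 1: "circ P m (d - 1) n (e + 1) i a (dif P n e y) = \<zero>\<^bsub>space P (m + n - 1) (d + e)\<^esub>"
    using circ_zero_right[OF 3(3) a(1), of n "e + 1"] by (simp add: y dd)
  have "circ P m d n e i x y = dif P (m + n - 1) (d + e - 1) (circ P m (d - 1) n e i a y)"
    using dif_circ[OF a(1) y(1) 3(3)] circ_closed[OF dif_closed[OF a(1)] y(1) 3(3)]
    unfolding 1 dd a(2) by (simp add: vect_smult_zero[OF vect_space] vect_rzero[OF vect_space])
  then show ?case
    using circ_closed[OF a(1) y(1) 3(3)] unfolding dd by (simp add: boundaries_def)
next
  case (4 x m d y n e i)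
  then obtain b where b: "b \<in> elts P n (e - 1)" "y = dif P n (e - 1) b"
    by (auto simp: boundaries_def)
  have x: "x \<in> elts P m d" "dif P m d x = \<zero>\<^bsub>space P m (d + 1)\<^esub>"
    using 4 by auto
  have dd: "d + (e - 1) + 1 = d + e" "d + 1 + (e - 1) = d + e" "d + (e - 1) = d + e - 1" "e - 1 + 1 = e"
    by auto
  have 1: "circ P m (d + 1) n (e - 1) i (dif P m d x) b = \<zero>\<^bsub>space P (m + n - 1) (d + e)\<^esub>"
    using circ_zero_left[OF 4(3) b(1), of "d + 1"] by (simp add: x dd)
  note cl = circ_closed[OF x(1) b(1) 4(3), unfolded dd] circ_closed[OF x(1) dif_closed[OF b(1)] 4(3), unfolded dd]
  have "dif P (m + n - 1) (d + e - 1) (circ P m d n (e - 1) i x b) =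
      ((- 1) powi d) \<odot>\<^bsub>space P (m + n - 1) (d + e)\<^esub> circ P m d n e i x y"
    using dif_circ[OF x(1) b(1) 4(3)] cl
    unfolding 1 dd b(2) by (simp add: vect_lzero[OF vect_space] vect_smult[OF vect_space])
  then have "dif P (m + n - 1) (d + e - 1) (((- 1) powi d) \<odot>\<^bsub>space P (m + n - 1) (d + e - 1)\<^esub> circ P m d n (e - 1) i x b) =
      (((- 1) powi d) * ((- 1) powi d)) \<odot>\<^bsub>space P (m + n - 1) (d + e)\<^esub> circ P m d n e i x y"
    using cl b(2) lin_mapD(3)[OF dif_linear cl(1), of "(- 1) powi d"] by (simp flip: vect_smult_assoc[OF vect_space])
  then have "circ P m d n e i x y =
      dif P (m + n - 1) (d + e - 1) (((- 1) powi d) \<odot>\<^bsub>space P (m + n - 1) (d + e - 1)\<^esub> circ P m d n (e - 1) i x b)"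
    using cl b(2) by (simp add: powi_ep vect_smult_one[OF vect_space])
  then show ?case
    using cl vect_smult[OF vect_space] by (simp add: boundaries_def)
next
  case (5 x n d)
  then have "dif P n d x = \<zero>\<^bsub>space P n (d + 1)\<^esub>"
    using dif_dif[of _ n "d - 1"] by (auto simp: boundaries_def add.commute)
  then show ?case
    using dif_zero[of n d] vect_zero[OF vect_space, of n d] by (force simp: boundaries_def)
qed

lemma elts_cohomology: "elts (cohomology P) n d = coset (cycles P) (boundaries P) n d ` Zs n d"
  unfolding cohomology_def dg_operad_ideal.elts_quot[OF boundaries_ideal] cycles_simps ..

lemma class_eq_iff: "\<lbrakk>x \<in> Zs n d; y \<in> Zs n d\<rbrakk> \<Longrightarrow>
    coset (cycles P) (boundaries P) n d x = coset (cycles P) (boundaries P) n d y \<longleftrightarrow>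
    (\<exists>h\<in>boundaries P n d. x = h \<oplus>\<^bsub>space P n d\<^esub> y)"
  using dg_operad_ideal.coset_eq_iff[OF boundaries_ideal, of x n d y] by simp

end

context dg_operad_hom
begin

lemma hom_cycle: "x \<in> P.Zs n d \<Longrightarrow> \<phi> n d x \<in> Q.Zs n d"
  by (simp add: hom_closed hom_zero flip: hom_dif)

lemma hom_boundary: "x \<in> boundaries P n d \<Longrightarrow> \<phi> n d x \<in> boundaries Q n d"
  using hom_dif[of _ n "d - 1"] hom_closed[of _ n "d - 1"] by (force simp: boundaries_def)

lemma cohomology_map_class:
  assumes "x \<in> P.Zs n d"
  shows "cohomology_map Q \<phi> n d (coset (cycles P) (boundaries P) n d x) =
    coset (cycles Q) (boundaries Q) n d (\<phi> n d x)"
  unfolding cohomology_map_def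
proof (rule dg_operad_ideal.UN_coset[OF P.boundaries_ideal], goal_cases)
  case (2 h)
  then have h: "h \<in> elts P n d"
    using dg_operad_ideal.J_elts[OF P.boundaries_ideal, of h n d] by simp
  then show ?case
    using assms dg_operad_ideal.coset_absorb[OF Q.boundaries_ideal _ hom_boundary[OF 2]] hom_cycle[OF assms]
    by (simp add: lin_mapD(2)[OF hom_linear])
qed (use assms in simp)

text \<open>Bijectivity on cohomology expressed by representatives: a trivial kernel suffices for
  injectivity since the difference of two cycles is again a cycle, and surjectivity is required only
  up to boundaries.\<close>

lemma quasi_isoI:
  assumes inj: "\<And>n d x. \<lbrakk>x \<in> P.Zs n d; \<phi> n d x \<in> boundaries Q n d\<rbrakk> \<Longrightarrow> x \<in> boundaries P n d"
    and surj: "\<And>n d y. y \<in> Q.Zs n d \<Longrightarrow> \<exists>x\<in>P.Zs n d. \<exists>b\<in>boundaries Q n d. y = b \<oplus>\<^bsub>space Q n d\<^esub> \<phi> n d x"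
  shows "quasi_iso P Q \<phi>"
  unfolding quasi_iso_def
proof (intro conjI allI dg_operad_hom_axioms bij_betw_imageI inj_onI)
  fix n d C D assume "C \<in> elts (cohomology P) n d" "D \<in> elts (cohomology P) n d"
    and eq: "cohomology_map Q \<phi> n d C = cohomology_map Q \<phi> n d D"
  then obtain x y where x: "x \<in> P.Zs n d" "C = coset (cycles P) (boundaries P) n d x"
    and y: "y \<in> P.Zs n d" "D = coset (cycles P) (boundaries P) n d y"
    by (auto simp: P.elts_cohomology)
  obtain b where b: "b \<in> boundaries Q n d" "\<phi> n d x = b \<oplus>\<^bsub>space Q n d\<^esub> \<phi> n d y"
    using eq Q.class_eq_iff[OF hom_cycle[OF x(1)] hom_cycle[OF y(1)]]
    by (auto simp: x y cohomology_map_class simp del: mem_Collect_eq)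
  have bQ: "b \<in> elts Q n d"
    using dg_operad_ideal.J_elts[OF Q.boundaries_ideal b(1)] by simp
  let ?z = "x \<oplus>\<^bsub>space P n d\<^esub> (- 1) \<odot>\<^bsub>space P n d\<^esub> y"
  have my: "(- 1) \<odot>\<^bsub>space P n d\<^esub> y \<in> P.Zs n d"
    using P.vsub_Zs[of n d] y(1) unfolding vsub_def by blast
  then have z: "?z \<in> P.Zs n d"
    using P.vsub_Zs[of n d] x(1) unfolding vsub_def by blast
  have "\<phi> n d ?z = b"
    using x(1) y(1) my bQ hom_closed[of y n d]
    by (simp add: lin_mapD[OF hom_linear] b vect_assoc[OF Q.vect_space] vect_smult[OF Q.vect_space]
        vect_neg[OF Q.vect_space] vect_rzero[OF Q.vect_space])
  then have "?z \<in> boundaries P n d"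
    using inj[OF z] b by simp
  moreover have "x = ?z \<oplus>\<^bsub>space P n d\<^esub> y"
    using x(1) y(1) vect_comm[OF P.vect_space, of "(- 1) \<odot>\<^bsub>space P n d\<^esub> y" n d y]
    by (simp add: vect_assoc[OF P.vect_space] vect_smult[OF P.vect_space] vect_neg[OF P.vect_space] vect_rzero[OF P.vect_space])
  ultimately show "C = D"
    using P.class_eq_iff[OF x(1) y(1)] x y by auto
next
  fix n d
  show "cohomology_map Q \<phi> n d ` elts (cohomology P) n d = elts (cohomology Q) n d"
  proof (intro equalityI subsetI)
    fix D assume "D \<in> elts (cohomology Q) n d"
    then obtain y where y: "y \<in> Q.Zs n d" "D = coset (cycles Q) (boundaries Q) n d y"
      by (auto simp: Q.elts_cohomology)
    then obtain x b where x: "x \<in> P.Zs n d" and b: "b \<in> boundaries Q n d" "y = b \<oplus>\<^bsub>space Q n d\<^esub> \<phi> n d x"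
      using surj by blast
    have "D = cohomology_map Q \<phi> n d (coset (cycles P) (boundaries P) n d x)"
      unfolding cohomology_map_class[OF x] y(2) using Q.class_eq_iff[OF y(1) hom_cycle[OF x]] b by blast
    then show "D \<in> cohomology_map Q \<phi> n d ` elts (cohomology P) n d"
      using x by (auto simp: P.elts_cohomology)
  next
    fix D assume "D \<in> cohomology_map Q \<phi> n d ` elts (cohomology P) n d"
    then obtain x where x: "x \<in> P.Zs n d"
        "D = cohomology_map Q \<phi> n d (coset (cycles P) (boundaries P) n d x)"
      unfolding P.elts_cohomology by blast
    then show "D \<in> elts (cohomology Q) n d"
      using hom_cycle[OF x(1)] cohomology_map_class[OF x(1)] unfolding Q.elts_cohomology by blast
  qed
qed

lemma hom_cycles: "dg_operad_hom (cycles P) Q \<phi>"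
proof (intro dg_operad_hom.intro P.dg_operad_cycles Q.dg_operad_axioms dg_operad_hom_axioms.intro
    lin_mapI, unfold cycles_simps, goal_cases)
  case 4
  show ?case by (rule hom_ident)
next
  case (5 x m d y n e i)
  then show ?case by (intro hom_circ) simp_all
next
  case (7 x n d)
  then show ?case by (intro hom_dif) simp
qed (simp_all add: lin_mapD[OF hom_linear] hom_act)

end

section \<open>Isomorphisms and formality\<close>

lemma operad_iso_inverse:
  assumes "operad_iso P Q \<phi>"
  shows "operad_iso Q P (\<lambda>n d. inv_into (elts P n d) (\<phi> n d))"
proof -
  interpret h: dg_operad_hom P Q \<phi>
    using assms by (simp add: operad_iso_def)
  have bij: "bij_betw (\<phi> n d) (elts P n d) (elts Q n d)" for n d
    using assms by (simp add: operad_iso_def)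
  let ?g = "\<lambda>n d. inv_into (elts P n d) (\<phi> n d)"
  have ex: "\<exists>x\<in>elts P n d. y = \<phi> n d x" if "y \<in> elts Q n d" for n d y
    using bij that by (fastforce simp: bij_betw_def)
  have g: "?g n d (\<phi> n d x) = x" if "x \<in> elts P n d" for n d x
    using bij that by (simp add: bij_betw_def)
  note One_nat_def [simp del]
  have "dg_operad_hom Q P ?g"
  proof (rule dg_operad_hom_image[OF h.Q.dg_operad_axioms], goal_cases)
    case (1 n d)
    show ?case
      using bij_betw_inv_into[OF bij] by (simp add: bij_betw_def)
  next
    case (4 n d)
    show ?case
      using g[OF vect_zero[OF h.P.vect_space], of n d] by (simp add: h.hom_zero)
  next
    case 5
    show ?case
      using g[OF h.P.ident_closed] by (simp add: h.hom_ident)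
  qed (auto dest!: ex simp: g h.P.closed lin_mapD(2,3)[OF h.hom_linear, symmetric]
      simp flip: h.hom_circ h.hom_act h.hom_dif)
  then show ?thesis
    unfolding operad_iso_def using bij_betw_inv_into[OF bij] by blast
qed

lemma operad_iso_quasi_iso:
  assumes "operad_iso P Q \<phi>"
  shows "quasi_iso P Q \<phi>"
proof -
  interpret h: dg_operad_hom P Q \<phi>
    using assms by (simp add: operad_iso_def)
  have bij: "bij_betw (\<phi> n d) (elts P n d) (elts Q n d)" for n d
    using assms by (simp add: operad_iso_def)
  have ex: "\<exists>x\<in>elts P n d. y = \<phi> n d x" if "y \<in> elts Q n d" for n d y
    using bij that by (fastforce simp: bij_betw_def)
  have inj: "\<lbrakk>\<phi> n d x = \<phi> n d y; x \<in> elts P n d; y \<in> elts P n d\<rbrakk> \<Longrightarrow> x = y" for n d x y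
    using bij by (auto simp: bij_betw_def dest: inj_onD)
  show ?thesis
  proof (rule h.quasi_isoI)
    fix n d x assume x: "x \<in> h.P.Zs n d" and b: "\<phi> n d x \<in> boundaries Q n d"
    then obtain z where z: "z \<in> elts Q n (d - 1)" "\<phi> n d x = dif Q n (d - 1) z"
      by (auto simp: boundaries_def)
    obtain y where y: "y \<in> elts P n (d - 1)" "\<phi> n d x = dif Q n (d - 1) (\<phi> n (d - 1) y)"
      using ex[OF z(1)] z(2) by auto
    then have "\<phi> n d x = \<phi> n d (dif P n (d - 1) y)"
      using h.hom_dif[OF y(1)] by simp
    then have "x = dif P n (d - 1) y"
      using inj x h.P.dif_closed[OF y(1)] by simp
    then show "x \<in> boundaries P n d"
      using y(1) by (simp add: boundaries_def)
  next
    fix n d y assume y: "y \<in> h.Q.Zs n d"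
    then obtain x where x: "x \<in> elts P n d" "y = \<phi> n d x"
      using ex by blast
    then have "\<phi> n (d + 1) (dif P n d x) = \<phi> n (d + 1) \<zero>\<^bsub>space P n (d + 1)\<^esub>"
      using y h.hom_dif[OF x(1)] h.hom_zero[of n "d + 1"] by simp
    then have "dif P n d x = \<zero>\<^bsub>space P n (d + 1)\<^esub>"
      using inj h.P.dif_closed[OF x(1)] vect_zero[OF h.P.vect_space] by blast
    moreover have "\<zero>\<^bsub>space Q n d\<^esub> \<in> boundaries Q n d"
      using dg_operad_ideal.vsub_J[OF h.Q.boundaries_ideal, of n d] by (simp add: vsub_def)
    ultimately show "\<exists>x\<in>h.P.Zs n d. \<exists>b\<in>boundaries Q n d. y = b \<oplus>\<^bsub>space Q n d\<^esub> \<phi> n d x"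
      using x y by (intro bexI[of _ x] bexI[of _ "\<zero>\<^bsub>space Q n d\<^esub>"]) (auto simp: vect_lzero[OF h.Q.vect_space])
  qed
qed

text \<open>The zero differential makes all boundaries of \<open>Q\<close> trivial, so
  \<open>Q\<close> is its own cohomology and a homomorphism to it factors through the classes of
  cycles. The factored map is an isomorphism from the cohomology of \<open>P\<close> onto
  \<open>Q\<close>; its inverse is the last arrow of the zigzag from \<open>P\<close> over
  \<open>Q\<close> to \<open>cohomology P\<close> that formality asks for.\<close>

lemma formality_criterion:
  fixes P Q :: "('k::field, 'a) operad"
  assumes hom: "dg_operad_hom P Q \<phi>"
    and Q: "\<And>n d y. y \<in> elts Q n d \<Longrightarrow> dif Q n d y = \<zero>\<^bsub>space Q n (d + 1)\<^esub>"
    and inj: "\<And>n d x. \<lbrakk>x \<in> elts (cycles P) n d; \<phi> n d x = \<zero>\<^bsub>space Q n d\<^esub>\<rbrakk> \<Longrightarrow> x \<in> boundaries P n d"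
    and surj: "\<And>n d y. y \<in> elts Q n d \<Longrightarrow> \<exists>x\<in>elts (cycles P) n d. \<phi> n d x = y"
  shows "quasi_iso P Q \<phi>" "operad_iso (cohomology P) Q (induced \<phi>)" "formal P"
proof -
  interpret h: dg_operad_hom P Q \<phi>
    by (rule hom)
  have bd: "boundaries Q n d = {\<zero>\<^bsub>space Q n d\<^esub>}" for n d
    using Q[of _ n "d - 1"] vect_zero[OF h.Q.vect_space, of n "d - 1"] by (force simp: boundaries_def)
  show q: "quasi_iso P Q \<phi>"
  proof (rule h.quasi_isoI)
    fix n d y assume "y \<in> h.Q.Zs n d"
    then show "\<exists>x\<in>h.P.Zs n d. \<exists>b\<in>boundaries Q n d. y = b \<oplus>\<^bsub>space Q n d\<^esub> \<phi> n d x"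
      using surj[of y n d] by (auto simp: bd vect_lzero[OF h.Q.vect_space])
  qed (use inj bd in auto)
  have zero: "\<phi> n d x = \<zero>\<^bsub>space Q n d\<^esub>" if "x \<in> boundaries P n d" for n d x
    using h.hom_boundary[OF that] by (simp add: bd)
  have "dg_operad_hom (cohomology P) Q (induced \<phi>)"
    unfolding cohomology_def by (rule induced_hom[OF h.P.boundaries_ideal h.hom_cycles zero])
  moreover have "bij_betw (induced \<phi> n d) (elts (cohomology P) n d) (elts Q n d)" for n d
  proof -
    let ?c = "coset (cycles P) (boundaries P) n d"
    have ind: "induced \<phi> n d (?c x) = \<phi> n d x" if "x \<in> h.P.Zs n d" for x
      by (rule induced_coset[OF h.P.boundaries_ideal h.hom_cycles zero]) (use that in simp_all)
    have "inj_on (induced \<phi> n d) (elts (cohomology P) n d)"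
    proof (rule inj_onI)
      fix C D assume CD: "C \<in> elts (cohomology P) n d" "D \<in> elts (cohomology P) n d"
        and eq: "induced \<phi> n d C = induced \<phi> n d D"
      then obtain x y where x: "x \<in> h.P.Zs n d" "C = ?c x" and y: "y \<in> h.P.Zs n d" "D = ?c y"
        by (auto simp: h.P.elts_cohomology)
      then have e: "\<phi> n d x = \<phi> n d y"
        using eq by (simp add: ind del: mem_Collect_eq)
      have "cohomology_map Q \<phi> n d C = cohomology_map Q \<phi> n d D"
        using x y e by (simp add: h.cohomology_map_class del: mem_Collect_eq)
      moreover have "inj_on (cohomology_map Q \<phi> n d) (elts (cohomology P) n d)"
        using q by (simp add: quasi_iso_def bij_betw_def)
      ultimately show "C = D"
        using CD by (auto dest: inj_onD)
    qed
    moreover have "induced \<phi> n d ` elts (cohomology P) n d = elts Q n d"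
    proof (intro equalityI subsetI)
      fix y assume "y \<in> elts Q n d"
      then obtain x where x: "x \<in> h.P.Zs n d" "\<phi> n d x = y"
        using surj[of y n d] by auto
      then show "y \<in> induced \<phi> n d ` elts (cohomology P) n d"
        using ind[OF x(1)] unfolding h.P.elts_cohomology by (intro image_eqI[of _ _ "?c x"]) (auto simp del: mem_Collect_eq)
    next
      fix y assume "y \<in> induced \<phi> n d ` elts (cohomology P) n d"
      then show "y \<in> elts Q n d"
        using ind h.hom_closed unfolding h.P.elts_cohomology by force
    qed
    ultimately show ?thesis
      by (simp add: bij_betw_def)
  qed
  ultimately show iso: "operad_iso (cohomology P) Q (induced \<phi>)"
    by (simp add: operad_iso_def)
  have "equivclp (\<lambda>A B. \<exists>\<phi>. quasi_iso A B \<phi>) P Q"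
    using q by blast
  then show "formal P"
    using operad_iso_quasi_iso[OF operad_iso_inverse[OF iso]] unfolding formal_def by blast
qed

section \<open>A model of the free algebra\<close>

text \<open>
  \<open>Nd a S\<close> stands for the bracket \<open>F\<^sub>k\<close> of \<open>\<Delta>\<^sub>a\<close>, \<open>k = |S|\<close>, applied to the elements of \<open>S\<close>. A leaf with a
  negative label is an odd element on which all brackets vanish; it serves as a formal odd scalar,
  with which odd arguments can be made even.
\<close>

datatype tr = Lf int | Nd nat "tr fset"

instance tr :: countable
  by countable_datatype

type_synonym forest = "tr fset"
type_synonym 'k fcomb = "forest \<Rightarrow>\<^sub>0 'k"

lemma size_child [termination_simp]: "x |\<in>| S \<Longrightarrow> size x < Suc (\<Sum>x\<in>fset S. Suc (size (x :: tr)))"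
  using member_le_sum[of x "fset S" "\<lambda>x. Suc (size x)"] by simp

text \<open>The label \<open>0\<close> of the degenerate node only serves to make all label sets nonempty.\<close>

primrec lv :: "tr \<Rightarrow> int set" where
  "lv (Lf j) = {j}"
| "lv (Nd a S) = (if S = {||} then {0} else \<Union> (fset (lv |`| S)))"

fun dg :: "tr \<Rightarrow> int" where
  "dg (Lf j) = (if j < 0 then 1 else 0)"
| "dg (Nd a S) = 1 - 2 * int a + (\<Sum>x\<in>fset S. dg x)"

definition fl :: "forest \<Rightarrow> int set" where
  "fl S = (\<Union>x\<in>fset S. lv x)"

definition dgf :: "forest \<Rightarrow> int" where
  "dgf S = (\<Sum>x\<in>fset S. dg x)"

definition inert :: "forest \<Rightarrow> bool" where
  "inert S \<longleftrightarrow> (\<exists>j<0. Lf j |\<in>| S)"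

lemma lv_Nd [simp]: "S \<noteq> {||} \<Longrightarrow> lv (Nd a S) = fl S"
  by (simp add: fl_def)

lemma dg_Nd [simp]: "dg (Nd a S) = 1 - 2 * int a + dgf S"
  by (simp add: dgf_def)

declare lv.simps(2) [simp del] dg.simps(2) [simp del]

lemma lv_nonempty [simp]: "lv t \<noteq> {}"
proof (induction t)
  case (Nd a S)
  then show ?case
    by (cases "S = {||}") (auto simp: lv.simps)
qed simp

lemma fl_empty [simp]: "fl {||} = {}" and fl_single [simp]: "fl {|t|} = lv t"
  and fl_union [simp]: "fl (S |\<union>| T) = fl S \<union> fl T" and fl_insert [simp]: "fl (finsert t S) = lv t \<union> fl S"
  by (auto simp: fl_def)

lemma fl_empty_iff [simp]: "fl S = {} \<longleftrightarrow> S = {||}"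
  by (auto simp: fl_def)

lemma fl_mono: "S |\<subseteq>| T \<Longrightarrow> fl S \<subseteq> fl T"
  by (auto simp: fl_def)

lemma fl_split: "J |\<subseteq>| S \<Longrightarrow> fl S = fl J \<union> fl (S |-| J)"
  by (auto simp: fl_def)

lemma dgf_empty [simp]: "dgf {||} = 0" and dgf_single [simp]: "dgf {|t|} = dg t"
  by (simp_all add: dgf_def)

lemma dgf_union: "fset S \<inter> fset T = {} \<Longrightarrow> dgf (S |\<union>| T) = dgf S + dgf T"
  by (simp add: dgf_def sum.union_disjoint)

lemma fset_diff_disjoint [simp]: "fset J \<inter> fset (S |-| J) = {}"
  by auto

lemma funion_subset [simp]: "J |\<subseteq>| S \<Longrightarrow> J |\<union>| S = S"
  by auto

lemma dgf_split: "J |\<subseteq>| S \<Longrightarrow> dgf S = dgf J + dgf (S |-| J)"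
  using dgf_union[of J "S |-| J"] by simp

lemma fl_disjoint: "fl S \<inter> fl T = {} \<Longrightarrow> fset S \<inter> fset T = {}"
proof (rule ccontr)
  assume d: "fl S \<inter> fl T = {}" and "fset S \<inter> fset T \<noteq> {}"
  then obtain x where x: "x |\<in>| S" "x |\<in>| T"
    by blast
  obtain j where "j \<in> lv x"
    using lv_nonempty by blast
  then show False
    using d x by (auto simp: fl_def)
qed

text \<open>A monomial stands for the product of its trees in increasing order of their encodings by
  \<open>to_nat\<close>. The factor is the Koszul sign of two odd trees that stand in the wrong
  order.\<close>

definition eps :: "tr \<Rightarrow> tr \<Rightarrow> 'k::field" where
  "eps s t = (if odd (dg s) \<and> odd (dg t) \<and> to_nat t < to_nat s then - 1 else 1)"

text \<open>The sign of sorting the product of two sorted monomials.\<close>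

definition sg :: "forest \<Rightarrow> forest \<Rightarrow> 'k::field" where
  "sg S T = (\<Prod>s\<in>fset S. \<Prod>t\<in>fset T. eps s t)"

lemma sg_empty [simp]: "sg {||} T = 1" "sg S {||} = 1"
  by (simp_all add: sg_def)

lemma sg_union_left: "fset S \<inter> fset S' = {} \<Longrightarrow> sg (S |\<union>| S') T = sg S T * sg S' T"
  by (simp add: sg_def prod.union_disjoint)

lemma sg_union_right: "fset T \<inter> fset T' = {} \<Longrightarrow> sg S (T |\<union>| T') = sg S T * sg S T'"
  by (simp add: sg_def prod.union_disjoint prod.distrib)

lemma eps_square [simp]: "eps s t * eps s t = 1"
  by (simp add: eps_def)

lemma sg_square [simp]: "sg S T * sg S T = 1"
  by (simp add: sg_def flip: prod.distrib)

lemma sg_square_left [simp]: "sg S T * (sg S T * x) = x"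
  by (simp add: mult.assoc[symmetric])

lemma sg_nonzero [simp]: "sg S T \<noteq> 0"
  using sg_square[of S T] by (metis mult_zero_left zero_neq_one)

lemma eps_swap: "s \<noteq> t \<Longrightarrow> eps s t * eps t s = ep (dg s * dg t)"
  by (auto simp: eps_def ep_def)

lemma prod_ep: "(\<Prod>s\<in>A. ep (f s)) = ep (\<Sum>s\<in>A. f s)"
  by (induction A rule: infinite_finite_induct) (auto simp: ep_add)

lemma sg_swap:
  assumes "fset S \<inter> fset T = {}"
  shows "sg S T * sg T S = ep (dgf S * dgf T)"
proof -
  have "sg S T * sg T S = (\<Prod>s\<in>fset S. \<Prod>t\<in>fset T. eps s t * eps t s)"
    unfolding sg_def prod.distrib by (subst (2) prod.swap) simp
  also have "\<dots> = (\<Prod>s\<in>fset S. \<Prod>t\<in>fset T. ep (dg s * dg t))"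
    using assms by (intro prod.cong refl eps_swap) auto
  also have "\<dots> = ep (dgf S * dgf T)"
    by (simp add: prod_ep dgf_def sum_product)
  finally show ?thesis .
qed

lemma sg_swap': "fset S \<inter> fset T = {} \<Longrightarrow> sg S T = ep (dgf S * dgf T) * sg T S"
  using sg_swap[of S T] by (metis mult.assoc mult.right_neutral sg_square)

section \<open>The graded commutative product\<close>

definition dis :: "forest \<Rightarrow> forest \<Rightarrow> bool" where
  "dis S T \<longleftrightarrow> fl S \<inter> fl T = {}"

lemma dis_disjoint: "dis S T \<Longrightarrow> fset S \<inter> fset T = {}"
  by (simp add: dis_def fl_disjoint)

lemma dis_commute: "dis S T \<longleftrightarrow> dis T S"
  by (auto simp: dis_def)

lemma dis_union [simp]: "dis (S |\<union>| S') T \<longleftrightarrow> dis S T \<and> dis S' T" "dis T (S |\<union>| S') \<longleftrightarrow> dis T S \<and> dis T S'"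
  by (auto simp: dis_def)

lemma dis_empty [simp]: "dis {||} T" "dis S {||}"
  by (auto simp: dis_def)

text \<open>Products of monomials with common labels are zero. Only multilinear expressions survive,
  so a monomial can be a set of trees and powers of a tree never arise; associativity persists
  because label sets unite under multiplication.\<close>

definition mlt :: "'k::field fcomb \<Rightarrow> 'k fcomb \<Rightarrow> 'k fcomb" where
  "mlt x y = lin (\<lambda>S. lin (\<lambda>T. if dis S T then psc (sg S T) (bs (S |\<union>| T)) else 0) y) x"

lemma mlt_bs: "mlt (bs S) (bs T) = (if dis S T then psc (sg S T) (bs (S |\<union>| T)) else 0)"
  by (simp add: mlt_def)

lemma plinear_mlt_left [plinear_intros]: "plinear f \<Longrightarrow> plinear (\<lambda>x. mlt (f x) y)"
  unfolding mlt_def by (rule plinear_compose)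

lemma plinear_mlt_right [plinear_intros]: "plinear f \<Longrightarrow> plinear (\<lambda>x. mlt y (f x))"
  unfolding mlt_def by (rule plinear_lin_param) (rule plinear_compose)

lemmas pl_mlt_left = plinear_mlt_left[OF plinear_id]
lemmas pl_mlt_right = plinear_mlt_right[OF plinear_id]

lemma mlt_zero [simp]: "mlt 0 y = 0" "mlt x 0 = 0"
  by (simp_all add: plinear_zero[OF pl_mlt_left] plinear_zero[OF pl_mlt_right])

lemma mlt_psc: "mlt (psc c x) y = psc c (mlt x y)" "mlt x (psc c y) = psc c (mlt x y)"
  by (simp_all add: plinear_psc[OF pl_mlt_left] plinear_psc[OF pl_mlt_right])

lemma mlt_sum: "mlt (sum f A) y = (\<Sum>a\<in>A. mlt (f a) y)" "mlt x (sum f A) = (\<Sum>a\<in>A. mlt x (f a))"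
  by (simp_all add: plinear_sum[OF pl_mlt_left] plinear_sum[OF pl_mlt_right])

lemma mlt_assoc: "mlt (mlt x y) z = mlt x (mlt y z)"
proof (rule plinear3_eqI[where f = "\<lambda>x y z. mlt (mlt x y) z" and g = "\<lambda>x y z. mlt x (mlt y z)"])
  fix S T U
  show "mlt (mlt (bs S) (bs T)) (bs U) = (mlt (bs S) (mlt (bs T) (bs U)) :: 'a fcomb)"
    by (auto simp: mlt_bs mlt_psc sg_union_left sg_union_right dis_disjoint algebra_simps
        funion_assoc)
qed (intro plinear_intros)+

lemma mlt_unit [simp]: "mlt (bs {||}) x = x" "mlt x (bs {||}) = x"
  by (rule plinear_eqI[where f = "mlt (bs {||})" and g = "\<lambda>x. x"],
      auto simp: mlt_bs intro: plinear_id pl_mlt_right)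
    (rule plinear_eqI[where f = "\<lambda>x. mlt x (bs {||})" and g = "\<lambda>x. x"],
      auto simp: mlt_bs intro: plinear_id pl_mlt_left)

text \<open>Signs depend on the parity of degrees alone. Recording just the parity lets all Delta_a
  be treated alike, as odd operators.\<close>

definition par :: "int \<Rightarrow> 'k::field fcomb \<Rightarrow> bool" where
  "par p x \<longleftrightarrow> (\<forall>S\<in>keys x. even (dgf S - p))"

lemma mlt_commute:
  assumes "par p x" "par q y"
  shows "mlt x y = psc (ep (p * q)) (mlt y x)"
proof (rule plinear2_eqI[where f = mlt and g = "\<lambda>x y. psc (ep (p * q)) (mlt y x)"])
  fix S T assume S: "S \<in> keys x" and T: "T \<in> keys y"
  then have "even (p * q - dgf S * dgf T)"
    using assms by (auto simp: par_def)
  then have "ep (p * q) = (ep (dgf S * dgf T) :: 'a)"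
    by (rule ep_cong)
  then show "mlt (bs S) (bs T) = psc (ep (p * q)) (mlt (bs T) (bs S) :: 'a fcomb)"
  proof (cases "dis S T")
    case True
    then have "sg S T = ep (dgf S * dgf T) * (sg T S :: 'a)"
      by (intro sg_swap' dis_disjoint)
    then show ?thesis
      using True \<open>ep (p * q) = (ep (dgf S * dgf T) :: 'a)\<close> dis_commute[of S T]
      by (simp add: mlt_bs funion_commute)
  next
    case False
    then show ?thesis
      using dis_commute[of S T] by (simp add: mlt_bs)
  qed
qed (intro plinear_intros)+

lemma in_keys_pscD: "K \<in> keys (psc c x) \<Longrightarrow> K \<in> keys x"
  by (auto simp: in_keys_iff)

lemma keys_mlt: "K \<in> keys (mlt x y) \<Longrightarrow> \<exists>S\<in>keys x. \<exists>T\<in>keys y. dis S T \<and> K = S |\<union>| T"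
  unfolding mlt_def using keys_psc by (fastforce elim!: in_keys_linE split: if_splits)

lemma par_mlt: "par p x \<Longrightarrow> par q y \<Longrightarrow> par (p + q) (mlt x y)"
  by (fastforce simp: par_def dgf_union dis_disjoint dest!: keys_mlt)

section \<open>Operators given by convolution\<close>

abbreviation subf :: "forest \<Rightarrow> forest set" where
  "subf S \<equiv> {I. I |\<subseteq>| S}"

lemma finite_subf [simp]: "finite (subf S)"
proof -
  have "subf S = fset (fPow S)"
    by auto
  then show ?thesis
    by simp
qed

text \<open>
  The convolution of \<open>f\<close> with the identity: \<open>f\<close> is applied to all submonomials satisfying \<open>P\<close>. The
  operator \<open>cv (la a)\<close> is the interpretation of \<open>\<Delta>\<^sub>a\<close>.
\<close>

definition cvp :: "(forest \<Rightarrow> bool) \<Rightarrow> (forest \<Rightarrow> 'k::field fcomb) \<Rightarrow> 'k fcomb \<Rightarrow> 'k fcomb" where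
  "cvp P f = lin (\<lambda>S. \<Sum>I\<in>{I\<in>subf S. P I}. psc (sg I (S |-| I)) (mlt (f I) (bs (S |-| I))))"

definition cv :: "(forest \<Rightarrow> 'k::field fcomb) \<Rightarrow> 'k fcomb \<Rightarrow> 'k fcomb" where
  "cv f = lin (\<lambda>S. \<Sum>I\<in>subf S. psc (sg I (S |-| I)) (mlt (f I) (bs (S |-| I))))"

lemma cv_bs: "cv f (bs S) = (\<Sum>I\<in>subf S. psc (sg I (S |-| I)) (mlt (f I) (bs (S |-| I))))"
  by (simp add: cv_def)

lemma plinear_cv [plinear_intros]: "plinear g \<Longrightarrow> plinear (\<lambda>x. cv f (g x))"
  unfolding cv_def by (rule plinear_compose)

lemma plinear_cvp [plinear_intros]: "plinear g \<Longrightarrow> plinear (\<lambda>x. cvp P f (g x))"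
  unfolding cvp_def by (rule plinear_compose)

lemmas pl_cv = plinear_cv[OF plinear_id]
lemmas pl_cvp = plinear_cvp[OF plinear_id]

lemma cvp_True: "cvp (\<lambda>I. True) f = cv f"
  by (simp add: cv_def cvp_def)

lemma cvp_cong: "(\<And>S I. \<lbrakk>S \<in> keys x; I |\<subseteq>| S; f I \<noteq> 0\<rbrakk> \<Longrightarrow> P I \<longleftrightarrow> Q I) \<Longrightarrow> cvp P f x = cvp Q f x"
  unfolding cvp_def
proof (rule lin_cong[OF refl], goal_cases)
  case (1 S)
  then have "f I = 0" if "I |\<subseteq>| S" "P I \<noteq> Q I" for I
    using that by blast
  then show ?case
    by (intro sum.mono_neutral_cong) auto
qed

lemma cvp_split:
  "(\<And>I. P I \<longleftrightarrow> Q I \<or> R I) \<Longrightarrow> (\<And>I. \<not> (Q I \<and> R I)) \<Longrightarrow> cvp P f x = cvp Q f x + cvp R f x"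
  unfolding cvp_def lin_plus_fun[symmetric]
proof (rule lin_cong[OF refl], goal_cases)
  case (1 S)
  have "{I \<in> subf S. P I} = {I \<in> subf S. Q I} \<union> {I \<in> subf S. R I}"
    using 1 by auto
  then show ?case
    using 1(2) by (simp add: sum.union_disjoint disjoint_iff)
qed


text \<open>What is convolved replaces a nonempty monomial by single trees with the same labels.
  Keeping the labels guarantees that a product which is zero for common labels stays zero after
  applying \<open>f\<close>; the degree shift governs the sign of moving \<open>f\<close> past other
  factors.\<close>

definition wv :: "(forest \<Rightarrow> 'k::field fcomb) \<Rightarrow> int \<Rightarrow> bool" where
  "wv f p \<longleftrightarrow> (\<forall>I K. K \<in> keys (f I) \<longrightarrow> I \<noteq> {||} \<and> (\<exists>t. K = {|t|} \<and> dg t = dgf I + p \<and> lv t = fl I))"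

lemma wvE:
  assumes "wv f p" "K \<in> keys (f I)"
  obtains t where "K = {|t|}" "dg t = dgf I + p" "lv t = fl I" "I \<noteq> {||}"
  using assms unfolding wv_def by blast

lemma wv_par: "wv f p \<Longrightarrow> par (dgf I + p) (f I)"
  by (auto simp: par_def elim!: wvE)

lemma mlt_eq_0: "(\<And>S T. \<lbrakk>S \<in> keys x; T \<in> keys y\<rbrakk> \<Longrightarrow> \<not> dis S T) \<Longrightarrow> mlt x y = 0"
  using keys_mlt[of _ x y] by (metis ex_in_conv keys_eq_empty)

lemma wv_mlt_eq_0: "wv f p \<Longrightarrow> \<not> dis I T \<Longrightarrow> mlt (f I) (bs T) = 0"
  by (rule mlt_eq_0) (auto elim!: wvE simp: dis_def)

lemma funion_fminus_cancel_left: "J |\<subseteq>| S |-| I \<Longrightarrow> I |\<union>| J |-| I = J"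
  by auto

text \<open>Choosing \<open>I\<close> and then \<open>J\<close> in the rest amounts to choosing
  their union \<open>K\<close> and then \<open>I\<close> inside \<open>K\<close>.\<close>

lemma sum_subf_reindex:
  "(\<Sum>I\<in>subf S. \<Sum>J\<in>subf (S |-| I). h I J) = (\<Sum>K\<in>subf S. \<Sum>I\<in>subf K. h I (K |-| I))"
  by (simp add: sum.Sigma)
    (rule sum.reindex_bij_witness[where i = "\<lambda>(K, I). (I, K |-| I)" and j = "\<lambda>(I, J). (I |\<union>| J, I)"],
      auto simp: funion_fminus_cancel_left)

lemma sum_subf_swap:
  "(\<Sum>I\<in>subf S. \<Sum>J\<in>subf (S |-| I). h I J) = (\<Sum>J\<in>subf S. \<Sum>I\<in>subf (S |-| J). h I J)"
  by (simp add: sum.Sigma)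
    (rule sum.reindex_bij_witness[where i = "\<lambda>(J, I). (I, J)" and j = "\<lambda>(I, J). (J, I)"], auto)


text \<open>The submonomials of a product that avoid \<open>T\<close> are exactly those of the other
  factor. In the recursion for the order operations this identifies the terms in which one argument
  is multiplied from outside.\<close>

lemma mlt_cvp_bs:
  assumes f: "wv f p"
  shows "mlt (cvp P f x) (bs T) = cvp (\<lambda>I. P I \<and> fset I \<inter> fset T = {}) f (mlt x (bs T))"
proof (rule plinear_eqI[where f = "\<lambda>x. mlt (cvp P f x) (bs T)"
      and g = "\<lambda>x. cvp (\<lambda>I. P I \<and> fset I \<inter> fset T = {}) f (mlt x (bs T))"])
  fix S
  have l: "mlt (cvp P f (bs S)) (bs T) =
      (\<Sum>I\<in>{I\<in>subf S. P I}. psc (sg I (S |-| I)) (mlt (f I) (mlt (bs (S |-| I)) (bs T))))"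
    by (simp add: cvp_def mlt_sum mlt_psc mlt_assoc)
  show "mlt (cvp P f (bs S)) (bs T) = cvp (\<lambda>I. P I \<and> fset I \<inter> fset T = {}) f (mlt (bs S) (bs T))"
  proof (cases "dis S T")
    case True
    then have d: "fset S \<inter> fset T = {}"
      by (rule dis_disjoint)
    have "cvp (\<lambda>I. P I \<and> fset I \<inter> fset T = {}) f (mlt (bs S) (bs T)) =
        psc (sg S T) (\<Sum>I\<in>{I\<in>subf (S |\<union>| T). P I \<and> fset I \<inter> fset T = {}}.
          psc (sg I ((S |\<union>| T) |-| I)) (mlt (f I) (bs ((S |\<union>| T) |-| I))))"
      using True by (simp add: mlt_bs cvp_def lin_psc)
    also have "{I\<in>subf (S |\<union>| T). P I \<and> fset I \<inter> fset T = {}} = {I\<in>subf S. P I}"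
      using d by auto
    also have "psc (sg S T) (\<Sum>I\<in>{I\<in>subf S. P I}. psc (sg I ((S |\<union>| T) |-| I)) (mlt (f I) (bs ((S |\<union>| T) |-| I)))) =
        (\<Sum>I\<in>{I\<in>subf S. P I}. psc (sg I (S |-| I)) (mlt (f I) (mlt (bs (S |-| I)) (bs T))))"
      unfolding psc_sum
    proof (rule sum.cong[OF refl], goal_cases)
      case (1 I)
      then have I: "I |\<subseteq>| S"
        by simp
      then have e: "(S |\<union>| T) |-| I = (S |-| I) |\<union>| T" "fset (S |-| I) \<inter> fset T = {}"
        using d by auto
      have dd: "dis (S |-| I) T"
        using True fl_mono[of "S |-| I" S] by (auto simp: dis_def)
      have "sg S T = sg I T * (sg (S |-| I) T :: 'a)"
        using sg_union_left[of I "S |-| I" T] I by simp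
      then show ?case
        using dd e by (simp add: mlt_bs mlt_psc sg_union_right algebra_simps)
    qed
    finally show ?thesis
      using l by simp
  next
    case False
    \<comment> \<open>A label common to \<open>S\<close> and \<open>T\<close> belongs to
      \<open>I\<close> or to its complement, and \<open>f\<close> keeps the labels of
      \<open>I\<close>; so every summand vanishes together with the product.\<close>
    have "mlt (f I) (mlt (bs (S |-| I)) (bs T)) = 0" if I: "I |\<subseteq>| S" for I
    proof (cases "dis (S |-| I) T")
      case True
      then have "\<not> dis I ((S |-| I) |\<union>| T)"
        using False fl_split[OF I] by (auto simp: dis_def)
      then show ?thesis
        using True wv_mlt_eq_0[OF f] by (simp add: mlt_bs mlt_psc)
    qed (simp add: mlt_bs)
    then show ?thesis
      using False by (simp add: l mlt_bs plinear_zero[OF pl_cvp])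
  qed
qed (intro plinear_intros)+

lemma mlt_cv_eq_0:
  assumes f: "wv f p" and d: "\<not> dis T R"
  shows "mlt (bs T) (cv f (bs R)) = 0"
proof (rule mlt_eq_0)
  fix S K assume S: "S \<in> keys (bs T :: 'a fcomb)" and K: "K \<in> keys (cv f (bs R))"
  obtain I where I: "I |\<subseteq>| R" "K \<in> keys (psc (sg I (R |-| I)) (mlt (f I) (bs (R |-| I))))"
    using K unfolding cv_bs by (auto elim: keys_sumE)
  then have "K \<in> keys (mlt (f I) (bs (R |-| I)))"
    by (auto dest: in_keys_pscD)
  then obtain L where "L \<in> keys (f I)" "K = L |\<union>| (R |-| I)"
    by (auto dest: keys_mlt)
  then have "fl K = fl R"
    using fl_split[OF I(1)] by (auto elim!: wvE[OF f])
  then show "\<not> dis S K"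
    using d S by (simp add: dis_def)
qed

text \<open>The submonomials of the product are divided according to whether they contain
  \<open>t\<close>. Those that do not give \<open>t\<close> times the operator applied to
  \<open>R\<close>, with the sign of moving an odd operator past \<open>t\<close>.\<close>

lemma cv_mlt_tree:
  assumes f: "wv f p" and p: "odd p"
  shows "cv f (mlt (bs {|t|}) (bs R)) = psc (ep (dg t)) (mlt (bs {|t|}) (cv f (bs R))) +
    (\<Sum>J\<in>subf R. psc (sg J (R |-| J)) (mlt (lin f (mlt (bs {|t|}) (bs J))) (bs (R |-| J))))"
    (is "_ = ?A + ?B")
proof (cases "dis {|t|} R")
  case True
  then have t: "t |\<notin>| R"
    using dis_disjoint by fastforce
  have djt: "fset {|t|} \<inter> fset J = {}" if "J |\<subseteq>| R" for J
    using t that by auto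
  have disJ: "dis {|t|} J" if "J |\<subseteq>| R" for J
    using True fl_mono[OF that] by (auto simp: dis_def)
  have sp: "sg {|t|} R = sg {|t|} J * (sg {|t|} (R |-| J) :: 'a)" if "J |\<subseteq>| R" for J
    using sg_union_right[of J "R |-| J" "{|t|}"] that by simp
  have fin: "finite {J. J |\<subseteq>| finsert t R}"
    using finite_subf[of "finsert t R"] .
  have part: "subf (finsert t R) = subf R \<union> finsert t ` subf R"
  proof (intro equalityI subsetI)
    fix I assume I: "I \<in> subf (finsert t R)"
    show "I \<in> subf R \<union> finsert t ` subf R"
    proof (cases "t |\<in>| I")
      case True
      then have "I = finsert t (I |-| {|t|})" "I |-| {|t|} |\<subseteq>| R"
        using I by auto
      then show ?thesis
        by blast
    qed (use I in auto)
  qed auto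
  let ?h = "\<lambda>I. psc (sg {|t|} R) (psc (sg I (finsert t R |-| I)) (mlt (f I) (bs (finsert t R |-| I))))"
  have "cv f (mlt (bs {|t|}) (bs R)) = (\<Sum>I\<in>subf (finsert t R). ?h I)"
    using True by (simp add: mlt_bs plinear_psc[OF pl_cv] cv_bs psc_sum)
  also have "\<dots> = (\<Sum>I\<in>subf R. ?h I) + (\<Sum>I\<in>finsert t ` subf R. ?h I)"
    unfolding part by (rule sum.union_disjoint) (use t in auto)
  also have "(\<Sum>I\<in>finsert t ` subf R. ?h I) = (\<Sum>J\<in>subf R. ?h (finsert t J))"
    by (subst sum.reindex) (use t in \<open>auto simp: inj_on_def\<close>)
  also have "\<dots> = ?B"
  proof (rule sum.cong[OF refl], goal_cases)
    case (1 J)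
    then have J: "J |\<subseteq>| R"
      by simp
    have e: "finsert t R |-| finsert t J = R |-| J"
      using t by auto
    have "sg (finsert t J) (R |-| J) = sg {|t|} (R |-| J) * (sg J (R |-| J) :: 'a)"
      using sg_union_left[of "{|t|}" J "R |-| J"] t J by auto
    then show ?case
      using disJ[OF J] unfolding e sp[OF J] by (simp add: mlt_bs lin_psc mlt_psc algebra_simps)
  qed
  also have "(\<Sum>I\<in>subf R. ?h I) = ?A"
    unfolding cv_bs mlt_sum psc_sum
  proof (rule sum.cong[OF refl], goal_cases)
    case (1 J)
    then have J: "J |\<subseteq>| R"
      by simp
    have e: "finsert t R |-| J = finsert t (R |-| J)"
      using t J by auto
    have 1: "sg J (finsert t (R |-| J)) = sg J {|t|} * (sg J (R |-| J) :: 'a)"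
      using sg_union_right[of "{|t|}" "R |-| J" J] t by simp
    have "bs (finsert t (R |-| J)) = psc (sg {|t|} (R |-| J)) (mlt (bs {|t|}) (bs (R |-| J)) :: 'a fcomb)"
      using disJ[of "R |-| J"] by (auto simp: mlt_bs)
    then have 2: "mlt (f J) (bs (finsert t (R |-| J))) =
        psc (sg {|t|} (R |-| J) * ep ((dgf J + p) * dg t)) (mlt (bs {|t|}) (mlt (f J) (bs (R |-| J))))"
      using mlt_commute[OF wv_par[OF f, of J], of "dg t" "bs {|t|}"]
      by (simp add: mlt_psc par_def flip: mlt_assoc)
    have 3: "ep ((dgf J + p) * dg t) = ep (dg t * dgf J) * (ep (dg t) :: 'a)"
      unfolding ep_add[symmetric] using p by (intro ep_cong) (auto simp: algebra_simps)
    have 4: "sg {|t|} J = ep (dg t * dgf J) * (sg J {|t|} :: 'a)"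
      using sg_swap'[OF djt[OF J]] by simp
    show ?case
      unfolding e 1 2 sp[OF J] 3 4 by (simp add: mlt_psc algebra_simps)
  qed
  finally show ?thesis .
next
  case False
  have "mlt (lin f (mlt (bs {|t|}) (bs J))) (bs (R |-| J)) = 0" if J: "J |\<subseteq>| R" for J
  proof (cases "dis {|t|} J")
    case True
    then have "\<not> dis (finsert t J) (R |-| J)"
      using False fl_split[OF J] by (auto simp: dis_def)
    then show ?thesis
      using True wv_mlt_eq_0[OF f] by (simp add: mlt_bs lin_psc mlt_psc)
  qed (simp add: mlt_bs)
  then show ?thesis
    using False mlt_cv_eq_0[OF f False] by (simp add: mlt_bs plinear_zero[OF pl_cv])
qed

lemma cv_mlt_wv:
  assumes f: "wv f p" "odd p" and g: "wv g q" "odd q"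
  shows "cv f (mlt (g I) (bs R)) = psc (- ep (dgf I)) (mlt (g I) (cv f (bs R))) +
    (\<Sum>J\<in>subf R. psc (sg J (R |-| J)) (mlt (lin f (mlt (g I) (bs J))) (bs (R |-| J))))"
proof (rule plinear_eqI[where f = "\<lambda>x. cv f (mlt x (bs R))" and g = "\<lambda>x. psc (- ep (dgf I)) (mlt x (cv f (bs R))) +
    (\<Sum>J\<in>subf R. psc (sg J (R |-| J)) (mlt (lin f (mlt x (bs J))) (bs (R |-| J))))"])
  fix K assume "K \<in> keys (g I)"
  then obtain t where K: "K = {|t|}" "dg t = dgf I + q"
    using g by (auto elim: wvE)
  then have "- ep (dgf I) = (ep (dg t) :: 'a)"
    using g by (auto simp: ep_def)
  then show "cv f (mlt (bs K) (bs R)) = psc (- ep (dgf I)) (mlt (bs K) (cv f (bs R))) +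
    (\<Sum>J\<in>subf R. psc (sg J (R |-| J)) (mlt (lin f (mlt (bs K) (bs J))) (bs (R |-| J))))"
    unfolding K(1) using cv_mlt_tree[OF f, of t R] by simp
qed (intro plinear_intros)+

text \<open>The part of the composite of the two operators in which \<open>f\<close> and
  \<open>g\<close> act on disjoint submonomials.\<close>

definition cross :: "(forest \<Rightarrow> 'k::field fcomb) \<Rightarrow> (forest \<Rightarrow> 'k fcomb) \<Rightarrow> forest \<Rightarrow> 'k fcomb" where
  "cross f g S = (\<Sum>I\<in>subf S. psc (sg I (S |-| I) * - ep (dgf I)) (mlt (g I) (cv f (bs (S |-| I)))))"

text \<open>Once \<open>g\<close> has replaced \<open>I\<close> by a tree, \<open>f\<close> either
  avoids this tree, which gives the cross terms, or absorbs it together with some \<open>J\<close>.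
  Collecting the latter summands by the union of \<open>I\<close> and \<open>J\<close> gives a
  convolution again.\<close>

lemma cv_cv:
  assumes f: "wv f p" "odd p" and g: "wv g q" "odd q"
  shows "cv f (cv g (bs S)) = cross f g S + cv (\<lambda>I. lin f (cv g (bs I))) (bs S)"
proof -
  have "cv f (cv g (bs S)) = (\<Sum>I\<in>subf S. psc (sg I (S |-| I)) (cv f (mlt (g I) (bs (S |-| I)))))"
    by (simp add: cv_bs[of g] plinear_sum[OF pl_cv] plinear_psc[OF pl_cv])
  also have "\<dots> = cross f g S + (\<Sum>I\<in>subf S. \<Sum>J\<in>subf (S |-| I). psc (sg I (S |-| I) * sg J (S |-| I |-| J))
      (mlt (lin f (mlt (g I) (bs J))) (bs (S |-| I |-| J))))"
    unfolding cv_mlt_wv[OF f g] cross_def by (simp add: psc_add psc_sum sum.distrib)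
  also have "(\<Sum>I\<in>subf S. \<Sum>J\<in>subf (S |-| I). psc (sg I (S |-| I) * sg J (S |-| I |-| J))
      (mlt (lin f (mlt (g I) (bs J))) (bs (S |-| I |-| J)))) =
      (\<Sum>K\<in>subf S. \<Sum>I\<in>subf K. psc (sg I (S |-| I) * sg (K |-| I) (S |-| I |-| (K |-| I)))
      (mlt (lin f (mlt (g I) (bs (K |-| I)))) (bs (S |-| I |-| (K |-| I)))))"
    by (rule sum_subf_reindex)
  also have "\<dots> = cv (\<lambda>I. lin f (cv g (bs I))) (bs S)"
    unfolding cv_bs lin_sum mlt_sum psc_sum
  proof (intro sum.cong refl, goal_cases)
    case (1 K I)
    then have K: "K |\<subseteq>| S" and I: "I |\<subseteq>| K"
      by auto
    have e: "S |-| I |-| (K |-| I) = S |-| K" "S |-| I = (K |-| I) |\<union>| (S |-| K)"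
      using K I by auto
    have "sg I (S |-| I) = sg I (K |-| I) * (sg I (S |-| K) :: 'a)"
      unfolding e(2) by (rule sg_union_right) auto
    moreover have "sg K (S |-| K) = sg I (S |-| K) * (sg (K |-| I) (S |-| K) :: 'a)"
      using sg_union_left[of I "K |-| I" "S |-| K"] I by simp
    ultimately show ?case
      unfolding e(1) by (simp add: lin_psc mlt_psc algebra_simps)
  qed
  finally show ?thesis .
qed

text \<open>Actions on disjoint submonomials commute up to the Koszul sign, which is -1 for odd
  operators. Hence the graded commutator of two such convolution operators is again a convolution
  operator.\<close>

lemma cross_antisym:
  assumes f: "wv f p" "odd p" and g: "wv g q" "odd q"
  shows "cross f g S + cross g f S = 0"
proof -
  have l: "cross f g S = (\<Sum>I\<in>subf S. \<Sum>J\<in>subf (S |-| I). psc (- (sg I (S |-| I) * sg J (S |-| I |-| J) * ep (dgf I)))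
     (mlt (g I) (mlt (f J) (bs (S |-| I |-| J)))))" for f g :: "forest \<Rightarrow> 'a fcomb"
    by (simp add: cross_def cv_bs mlt_sum psc_sum mlt_psc algebra_simps)
  have "cross g f S = (\<Sum>I\<in>subf S. \<Sum>J\<in>subf (S |-| I). psc (- (sg J (S |-| J) * sg I (S |-| J |-| I) * ep (dgf J)))
     (mlt (f J) (mlt (g I) (bs (S |-| J |-| I)))))"
    unfolding l by (rule sum_subf_swap)
  also have "\<dots> = - cross f g S"
    unfolding l sum_negf[symmetric]
  proof (intro sum.cong refl, goal_cases)
    case (1 I J)
    then have I: "I |\<subseteq>| S" and J: "J |\<subseteq>| S |-| I"
      by auto
    let ?R = "S |-| I |-| J"
    have R: "S |-| J |-| I = ?R" and SI: "S |-| I = J |\<union>| ?R" and SJ: "S |-| J = I |\<union>| ?R"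
      using I J by auto
    have d: "fset I \<inter> fset J = {}" "fset J \<inter> fset ?R = {}" "fset I \<inter> fset ?R = {}"
      using J by auto
    have 1: "sg I (S |-| I) = sg I J * (sg I ?R :: 'a)" "sg J (S |-| J) = sg J I * (sg J ?R :: 'a)"
      using sg_union_right[OF d(2), of I, where 'a = 'a] sg_union_right[OF d(3), of J, where 'a = 'a]
      by (simp_all only: SI[symmetric] SJ[symmetric])
    have 2: "mlt (f J) (mlt (g I) (bs ?R)) = psc (ep ((dgf J + p) * (dgf I + q))) (mlt (g I) (mlt (f J) (bs ?R)))"
      using mlt_commute[OF wv_par[OF f(1)] wv_par[OF g(1)], of J I] by (simp add: mlt_psc flip: mlt_assoc)
    have 3: "sg J I = ep (dgf I * dgf J) * (sg I J :: 'a)"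
      using sg_swap'[of J I] d by (simp add: Int_commute mult.commute)
    have "even ((dgf I * dgf J + dgf J + (dgf J + p) * (dgf I + q)) - (dgf I + 1))"
      using f g by auto
    then have "ep (dgf I * dgf J + dgf J + (dgf J + p) * (dgf I + q)) = (ep (dgf I + 1) :: 'a)"
      by (rule ep_cong)
    then have 4: "ep (dgf I * dgf J) * ep (dgf J) * ep ((dgf J + p) * (dgf I + q)) = - (ep (dgf I) :: 'a)"
      by (simp add: ep_add)
    have "sg J (S |-| J) * sg I ?R * ep (dgf J) * ep ((dgf J + p) * (dgf I + q)) =
      (ep (dgf I * dgf J) * ep (dgf J) * ep ((dgf J + p) * (dgf I + q))) * (sg I (S |-| I) * sg J ?R :: 'a)"
      unfolding 1 3 by (simp only: mult_ac)
    then have "- (sg J (S |-| J) * sg I ?R * ep (dgf J)) * ep ((dgf J + p) * (dgf I + q)) =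
      - (- (sg I (S |-| I) * sg J ?R * ep (dgf I)) :: 'a)"
      unfolding 4 by (simp add: mult_ac)
    then show ?case
      unfolding R 2 psc_psc by (simp only: psc_uminus)
  qed
  finally show ?thesis
    by simp
qed

section \<open>The operators and the differential of the model\<close>

definition la :: "nat \<Rightarrow> forest \<Rightarrow> 'k::field fcomb" where
  "la a S = (if S \<noteq> {||} \<and> fcard S \<le> a + 1 \<and> \<not> inert S then bs {|Nd a S|} else 0)"

abbreviation DD :: "nat \<Rightarrow> 'k::field fcomb \<Rightarrow> 'k fcomb" where
  "DD a \<equiv> cv (la a)"

lemma wv_la: "wv (la a) (1 - 2 * int a)"
  by (auto simp: wv_def la_def split: if_splits)

text \<open>Solved from the required identity that the graded commutator of the differential with
  Delta_a is the sum of the composites of Delta_b with Delta_(a-b), read off on the single-tree part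
  of a monomial: the first sum splits the root, the second differentiates one child. The second sum
  is \<open>dN\<close> of the children written out, so that the recursive call visibly concerns a
  smaller tree.\<close>

function dt :: "tr \<Rightarrow> 'k::field fcomb" where
  "dt (Lf j) = 0"
| "dt (Nd a S) = (\<Sum>b\<in>{1..<a}. lin (la b) (DD (a - b) (bs S))) -
     lin (la a) (\<Sum>s\<in>fset S. psc (sg {|s|} (S |-| {|s|})) (mlt (dt s) (bs (S |-| {|s|}))))"
  by pat_completeness auto
termination
  by (relation "measure size") (auto simp: size_child)

text \<open>The convolution of a function supported on single trees is a derivation; so
  \<open>dN\<close> is the derivation extending \<open>dt\<close>.\<close>

definition dth :: "forest \<Rightarrow> 'k::field fcomb" where
  "dth S = (if fcard S = 1 then dt (SOME s. s |\<in>| S) else 0)"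

abbreviation dN :: "'k::field fcomb \<Rightarrow> 'k fcomb" where
  "dN \<equiv> cv dth"

lemma fcard_single [simp]: "fcard {|s|} = 1"
  by (simp add: fcard.rep_eq)

lemma dth_single [simp]: "dth {|s|} = dt s"
  by (simp add: dth_def)

lemma fcard_1E: 
  assumes "fcard S = 1"
  obtains s where "S = {|s|}"
proof -
  obtain s where "fset S = {s}"
    using assms by (auto simp: fcard.rep_eq card_1_singleton_iff)
  then have "S = {|s|}"
    by (metis bot_fset.rep_eq finsert.rep_eq fset_inject)
  then show ?thesis
    using that by blast
qed

lemma dth_eq_0: "(\<And>s. S \<noteq> {|s|}) \<Longrightarrow> dth S = 0"
  by (metis dth_def fcard_1E)

lemma dN_bs: "dN (bs S) = (\<Sum>s\<in>fset S. psc (sg {|s|} (S |-| {|s|})) (mlt (dt s) (bs (S |-| {|s|}))))"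
proof -
  have z: "dth I = 0" if "I |\<subseteq>| S" "I \<notin> (\<lambda>s. {|s|}) ` fset S" for I
    using that by (intro dth_eq_0) auto
  have "dN (bs S) = (\<Sum>I\<in>(\<lambda>s. {|s|}) ` fset S. psc (sg I (S |-| I)) (mlt (dth I) (bs (S |-| I))))"
    unfolding cv_bs by (rule sum.mono_neutral_right) (auto simp: z)
  also have "\<dots> = (\<Sum>s\<in>fset S. psc (sg {|s|} (S |-| {|s|})) (mlt (dt s) (bs (S |-| {|s|}))))"
    by (subst sum.reindex) (auto simp: inj_on_def)
  finally show ?thesis .
qed

lemma dt_Nd: "dt (Nd a S) = (\<Sum>b\<in>{1..<a}. lin (la b) (DD (a - b) (bs S))) - lin (la a) (dN (bs S))"
  by (simp add: dN_bs)

declare dt.simps(2) [simp del]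

lemma keys_cv_bs:
  assumes "wv f p" "K \<in> keys (cv f (bs S))"
  shows "\<exists>I t. I |\<subseteq>| S \<and> {|t|} \<in> keys (f I) \<and> dg t = dgf I + p \<and> lv t = fl I \<and> dis {|t|} (S |-| I) \<and>
    I \<noteq> {||} \<and> K = finsert t (S |-| I)"
proof -
  obtain I where I: "I |\<subseteq>| S" "K \<in> keys (psc (sg I (S |-| I)) (mlt (f I) (bs (S |-| I))))"
    using assms(2) unfolding cv_bs by (auto elim: keys_sumE)
  then have "K \<in> keys (mlt (f I) (bs (S |-| I)))"
    by (auto dest: in_keys_pscD)
  then obtain L where L: "L \<in> keys (f I)" "K = L |\<union>| (S |-| I)" "dis L (S |-| I)"
    by (auto dest: keys_mlt)
  obtain t where "L = {|t|}" "dg t = dgf I + p" "lv t = fl I" "I \<noteq> {||}"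
    by (rule wvE[OF assms(1) L(1)])
  then show ?thesis
    using L I by (intro exI[of _ I] exI[of _ t]) auto
qed

lemma cv_degree:
  assumes "wv f p" "K \<in> keys (cv f (bs S))"
  shows "dgf K = dgf S + p" "fl K = fl S" "S \<noteq> {||}"
proof -
  obtain I t where *: "I |\<subseteq>| S" "dg t = dgf I + p" "lv t = fl I" "dis {|t|} (S |-| I)" "K = finsert t (S |-| I)"
    "I \<noteq> {||}"
    using keys_cv_bs[OF assms] by blast
  then show "dgf K = dgf S + p"
    using dgf_union[of "{|t|}" "S |-| I"] dis_disjoint[OF *(4)] dgf_split[OF *(1)] by simp
  show "fl K = fl S"
    using * fl_split[OF *(1)] by simp
  show "S \<noteq> {||}"
    using * by auto
qed

lemma dt_keys: "K \<in> keys (dt s :: 'k::field fcomb) \<Longrightarrow> \<exists>t. K = {|t|} \<and> dg t = dg s + 1 \<and> lv t = lv s"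
proof (induction s arbitrary: K)
  case (Nd a S)
  have la: "\<exists>t. K = {|t|} \<and> dg t = dgf L + 1 - 2 * int b \<and> lv t = fl L" if "K \<in> keys (la b L :: 'k fcomb)" for b L
    using wvE[OF wv_la that] by force
  have "K \<in> keys (\<Sum>b\<in>{1..<a}. lin (la b) (DD (a - b) (bs S)) :: 'k fcomb) \<or>
      K \<in> keys (lin (la a) (dN (bs S)) :: 'k fcomb)"
    using Nd.prems unfolding dt_Nd by (rule keys_minusE)
  then show ?case
  proof
    assume "K \<in> keys (\<Sum>b\<in>{1..<a}. lin (la b) (DD (a - b) (bs S)) :: 'k fcomb)"
    then obtain b L where b: "b \<in> {1..<a}" and L: "L \<in> keys (DD (a - b) (bs S) :: 'k fcomb)" "K \<in> keys (la b L :: 'k fcomb)"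
      by (elim keys_sumE in_keys_linE) blast
    then show ?thesis
      using la[OF L(2)] cv_degree[OF wv_la L(1)] by (auto simp: of_nat_diff)
  next
    assume "K \<in> keys (lin (la a) (dN (bs S)) :: 'k fcomb)"
    then obtain L where L: "L \<in> keys (dN (bs S) :: 'k fcomb)" "K \<in> keys (la a L :: 'k fcomb)"
      by (elim in_keys_linE) blast
    obtain s where s: "s |\<in>| S"
      and "L \<in> keys (psc (sg {|s|} (S |-| {|s|})) (mlt (dt s) (bs (S |-| {|s|}))) :: 'k fcomb)"
      using L(1) unfolding dN_bs by (elim keys_sumE) blast
    then obtain M where M: "M \<in> keys (dt s :: 'k fcomb)" "dis M (S |-| {|s|})" "L = M |\<union>| (S |-| {|s|})"
      by (auto dest!: in_keys_pscD keys_mlt)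
    obtain t where t: "M = {|t|}" "dg t = dg s + 1" "lv t = lv s"
      using Nd.IH[OF _ M(1)] s by blast
    have "{|s|} |\<subseteq>| S"
      using s by auto
    then have "dgf L = dgf S + 1" "fl L = fl S" "S \<noteq> {||}"
      using dgf_union[of M "S |-| {|s|}"] dis_disjoint[OF M(2)] dgf_split[of "{|s|}" S] fl_split[of "{|s|}" S] M t s
      by auto
    then show ?thesis
      using la[OF L(2)] by auto
  qed
qed simp

lemma wv_dth: "wv dth 1"
  unfolding wv_def
proof (intro allI impI)
  fix I K assume K: "K \<in> keys (dth I :: 'a fcomb)"
  then obtain s where "I = {|s|}"
    using dth_eq_0[of I, where 'a = 'a] by force
  then show "I \<noteq> {||} \<and> (\<exists>t. K = {|t|} \<and> dg t = dgf I + 1 \<and> lv t = fl I)"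
    using dt_keys K by auto
qed

text \<open>The defining property of \<open>dt\<close>, which is valid also when the bracket of \<open>I\<close> vanishes.\<close>

lemma dth_DD_la_dN:
  "lin dth (DD a (bs I)) + lin (la a) (dN (bs I)) = (\<Sum>b\<in>{1..<a}. lin (la b) (DD (a - b) (bs I)) :: 'k::field fcomb)"
proof -
  \<comment> \<open>Only \<open>J = I\<close> contributes: for a smaller \<open>J\<close> the
    resulting forest has a further tree beside the new bracket, and \<open>dth\<close> vanishes on
    forests with several trees.\<close>
  have dth: "lin dth (DD a (bs I)) = (lin dth (la a I) :: 'k fcomb)"
  proof -
    have "lin dth (DD a (bs I)) = (\<Sum>J\<in>subf I. psc (sg J (I |-| J)) (lin dth (mlt (la a J) (bs (I |-| J)))) :: 'k fcomb)"
      by (simp add: cv_bs lin_sum lin_psc)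
    also have "\<dots> = (\<Sum>J\<in>{I}. psc (sg J (I |-| J)) (lin dth (mlt (la a J) (bs (I |-| J)))))"
    proof (rule sum.mono_neutral_right, goal_cases)
      case 3
      show ?case
      proof
        fix J assume J: "J \<in> subf I - {I}"
        then have "I |-| J \<noteq> {||}"
          by auto
        then obtain u where u: "u |\<in>| I |-| J"
          by auto
        have "dth K = (0 :: 'k fcomb)" if K: "K \<in> keys (mlt (la a J) (bs (I |-| J)) :: 'k fcomb)" for K
        proof (rule dth_eq_0)
          fix s
          obtain L where L: "L \<in> keys (la a J :: 'k fcomb)" "dis L (I |-| J)" "K = L |\<union>| (I |-| J)"
            using keys_mlt[OF K] by auto
          obtain t where t: "L = {|t|}"
            by (rule wvE[OF wv_la L(1)])
          then have "t |\<notin>| I |-| J"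
            using dis_disjoint[OF L(2)] by auto
          then show "K \<noteq> {|s|}"
            using u L(3) t by auto
        qed
        then have "lin dth (mlt (la a J) (bs (I |-| J))) = (0 :: 'k fcomb)"
          by (simp add: lin_def)
        then show "psc (sg J (I |-| J)) (lin dth (mlt (la a J) (bs (I |-| J)))) = (0 :: 'k fcomb)"
          by simp
      qed
    qed auto
    finally show ?thesis
      by simp
  qed
  show ?thesis
  proof (cases "I \<noteq> {||} \<and> fcard I \<le> a + 1 \<and> \<not> inert I")
    case True
    then have "la a I = (bs {|Nd a I|} :: 'k fcomb)"
      by (simp add: la_def)
    then show ?thesis
      by (simp add: dth dt_Nd)
  next
    case False
    then have 1: "la a I = (0 :: 'k fcomb)"
      by (auto simp: la_def)
    \<comment> \<open>Differentiating one tree changes neither the number of trees nor the presence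
      of an odd scalar, whose differential is zero. So the bracket still vanishes.\<close>
    have 2: "lin (la a) (dN (bs I)) = (0 :: 'k fcomb)"
    proof -
      have "la a K = (0 :: 'k fcomb)" if K: "K \<in> keys (dN (bs I) :: 'k fcomb)" for K
      proof -
        obtain J t where J: "J |\<subseteq>| I" "{|t|} \<in> keys (dth J :: 'k fcomb)" "dis {|t|} (I |-| J)" "K = finsert t (I |-| J)"
          using keys_cv_bs[OF wv_dth K] by blast
        obtain s where s: "J = {|s|}" "dt s \<noteq> (0 :: 'k fcomb)"
          using J(2) dth_eq_0[of J, where 'a = 'k] by force
        have t: "t |\<notin>| I |-| {|s|}"
          using dis_disjoint[OF J(3)] s by auto
        have "s |\<in>| I"
          using J s by auto
        then have "fcard K = fcard I"
          using t J s fcard_Suc_fminus1[of s I] by (simp add: fcard_finsert_disjoint)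
        moreover have "inert I \<Longrightarrow> inert K"
        proof -
          assume "inert I"
          then obtain j where j: "j < 0" "Lf j |\<in>| I"
            by (auto simp: inert_def)
          then have "Lf j \<noteq> s"
            using s(2) by auto
          then show "inert K"
            using j J s by (auto simp: inert_def)
        qed
        moreover have "I \<noteq> {||}"
          using J s by auto
        ultimately show ?thesis
          using False by (auto simp: la_def)
      qed
      then show ?thesis
        by (simp add: lin_def)
    qed
    \<comment> \<open>If \<open>I\<close> has at least \<open>a + 2\<close> trees, replacing at most
      \<open>a - b + 1\<close> of them by one leaves at least \<open>b + 2\<close>, too many for a
      bracket of Delta_b. An odd scalar cannot be absorbed by the inner bracket, so it remains and
      kills the outer one.\<close>
    have 3: "lin (la b) (DD (a - b) (bs I)) = (0 :: 'k fcomb)" if b: "b \<in> {1..<a}" for b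
    proof -
      have "la b K = (0 :: 'k fcomb)" if K: "K \<in> keys (DD (a - b) (bs I) :: 'k fcomb)" for K
      proof -
        obtain J t where J: "J |\<subseteq>| I" "{|t|} \<in> keys (la (a - b) J :: 'k fcomb)" "dis {|t|} (I |-| J)" "K = finsert t (I |-| J)"
          using keys_cv_bs[OF wv_la K] by blast
        have c: "fcard J \<le> a - b + 1" "\<not> inert J" "J \<noteq> {||}"
          using J(2) by (auto simp: la_def split: if_splits)
        have t: "t |\<notin>| I |-| J"
          using dis_disjoint[OF J(3)] by auto
        have "fcard I = fcard J + fcard (I |-| J)"
          using fcard_funion_disjoint[of J "I |-| J"] J(1) by simp
        moreover have "fcard K = Suc (fcard (I |-| J))"
          using t J by (simp add: fcard_finsert_disjoint)
        moreover have "inert I \<Longrightarrow> inert K"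
          using c J by (auto simp: inert_def)
        moreover have "I \<noteq> {||}"
          using c J by auto
        ultimately show ?thesis
          using False c b by (auto simp: la_def)
      qed
      then show ?thesis
        by (simp add: lin_def)
    qed
    show ?thesis
      using 3 by (simp add: dth 1 2)
  qed
qed

lemma odd_la: "odd (1 - 2 * int a)"
  by simp

text \<open>Apart from cross terms both sides are convolutions, and these agree by
  \<open>dth_DD_la_dN\<close>. The cross terms on the left cancel by antisymmetry. Those on the
  right change sign under exchanging \<open>b\<close> and \<open>a - b\<close>, so that twice their
  sum is zero; here 2 must be invertible.\<close>

lemma dN_DD:
  "dN (DD a x) + DD a (dN x) = (\<Sum>b\<in>{1..<a}. DD b (DD (a - b) x) :: 'k::field_char_0 fcomb)"
proof (rule plinear_eqI[where f = "\<lambda>x. dN (DD a x) + DD a (dN x)" and g = "\<lambda>x. \<Sum>b\<in>{1..<a}. DD b (DD (a - b) x)"])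
  fix S
  note la = wv_la odd_la and d = wv_dth odd_one
  have "(\<Sum>b\<in>{1..<a}. cross (la b) (la (a - b)) S) = (\<Sum>b\<in>{1..<a}. cross (la (a - b)) (la b) S :: 'k fcomb)"
    by (rule sum.reindex_bij_witness[where i = "\<lambda>b. a - b" and j = "\<lambda>b. a - b"]) auto
  moreover have "(\<Sum>b\<in>{1..<a}. cross (la b) (la (a - b)) S) + (\<Sum>b\<in>{1..<a}. cross (la (a - b)) (la b) S) = (0 :: 'k fcomb)"
    unfolding sum.distrib[symmetric] by (intro sum.neutral ballI cross_antisym[OF la la])
  moreover have "psc 2 y = y + y" for y :: "'k fcomb"
    by (metis one_add_one psc_1 psc_add_left)
  ultimately have "psc 2 (\<Sum>b\<in>{1..<a}. cross (la b) (la (a - b)) S) = (0 :: 'k fcomb)"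
    by metis
  moreover have "y = psc (1/2) (psc 2 y)" for y :: "'k fcomb"
    by simp
  ultimately have 1: "(\<Sum>b\<in>{1..<a}. cross (la b) (la (a - b)) S) = (0 :: 'k fcomb)"
    by (metis psc_zero)
  have "dN (DD a (bs S)) + DD a (dN (bs S)) =
      cv (\<lambda>I. lin dth (DD a (bs I))) (bs S) + (cv (\<lambda>I. lin (la a) (dN (bs I))) (bs S) :: 'k fcomb)"
    unfolding cv_cv[OF d la] cv_cv[OF la d]
    using cross_antisym[OF la d, of a S] by (simp add: algebra_simps)
  also have "\<dots> = cv (\<lambda>I. lin dth (DD a (bs I)) + lin (la a) (dN (bs I))) (bs S)"
    by (simp add: cv_bs plinear_add[OF pl_mlt_left] psc_add sum.distrib)
  also have "\<dots> = (\<Sum>b\<in>{1..<a}. cv (\<lambda>I. lin (la b) (DD (a - b) (bs I))) (bs S))"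
    unfolding dth_DD_la_dN by (simp add: cv_bs mlt_sum psc_sum) (rule sum.swap)
  also have "\<dots> = (\<Sum>b\<in>{1..<a}. DD b (DD (a - b) (bs S)))"
    by (simp add: cv_cv[OF la la] sum.distrib 1 del: One_nat_def)
  finally show "dN (DD a (bs S)) + DD a (dN (bs S)) = (\<Sum>b\<in>{1..<a}. DD b (DD (a - b) (bs S)) :: 'k fcomb)" .
qed (intro plinear_intros)+

text \<open>A single tree of a product lies in exactly one of the two factors. The summands avoiding
  \<open>T\<close> give the first term; those avoiding \<open>S\<close> give the second after the
  factors have been exchanged twice, which produces the sign.\<close>

lemma dN_mlt:
  assumes "par p x"
  shows "dN (mlt x y) = mlt (dN x) y + psc (ep p) (mlt x (dN y))"
proof (rule plinear2_eqI[where f = "\<lambda>x y. dN (mlt x y)" and g = "\<lambda>x y. mlt (dN x) y + psc (ep p) (mlt x (dN y))"])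
  fix S T assume S: "S \<in> keys x" and T: "T \<in> keys y"
  have p: "ep p = (ep (dgf S) :: 'a)"
    using S assms by (intro ep_cong) (auto simp: par_def)
  have pS: "par (dgf S) (bs S :: 'a fcomb)" for S
    by (simp add: par_def)
  have pd: "par (dgf S + 1) (dN (bs S) :: 'a fcomb)" for S
    by (auto simp: par_def cv_degree(1)[OF wv_dth])
  have "dN (mlt (bs S) (bs T)) = cvp (\<lambda>I. True) dth (mlt (bs S) (bs T) :: 'a fcomb)"
    by (simp add: cvp_True)
  also have "\<dots> = cvp (\<lambda>I. True \<and> fset I \<inter> fset T = {}) dth (mlt (bs S) (bs T)) +
      cvp (\<lambda>I. fset I \<inter> fset T \<noteq> {}) dth (mlt (bs S) (bs T))"
    by (rule cvp_split) auto
  also have "cvp (\<lambda>I. fset I \<inter> fset T \<noteq> {}) dth (mlt (bs S) (bs T)) =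
      cvp (\<lambda>I. True \<and> fset I \<inter> fset S = {}) dth (mlt (bs S) (bs T) :: 'a fcomb)"
  proof (rule cvp_cong, goal_cases)
    case (1 U I)
    then have U: "U = S |\<union>| T" "dis S T"
      by (auto dest: keys_mlt)
    obtain s where "I = {|s|}"
      using dth_eq_0[of I, where 'a = 'a] 1(3) by blast
    then show ?case
      using U 1(2) dis_disjoint[OF U(2)] by auto
  qed
  also have "\<dots> = psc (ep (dgf S * dgf T)) (cvp (\<lambda>I. True \<and> fset I \<inter> fset S = {}) dth (mlt (bs T) (bs S)))"
    using mlt_commute[OF pS pS, of S T] by (simp add: plinear_psc[OF pl_cvp])
  also have "\<dots> = psc (ep (dgf S * dgf T)) (mlt (dN (bs T)) (bs S))"
    unfolding mlt_cvp_bs[OF wv_dth, symmetric] cvp_True ..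
  also have "\<dots> = psc (ep (dgf S * dgf T) * ep ((dgf T + 1) * dgf S)) (mlt (bs S) (dN (bs T)))"
    using mlt_commute[OF pd pS, of T S] by simp
  also have "ep (dgf S * dgf T) * ep ((dgf T + 1) * dgf S) = (ep (dgf S) :: 'a)"
    unfolding ep_add[symmetric] by (rule ep_cong) (auto simp: algebra_simps)
  also have "cvp (\<lambda>I. True \<and> fset I \<inter> fset T = {}) dth (mlt (bs S) (bs T)) = mlt (dN (bs S)) (bs T :: 'a fcomb)"
    unfolding mlt_cvp_bs[OF wv_dth, symmetric] cvp_True ..
  finally show "dN (mlt (bs S) (bs T)) = mlt (dN (bs S)) (bs T) + psc (ep p) (mlt (bs S) (dN (bs T)) :: 'a fcomb)"
    by (simp add: p)
qed (intro plinear_intros)+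

section \<open>Evaluation of trees in the model\<close>

text \<open>There are no Koszul signs: they would come from moving an operation past an argument,
  and the intended arguments are even.\<close>

primrec ev :: "(nat \<Rightarrow> 'k::field fcomb) \<Rightarrow> nat tree \<Rightarrow> 'k fcomb" where
  "ev v (Leaf j) = v j"
| "ev v (Mul s t) = mlt (ev v s) (ev v t)"
| "ev v (Del a t) = DD a (ev v t)"

lemma ev_cong: "(\<And>j. j \<in> lset t \<Longrightarrow> v j = w j) \<Longrightarrow> ev v t = ev w t"
  by (induction t) auto

lemma ev_subst: "ev v (subst f t) = ev (\<lambda>j. ev v (f j)) t"
  by (induction t) auto

lemma ev_map_tree: "ev v (map_tree g t) = ev (\<lambda>j. v (g j)) t"
  by (simp add: map_tree_subst ev_subst)

lemma par_DD:
  assumes x: "par p x"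
  shows "par (p + 1) (DD a x)"
  unfolding par_def
proof
  fix K assume K: "K \<in> keys (DD a x)"
  obtain S where S: "S \<in> keys x" "K \<in> keys (DD a (bs S) :: 'a fcomb)"
    using K[unfolded plinear_eq_lin[OF pl_cv, of "la a" x]] by (rule in_keys_linE)
  then show "even (dgf K - (p + 1))"
    using cv_degree(1)[OF wv_la S(2)] x by (simp add: par_def)
qed

lemma par_ev: "(\<And>j. j \<in> lset t \<Longrightarrow> par 0 (v j)) \<Longrightarrow> par (tdeg t) (ev v t)"
proof (induction t)
  case (Del a t)
  then have "par (tdeg t + 1) (ev v (Del a t))"
    by (simp add: par_DD)
  then show ?case
    by (auto simp: par_def)
qed (auto intro: par_mlt)

lemma plinear_ev_slot:
  "\<lbrakk>distinct (leaves t); i \<in> lset t\<rbrakk> \<Longrightarrow> plinear (\<lambda>x. ev (v(i := x)) t)"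
proof (induction t)
  case (Mul s t)
  show ?case
  proof (cases "i \<in> lset s")
    case True
    then have "\<And>x. ev (v(i := x)) t = ev v t"
      using Mul.prems by (intro ev_cong) auto
    then show ?thesis
      using True Mul by (auto intro: plinear_mlt_left simp del: fun_upd_apply)
  next
    case False
    then have "\<And>x. ev (v(i := x)) s = ev v s"
      by (intro ev_cong) auto
    then show ?thesis
      using False Mul by (auto intro: plinear_mlt_right simp del: fun_upd_apply)
  qed
qed (auto intro: plinear_intros)

text \<open>At even cycles evaluation is a chain map: the derivation rule for \<open>mlt\<close> and
  the commutator formula for \<open>DD a\<close> are the two recursive clauses of
  \<open>tree_delta\<close>.\<close>

lemma dN_ev:
  fixes v :: "nat \<Rightarrow> 'k::field_char_0 fcomb"
  assumes "\<And>j. par 0 (v j)" "\<And>j. dN (v j) = 0"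
  shows "lin (ev v) (tree_delta t) = dN (ev v t)"
proof (induction t)
  case (Mul s t)
  have "lin (ev v) (mulc x y) = mlt (lin (ev v) x) (lin (ev v) y)" for x y
    by (rule plinear2_eqI[where f = "\<lambda>x y. lin (ev v) (mulc x y)" and g = "\<lambda>x y. mlt (lin (ev v) x) (lin (ev v) y)"])
      (auto intro!: plinear_intros)
  then show ?case
    using Mul dN_mlt[OF par_ev, of s v "ev v t"] assms(1)
    by (simp add: tree_delta_Mul lin_add lin_psc)
next
  case (Del a t)
  have "lin (ev v) (delc a x) = DD a (lin (ev v) x)" for x
    by (rule plinear_eqI[where f = "\<lambda>x. lin (ev v) (delc a x)" and g = "\<lambda>x. DD a (lin (ev v) x)"])
      (auto intro!: plinear_intros)
  then show ?case
    using Del dN_DD[of a "ev v t"] by (simp add: tree_delta_Del lin_diff lin_sum algebra_simps)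
qed (simp add: assms)

lemma finite_lv [simp]: "finite (lv t)"
proof (induction t)
  case (Nd a S)
  then show ?case
    by (cases "S = {||}") (auto simp: lv.simps)
qed simp

lemma finite_fl [simp]: "finite (fl S)"
  by (simp add: fl_def)

section \<open>Evaluation of the order operations\<close>

abbreviation bsf :: "(nat \<Rightarrow> forest) \<Rightarrow> nat \<Rightarrow> 'k::field fcomb" where
  "bsf S \<equiv> \<lambda>j. bs (S j)"

definition even_forests :: "(nat \<Rightarrow> forest) \<Rightarrow> bool" where
  "even_forests S \<longleftrightarrow> (\<forall>j. even (dgf (S j)))"

lemma par_bsf: "even_forests S \<Longrightarrow> par 0 (bsf S j)"
  by (simp add: even_forests_def par_def)

primrec mprod :: "(nat \<Rightarrow> forest) \<Rightarrow> nat \<Rightarrow> 'k::field fcomb" where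
  "mprod S 0 = bs {||}"
| "mprod S (Suc k) = mlt (mprod S k) (bs (S (Suc k)))"

definition meets :: "(nat \<Rightarrow> forest) \<Rightarrow> nat \<Rightarrow> forest \<Rightarrow> bool" where
  "meets S k I \<longleftrightarrow> (\<forall>j\<in>{1..k}. fset I \<inter> fset (S j) \<noteq> {})"

lemma meets_Suc: "meets S (Suc k) I \<longleftrightarrow> meets S k I \<and> fset I \<inter> fset (S (Suc k)) \<noteq> {}"
  by (auto simp: meets_def atLeastAtMostSuc_conv)

lemma meets_cong: "(\<And>j. j \<in> {1..k} \<Longrightarrow> S j = S' j) \<Longrightarrow> meets S k I \<longleftrightarrow> meets S' k I"
  by (simp add: meets_def)

lemma mprod_cong: "(\<And>j. j \<in> {1..k} \<Longrightarrow> S j = S' j) \<Longrightarrow> mprod S k = mprod S' k"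
  by (induction k) auto

text \<open>The factors of a nonvanishing product are disjoint, so each of them contributes an
  element of its own to \<open>I\<close>.\<close>

lemma meets_fcard:
  "U \<in> keys (mprod S k :: 'k::field fcomb) \<Longrightarrow> I |\<subseteq>| U \<Longrightarrow> meets S k I \<Longrightarrow> k \<le> fcard I"
proof (induction k arbitrary: U I)
  case (Suc k)
  obtain V where V: "V \<in> keys (mprod S k :: 'k fcomb)" "dis V (S (Suc k))" "U = V |\<union>| S (Suc k)"
    using Suc.prems(1) by (auto dest: keys_mlt)
  let ?I = "I |-| S (Suc k)"
  have "meets S k I" and ne: "fset I \<inter> fset (S (Suc k)) \<noteq> {}"
    using Suc.prems(3) by (auto simp: meets_Suc)
  moreover have "\<And>U j. \<lbrakk>U \<in> keys (mprod S k :: 'k fcomb); j \<in> {1..k}\<rbrakk> \<Longrightarrow> S j |\<subseteq>| U"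
  proof (induction k)
    case (Suc k)
    then show ?case
      by (fastforce dest!: keys_mlt simp: le_Suc_eq)
  qed simp
  ultimately have "meets S k ?I"
    using dis_disjoint[OF V(2)] V(1) unfolding meets_def by fastforce
  then have "k \<le> fcard ?I"
    using Suc.prems(2) V by (intro Suc.IH[OF V(1)]) auto
  moreover have "?I |\<subset>| I"
    using ne by auto
  then have "fcard ?I < fcard I"
    by (rule pfsubset_fcard_mono)
  ultimately show ?case
    by simp
qed simp

lemma ev_graft:
  assumes "t \<in> trees A n e"
  shows "ev v (graft i s t) =
    ev (\<lambda>j. if j < i then v j else if j = i then ev (\<lambda>l. v (i + l - 1)) t else v (j + n - 1)) s"
  unfolding graft_subst[OF assms] ev_subst by (rule arg_cong[where f = "\<lambda>w. ev w s"]) (auto simp: ev_map_tree)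

lemma lin_ev_free_circ:
  assumes "keys y \<subseteq> trees A n e"
  shows "lin (ev v) (free_circ i x y) = lin (\<lambda>s. lin (\<lambda>t. psc (ep (deg_right i s * e))
    (ev (\<lambda>j. if j < i then v j else if j = i then ev (\<lambda>l. v (i + l - 1)) t else v (j + n - 1)) s)) y) x"
  unfolding free_circ_lin lin_lin lin_psc lin_bs
  using assms by (intro lin_cong refl) (auto simp: ev_graft trees_tdeg[of _ A n e] subset_iff)

lemma mu_trees: "keys (mu :: 'k::field comb) \<subseteq> trees A 2 0"
  by (auto simp: mu_def trees_def)

lemma Delta_trees: "a \<in> A \<Longrightarrow> keys (Delta a :: 'k::field comb) \<subseteq> trees A 1 (1 - 2 * int a)"
  by (auto simp: Delta_def trees_def)

lemma lin_ev_circ_mu: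
  "lin (ev v) (free_circ i x mu) =
    lin (ev (\<lambda>j. if j < i then v j else if j = i then mlt (v i) (v (i + 1)) else v (j + 1))) x"
  unfolding lin_ev_free_circ[OF mu_trees] by (simp add: mu_def cong: if_cong)

lemma lin_ev_mu_circ:
  "keys x \<subseteq> trees A n e \<Longrightarrow> lin (ev v) (free_circ 1 mu x) = mlt (lin (ev v) x) (v (n + 1))"
  unfolding lin_ev_free_circ by (simp add: mu_def plinear_of_lin[OF pl_mlt_left] add.commute)

lemma lin_ev_act: "lin (ev v) (free_act \<sigma> x) = lin (ev (\<lambda>j. v (inv_into UNIV \<sigma> j))) x"
  by (simp add: free_act_lin lin_lin ev_map_tree)

lemma free_act_trees: "keys x \<subseteq> trees A n d \<Longrightarrow> \<sigma> permutes {1..n} \<Longrightarrow> keys (free_act \<sigma> x) \<subseteq> trees A n d"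
  unfolding free_act_lin using map_tree_permutes[of _ A n d \<sigma>] by (auto elim!: in_keys_linE)

lemma order_op_trees:
  assumes "a \<in> A"
  shows "keys (order_op (Delta a :: 'k::field comb) (Suc k)) \<subseteq> trees A (Suc k) (1 - 2 * int a)"
proof (induction k)
  case 0
  then show ?case
    using Delta_trees[OF assms] by simp
next
  case (Suc k)
  let ?F = "order_op (Delta a :: 'k comb) (Suc k)"
  have 1: "keys (free_circ (Suc k) ?F mu) \<subseteq> trees A (Suc (Suc k)) (1 - 2 * int a)"
    using free_circ_closed[OF Suc mu_trees, of "Suc k"] by simp
  have 2: "keys (free_circ 1 mu ?F) \<subseteq> trees A (Suc (Suc k)) (1 - 2 * int a)"
    using free_circ_closed[OF mu_trees Suc, of 1] by simp
  have 3: "keys (free_act (transpose (Suc k) (Suc (Suc k))) (free_circ 1 mu ?F)) \<subseteq> trees A (Suc (Suc k)) (1 - 2 * int a)"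
    by (rule free_act_trees[OF 2]) (auto intro: permutes_swap_id)
  show ?case
    using 1 2 3 by (auto simp: Let_def dest!: keys_minusE)
qed

lemma ev_slot_lin:
  assumes "keys x \<subseteq> trees A n d" "i \<in> {1..n}"
  shows "plinear (\<lambda>y. lin (ev (v(i := y))) x)"
proof -
  have "plinear (\<lambda>y. ev (v(i := y)) t)" if "t \<in> keys x" for t
    using assms that by (intro plinear_ev_slot) (auto simp: trees_def)
  then show ?thesis
    unfolding lin_def by (intro plinear_Sum plinear_scale)
qed

lemma lin_ev_cong:
  "keys x \<subseteq> trees A n d \<Longrightarrow> (\<And>j. j \<in> {1..n} \<Longrightarrow> v j = w j) \<Longrightarrow> lin (ev v) x = lin (ev w) x"
  by (intro lin_cong refl ev_cong) (auto simp: trees_def)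

text \<open>The recursion for the order operations is an inclusion-exclusion. Its first term
  collects the brackets of submonomials meeting the first factors and the union of the last two; the
  two subtracted terms remove those meeting only one of the last two. What remains are the
  submonomials meeting every factor.\<close>

lemma ev_order_op:
  "even_forests S \<Longrightarrow>
    lin (ev (bsf S)) (order_op (Delta a) (Suc k)) = (cvp (meets S (Suc k)) (la a) (mprod S (Suc k)) :: 'k::field fcomb)"
proof (induction k arbitrary: S)
  case 0
  have "cvp (meets S (Suc 0)) (la a) (mprod S (Suc 0)) = (cvp (\<lambda>I. True) (la a) (bs (S 1)) :: 'k fcomb)"
  proof (simp, rule cvp_cong, goal_cases)
    case (1 U I)
    then have "I \<noteq> {||}" "I |\<subseteq>| S 1"
      by (auto simp: la_def split: if_splits)
    then show ?case
      by (auto simp: meets_def)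
  qed
  then show ?case
    by (simp add: Delta_def cvp_True)
next
  case (Suc k)
  define n where "n = Suc k"
  let ?F = "order_op (Delta a :: 'k comb) n" and ?G = "free_circ 1 mu (order_op (Delta a :: 'k comb) n)"
  have F: "keys ?F \<subseteq> trees {a} n (1 - 2 * int a)"
    unfolding n_def by (rule order_op_trees) simp
  have n: "n \<in> {1..n}"
    by (simp add: n_def)
  have IH: "even_forests S \<Longrightarrow> lin (ev (bsf S)) ?F = cvp (meets S n) (la a) (mprod S n)" for S
    using Suc.IH by (simp only: n_def)
  let ?S1 = "S(n := S n |\<union>| S (Suc n))"
  define c where "c = (if dis (S n) (S (Suc n)) then sg (S n) (S (Suc n)) else 0 :: 'k)"
  have c: "mlt (bs (S n)) (bs (S (Suc n))) = psc c (bs (S n |\<union>| S (Suc n)))"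
    by (simp add: c_def mlt_bs)
  have m: "mprod S n = mlt (mprod S k) (bs (S n) :: 'k fcomb)" for S
    by (simp add: n_def)
  have T1: "lin (ev (bsf S)) (free_circ n ?F mu) = cvp (meets ?S1 n) (la a) (mprod S (Suc n))"
  proof (cases "dis (S n) (S (Suc n))")
    case True
    have "even_forests ?S1"
      using Suc.prems dgf_union[OF dis_disjoint[OF True]] by (auto simp: even_forests_def)
    have "lin (ev (bsf S)) (free_circ n ?F mu) = lin (ev ((bsf ?S1)(n := psc c (bs (S n |\<union>| S (Suc n)))))) ?F"
      unfolding lin_ev_circ_mu by (rule lin_ev_cong[OF F]) (auto simp: c)
    also have "\<dots> = psc c (lin (ev ((bsf ?S1)(n := bs (S n |\<union>| S (Suc n))))) ?F)"
      by (rule plinear_psc[OF ev_slot_lin[OF F n]])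
    also have "(bsf ?S1)(n := bs (S n |\<union>| S (Suc n))) = (bsf ?S1 :: nat \<Rightarrow> 'k fcomb)"
      by auto
    also have "psc c (lin (ev (bsf ?S1)) ?F) = cvp (meets ?S1 n) (la a) (psc c (mprod ?S1 n))"
      using Suc.IH[OF \<open>even_forests ?S1\<close>] by (simp only: n_def plinear_psc[OF pl_cvp])
    also have "psc c (mprod ?S1 n) = mprod S (Suc n)"
      using mprod_cong[of k ?S1 S, where 'a = 'k] by (simp add: m mlt_assoc c mlt_psc) (simp add: n_def)
    finally show ?thesis .
  next
    case False
    have "lin (ev (bsf S)) (free_circ n ?F mu) = lin (ev ((bsf ?S1)(n := 0))) ?F"
      unfolding lin_ev_circ_mu by (rule lin_ev_cong[OF F]) (use False in \<open>auto simp: mlt_bs\<close>)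
    also have "\<dots> = 0"
      by (rule plinear_zero[OF ev_slot_lin[OF F n]])
    finally show ?thesis
      using False by (simp add: m mlt_assoc mlt_bs plinear_zero[OF pl_cvp])
  qed
  have T2: "lin (ev (bsf S)) ?G = cvp (\<lambda>I. meets S n I \<and> fset I \<inter> fset (S (Suc n)) = {}) (la a) (mprod S (Suc n))"
    by (simp only: lin_ev_mu_circ[OF F] IH[OF Suc.prems] mlt_cvp_bs[OF wv_la] mprod.simps Suc_eq_plus1[symmetric])
  let ?S3 = "\<lambda>j. S (transpose n (Suc n) j)"
  have "even_forests ?S3"
    using Suc.prems by (simp add: even_forests_def)
  have "lin (ev (bsf S)) (free_act (transpose n (n + 1)) ?G) = lin (ev (bsf ?S3)) ?G"
    by (simp add: lin_ev_act)
  also have "\<dots> = cvp (\<lambda>I. meets ?S3 n I \<and> fset I \<inter> fset (S n) = {}) (la a) (mlt (mprod ?S3 n) (bs (S n)))"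
    by (simp only: lin_ev_mu_circ[OF F] IH[OF \<open>even_forests ?S3\<close>] mlt_cvp_bs[OF wv_la] Suc_eq_plus1[symmetric]
        transpose_apply_second)
  also have "mlt (mprod ?S3 n) (bs (S n)) = (mlt (mprod S k) (mlt (bs (S (Suc n))) (bs (S n))) :: 'k fcomb)"
    using mprod_cong[of k ?S3 S, where 'a = 'k] by (simp add: m mlt_assoc transpose_def n_def)
  also have "mlt (bs (S (Suc n))) (bs (S n)) = mlt (bs (S n)) (bs (S (Suc n)) :: 'k fcomb)"
    using mlt_commute[OF par_bsf[OF Suc.prems, of "Suc n"] par_bsf[OF Suc.prems, of n]] by simp
  also have "mlt (mprod S k) \<dots> = mprod S (Suc n)"
    by (simp add: m mlt_assoc)
  finally have T3: "lin (ev (bsf S)) (free_act (transpose n (n + 1)) ?G) =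
      cvp (\<lambda>I. meets ?S3 n I \<and> fset I \<inter> fset (S n) = {}) (la a) (mprod S (Suc n))" .
  have e: "meets ?S1 n I \<longleftrightarrow> meets S k I \<and> (fset I \<inter> fset (S n) \<noteq> {} \<or> fset I \<inter> fset (S (Suc n)) \<noteq> {})"
      "meets S n I \<longleftrightarrow> meets S k I \<and> fset I \<inter> fset (S n) \<noteq> {}"
      "meets ?S3 n I \<longleftrightarrow> meets S k I \<and> fset I \<inter> fset (S (Suc n)) \<noteq> {}" for I
    using meets_cong[of k ?S1 S I] meets_cong[of k ?S3 S I]
    by (auto simp: n_def meets_Suc)
  have "cvp (meets ?S1 n) (la a) (mprod S (Suc n)) = cvp (meets S (Suc n)) (la a) (mprod S (Suc n)) +
      cvp (\<lambda>I. meets S k I \<and> (fset I \<inter> fset (S n) \<noteq> {}) \<noteq> (fset I \<inter> fset (S (Suc n)) \<noteq> {})) (la a) (mprod S (Suc n) :: 'k fcomb)"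
    by (rule cvp_split) (auto simp: e meets_Suc)
  also have "cvp (\<lambda>I. meets S k I \<and> (fset I \<inter> fset (S n) \<noteq> {}) \<noteq> (fset I \<inter> fset (S (Suc n)) \<noteq> {})) (la a) (mprod S (Suc n) :: 'k fcomb) =
      cvp (\<lambda>I. meets S n I \<and> fset I \<inter> fset (S (Suc n)) = {}) (la a) (mprod S (Suc n)) +
      cvp (\<lambda>I. meets ?S3 n I \<and> fset I \<inter> fset (S n) = {}) (la a) (mprod S (Suc n))"
    by (rule cvp_split) (auto simp: e)
  finally have "lin (ev (bsf S)) (free_circ n ?F mu) - lin (ev (bsf S)) ?G -
      lin (ev (bsf S)) (free_act (transpose n (n + 1)) ?G) = cvp (meets S (Suc n)) (la a) (mprod S (Suc n))"
    unfolding T1 T2 T3 by (simp del: fun_upd_apply)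
  then show ?case
    by (simp add: Let_def lin_diff n_def)
qed

text \<open>Arguments of even degree suffice, since the model contains odd scalars.\<close>

definition acts_zero :: "'k::field comb \<Rightarrow> bool" where
  "acts_zero x \<longleftrightarrow> (\<forall>S. even_forests S \<longrightarrow> lin (ev (bsf S)) x = 0)"

text \<open>A submonomial meeting \<open>a + 2\<close> disjoint factors has more than
  \<open>a + 1\<close> elements, and there \<open>la a\<close> is zero.\<close>

lemma acts_zero_order_op: "acts_zero (order_op (Delta a) (a + 2))"
  unfolding acts_zero_def
proof (intro allI impI)
  fix S assume "even_forests S"
  then have "lin (ev (bsf S)) (order_op (Delta a) (a + 2)) = (cvp (meets S (a + 2)) (la a) (mprod S (a + 2)) :: 'a fcomb)"
    using ev_order_op[of S a "Suc a"] by simp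
  also have "\<dots> = cvp (\<lambda>I. False) (la a) (mprod S (a + 2))"
  proof (rule cvp_cong, goal_cases)
    case (1 U I)
    have "fcard I \<le> a + 1"
      using 1(3) by (auto simp: la_def split: if_splits)
    then show ?case
      using meets_fcard[OF 1(1,2)] by auto
  qed
  finally show "lin (ev (bsf S)) (order_op (Delta a) (a + 2)) = (0 :: 'a fcomb)"
    by (simp add: cvp_def)
qed

lemma acts_zero_slot:
  assumes x: "keys x \<subseteq> trees A n d" "acts_zero x" and i: "i \<in> {1..n}" and S: "even_forests S" and y: "par 0 y"
  shows "lin (ev ((bsf S)(i := y))) x = 0"
proof (rule plinear_eqI[OF ev_slot_lin[OF x(1) i] plinear_const0])
  fix K assume "K \<in> keys y"
  then have K: "even_forests (S(i := K))"
    using S y by (auto simp: even_forests_def par_def)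
  have e: "(bsf S)(i := bs K) = (bsf (S(i := K)) :: nat \<Rightarrow> 'a fcomb)"
    by auto
  show "lin (ev ((bsf S)(i := bs K))) x = 0"
    unfolding e by (rule x(2)[unfolded acts_zero_def, rule_format, OF K])
qed

section \<open>Odd scalars and the ideal\<close>

lemma DD_scalar:
  assumes "j < 0"
  shows "DD a (mlt x (bs {|Lf j|})) = mlt (DD a x) (bs {|Lf j|})"
proof -
  have "cvp (\<lambda>I. True) (la a) (mlt x (bs {|Lf j|})) =
      cvp (\<lambda>I. True \<and> fset I \<inter> fset {|Lf j|} = {}) (la a) (mlt x (bs {|Lf j|}))"
    by (rule cvp_cong) (use assms in \<open>auto simp: la_def inert_def split: if_splits\<close>)
  then show ?thesis
    unfolding mlt_cvp_bs[OF wv_la, symmetric] cvp_True .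
qed

text \<open>On its way out to the right the odd scalar passes exactly the vertices to the right of
  leaf \<open>i\<close>. The resulting sign is the one that partial composition with an odd
  operation carries.\<close>

lemma ev_scalar:
  assumes "j < 0" "distinct (leaves s)" "i \<in> lset s" "\<And>k. par 0 (w k)"
  shows "ev (w(i := mlt x (bs {|Lf j|}))) s = psc (ep (deg_right i s)) (mlt (ev (w(i := x)) s) (bs {|Lf j|}))"
  using assms(2,3)
proof (induction s)
  case (Mul s t)
  let ?e = "bs {|Lf j|} :: 'a fcomb"
  show ?case
  proof (cases "i \<in> lset s")
    case True
    then have t: "ev (w(i := y)) t = ev w t" for y
      using Mul.prems by (intro ev_cong) auto
    have "par (tdeg t) (ev w t)"
      by (rule par_ev) (rule assms(4))
    moreover have "par 1 ?e"
      using assms(1) by (simp add: par_def)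
    ultimately have "mlt ?e (ev w t) = psc (ep (tdeg t)) (mlt (ev w t) ?e)"
      using mlt_commute[of 1 ?e "tdeg t"] by simp
    then show ?thesis
      using True Mul by (simp add: t mlt_psc mlt_assoc ep_add mult.commute del: fun_upd_apply)
  next
    case False
    then have s: "ev (w(i := y)) s = ev w s" for y
      by (intro ev_cong) auto
    show ?thesis
      using False Mul by (simp add: s mlt_psc mlt_assoc del: fun_upd_apply)
  qed
qed (simp_all add: plinear_psc[OF pl_cv] DD_scalar[OF assms(1)])

text \<open>Removing \<open>T\<close> from each monomial and undoing the sign is a left inverse of
  the multiplication.\<close>

lemma mlt_scalar_inj:
  assumes "mlt x (bs T) = 0" "\<And>K. K \<in> keys x \<Longrightarrow> dis K T"
  shows "x = 0"
proof -
  let ?r = "lin (\<lambda>U. psc (sg (U |-| T) T) (bs (U |-| T)))"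
  have "?r (mlt x (bs T)) = x"
  proof (rule plinear_eqI[where f = "\<lambda>x. ?r (mlt x (bs T))" and g = "\<lambda>x. x"])
    fix K assume "K \<in> keys x"
    then have d: "dis K T"
      by (rule assms(2))
    then have "K |\<union>| T |-| T = K"
      using dis_disjoint by fastforce
    then show "?r (mlt (bs K) (bs T)) = bs K"
      using d by (simp add: mlt_bs lin_psc)
  qed (intro plinear_intros)+
  then show ?thesis
    using assms(1) by simp
qed

lemma fresh_scalar: "\<exists>j<0. \<forall>K\<in>keys (x :: 'k::field fcomb). dis K {|Lf j|}"
proof -
  have "finite (\<Union>K\<in>keys x. fl K)"
    by simp
  then have "infinite ({..<0} - (\<Union>K\<in>keys x. fl K))"
    using infinite_Iio[of "0 :: int"] by (rule Diff_infinite_finite)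
  then have "{..<0} - (\<Union>K\<in>keys x. fl K) \<noteq> {}"
    by (metis finite.emptyI)
  then show ?thesis
    by (auto simp: dis_def)
qed

text \<open>If \<open>y\<close> has odd degree, its value is not an admissible argument for testing
  \<open>x\<close>. Multiplied by an odd scalar with a label occurring nowhere in the result it
  becomes even, and \<open>x\<close> vanishes on it. Pulling the scalar out again leaves the desired
  value times the scalar, and multiplication by a fresh scalar is injective.\<close>

lemma acts_zero_circ_left:
  assumes x: "keys x \<subseteq> trees A m d" "acts_zero x" and y: "keys y \<subseteq> trees A n e" and i: "i \<in> {1..m}"
  shows "acts_zero (free_circ i x y)"
  unfolding acts_zero_def
proof (intro allI impI)
  fix S assume S: "even_forests S"
  define w where "w = (\<lambda>j. if j < i then S j else S (j + n - 1))"
  have w: "even_forests w"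
    using S by (simp add: even_forests_def w_def)
  have z: "lin (\<lambda>s. psc (ep (deg_right i s * e)) (ev ((bsf w)(i := ev (\<lambda>l. bsf S (i + l - 1)) t)) s)) x = 0"
    if t: "t \<in> keys y" for t
  proof -
    define T where "T = ev (\<lambda>l. bs (S (i + l - 1)) :: 'a fcomb) t"
    have "par (tdeg t) T"
      unfolding T_def by (rule par_ev) (use S in \<open>simp add: even_forests_def par_def\<close>)
    then have T: "par e T"
      using t y trees_tdeg by blast
    show ?thesis
    proof (cases "even e")
      case True
      then have "par 0 T"
        using T by (simp add: par_def)
      then show ?thesis
        using acts_zero_slot[OF x i w] True by (simp add: T_def ep_def)
    next
      case False
      let ?Z = "lin (\<lambda>s. psc (ep (deg_right i s * e)) (ev ((bsf w)(i := T)) s)) x"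
      obtain j where j: "j < 0" "\<forall>K\<in>keys ?Z. dis K {|Lf j|}"
        using fresh_scalar by blast
      have "par 1 (bs {|Lf j|})"
        using j by (simp add: par_def)
      then have "par (e + 1) (mlt T (bs {|Lf j|}))"
        using T par_mlt by blast
      then have "par 0 (mlt T (bs {|Lf j|}))"
        using False by (simp add: par_def)
      then have "lin (ev ((bsf w)(i := mlt T (bs {|Lf j|})))) x = 0"
        by (rule acts_zero_slot[OF x i w])
      moreover have "lin (ev ((bsf w)(i := mlt T (bs {|Lf j|})))) x = mlt ?Z (bs {|Lf j|})"
        unfolding plinear_of_lin[OF pl_mlt_left]
      proof (rule lin_cong[OF refl])
        fix s assume "s \<in> keys x"
        then have s: "distinct (leaves s)" "i \<in> lset s"
          using x(1) i by (auto simp: trees_def)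
        have "ep (deg_right i s * e) = (ep (deg_right i s) :: 'a)"
          using False by (intro ep_cong) (auto simp: algebra_simps)
        then show "ev ((bsf w)(i := mlt T (bs {|Lf j|}))) s =
            mlt (psc (ep (deg_right i s * e)) (ev ((bsf w)(i := T)) s)) (bs {|Lf j|})"
          using ev_scalar[OF j(1) s, where w = "bsf w" and x = T, OF par_bsf[OF w]]
          by (simp add: mlt_psc del: fun_upd_apply)
      qed
      ultimately have "mlt ?Z (bs {|Lf j|}) = 0"
        by simp
      then show ?thesis
        unfolding T_def[symmetric] by (rule mlt_scalar_inj) (use j in blast)
    qed
  qed
  have e: "(\<lambda>j. if j < i then bsf S j else if j = i then z else bsf S (j + n - 1)) = (bsf w)(i := z)" for z
    by (auto simp: w_def fun_eq_iff)
  have "lin (\<lambda>t. lin (\<lambda>s. psc (ep (deg_right i s * e))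
      (ev (\<lambda>j. if j < i then bsf S j else if j = i then ev (\<lambda>l. bsf S (i + l - 1)) t else bsf S (j + n - 1)) s)) x) y =
      lin (\<lambda>t. 0) y"
    unfolding e by (rule lin_cong[OF refl]) (rule z)
  then show "lin (ev (bsf S)) (free_circ i x y) = 0"
    unfolding lin_ev_free_circ[OF y] by (subst lin_swap) simp
qed

lemma acts_zero_circ_right:
  assumes x: "keys x \<subseteq> trees A m d" and y: "keys y \<subseteq> trees A n e" "acts_zero y" and i: "i \<in> {1..m}"
  shows "acts_zero (free_circ i x y)"
  unfolding acts_zero_def
proof (intro allI impI)
  fix S assume S: "even_forests S"
  define w where "w = (\<lambda>j. if j < i then bsf S j else bsf S (j + n - 1) :: 'a fcomb)"
  have "even_forests (\<lambda>l. S (i + l - 1))"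
    using S by (simp add: even_forests_def)
  then have 0: "lin (ev (\<lambda>l. bsf S (i + l - 1))) y = 0"
    using y(2) by (simp add: acts_zero_def)
  have z: "lin (\<lambda>t. psc (ep (deg_right i s * e)) (ev (w(i := ev (\<lambda>l. bsf S (i + l - 1)) t)) s)) y = 0"
    if "s \<in> keys x" for s
  proof -
    have "plinear (\<lambda>z. ev (w(i := z)) s)"
      using that x i by (intro plinear_ev_slot) (auto simp: trees_def)
    then have "lin (\<lambda>t. ev (w(i := ev (\<lambda>l. bsf S (i + l - 1)) t)) s) y = 0"
      using plinear_of_lin[of "\<lambda>z. ev (w(i := z)) s" "ev (\<lambda>l. bsf S (i + l - 1))" y] 0 plinear_zero by metis
    then show ?thesis
      by (simp add: lin_psc_fun)
  qed
  have e: "(\<lambda>j. if j < i then bsf S j else if j = i then z else bsf S (j + n - 1)) = w(i := z)" for z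
    by (auto simp: w_def fun_eq_iff)
  have "lin (ev (bsf S)) (free_circ i x y) = lin (\<lambda>s. 0) x"
    unfolding lin_ev_free_circ[OF y(1)] e by (rule lin_cong[OF refl]) (rule z)
  then show "lin (ev (bsf S)) (free_circ i x y) = 0"
    by simp
qed

lemma op_ideal_acts_zero:
  assumes "op_ideal (free_operad A D) R n d x"
    and R: "\<And>n d r. (n, d, r) \<in> R \<Longrightarrow> keys r \<subseteq> trees A n d \<and> acts_zero r"
  shows "keys x \<subseteq> trees A n d \<and> acts_zero (x :: 'k::field comb)"
  using assms(1)
proof (induction rule: op_ideal.induct)
  case (gen n d r)
  then show ?case by (rule R)
next
  case (zero n d)
  then show ?case by (simp add: acts_zero_def)
next
  case (add n d x y)
  then show ?case
    by (auto simp: acts_zero_def lin_add dest!: keys_plusE)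
next
  case (smult n d x c)
  then show ?case
    by (auto simp: acts_zero_def lin_psc dest!: in_keys_pscD)
next
  case (act n d x \<sigma>)
  moreover have "acts_zero (free_act \<sigma> x)"
    unfolding acts_zero_def
  proof (intro allI impI)
    fix S assume "even_forests S"
    then have "even_forests (\<lambda>j. S (inv_into UNIV \<sigma> j))"
      by (simp add: even_forests_def)
    then show "lin (ev (bsf S)) (free_act \<sigma> x) = 0"
      using act by (simp add: acts_zero_def lin_ev_act)
  qed
  ultimately show ?case
    by (simp add: free_act_trees)
next
  case (circ_left m d x y n e i)
  then show ?case
    using free_circ_closed[of x A m d y n e i] acts_zero_circ_left[of x A m d y n e i] by simp
next
  case (circ_right x m d n e y i)
  then show ?case
    using free_circ_closed[of x A m d y n e i] acts_zero_circ_right[of x A m d y n e i] by simp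
qed

lemma com_relations_acts_zero:
  assumes "(n, d, r) \<in> com_relations"
  shows "keys r \<subseteq> trees A n d \<and> acts_zero (r :: 'k::field comb)"
proof -
  consider "(n, d, r) = (2, 0, free_act (transpose 1 2) mu - mu)"
    | "(n, d, r) = (3, 0, free_circ 1 mu mu - free_circ 2 mu mu)"
    using assms by (auto simp: com_relations_def)
  then show ?thesis
  proof cases
    case 1
    have "keys (free_act (transpose 1 2) mu :: 'k comb) \<subseteq> trees A 2 0"
      by (rule free_act_trees[OF mu_trees]) (auto intro: permutes_swap_id)
    then have "keys r \<subseteq> trees A n d"
      using 1 mu_trees[of A, where 'k = 'k] by (auto dest!: keys_minusE)
    moreover have "acts_zero r"
      unfolding acts_zero_def
    proof (intro allI impI)
      fix S assume S: "even_forests S"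
      have "mlt (bs (S 2)) (bs (S 1)) = (mlt (bs (S 1)) (bs (S 2)) :: 'k fcomb)"
        using mlt_commute[OF par_bsf[OF S, of 2] par_bsf[OF S, of 1]] by simp
      then show "lin (ev (bsf S)) r = 0"
        using 1 by (simp add: lin_diff lin_ev_act mu_def)
    qed
    ultimately show ?thesis ..
  next
    case 2
    have "keys (free_circ 1 mu mu :: 'k comb) \<subseteq> trees A 3 0" "keys (free_circ 2 mu mu :: 'k comb) \<subseteq> trees A 3 0"
      using free_circ_closed[OF mu_trees mu_trees, of 1 A, where 'a = 'k]
        free_circ_closed[OF mu_trees mu_trees, of 2 A, where 'a = 'k] by simp_all
    then have "keys r \<subseteq> trees A n d"
      using 2 by (auto dest!: keys_minusE)
    moreover have "acts_zero r"
      unfolding acts_zero_def using 2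
      by (simp add: lin_diff lin_ev_circ_mu) (simp add: mu_def mlt_assoc numeral_eq_Suc)
    ultimately show ?thesis ..
  qed
qed

lemma BV_inf_ideal_acts_zero:
  assumes "x \<in> BV_inf_ideal n d"
  shows "keys x \<subseteq> trees {1..} n d" "acts_zero (x :: 'k::field comb)"
proof -
  have "keys x \<subseteq> trees {1..} n d \<and> acts_zero x"
  proof (rule op_ideal_acts_zero)
    show "op_ideal (free_operad {1..} delta) (com_relations \<union> order_relation ` {1..}) n d x"
      using assms by (simp add: BV_inf_ideal_def ideal_gen_def BV_inf_free_def lin_ext_lin)
    fix n d and r :: "'k comb" assume "(n, d, r) \<in> com_relations \<union> order_relation ` {1..}"
    then show "keys r \<subseteq> trees {1..} n d \<and> acts_zero r"
    proof
      assume "(n, d, r) \<in> order_relation ` {1..}"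
      then obtain a where a: "a \<in> {1..}" "n = a + 2" "d = 1 - 2 * int a" "r = order_op (Delta a) (a + 2)"
        by (auto simp: order_relation_def)
      then show ?thesis
        using order_op_trees[OF a(1), of "Suc a", where 'k = 'k] acts_zero_order_op by simp
    qed (rule com_relations_acts_zero)
  qed
  then show "keys x \<subseteq> trees {1..} n d" "acts_zero x"
    by auto
qed

section \<open>Well-formed forests and shapes of trees\<close>

abbreviation vE :: "nat \<Rightarrow> 'k::field fcomb" where
  "vE \<equiv> \<lambda>j. bs {|Lf (int j)|}"

abbreviation EE :: "'k::field comb \<Rightarrow> 'k fcomb" where
  "EE \<equiv> lin (ev vE)"

definition pdis :: "forest \<Rightarrow> bool" where
  "pdis S \<longleftrightarrow> (\<forall>s\<in>fset S. \<forall>t\<in>fset S. s \<noteq> t \<longrightarrow> lv s \<inter> lv t = {})"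

text \<open>Cuts out the trees that occur in values of operations on the inputs: no odd scalars,
  brackets of admissible size, and siblings without common labels.\<close>

fun wft :: "tr \<Rightarrow> bool" where
  "wft (Lf j) = (0 \<le> j)"
| "wft (Nd a S) = (S \<noteq> {||} \<and> fcard S \<le> a + 1 \<and> (\<forall>s\<in>fset S. wft s) \<and> pdis S)"

fun dl :: "tr \<Rightarrow> nat set" where
  "dl (Lf j) = {}"
| "dl (Nd a S) = insert a (\<Union>s\<in>fset S. dl s)"

text \<open>For trees with disjoint siblings this counts the pairs of a node and a leaf below it. It
  is chosen such that a bracket of all factors outweighs every bracket of only some of them.\<close>

fun ms :: "tr \<Rightarrow> nat" where
  "ms (Lf j) = 0"
| "ms (Nd a S) = card (fl S) + (\<Sum>s\<in>fset S. ms s)"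

definition wff :: "forest \<Rightarrow> bool" where
  "wff S \<longleftrightarrow> (\<forall>s\<in>fset S. wft s) \<and> pdis S"

definition dlf :: "forest \<Rightarrow> nat set" where
  "dlf S = (\<Union>s\<in>fset S. dl s)"

definition msf :: "forest \<Rightarrow> nat" where
  "msf S = (\<Sum>s\<in>fset S. ms s)"

lemma wft_Nd [simp]: "wft (Nd a S) \<longleftrightarrow> S \<noteq> {||} \<and> fcard S \<le> a + 1 \<and> wff S"
  by (auto simp: wff_def)

lemma dl_Nd [simp]: "dl (Nd a S) = insert a (dlf S)"
  by (auto simp: dlf_def)

lemma ms_Nd [simp]: "ms (Nd a S) = card (fl S) + msf S"
  by (simp add: msf_def)

declare wft.simps(2) [simp del] dl.simps(2) [simp del] ms.simps(2) [simp del]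

lemma wff_empty [simp]: "wff {||}" and wff_single [simp]: "wff {|t|} \<longleftrightarrow> wft t"
  by (simp_all add: wff_def pdis_def)

lemma dlf_simps [simp]: "dlf {||} = {}" "dlf (finsert t S) = dl t \<union> dlf S" "dlf (S |\<union>| T) = dlf S \<union> dlf T"
  by (auto simp: dlf_def)

lemma dlf_mono: "S |\<subseteq>| T \<Longrightarrow> dlf S \<subseteq> dlf T"
  by (auto simp: dlf_def)

lemma lv_subset_fl: "s |\<in>| S \<Longrightarrow> lv s \<subseteq> fl S"
  by (auto simp: fl_def)

lemma pdis_mono: "S |\<subseteq>| T \<Longrightarrow> pdis T \<Longrightarrow> pdis S"
  unfolding pdis_def by (meson fset_mp)

lemma wff_mono: "S |\<subseteq>| T \<Longrightarrow> wff T \<Longrightarrow> wff S"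
  unfolding wff_def using pdis_mono by (meson fset_mp)

lemma pdis_union: "dis S T \<Longrightarrow> pdis (S |\<union>| T) \<longleftrightarrow> pdis S \<and> pdis T"
proof -
  assume d: "dis S T"
  have "lv s \<inter> lv t = {}" "lv t \<inter> lv s = {}" if "s |\<in>| S" "t |\<in>| T" for s t
    using d lv_subset_fl[OF that(1)] lv_subset_fl[OF that(2)] by (auto simp: dis_def)
  then show ?thesis
    unfolding pdis_def by (simp add: ball_Un)
qed

lemma wff_union: "dis S T \<Longrightarrow> wff (S |\<union>| T) \<longleftrightarrow> wff S \<and> wff T"
  by (auto simp: wff_def pdis_union)

lemma wff_finsert: "dis {|t|} S \<Longrightarrow> wff (finsert t S) \<longleftrightarrow> wft t \<and> wff S"
  using wff_union[of "{|t|}" S] by simp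

lemma msf_empty [simp]: "msf {||} = 0" and msf_single [simp]: "msf {|t|} = ms t"
  by (simp_all add: msf_def)

lemma msf_union: "fset S \<inter> fset T = {} \<Longrightarrow> msf (S |\<union>| T) = msf S + msf T"
  by (simp add: msf_def sum.union_disjoint)

lemma msf_finsert: "dis {|t|} S \<Longrightarrow> msf (finsert t S) = ms t + msf S"
  using msf_union[of "{|t|}" S] dis_disjoint[of "{|t|}" S] by simp

lemma msf_split: "J |\<subseteq>| S \<Longrightarrow> msf S = msf J + msf (S |-| J)"
  using msf_union[of J "S |-| J"] by simp

lemma pdis_dis_diff: "pdis S \<Longrightarrow> J |\<subseteq>| S \<Longrightarrow> dis J (S |-| J)"
  by (fastforce simp: pdis_def dis_def fl_def)

lemma wff_dis_diff: "wff S \<Longrightarrow> J |\<subseteq>| S \<Longrightarrow> dis J (S |-| J)"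
  by (simp add: wff_def pdis_dis_diff)

section \<open>Forests as values of operations\<close>

definition forests :: "nat set \<Rightarrow> int set \<Rightarrow> int \<Rightarrow> forest set" where
  "forests A V d = {S. wff S \<and> fl S = V \<and> dlf S \<subseteq> A \<and> dgf S = d}"

lemma la_keys: "K \<in> keys (la a I) \<Longrightarrow> K = {|Nd a I|} \<and> I \<noteq> {||} \<and> fcard I \<le> a + 1 \<and> \<not> inert I"
  by (auto simp: la_def split: if_splits)

lemma keys_DD_bs:
  assumes "K \<in> keys (DD a (bs S))"
  obtains I where "I |\<subseteq>| S" "I \<noteq> {||}" "fcard I \<le> a + 1" "dis {|Nd a I|} (S |-| I)"
    "K = finsert (Nd a I) (S |-| I)"
proof -
  obtain I t where I: "I |\<subseteq>| S" "{|t|} \<in> keys (la a I :: 'a fcomb)" "dis {|t|} (S |-| I)" "K = finsert t (S |-| I)"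
    using keys_cv_bs[OF wv_la assms] by blast
  show thesis
    using la_keys[OF I(2)] I by (intro that[of I]) auto
qed

lemma keys_DD:
  fixes x :: "'k::field fcomb"
  assumes "K \<in> keys (DD a x)"
  obtains S where "S \<in> keys x" "K \<in> keys (DD a (bs S) :: 'k fcomb)"
  using assms[unfolded plinear_eq_lin[OF pl_cv, of "la a" x]] by (rule in_keys_linE) (rule that)

lemma DD_forests:
  assumes "keys x \<subseteq> forests A V d" "a \<in> A"
  shows "keys (DD a x) \<subseteq> forests A V (d + (1 - 2 * int a))"
proof
  fix K assume K: "K \<in> keys (DD a x)"
  then obtain S where S: "S \<in> keys x" "K \<in> keys (DD a (bs S) :: 'a fcomb)"
    by (rule keys_DD)
  then have S': "S \<in> forests A V d"
    using assms by auto
  obtain I where I: "I |\<subseteq>| S" "I \<noteq> {||}" "fcard I \<le> a + 1" "dis {|Nd a I|} (S |-| I)"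
    "K = finsert (Nd a I) (S |-| I)"
    by (rule keys_DD_bs[OF S(2)])
  have "S |-| I |\<subseteq>| S"
    by auto
  then show "K \<in> forests A V (d + (1 - 2 * int a))"
    using cv_degree(1,2)[OF wv_la S(2)] S' I assms(2) wff_mono[of I S] wff_mono[of "S |-| I" S]
      dlf_mono[of I S] dlf_mono[of "S |-| I" S]
    by (auto simp: forests_def wff_finsert)
qed

lemma mlt_forests:
  assumes "keys x \<subseteq> forests A V d" "keys y \<subseteq> forests A W e"
  shows "keys (mlt x y) \<subseteq> forests A (V \<union> W) (d + e)"
  using assms by (fastforce simp: forests_def wff_union dgf_union dis_disjoint dest!: keys_mlt)

lemma ev_forests:
  "deltas t \<subseteq> A \<Longrightarrow> keys (ev vE t) \<subseteq> forests A (int ` lset t) (tdeg t)"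
proof (induction t)
  case (Mul s t)
  then show ?case
    using mlt_forests[of "ev vE s" A _ _ "ev vE t"] by (simp add: image_Un)
next
  case (Del a t)
  then show ?case
    using DD_forests[of "ev vE t" A _ "tdeg t" a] by (simp add: add.commute)
qed (simp add: forests_def)

lemma EE_forests: "keys x \<subseteq> trees A n d \<Longrightarrow> keys (EE x) \<subseteq> forests A (int ` {1..n}) d"
proof
  fix K assume x: "keys x \<subseteq> trees A n d" and "K \<in> keys (EE x)"
  then obtain t where t: "t \<in> keys x" "K \<in> keys (ev vE t :: 'a fcomb)"
    by (elim in_keys_linE)
  then have "t \<in> trees A n d"
    using x by auto
  then show "K \<in> forests A (int ` {1..n}) d"
    using ev_forests[of t A, where 'a = 'a] t by (auto simp: trees_def)
qed

lemma EE_delta: "EE (delta x) = dN (EE x :: 'k::field_char_0 fcomb)"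
proof (rule plinear_eqI[where f = "\<lambda>x. EE (delta x)" and g = "\<lambda>x. dN (EE x)"])
  fix t
  have "lin (ev vE) (tree_delta t) = dN (ev vE t :: 'k fcomb)"
    by (rule dN_ev) (simp_all add: par_def dN_bs)
  then show "EE (delta (bs t)) = dN (EE (bs t) :: 'k fcomb)"
    by simp
qed (intro plinear_intros)+

text \<open>Each Delta_a is read as the bracket of all factors of its argument, and order and
  bracketing of products are forgotten. This is the leading forest of the evaluation, if it is
  well-formed.\<close>

primrec sh :: "nat tree \<Rightarrow> forest" where
  "sh (Leaf j) = {|Lf (int j)|}"
| "sh (Mul s t) = sh s |\<union>| sh t"
| "sh (Del a t) = {|Nd a (sh t)|}"

lemma sh_nonempty [simp]: "sh t \<noteq> {||}"
  by (induction t) auto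

lemma fl_sh [simp]: "fl (sh t) = int ` lset t"
  by (induction t) (auto simp: image_Un)

lemma dlf_sh [simp]: "dlf (sh t) = deltas t"
  by (induction t) auto

lemma dis_sh: "lset s \<inter> lset t = {} \<Longrightarrow> dis (sh s) (sh t)"
  by (auto simp: dis_def)

lemma dgf_sh: "distinct (leaves t) \<Longrightarrow> dgf (sh t) = tdeg t"
  by (induction t) (auto simp: dgf_union dis_sh dis_disjoint)

lemma pdis_sh: "distinct (leaves t) \<Longrightarrow> pdis (sh t)"
  by (induction t) (auto simp: pdis_union dis_sh, auto simp: pdis_def)

lemma wff_sh_Mul: "distinct (leaves (Mul s t)) \<Longrightarrow> wff (sh (Mul s t)) \<longleftrightarrow> wff (sh s) \<and> wff (sh t)"
  by (simp add: wff_union dis_sh)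

text \<open>The measure \<open>msf\<close> of the shape computed on the tree itself; the termination
  of the rewriting to normal forms is measured by it.\<close>

primrec pm :: "nat tree \<Rightarrow> nat" where
  "pm (Leaf j) = 0"
| "pm (Mul s t) = pm s + pm t"
| "pm (Del a t) = length (leaves t) + pm t"

lemma msf_sh: "distinct (leaves t) \<Longrightarrow> msf (sh t) = pm t"
  by (induction t) (auto simp: msf_union dis_sh dis_disjoint card_image distinct_card)

text \<open>Among the terms of Delta_a on a monomial the bracket of all its trees has the greatest
  measure: a bracket of a proper part covers strictly fewer labels, since the remaining trees have
  labels of their own. Products and terms of lower order preserve this strict inequality.\<close>

lemma ev_leading:
  assumes "distinct (leaves t)" "wff (sh t)"
  shows "\<exists>c x. c \<noteq> 0 \<and> ev vE t = psc c (bs (sh t)) + x \<and>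
    (\<forall>K\<in>keys (x :: 'k::field fcomb). msf K < msf (sh t) \<and> fl K = fl (sh t))"
  using assms
proof (induction t)
  case (Leaf j)
  show ?case
    by (intro exI[of _ 1] exI[of _ 0]) simp
next
  case (Mul s t)
  obtain c x where s: "c \<noteq> 0" "ev vE s = psc c (bs (sh s)) + x"
      "\<And>K. K \<in> keys (x :: 'k fcomb) \<Longrightarrow> msf K < msf (sh s) \<and> fl K = fl (sh s)"
    using Mul.IH(1) Mul.prems wff_sh_Mul by (metis distinct_append leaves.simps(2))
  obtain d y where t: "d \<noteq> 0" "ev vE t = psc d (bs (sh t)) + y"
      "\<And>K. K \<in> keys (y :: 'k fcomb) \<Longrightarrow> msf K < msf (sh t) \<and> fl K = fl (sh t)"
    using Mul.IH(2) Mul.prems wff_sh_Mul by (metis distinct_append leaves.simps(2))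
  have d: "dis (sh s) (sh t)"
    using Mul.prems by (auto intro: dis_sh)
  let ?z = "psc c (mlt (bs (sh s)) y) + (psc d (mlt x (bs (sh t))) + mlt x y)"
  have "ev vE (Mul s t) = psc (c * d * sg (sh s) (sh t)) (bs (sh (Mul s t))) + ?z"
    using d by (simp add: s(2) t(2) plinear_add[OF pl_mlt_left] plinear_add[OF pl_mlt_right] mlt_psc mlt_bs
        psc_add algebra_simps)
  moreover have "msf K < msf (sh (Mul s t)) \<and> fl K = fl (sh (Mul s t))" if K: "K \<in> keys ?z" for K
  proof -
    have "K \<in> keys (mlt (bs (sh s)) y) \<or> K \<in> keys (mlt x (bs (sh t))) \<or> K \<in> keys (mlt x y)"
      using K by (auto dest!: keys_plusE in_keys_pscD)
    then have "\<exists>L M. (L = sh s \<or> L \<in> keys x) \<and> (M \<in> keys y \<or> M = sh t) \<and> (L \<in> keys x \<or> M \<in> keys y) \<and>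
        K = L |\<union>| M \<and> dis L M"
    proof (elim disjE)
      assume "K \<in> keys (mlt (bs (sh s)) y)"
      from keys_mlt[OF this] obtain M where "M \<in> keys y" "dis (sh s) M" "K = sh s |\<union>| M"
        by auto
      then show ?thesis
        by (intro exI[of _ "sh s"] exI[of _ M]) simp
    next
      assume "K \<in> keys (mlt x (bs (sh t)))"
      from keys_mlt[OF this] obtain L where "L \<in> keys x" "dis L (sh t)" "K = L |\<union>| sh t"
        by auto
      then show ?thesis
        by (intro exI[of _ L] exI[of _ "sh t"]) simp
    next
      assume "K \<in> keys (mlt x y)"
      from keys_mlt[OF this] obtain L M where "L \<in> keys x" "M \<in> keys y" "dis L M" "K = L |\<union>| M"
        by auto
      then show ?thesis
        by (intro exI[of _ L] exI[of _ M]) simp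
    qed
    then obtain L M where L: "L = sh s \<or> L \<in> keys x" and M: "M \<in> keys y \<or> M = sh t"
      and LM: "L \<in> keys x \<or> M \<in> keys y" and K': "K = L |\<union>| M" "dis L M"
      by blast
    have "msf L \<le> msf (sh s) \<and> fl L = fl (sh s) \<and> (L \<in> keys x \<longrightarrow> msf L < msf (sh s))"
      using L s(3)[of L] by auto
    moreover have "msf M \<le> msf (sh t) \<and> fl M = fl (sh t) \<and> (M \<in> keys y \<longrightarrow> msf M < msf (sh t))"
      using M t(3)[of M] by auto
    moreover have "msf K = msf L + msf M" "msf (sh (Mul s t)) = msf (sh s) + msf (sh t)"
      using K' d by (simp_all add: msf_union dis_disjoint)
    ultimately show ?thesis
      using LM K'(1) by auto
  qed
  ultimately show ?case
    using s(1) t(1) by (intro exI[of _ "c * d * sg (sh s) (sh t)"] exI[of _ ?z]) simp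
next
  case (Del a t)
  let ?S = "sh t"
  have S: "wff ?S" "fcard ?S \<le> a + 1"
    using Del.prems by simp_all
  obtain c x where t: "c \<noteq> 0" "ev vE t = psc c (bs ?S) + x"
      "\<And>K. K \<in> keys (x :: 'k fcomb) \<Longrightarrow> msf K < msf ?S \<and> fl K = fl ?S"
    using Del.IH Del.prems S(1) by auto
  have "\<not> inert ?S"
    using S(1) by (auto simp: inert_def wff_def)
  then have la: "la a ?S = (bs {|Nd a ?S|} :: 'k fcomb)"
    using S by (simp add: la_def)
  define y where "y = (\<Sum>I\<in>subf ?S - {?S}. psc (sg I (?S |-| I)) (mlt (la a I) (bs (?S |-| I))) :: 'k fcomb)"
  have y: "DD a (bs ?S) = bs {|Nd a ?S|} + y"
    unfolding cv_bs y_def by (subst sum.remove[of _ ?S]) (simp_all add: la)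
  have small: "msf K < msf (sh (Del a t)) \<and> fl K = fl (sh (Del a t))" if K: "K \<in> keys y" for K
  proof -
    obtain I where I: "I |\<subseteq>| ?S" "I \<noteq> ?S" "K \<in> keys (psc (sg I (?S |-| I)) (mlt (la a I) (bs (?S |-| I))) :: 'k fcomb)"
      using K unfolding y_def by (elim keys_sumE) auto
    then have "K \<in> keys (mlt (la a I) (bs (?S |-| I)) :: 'k fcomb)"
      by (auto dest: in_keys_pscD)
    then have K': "K = finsert (Nd a I) (?S |-| I)" "dis {|Nd a I|} (?S |-| I)" "I \<noteq> {||}"
      by (auto dest!: keys_mlt la_keys)
    have "fl I \<inter> fl (?S |-| I) = {}"
      using wff_dis_diff[OF S(1) I(1)] by (simp add: dis_def)
    moreover have "fl (?S |-| I) \<noteq> {}"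
      using I by auto
    then obtain z where "z \<in> fl (?S |-| I)"
      by blast
    ultimately have "fl I \<subset> fl ?S"
      unfolding fl_split[OF I(1)] by blast
    then have "card (fl I) < card (fl ?S)"
      by (intro psubset_card_mono) auto
    then show ?thesis
      using K' msf_finsert[OF K'(2)] msf_split[OF I(1)] fl_split[OF I(1)] by simp
  qed
  have small': "msf K < msf (sh (Del a t)) \<and> fl K = fl (sh (Del a t))" if K: "K \<in> keys (DD a x)" for K
  proof -
    obtain U where U: "U \<in> keys x" "K \<in> keys (DD a (bs U) :: 'k fcomb)"
      using K by (rule keys_DD)
    obtain I where I: "I |\<subseteq>| U" "I \<noteq> {||}" "dis {|Nd a I|} (U |-| I)" "K = finsert (Nd a I) (U |-| I)"
      by (rule keys_DD_bs[OF U(2)])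
    have "card (fl I) \<le> card (fl U)"
      using fl_mono[OF I(1)] by (intro card_mono) auto
    then have "msf K \<le> card (fl U) + msf U"
      using I msf_finsert[OF I(3)] msf_split[OF I(1)] by simp
    then show ?thesis
      using t(3)[OF U(1)] cv_degree(2)[OF wv_la U(2)] by simp
  qed
  have "ev vE (Del a t) = psc c (bs (sh (Del a t))) + (psc c y + DD a x)"
    by (simp add: t(2) plinear_add[OF pl_cv] plinear_psc[OF pl_cv] y psc_add)
  moreover have "msf K < msf (sh (Del a t)) \<and> fl K = fl (sh (Del a t))" if K: "K \<in> keys (psc c y + DD a x)" for K
    using keys_plusE[OF K] small small' by (auto dest: in_keys_pscD)
  ultimately show ?case
    using t(1) by blast
qed

section \<open>Every forest is a value\<close>

lemma ex_tree_of_forest: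
  assumes "S \<noteq> {||}" "pdis S" "\<And>u. u |\<in>| S \<Longrightarrow> \<exists>t. sh t = {|u|} \<and> distinct (leaves t)"
  shows "\<exists>t. sh t = S \<and> distinct (leaves t)"
  using assms
proof (induction S)
  case (insert u S)
  obtain t where t: "sh t = {|u|}" "distinct (leaves t)"
    using insert.prems(3) by blast
  have S: "S |\<subseteq>| finsert u S"
    by auto
  show ?case
  proof (cases "S = {||}")
    case True
    then show ?thesis
      using t by auto
  next
    case False
    then obtain s where s: "sh s = S" "distinct (leaves s)"
      using insert pdis_mono[OF S] by auto
    have "dis {|u|} (finsert u S |-| {|u|})"
      by (rule pdis_dis_diff[OF insert.prems(2)]) auto
    moreover have "finsert u S |-| {|u|} = S"
      using insert.hyps by auto
    ultimately have "fl (sh t) \<inter> fl (sh s) = {}"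
      using s t by (simp add: dis_def del: fl_sh)
    then have "lset t \<inter> lset s = {}"
      by auto
    then have "sh (Mul t s) = finsert u S \<and> distinct (leaves (Mul t s))"
      using s t by simp
    then show ?thesis
      by blast
  qed
qed simp

lemma ex_tree_of_tr: "wft u \<Longrightarrow> \<exists>t. sh t = {|u|} \<and> distinct (leaves t)"
proof (induction u)
  case (Lf j)
  then have "sh (Leaf (nat j)) = {|Lf j|} \<and> distinct (leaves (Leaf (nat j)))"
    by simp
  then show ?case
    by blast
next
  case (Nd a S)
  have "\<exists>t. sh t = S \<and> distinct (leaves t)"
    by (rule ex_tree_of_forest) (use Nd in \<open>auto simp: wff_def\<close>)
  then obtain t where "sh t = S" "distinct (leaves t)"
    by blast
  then have "sh (Del a t) = {|Nd a S|} \<and> distinct (leaves (Del a t))"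
    by simp
  then show ?case
    by blast
qed

lemma tree_in_trees_of_sh:
  assumes "sh t = f" "f \<in> forests A (int ` V) d" "distinct (leaves t)"
  shows "t \<in> trees_on A V d"
  using assms dgf_sh[OF assms(3)] by (auto simp: forests_def trees_on_def inj_image_eq_iff)

lemma ex_tree_of_forests:
  assumes "f \<in> forests A (int ` V) d" "V \<noteq> {}"
  shows "\<exists>t. sh t = f \<and> t \<in> trees_on A V d"
proof -
  have "\<exists>t. sh t = f \<and> distinct (leaves t)"
    by (rule ex_tree_of_forest) (use assms in \<open>auto simp: forests_def wff_def intro: ex_tree_of_tr\<close>)
  then show ?thesis
    using tree_in_trees_of_sh[OF _ assms(1)] by blast
qed

text \<open>Evaluation is triangular for the measure: a tree of shape \<open>f\<close> evaluates to
  a nonzero multiple of \<open>f\<close> plus forests that are values already by induction.\<close>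

lemma EE_surj_bs:
  assumes "f \<in> forests A (int ` {1..n}) d" "n \<noteq> 0"
  shows "\<exists>x. keys x \<subseteq> trees A n d \<and> EE x = (bs f :: 'k::field fcomb)"
  using assms(1)
proof (induction "msf f" arbitrary: f rule: less_induct)
  case less
  obtain t where t: "sh t = f" "t \<in> trees A n d"
    using ex_tree_of_forests[OF less.prems] assms(2) by (auto simp: trees_trees_on)
  obtain c x where x: "c \<noteq> 0" "ev vE t = psc c (bs f) + x"
    "\<And>K. K \<in> keys (x :: 'k fcomb) \<Longrightarrow> msf K < msf f"
    using ev_leading[of t, where 'k = 'k] t less.prems by (auto simp: trees_def forests_def)
  have "keys (ev vE t :: 'k fcomb) \<subseteq> forests A (int ` {1..n}) d"
    using EE_forests[of "bs t :: 'k comb" A n d] t by simp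
  moreover have "x = ev vE t - psc c (bs f)"
    using x(2) by simp
  ultimately have xf: "K \<in> forests A (int ` {1..n}) d" if "K \<in> keys x" for K
    using that less.prems by (auto dest!: keys_minusE in_keys_pscD)
  have "\<forall>K\<in>keys x. \<exists>y. keys y \<subseteq> trees A n d \<and> EE y = (bs K :: 'k fcomb)"
    using less.hyps x(3) xf by blast
  then obtain h where h: "\<And>K. K \<in> keys x \<Longrightarrow> keys (h K) \<subseteq> trees A n d \<and> EE (h K) = (bs K :: 'k fcomb)"
    by metis
  let ?y = "psc (inverse c) (bs t - lin h x)"
  have "EE (lin h x) = lin bs x"
    unfolding lin_lin by (rule lin_cong[OF refl]) (use h in blast)
  then have "EE ?y = bs f"
    using x(1,2) by (simp add: lin_psc lin_diff)
  moreover have "keys ?y \<subseteq> trees A n d"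
    using h t(2) by (auto dest!: in_keys_pscD keys_minusE elim!: in_keys_linE)
  ultimately show ?case
    by blast
qed

lemma EE_surj:
  assumes "keys z \<subseteq> forests A (int ` {1..n}) d" "n \<noteq> 0"
  shows "\<exists>x. keys x \<subseteq> trees A n d \<and> EE x = (z :: 'k::field fcomb)"
proof -
  have "\<forall>K\<in>keys z. \<exists>y. keys y \<subseteq> trees A n d \<and> EE y = (bs K :: 'k fcomb)"
    using EE_surj_bs assms by blast
  then obtain h where h: "\<And>K. K \<in> keys z \<Longrightarrow> keys (h K) \<subseteq> trees A n d \<and> EE (h K) = (bs K :: 'k fcomb)"
    by metis
  have "EE (lin h z) = lin bs z"
    unfolding lin_lin by (rule lin_cong[OF refl]) (use h in blast)
  moreover have "keys (lin h z) \<subseteq> trees A n d"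
    using h by (auto elim!: in_keys_linE)
  ultimately show ?thesis
    by auto
qed

section \<open>The ideal on arbitrary finite sets of labels\<close>

abbreviation ptrees :: "nat set \<Rightarrow> int \<Rightarrow> nat tree set" where
  "ptrees \<equiv> trees_on {1..}"

lemma BV_inf_ideal_iff: "x \<in> BV_inf_ideal n d \<longleftrightarrow>
    op_ideal (free_operad {1..} delta) (com_relations \<union> order_relation ` {1..}) n d x"
  by (simp add: BV_inf_ideal_def ideal_gen_def BV_inf_free_def lin_ext_lin)

lemma free_ideal_closed:
  fixes A and D :: "'k::field comb \<Rightarrow> 'k comb" and R
  defines "J \<equiv> op_ideal (free_operad A D) R"
  shows "\<lbrakk>J n d x; J n d y\<rbrakk> \<Longrightarrow> J n d (x + y)" "J n d x \<Longrightarrow> J n d (psc c x)" "J n d 0"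
    "\<lbrakk>J n d x; \<sigma> permutes {1..n}\<rbrakk> \<Longrightarrow> J n d (free_act \<sigma> x)"
    "\<lbrakk>J m d x; keys z \<subseteq> trees A n e; i \<in> {1..m}\<rbrakk> \<Longrightarrow> J (m + n - 1) (d + e) (free_circ i x z)"
    "\<lbrakk>keys z \<subseteq> trees A m d; J n e x; i \<in> {1..m}\<rbrakk> \<Longrightarrow> J (m + n - 1) (d + e) (free_circ i z x)"
  using op_ideal.add[of "free_operad A D" R n d x y] op_ideal.smult[of "free_operad A D" R n d x c]
    op_ideal.zero[of "free_operad A D" R n d] op_ideal.act[of "free_operad A D" R n d x \<sigma>]
    op_ideal.circ_left[of "free_operad A D" R m d x z n e i]
    op_ideal.circ_right[of z "free_operad A D" m d R n e x i]
  by (simp_all add: J_def)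

lemmas BV_inf_ideal_closed =
  free_ideal_closed[where A = "{1..}" and D = delta and R = "com_relations \<union> order_relation ` {1..}",
    folded BV_inf_ideal_iff]
lemmas ideal_add = BV_inf_ideal_closed(1) and ideal_psc = BV_inf_ideal_closed(2) and ideal_zero = BV_inf_ideal_closed(3)
  and ideal_act = BV_inf_ideal_closed(4) and ideal_circ_left = BV_inf_ideal_closed(5)
  and ideal_circ_right = BV_inf_ideal_closed(6)

lemma BV_inf_ideal_keys: "x \<in> BV_inf_ideal n d \<Longrightarrow> keys x \<subseteq> ptrees {1..n} d"
  using BV_inf_ideal_acts_zero(1) trees_trees_on by metis

text \<open>Subtrees and inserted trees carry labels from arbitrary finite sets, while the ideal
  knows only initial segments; it is transported along a numbering of \<open>V\<close>. By
  \<open>JV_D\<close> the numbering can be changed at will, because the ideal is closed under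
  permutations.\<close>

definition JV :: "nat set \<Rightarrow> int \<Rightarrow> 'k::field comb set" where
  "JV V d = {x. keys x \<subseteq> ptrees V d \<and>
     (\<exists>\<beta>. bij_betw \<beta> V {1..card V} \<and> relc \<beta> x \<in> BV_inf_ideal (card V) d)}"

lemma relc_relc: "relc f (relc g x) = relc (\<lambda>j. f (g j)) x"
  by (simp add: relc_def lin_lin map_tree_map_tree)

lemma relc_cong: "keys x \<subseteq> trees_on A V d \<Longrightarrow> (\<And>j. j \<in> V \<Longrightarrow> f j = g j) \<Longrightarrow> relc f x = relc g x"
  unfolding relc_def by (intro lin_cong refl arg_cong[where f = bs] map_tree_cong') (auto simp: trees_on_def)

lemma relc_ident: "keys x \<subseteq> trees_on A V d \<Longrightarrow> (\<And>j. j \<in> V \<Longrightarrow> f j = j) \<Longrightarrow> relc f x = x"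
  using relc_cong[of x A V d f "\<lambda>j. j"] by (simp add: relc_def tree.map_ident)

lemma relc_keys:
  "keys x \<subseteq> trees_on A V d \<Longrightarrow> inj_on g V \<Longrightarrow> keys (relc g x) \<subseteq> trees_on A (g ` V) d"
  using keys_relc[of g x] map_tree_in_trees_on[of _ A V d g] by blast

lemma JV_keys: "x \<in> JV V d \<Longrightarrow> keys x \<subseteq> ptrees V d"
  by (simp add: JV_def)

lemma JV_I: "\<lbrakk>keys x \<subseteq> ptrees V d; bij_betw \<beta> V {1..card V}; relc \<beta> x \<in> BV_inf_ideal (card V) d\<rbrakk> \<Longrightarrow> x \<in> JV V d"
  by (auto simp: JV_def)

lemma JV_D:
  assumes x: "x \<in> JV V d" and \<beta>': "bij_betw \<beta>' V {1..card V}"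
  shows "relc \<beta>' x \<in> BV_inf_ideal (card V) d"
proof -
  let ?m = "card V"
  obtain \<beta> where \<beta>: "bij_betw \<beta> V {1..?m}" "relc \<beta> x \<in> BV_inf_ideal ?m d"
    using x by (auto simp: JV_def)
  define \<sigma> where "\<sigma> l = (if l \<in> {1..?m} then \<beta> (inv_into V \<beta>' l) else l)" for l
  have "bij_betw (\<lambda>l. \<beta> (inv_into V \<beta>' l)) {1..?m} {1..?m}"
    using bij_betw_trans[OF bij_betw_inv_into[OF \<beta>'] \<beta>(1)] by (simp add: comp_def)
  then have "bij_betw \<sigma> {1..?m} {1..?m}"
    by (rule bij_betw_cong[THEN iffD1, rotated]) (simp add: \<sigma>_def)
  then have \<sigma>: "\<sigma> permutes {1..?m}"
    by (intro bij_imp_permutes) (auto simp: \<sigma>_def)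
  have "inv_into UNIV \<sigma> (\<beta> v) = \<beta>' v" if v: "v \<in> V" for v
  proof -
    have "\<sigma> (\<beta>' v) = \<beta> v"
      using v \<beta>' by (auto simp: \<sigma>_def bij_betw_def)
    then show ?thesis
      using permutes_inverses(2)[OF \<sigma>] by metis
  qed
  then have "free_act \<sigma> (relc \<beta> x) = relc \<beta>' x"
    unfolding free_act_relc relc_relc by (intro relc_cong[OF JV_keys[OF x]])
  then show ?thesis
    using ideal_act[OF \<beta>(2) \<sigma>] by simp
qed

lemma ex_bij_card: "finite V \<Longrightarrow> \<exists>\<beta>. bij_betw \<beta> V {1..card V}"
  using ex_bij_betw_nat_finite_1 bij_betw_inv_into by blast

lemma JV_ideal: "x \<in> JV {1..n} d \<longleftrightarrow> x \<in> BV_inf_ideal n d"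
proof
  assume x: "x \<in> JV {1..n} d"
  have "bij_betw (\<lambda>j. j) {1..n} {1..card {1..n}}"
    by (simp add: bij_betw_def)
  then show "x \<in> BV_inf_ideal n d"
    using JV_D[OF x, of "\<lambda>j. j"] relc_ident[OF JV_keys[OF x], of "\<lambda>j. j"] by simp
next
  assume x: "x \<in> BV_inf_ideal n d"
  then show "x \<in> JV {1..n} d"
    using relc_ident[OF BV_inf_ideal_keys[OF x], of "\<lambda>j. j"] BV_inf_ideal_keys[OF x]
    by (intro JV_I[of _ _ _ "\<lambda>j. j"]) (simp_all add: bij_betw_def)
qed

lemma JV_zero: "finite V \<Longrightarrow> 0 \<in> JV V d"
  using ex_bij_card[of V] by (auto simp: relc_def ideal_zero intro: JV_I)

lemma JV_psc: "x \<in> JV V d \<Longrightarrow> psc c x \<in> JV V d"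
  unfolding JV_def by (auto simp: plinear_psc[OF pl_relc] intro: ideal_psc dest: in_keys_pscD)

lemma JV_add:
  assumes x: "x \<in> JV V d" and y: "y \<in> JV V d"
  shows "x + y \<in> JV V d"
proof -
  obtain \<beta> where \<beta>: "bij_betw \<beta> V {1..card V}" "relc \<beta> x \<in> BV_inf_ideal (card V) d"
    using x by (auto simp: JV_def)
  then have "relc \<beta> (x + y) \<in> BV_inf_ideal (card V) d"
    using JV_D[OF y \<beta>(1)] by (simp add: plinear_add[OF pl_relc] ideal_add)
  then show ?thesis
    using \<beta> JV_keys[OF x] JV_keys[OF y] by (intro JV_I[of _ _ _ \<beta>]) (auto dest!: keys_plusE)
qed

lemma JV_lin:
  assumes fin: "finite V" and f: "\<And>t. t \<in> keys x \<Longrightarrow> f t \<in> JV V d"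
  shows "lin f x \<in> JV V d"
  unfolding lin_def
proof -
  have "sum (\<lambda>t. psc (lkp x t) (f t)) S \<in> JV V d" if "finite S" "S \<subseteq> keys x" for S
    using that by (induction S rule: finite_induct) (auto simp: JV_zero[OF fin] intro: JV_add JV_psc f)
  then show "sum (\<lambda>t. psc (lkp x t) (f t)) (keys x) \<in> JV V d"
    by simp
qed

lemma JV_relabel:
  assumes x: "x \<in> JV V d" and g: "inj_on g V"
  shows "relc g x \<in> JV (g ` V) d"
proof -
  obtain \<beta> where \<beta>: "bij_betw \<beta> V {1..card V}" "relc \<beta> x \<in> BV_inf_ideal (card V) d"
    using x by (auto simp: JV_def)
  have "bij_betw (\<lambda>j. \<beta> (inv_into V g j)) (g ` V) {1..card V}"
    using bij_betw_trans[OF bij_betw_inv_into[OF inj_on_imp_bij_betw[OF g]] \<beta>(1)] by (simp add: comp_def)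
  moreover have "relc (\<lambda>j. \<beta> (inv_into V g j)) (relc g x) = relc \<beta> x"
    unfolding relc_relc by (rule relc_cong[OF JV_keys[OF x]]) (simp add: inv_into_f_f[OF g])
  ultimately show ?thesis
    using \<beta>(2) relc_keys[OF JV_keys[OF x] g] card_image[OF g]
    by (intro JV_I[of _ _ _ "\<lambda>j. \<beta> (inv_into V g j)"]) simp_all
qed

section \<open>Insertion of trees into elements of the ideal\<close>

lemma graft_label_bij:
  assumes \<beta>: "bij_betw \<beta> V {1..m}" and \<gamma>: "bij_betw \<gamma> Y {1..n}" and i: "i \<in> V"
    and d: "(V - {i}) \<inter> Y = {}"
  defines "\<delta> \<equiv> \<lambda>k. if k \<in> Y then \<beta> i + \<gamma> k - 1 else if \<beta> k < \<beta> i then \<beta> k else \<beta> k + n - 1"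
  shows "bij_betw \<delta> (V - {i} \<union> Y) {1..m + n - 1}" "card (V - {i} \<union> Y) = m + n - 1"
proof -
  have fin: "finite V" "finite Y"
    using \<beta> \<gamma> bij_betw_finite by blast+
  have cV: "card V = m" "card Y = n"
    using bij_betw_same_card[OF \<beta>] bij_betw_same_card[OF \<gamma>] by simp_all
  show c: "card (V - {i} \<union> Y) = m + n - 1"
    using fin cV i d card_Diff_singleton[OF i] card_gt_0_iff[of V] by (subst card_Un_disjoint) auto
  have \<beta>m: "k \<in> V \<Longrightarrow> 1 \<le> \<beta> k \<and> \<beta> k \<le> m" for k
    using \<beta> by (auto simp: bij_betw_def)
  have \<gamma>m: "k \<in> Y \<Longrightarrow> 1 \<le> \<gamma> k \<and> \<gamma> k \<le> n" for k
    using \<gamma> by (auto simp: bij_betw_def)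
  have \<beta>inj: "\<lbrakk>k \<in> V; l \<in> V; \<beta> k = \<beta> l\<rbrakk> \<Longrightarrow> k = l" for k l
    using \<beta> by (auto simp: bij_betw_def dest: inj_onD)
  have \<gamma>inj: "\<lbrakk>k \<in> Y; l \<in> Y; \<gamma> k = \<gamma> l\<rbrakk> \<Longrightarrow> k = l" for k l
    using \<gamma> by (auto simp: bij_betw_def dest: inj_onD)
  have dY: "\<delta> k = \<beta> i + \<gamma> k - 1" if "k \<in> Y" for k
    using that by (simp add: \<delta>_def)
  have dV: "k \<notin> Y \<and> \<delta> k = (if \<beta> k < \<beta> i then \<beta> k else \<beta> k + n - 1) \<and> \<beta> k \<noteq> \<beta> i" if "k \<in> V - {i}" for k
    using that d i \<beta>inj[of k i] by (auto simp: \<delta>_def)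
  have blkY: "\<beta> i \<le> \<delta> k \<and> \<delta> k < \<beta> i + n" if "k \<in> Y" for k
    using dY[OF that] \<gamma>m[OF that] \<beta>m[OF i] by auto
  have blkV: "\<delta> k < \<beta> i \<or> \<beta> i + n \<le> \<delta> k" if "k \<in> V - {i}" for k
    using dV[OF that] by (auto split: if_splits)
  have inj: "inj_on \<delta> (V - {i} \<union> Y)"
  proof (rule inj_onI)
    fix k l assume k: "k \<in> V - {i} \<union> Y" and l: "l \<in> V - {i} \<union> Y" and e: "\<delta> k = \<delta> l"
    show "k = l"
    proof (cases "k \<in> Y")
      case True
      then have "l \<in> Y"
        using blkY[of k] blkV[of l] e l by auto
      then have "\<gamma> k = \<gamma> l"
        using dY[OF True] dY[of l] e \<gamma>m[OF True] \<gamma>m[of l] \<beta>m[OF i] by auto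
      then show ?thesis
        using \<gamma>inj True \<open>l \<in> Y\<close> by blast
    next
      case False
      then have k': "k \<in> V - {i}"
        using k by auto
      have l': "l \<in> V - {i}"
        using blkV[OF k'] blkY[of l] e l by auto
      have "\<beta> k = \<beta> l"
        using dV[OF k'] dV[OF l'] e by (auto split: if_splits)
      then show ?thesis
        using \<beta>inj k' l' by blast
    qed
  qed
  have sub: "\<delta> ` (V - {i} \<union> Y) \<subseteq> {1..m + n - 1}"
  proof
    fix j assume "j \<in> \<delta> ` (V - {i} \<union> Y)"
    then obtain k where k: "k \<in> V - {i} \<union> Y" "j = \<delta> k"
      by blast
    show "j \<in> {1..m + n - 1}"
    proof (cases "k \<in> Y")
      case True
      then show ?thesis
        using k dY[OF True] \<gamma>m[OF True] \<beta>m[OF i] by auto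
    next
      case False
      then have k': "k \<in> V - {i}"
        using k by auto
      then show ?thesis
        using k(2) dV[OF k'] \<beta>m[of k] \<beta>m[OF i] by (auto split: if_splits)
    qed
  qed
  have "\<delta> ` (V - {i} \<union> Y) = {1..m + n - 1}"
    by (rule card_subset_eq) (use sub card_image[OF inj] c in auto)
  then show "bij_betw \<delta> (V - {i} \<union> Y) {1..m + n - 1}"
    using inj by (simp add: bij_betw_def)
qed

text \<open>The sign is that of the partial composition.\<close>

lemma JV_subst:
  assumes x: "x \<in> JV V d" and i: "i \<in> V" and t: "t \<in> ptrees Y e" and disj: "(V - {i}) \<inter> Y = {}"
  shows "lin (\<lambda>s. psc (ep (deg_right i s * e)) (bs (subst (\<lambda>j. if j = i then t else Leaf j) s))) x
    \<in> JV (V - {i} \<union> Y) (d + e)" (is "?z \<in> _")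
proof -
  let ?m = "card V" and ?n = "card Y"
  obtain \<beta> where \<beta>: "bij_betw \<beta> V {1..?m}" "relc \<beta> x \<in> BV_inf_ideal ?m d"
    using x by (auto simp: JV_def)
  obtain \<gamma> where \<gamma>: "bij_betw \<gamma> Y {1..?n}"
    using ex_bij_card trees_on_finite[OF t] by blast
  define \<delta> where "\<delta> = (\<lambda>k. if k \<in> Y then \<beta> i + \<gamma> k - 1 else if \<beta> k < \<beta> i then \<beta> k else \<beta> k + ?n - 1)"
  note \<delta> = graft_label_bij[OF \<beta>(1) \<gamma> i disj, folded \<delta>_def]
  have t': "map_tree \<gamma> t \<in> trees {1..} ?n e"
    using map_tree_in_trees_on[OF t, of \<gamma>] \<gamma> by (simp add: bij_betw_def trees_trees_on)
  have \<beta>i: "\<beta> i \<in> {1..?m}"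
    using \<beta>(1) i by (auto simp: bij_betw_def)
  have "relc \<delta> ?z = free_circ (\<beta> i) (relc \<beta> x) (bs (map_tree \<gamma> t))"
    unfolding free_circ_lin relc_def lin_lin lin_bs lin_psc
  proof (rule lin_cong[OF refl], goal_cases)
    case (1 s)
    then have s: "s \<in> ptrees V d"
      using JV_keys[OF x] by auto
    have "deg_right (\<beta> i) (map_tree \<beta> s) = deg_right i s"
      using deg_right_map_tree[of \<beta> s i] \<beta>(1) s i by (simp add: bij_betw_def trees_on_def)
    moreover have "tdeg t = e"
      using t by (simp add: trees_on_def)
    moreover have "map_tree \<delta> (subst (\<lambda>j. if j = i then t else Leaf j) s) = graft (\<beta> i) (map_tree \<beta> s) (map_tree \<gamma> t)"
      unfolding graft_subst[OF t'] subst_map_tree map_tree_subst'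
    proof (rule subst_cong, goal_cases)
      case (1 j)
      then have j: "j \<in> V"
        using s by (simp add: trees_on_def)
      show ?case
      proof (cases "j = i")
        case True
        have "map_tree \<delta> t = map_tree (\<lambda>l. \<beta> i + l - 1) (map_tree \<gamma> t)"
          unfolding map_tree_map_tree by (rule map_tree_cong') (use t in \<open>simp add: \<delta>_def trees_on_def\<close>)
        then show ?thesis
          using True by simp
      next
        case False
        then have "\<beta> j \<noteq> \<beta> i" "j \<notin> Y"
          using \<beta>(1) i j disj by (auto simp: bij_betw_def dest: inj_onD)
        then show ?thesis
          using False by (simp add: \<delta>_def)
      qed
    qed
    ultimately show ?case
      by simp
  qed
  moreover have "free_circ (\<beta> i) (relc \<beta> x) (bs (map_tree \<gamma> t)) \<in> BV_inf_ideal (?m + ?n - 1) (d + e)"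
    using t' by (intro ideal_circ_left[OF \<beta>(2) _ \<beta>i]) simp
  moreover have "keys ?z \<subseteq> ptrees (V - {i} \<union> Y) (d + e)"
  proof
    fix u assume "u \<in> keys ?z"
    then obtain s where s: "s \<in> keys x" and u: "u = subst (\<lambda>j. if j = i then t else Leaf j) s"
      by (auto elim!: in_keys_linE dest!: in_keys_pscD)
    have sV: "s \<in> ptrees V d"
      using s JV_keys[OF x] by auto
    have "u \<in> ptrees (\<Union>j\<in>V. if j = i then Y else {j}) (d + (\<Sum>j\<in>V. if j = i then e else 0))"
      unfolding u by (rule subst_in_trees_on[OF sV]) (use t disj in \<open>auto simp: trees_on_def\<close>)
    moreover have "(\<Union>j\<in>V. if j = i then Y else {j}) = V - {i} \<union> Y"
      using i by (auto split: if_splits)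
    ultimately show "u \<in> ptrees (V - {i} \<union> Y) (d + e)"
      using i trees_on_finite[OF sV] by simp
  qed
  ultimately show ?thesis
    using \<delta> by (intro JV_I[of _ _ _ \<delta>]) simp_all
qed

text \<open>The inputs are filled one after another; freshness of the inserted labels prevents a
  later insertion from hitting an earlier one. The accumulated sign depends on the tree
  \<open>s\<close>, and only its being nonzero is kept: that suffices for two-term relations and for
  solving a relation for one of its terms.\<close>

lemma JV_subst_all:
  fixes x :: "'k::field comb"
  assumes x: "x \<in> JV V d" and fin: "finite V" and \<tau>: "\<And>i. i \<in> V \<Longrightarrow> \<tau> i \<in> ptrees (Y i) (e i)"
    and disj: "\<And>i j. \<lbrakk>i \<in> V; j \<in> V; i \<noteq> j\<rbrakk> \<Longrightarrow> Y i \<inter> Y j = {}" and fresh: "\<And>i. i \<in> V \<Longrightarrow> Y i \<inter> V = {}"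
  shows "\<exists>\<epsilon>. (\<forall>s. \<epsilon> s \<noteq> 0) \<and> lin (\<lambda>s. psc (\<epsilon> s) (bs (subst \<tau> s))) x \<in> JV (\<Union>i\<in>V. Y i) (d + (\<Sum>i\<in>V. e i))"
proof -
  have "\<exists>\<epsilon>. (\<forall>s. \<epsilon> s \<noteq> 0) \<and> lin (\<lambda>s. psc (\<epsilon> s) (bs (subst (\<lambda>j. if j \<in> Z then \<tau> j else Leaf j) s))) x
      \<in> JV (V - Z \<union> (\<Union>i\<in>Z. Y i)) (d + (\<Sum>i\<in>Z. e i))" if "Z \<subseteq> V" for Z
    using finite_subset[OF that fin] that
  proof (induction Z rule: finite_induct)
    case empty
    show ?case
      using x by (intro exI[of _ "\<lambda>_. 1"]) (simp add: subst_Leaf)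
  next
    case (insert i Z)
    let ?f = "\<lambda>Z. subst (\<lambda>j. if j \<in> Z then \<tau> j else Leaf j)"
    obtain \<epsilon> where \<epsilon>: "\<forall>s. \<epsilon> s \<noteq> 0" "lin (\<lambda>s. psc (\<epsilon> s) (bs (?f Z s))) x \<in> JV (V - Z \<union> (\<Union>i\<in>Z. Y i)) (d + (\<Sum>i\<in>Z. e i))"
      using insert by auto
    have iV: "i \<in> V"
      using insert by auto
    have i: "i \<in> V - Z \<union> (\<Union>i\<in>Z. Y i)"
      using insert by auto
    have iY: "i \<notin> (\<Union>i\<in>Z. Y i)"
      using insert fresh by blast
    have d': "(V - Z \<union> (\<Union>i\<in>Z. Y i) - {i}) \<inter> Y i = {}"
      using fresh[OF iV] disj[OF _ iV] insert by blast
    have V': "V - Z \<union> (\<Union>i\<in>Z. Y i) - {i} \<union> Y i = V - insert i Z \<union> (\<Union>i\<in>insert i Z. Y i)"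
      using iY by auto
    have s: "subst (\<lambda>j. if j = i then \<tau> i else Leaf j) (?f Z s) = ?f (insert i Z) s" if "s \<in> keys x" for s
      unfolding subst_subst
    proof (rule subst_cong, goal_cases)
      case (1 j)
      then have j: "j \<in> V"
        using that JV_keys[OF x] by (auto simp: trees_on_def)
      have "subst (\<lambda>j. if j = i then \<tau> i else Leaf j) (\<tau> j) = subst Leaf (\<tau> j)" if "j \<in> Z"
        by (rule subst_cong) (use \<tau>[OF j] iY that in \<open>auto simp: trees_on_def\<close>)
      then show ?case
        using insert.hyps by (auto simp: subst_Leaf)
    qed
    let ?\<epsilon> = "\<lambda>s. \<epsilon> s * ep (deg_right i (?f Z s) * e i)"
    have "lin (\<lambda>s. psc (?\<epsilon> s) (bs (?f (insert i Z) s))) x =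
        lin (\<lambda>s. psc (ep (deg_right i s * e i)) (bs (subst (\<lambda>j. if j = i then \<tau> i else Leaf j) s)))
         (lin (\<lambda>s. psc (\<epsilon> s) (bs (?f Z s))) x)"
      unfolding lin_lin lin_psc lin_bs psc_psc by (rule lin_cong[OF refl]) (simp add: s)
    also have "\<dots> \<in> JV (V - insert i Z \<union> (\<Union>i\<in>insert i Z. Y i)) (d + (\<Sum>i\<in>Z. e i) + e i)"
      using JV_subst[OF \<epsilon>(2) i \<tau>[OF iV] d'] unfolding V' .
    finally have "lin (\<lambda>s. psc (?\<epsilon> s) (bs (?f (insert i Z) s))) x
        \<in> JV (V - insert i Z \<union> (\<Union>i\<in>insert i Z. Y i)) (d + (\<Sum>i\<in>insert i Z. e i))"
      using insert.hyps by (simp add: algebra_simps)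
    then show ?case
      using \<epsilon>(1) by (intro exI[of _ ?\<epsilon>]) simp
  qed
  from this[of V] obtain \<epsilon> where \<epsilon>: "\<forall>s. \<epsilon> s \<noteq> 0"
      "lin (\<lambda>s. psc (\<epsilon> s) (bs (subst (\<lambda>j. if j \<in> V then \<tau> j else Leaf j) s))) x \<in> JV (\<Union>i\<in>V. Y i) (d + (\<Sum>i\<in>V. e i))"
    by auto
  have "lin (\<lambda>s. psc (\<epsilon> s) (bs (subst (\<lambda>j. if j \<in> V then \<tau> j else Leaf j) s))) x = lin (\<lambda>s. psc (\<epsilon> s) (bs (subst \<tau> s))) x"
    using JV_keys[OF x] by (intro lin_cong refl arg_cong2[where f = psc] arg_cong[where f = bs] subst_cong) 
      (auto simp: trees_on_def)
  then show ?thesis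
    using \<epsilon> by auto
qed

lemma trees_on_Leaf: "Leaf k \<in> trees_on A {k} 0"
  by (simp add: trees_on_def)

lemma trees_on_Mul:
  "\<lbrakk>s \<in> trees_on A V d; t \<in> trees_on A W e; V \<inter> W = {}\<rbrakk> \<Longrightarrow> Mul s t \<in> trees_on A (V \<union> W) (d + e)"
  by (auto simp: trees_on_def)

lemma trees_on_Del: "\<lbrakk>t \<in> trees_on A V d; a \<in> A\<rbrakk> \<Longrightarrow> Del a t \<in> trees_on A V (d + (1 - 2 * int a))"
  by (auto simp: trees_on_def)

lemma keys_mulc_trees:
  assumes "keys x \<subseteq> trees_on A V d" "keys y \<subseteq> trees_on A W e" "V \<inter> W = {}"
  shows "keys (mulc x y) \<subseteq> trees_on A (V \<union> W) (d + e)"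
proof
  fix u assume "u \<in> keys (mulc x y)"
  then obtain s t where "u = Mul s t" "s \<in> keys x" "t \<in> keys y"
    using subsetD[OF keys_mulc] by blast
  then show "u \<in> trees_on A (V \<union> W) (d + e)"
    using assms trees_on_Mul[of s A V d t W e] by auto
qed

text \<open>Multiplying by a single leaf is a partial composition into an input of
  \<open>mu\<close>, so the ideal property applies. The leaf is later a placeholder into which an
  arbitrary second factor is inserted.\<close>

lemma JV_mulc_Leaf:
  assumes x: "x \<in> JV V d" and k: "k \<notin> V" and fin: "finite V"
  shows "mulc x (bs (Leaf k)) \<in> JV (insert k V) d" "mulc (bs (Leaf k)) x \<in> JV (insert k V) d"
proof -
  let ?m = "card V"
  obtain \<beta> where \<beta>: "bij_betw \<beta> V {1..?m}" "relc \<beta> x \<in> BV_inf_ideal ?m d"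
    using x by (auto simp: JV_def)
  have cl: "keys (mulc x (bs (Leaf k))) \<subseteq> ptrees (insert k V) d" "keys (mulc (bs (Leaf k)) x) \<subseteq> ptrees (insert k V) d"
    using keys_mulc_trees[of x "{1..}" V d "bs (Leaf k)" "{k}" 0] keys_mulc_trees[of "bs (Leaf k)" "{1..}" "{k}" 0 x V d]
      JV_keys[OF x] k by (simp_all add: trees_on_Leaf)
  have c: "card (insert k V) = ?m + 1"
    using k fin by simp
  have kx: "keys (relc \<beta> x) \<subseteq> trees {1..} ?m d"
    using BV_inf_ideal_keys[OF \<beta>(2)] by (simp add: trees_trees_on)
  have g: "graft i (Mul (Leaf 1) (Leaf 2)) s = (if i = 1 then Mul s (Leaf (?m + 1)) else Mul (Leaf 1) (map_tree Suc s))"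
    if "s \<in> keys (relc \<beta> x)" "i = 1 \<or> i = 2" for s i
  proof -
    have s: "s \<in> trees {1..} ?m d"
      using that(1) kx by auto
    then show ?thesis
      using that(2) by (auto simp: graft_subst[OF s] map_tree_ident' intro: map_tree_cong')
  qed
  let ?\<beta> = "\<lambda>j. if j = k then ?m + 1 else \<beta> j"
  let ?\<gamma> = "\<lambda>j. if j = k then 1 else Suc (\<beta> j)"
  have b: "bij_betw ?\<beta> (insert k V) {1..?m + 1}"
  proof -
    have "bij_betw ?\<beta> V {1..?m}"
      by (rule bij_betw_cong[THEN iffD1, rotated, OF \<beta>(1)]) (use k in auto)
    moreover have "bij_betw ?\<beta> {k} {?m + 1}"
      by (simp add: bij_betw_def)
    ultimately have "bij_betw ?\<beta> (V \<union> {k}) ({1..?m} \<union> {?m + 1})"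
      by (rule bij_betw_combine) simp
    moreover have "{1..?m} \<union> {?m + 1} = {1..?m + 1}"
      by auto
    ultimately show ?thesis
      by simp
  qed
  have b': "bij_betw ?\<gamma> (insert k V) {1..?m + 1}"
  proof -
    have "bij_betw Suc {1..?m} {Suc 1..Suc ?m}"
      unfolding bij_betw_def image_Suc_atLeastAtMost by simp
    from bij_betw_trans[OF \<beta>(1) this] have "bij_betw (\<lambda>j. Suc (\<beta> j)) V {Suc 1..Suc ?m}"
      by (simp add: comp_def)
    then have "bij_betw ?\<gamma> V {Suc 1..Suc ?m}"
      by (rule bij_betw_cong[THEN iffD1, rotated]) (use k in auto)
    moreover have "bij_betw ?\<gamma> {k} {1}"
      by (simp add: bij_betw_def)
    ultimately have "bij_betw ?\<gamma> (V \<union> {k}) ({Suc 1..Suc ?m} \<union> {1})"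
      by (rule bij_betw_combine) simp
    moreover have "{Suc 1..Suc ?m} \<union> {1} = {1..?m + 1}"
      by auto
    ultimately show ?thesis
      by simp
  qed
  have "free_circ 1 mu (relc \<beta> x) = relc ?\<beta> (mulc x (bs (Leaf k)))"
  proof -
    have e: "relc \<beta> x = relc ?\<beta> x"
      by (rule relc_cong[OF JV_keys[OF x]]) (use k in auto)
    have "free_circ 1 mu (relc \<beta> x) = lin (\<lambda>s. bs (Mul s (Leaf (?m + 1)))) (relc \<beta> x)"
      unfolding free_circ_lin mu_def lin_bs by (rule lin_cong[OF refl]) (use g[of _ 1] in simp)
    also have "\<dots> = mulc (relc \<beta> x) (relc ?\<beta> (bs (Leaf k)))"
      by (simp add: mulc_def)
    also have "\<dots> = relc ?\<beta> (mulc x (bs (Leaf k)))"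
      unfolding relc_mulc e[symmetric] ..
    finally show ?thesis .
  qed
  moreover have "free_circ 1 mu (relc \<beta> x) \<in> BV_inf_ideal (2 + ?m - 1) (0 + d)"
    by (rule ideal_circ_right[OF mu_trees \<beta>(2)]) simp
  ultimately show "mulc x (bs (Leaf k)) \<in> JV (insert k V) d"
    using b c cl by (intro JV_I[of _ _ _ ?\<beta>]) (simp_all add: add.commute)
  have "free_circ 2 mu (relc \<beta> x) = relc ?\<gamma> (mulc (bs (Leaf k)) x)"
  proof -
    have "free_circ 2 mu (relc \<beta> x) = lin (\<lambda>s. bs (Mul (Leaf 1) (map_tree Suc s))) (relc \<beta> x)"
      unfolding free_circ_lin mu_def lin_bs by (rule lin_cong[OF refl]) (use g[of _ 2] in simp)
    also have "\<dots> = mulc (bs (Leaf 1)) (relc Suc (relc \<beta> x))"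
      by (simp add: mulc_def relc_def lin_lin)
    also have "relc Suc (relc \<beta> x) = relc ?\<gamma> x"
      unfolding relc_relc by (rule relc_cong[OF JV_keys[OF x]]) (use k in auto)
    also have "bs (Leaf 1) = relc ?\<gamma> (bs (Leaf k) :: 'a comb)"
      by simp
    finally show ?thesis
      by (simp only: relc_mulc)
  qed
  moreover have "free_circ 2 mu (relc \<beta> x) \<in> BV_inf_ideal (2 + ?m - 1) (0 + d)"
    by (rule ideal_circ_right[OF mu_trees \<beta>(2)]) simp
  ultimately show "mulc (bs (Leaf k)) x \<in> JV (insert k V) d"
    using b' c cl by (intro JV_I[of _ _ _ ?\<gamma>]) (simp_all add: add.commute)
qed

lemma JV_mulc:
  assumes x: "x \<in> JV V d" and u: "u \<in> ptrees Y e" and disj: "V \<inter> Y = {}" and fin: "finite V"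
  shows "mulc x (bs u) \<in> JV (V \<union> Y) (d + e)" "mulc (bs u) x \<in> JV (V \<union> Y) (d + e)"
proof -
  obtain k where k: "k \<notin> V \<union> Y"
    using fin trees_on_finite[OF u] ex_new_if_finite[of "V \<union> Y"] by auto
  then have kV: "k \<notin> V" and Y: "(insert k V - {k}) \<inter> Y = {}" and V': "insert k V - {k} \<union> Y = V \<union> Y"
    using disj by auto
  have sx: "subst (\<lambda>j. if j = k then u else Leaf j) s = s" if "s \<in> keys x" for s
    using subst_notin[of k s u "\<lambda>j. j"] that JV_keys[OF x] kV by (auto simp: trees_on_def tree.map_ident)
  have dx: "deg_right k s = 0" "k \<notin> lset s" "tdeg s = d" if "s \<in> keys x" for s
    using that JV_keys[OF x] kV by (auto simp: trees_on_def intro: deg_right_notin)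
  have "lin (\<lambda>s. psc (ep (deg_right k s * e)) (bs (subst (\<lambda>j. if j = k then u else Leaf j) s))) (mulc x (bs (Leaf k))) = mulc x (bs u)"
    unfolding mulc_def lin_lin lin_bs by (rule lin_cong[OF refl]) (simp add: dx sx)
  then show "mulc x (bs u) \<in> JV (V \<union> Y) (d + e)"
    using JV_subst[OF JV_mulc_Leaf(1)[OF x kV fin] _ u Y] unfolding V' by simp
  have "lin (\<lambda>s. psc (ep (deg_right k s * e)) (bs (subst (\<lambda>j. if j = k then u else Leaf j) s))) (mulc (bs (Leaf k)) x) =
      psc (ep (d * e)) (mulc (bs u) x)"
    unfolding mulc_def lin_lin lin_bs lin_psc_fun[symmetric] by (rule lin_cong[OF refl]) (simp add: dx sx)
  then have "psc (ep (d * e)) (mulc (bs u) x) \<in> JV (V \<union> Y) (d + e)"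
    using JV_subst[OF JV_mulc_Leaf(2)[OF x kV fin] _ u Y] unfolding V' by simp
  then show "mulc (bs u) x \<in> JV (V \<union> Y) (d + e)"
    using JV_psc[of "psc (ep (d * e)) (mulc (bs u) x)" "V \<union> Y" "d + e" "ep (d * e)"] by simp
qed

lemma JV_delc:
  assumes x: "x \<in> JV V d" and a: "1 \<le> a"
  shows "delc a x \<in> JV V (d + (1 - 2 * int a))"
proof -
  let ?m = "card V"
  obtain \<beta> where \<beta>: "bij_betw \<beta> V {1..?m}" "relc \<beta> x \<in> BV_inf_ideal ?m d"
    using x by (auto simp: JV_def)
  have kx: "keys (relc \<beta> x) \<subseteq> trees {1..} ?m d"
    using BV_inf_ideal_keys[OF \<beta>(2)] by (simp add: trees_trees_on)
  have "free_circ 1 (Delta a) (relc \<beta> x) = delc a (relc \<beta> x)"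
    unfolding free_circ_lin Delta_def lin_bs delc_def
  proof (rule lin_cong[OF refl], goal_cases)
    case (1 s)
    then have s: "s \<in> trees {1..} ?m d"
      using kx by auto
    show ?case
      by (simp add: graft_subst[OF s] map_tree_ident')
  qed
  moreover have "free_circ 1 (Delta a) (relc \<beta> x) \<in> BV_inf_ideal (1 + ?m - 1) ((1 - 2 * int a) + d)"
    using a by (intro ideal_circ_right[OF Delta_trees \<beta>(2)]) auto
  moreover have "keys (delc a x) \<subseteq> ptrees V (d + (1 - 2 * int a))"
  proof
    fix u assume "u \<in> keys (delc a x)"
    then obtain s where "u = Del a s" "s \<in> keys x"
      using subsetD[OF keys_delc] by blast
    then show "u \<in> ptrees V (d + (1 - 2 * int a))"
      using JV_keys[OF x] a trees_on_Del[of s "{1..}" V d a] by auto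
  qed
  ultimately show ?thesis
    using \<beta>(1) by (intro JV_I[of _ _ _ \<beta>]) (simp_all add: relc_delc add.commute)
qed

section \<open>Normal forms modulo the ideal\<close>

definition well :: "nat tree \<Rightarrow> bool" where
  "well t \<longleftrightarrow> distinct (leaves t) \<and> deltas t \<subseteq> {1..}"

lemma well_ptrees: "well t \<Longrightarrow> t \<in> ptrees (lset t) (tdeg t)"
  by (simp add: well_def trees_on_def)

lemma ptrees_well: "t \<in> ptrees V d \<Longrightarrow> well t \<and> lset t = V \<and> tdeg t = d"
  by (simp add: well_def trees_on_def)

lemma well_simps [simp]:
  "well (Leaf j)" "well (Mul s t) \<longleftrightarrow> well s \<and> well t \<and> lset s \<inter> lset t = {}"
  "well (Del a t) \<longleftrightarrow> well t \<and> 1 \<le> a"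
  by (auto simp: well_def)

lemma relation_instance:
  fixes x :: "'k::field comb"
  assumes x: "x \<in> BV_inf_ideal m d" and \<tau>: "\<And>i. i \<in> {1..m} \<Longrightarrow> well (\<tau> i)"
    and disj: "\<And>i j. \<lbrakk>i \<in> {1..m}; j \<in> {1..m}; i \<noteq> j\<rbrakk> \<Longrightarrow> lset (\<tau> i) \<inter> lset (\<tau> j) = {}"
  shows "\<exists>\<epsilon>. (\<forall>s. \<epsilon> s \<noteq> 0) \<and> lin (\<lambda>s. psc (\<epsilon> s) (bs (subst \<tau> s))) x
    \<in> JV (\<Union>i\<in>{1..m}. lset (\<tau> i)) (d + (\<Sum>i\<in>{1..m}. tdeg (\<tau> i)))"
proof -
  \<comment> \<open>Inputs of the relation are renamed to numbers beyond all labels of the inserted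
    trees, as freshness in \<open>JV_subst_all\<close> demands.\<close>
  define N where "N = Max (insert 0 (\<Union>i\<in>{1..m}. lset (\<tau> i)))"
  have N: "k \<le> N" if "i \<in> {1..m}" "k \<in> lset (\<tau> i)" for i k
    unfolding N_def using that by (intro Max_ge) auto
  define g where "g i = N + i" for i
  have g: "inj_on g {1..m}"
    by (simp add: g_def inj_on_def)
  let ?V = "g ` {1..m}" and ?\<tau> = "\<lambda>j. \<tau> (j - N)"
  have "\<exists>\<epsilon>. (\<forall>s. \<epsilon> s \<noteq> 0) \<and> lin (\<lambda>s. psc (\<epsilon> s) (bs (subst ?\<tau> s))) (relc g x)
      \<in> JV (\<Union>i\<in>?V. lset (\<tau> (i - N))) (d + (\<Sum>i\<in>?V. tdeg (\<tau> (i - N))))"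
  proof (rule JV_subst_all)
    show "relc g x \<in> JV ?V d"
      using JV_relabel[OF _ g] x JV_ideal by blast
    show "\<tau> (j - N) \<in> ptrees (lset (\<tau> (j - N))) (tdeg (\<tau> (j - N)))" if "j \<in> ?V" for j
      by (intro well_ptrees \<tau>) (use that in \<open>auto simp: g_def\<close>)
    show "lset (\<tau> (i - N)) \<inter> lset (\<tau> (j - N)) = {}" if "i \<in> ?V" "j \<in> ?V" "i \<noteq> j" for i j
      by (rule disj) (use that in \<open>auto simp: g_def\<close>)
    show "lset (\<tau> (i - N)) \<inter> ?V = {}" if "i \<in> ?V" for i
    proof -
      have "i - N \<in> {1..m}"
        using that by (auto simp: g_def)
      from N[OF this] show ?thesis
        by (force simp: g_def)
    qed
  qed simp
  then obtain \<epsilon> where \<epsilon>: "\<forall>s. \<epsilon> s \<noteq> 0" and *: "lin (\<lambda>s. psc (\<epsilon> s) (bs (subst ?\<tau> s))) (relc g x)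
      \<in> JV (\<Union>i\<in>?V. lset (\<tau> (i - N))) (d + (\<Sum>i\<in>?V. tdeg (\<tau> (i - N))))"
    by blast
  have "lin (\<lambda>s. psc (\<epsilon> s) (bs (subst ?\<tau> s))) (relc g x) = lin (\<lambda>s. psc (\<epsilon> (map_tree g s)) (bs (subst \<tau> s))) x"
    by (simp add: relc_def lin_lin subst_map_tree g_def)
  moreover have "(\<Union>i\<in>?V. lset (\<tau> (i - N))) = (\<Union>i\<in>{1..m}. lset (\<tau> i))"
    unfolding image_image UN_simps by (simp add: g_def image_image)
  moreover have "(\<Sum>i\<in>?V. tdeg (\<tau> (i - N))) = (\<Sum>i\<in>{1..m}. tdeg (\<tau> i))"
    by (subst sum.reindex[OF g]) (simp add: g_def)
  ultimately show ?thesis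
    using * \<epsilon> by (intro exI[of _ "\<lambda>s. \<epsilon> (map_tree g s)"]) simp
qed

lemma ideal_gens:
  shows ideal_comm: "bs (Mul (Leaf 2) (Leaf 1)) - bs (Mul (Leaf 1) (Leaf 2)) \<in> (BV_inf_ideal 2 0 :: 'a::field comb set)"
    and ideal_assoc: "bs (Mul (Mul (Leaf 1) (Leaf 2)) (Leaf 3)) - bs (Mul (Leaf 1) (Mul (Leaf 2) (Leaf 3))) \<in> (BV_inf_ideal 3 0 :: 'b::field comb set)"
    and ideal_order: "1 \<le> a \<Longrightarrow> order_op (Delta a) (a + 2) \<in> (BV_inf_ideal (a + 2) (1 - 2 * int a) :: 'c::field comb set)"
proof -
  have "free_act (transpose 1 2) mu - mu = (bs (Mul (Leaf 2) (Leaf 1)) - bs (Mul (Leaf 1) (Leaf 2)) :: 'a comb)"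
    by (simp add: mu_def free_act_bs)
  then show "bs (Mul (Leaf 2) (Leaf 1)) - bs (Mul (Leaf 1) (Leaf 2)) \<in> (BV_inf_ideal 2 0 :: 'a comb set)"
    unfolding BV_inf_ideal_iff com_relations_def by (intro op_ideal.gen UnI1) (metis insertI1)
  have "free_circ 1 mu mu - free_circ 2 mu mu = (bs (Mul (Mul (Leaf 1) (Leaf 2)) (Leaf 3)) - bs (Mul (Leaf 1) (Mul (Leaf 2) (Leaf 3))) :: 'b comb)"
    by (simp add: mu_def free_circ_bs graft_def eval_nat_numeral)
  then show "bs (Mul (Mul (Leaf 1) (Leaf 2)) (Leaf 3)) - bs (Mul (Leaf 1) (Mul (Leaf 2) (Leaf 3))) \<in> (BV_inf_ideal 3 0 :: 'b comb set)"
    unfolding BV_inf_ideal_iff by (intro op_ideal.gen) (simp add: com_relations_def)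
  show "order_op (Delta a) (a + 2) \<in> (BV_inf_ideal (a + 2) (1 - 2 * int a) :: 'c comb set)" if "1 \<le> a"
    unfolding BV_inf_ideal_iff using that by (intro op_ideal.gen) (auto simp: order_relation_def)
qed

text \<open>The first argument only fixes the field.\<close>

definition eqv :: "'k::field itself \<Rightarrow> nat tree \<Rightarrow> nat tree \<Rightarrow> bool" where
  "eqv K s t \<longleftrightarrow> well s \<and> well t \<and> lset s = lset t \<and> tdeg s = tdeg t \<and>
     (\<exists>c::'k. c \<noteq> 0 \<and> bs s - psc c (bs t) \<in> JV (lset s) (tdeg s))"

lemma eqv_refl: "well s \<Longrightarrow> eqv K s s"
  unfolding eqv_def by (auto intro!: exI[of _ 1] JV_zero)

lemma eqv_sym:
  assumes "eqv K s t" 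
  shows "eqv (K :: 'k::field itself) t s"
proof -
  obtain c :: 'k where c: "c \<noteq> 0" "bs s - psc c (bs t) \<in> JV (lset s) (tdeg s)"
    using assms by (auto simp: eqv_def)
  have "psc (- inverse c) (bs s - psc c (bs t)) = bs t - psc (inverse c) (bs s)"
    using c(1) by (simp add: psc_diff psc_uminus)
  then have "bs t - psc (inverse c) (bs s) \<in> JV (lset s) (tdeg s)"
    using JV_psc[OF c(2)] by metis
  then show ?thesis
    using assms c(1) unfolding eqv_def by (auto intro!: exI[of _ "inverse c"])
qed

lemma eqv_trans:
  assumes "eqv K s t" "eqv K t u" 
  shows "eqv (K :: 'k::field itself) s u"
proof -
  obtain c :: 'k where c: "c \<noteq> 0" "bs s - psc c (bs t) \<in> JV (lset s) (tdeg s)"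
    using assms by (auto simp: eqv_def)
  obtain d :: 'k where d: "d \<noteq> 0" "bs t - psc d (bs u) \<in> JV (lset s) (tdeg s)"
    using assms by (auto simp: eqv_def)
  have "(bs s - psc c (bs t)) + psc c (bs t - psc d (bs u)) = bs s - psc (c * d) (bs u)"
    by (simp add: psc_diff)
  then have "bs s - psc (c * d) (bs u) \<in> JV (lset s) (tdeg s)"
    using JV_add[OF c(2) JV_psc[OF d(2)], of c] by metis
  then show ?thesis
    using assms c(1) d(1) unfolding eqv_def by (auto intro!: exI[of _ "c * d"])
qed

lemma eqv_Mul_left:
  assumes "eqv K s t" "well u" "lset s \<inter> lset u = {}"
  shows "eqv (K :: 'k::field itself) (Mul s u) (Mul t u)"
proof -
  obtain c :: 'k where c: "c \<noteq> 0" "bs s - psc c (bs t) \<in> JV (lset s) (tdeg s)"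
    using assms by (auto simp: eqv_def)
  have "mulc (bs s - psc c (bs t)) (bs u) = bs (Mul s u) - psc c (bs (Mul t u))"
    by (simp add: plinear_diff[OF pl_mulc_left] plinear_psc[OF pl_mulc_left])
  then have "bs (Mul s u) - psc c (bs (Mul t u)) \<in> JV (lset s \<union> lset u) (tdeg s + tdeg u)"
    using JV_mulc(1)[OF c(2) well_ptrees[OF assms(2)] assms(3)] by simp
  then show ?thesis
    using assms c(1) unfolding eqv_def by auto
qed

lemma eqv_Mul_right:
  assumes "eqv K s t" "well u" "lset s \<inter> lset u = {}"
  shows "eqv (K :: 'k::field itself) (Mul u s) (Mul u t)"
proof -
  obtain c :: 'k where c: "c \<noteq> 0" "bs s - psc c (bs t) \<in> JV (lset s) (tdeg s)"
    using assms by (auto simp: eqv_def)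
  have "mulc (bs u) (bs s - psc c (bs t)) = bs (Mul u s) - psc c (bs (Mul u t))"
    by (simp add: plinear_diff[OF pl_mulc_right] plinear_psc[OF pl_mulc_right])
  then have "bs (Mul u s) - psc c (bs (Mul u t)) \<in> JV (lset s \<union> lset u) (tdeg s + tdeg u)"
    using JV_mulc(2)[OF c(2) well_ptrees[OF assms(2)] assms(3)] by simp
  then show ?thesis
    using assms c(1) unfolding eqv_def by (auto simp: Un_commute add.commute)
qed

lemma eqv_Mul:
  assumes "eqv K s s'" "eqv K t t'" "lset s \<inter> lset t = {}"
  shows "eqv K (Mul s t) (Mul s' t')"
proof (rule eqv_trans)
  show "eqv K (Mul s t) (Mul s' t)"
    using assms by (intro eqv_Mul_left) (auto simp: eqv_def)
  show "eqv K (Mul s' t) (Mul s' t')"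
    using assms by (intro eqv_Mul_right) (auto simp: eqv_def)
qed

lemma eqv_Del:
  assumes "eqv K s t" "1 \<le> a"
  shows "eqv (K :: 'k::field itself) (Del a s) (Del a t)"
proof -
  obtain c :: 'k where c: "c \<noteq> 0" "bs s - psc c (bs t) \<in> JV (lset s) (tdeg s)"
    using assms by (auto simp: eqv_def)
  have "delc a (bs s - psc c (bs t)) = bs (Del a s) - psc c (bs (Del a t))"
    by (simp add: plinear_diff[OF pl_delc] plinear_psc[OF pl_delc])
  then have "bs (Del a s) - psc c (bs (Del a t)) \<in> JV (lset s) (tdeg s + (1 - 2 * int a))"
    using JV_delc[OF c(2) assms(2)] by simp
  then show ?thesis
    using assms c(1) unfolding eqv_def by (auto simp: add.commute)
qed

lemma eqvI:
  fixes c d :: "'k::field"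
  assumes "psc c (bs s) - psc d (bs t) \<in> JV (lset s) (tdeg s)" "c \<noteq> 0" "d \<noteq> 0"
    "well s" "well t" "lset s = lset t" "tdeg s = tdeg t"
  shows "eqv (K :: 'k itself) s t"
proof -
  have "psc (inverse c) (psc c (bs s) - psc d (bs t)) = bs s - psc (inverse c * d) (bs t)"
    using assms(2) by (simp add: psc_diff)
  then have "bs s - psc (inverse c * d) (bs t) \<in> JV (lset s) (tdeg s)"
    using JV_psc[OF assms(1), of "inverse c"] by simp
  then show ?thesis
    using assms unfolding eqv_def by (auto intro!: exI[of _ "inverse c * d"])
qed

section \<open>Trees of equal shape\<close>

lemma eqv_commute:
  assumes "well s" "well t" "lset s \<inter> lset t = {}"
  shows "eqv (K :: 'k::field itself) (Mul s t) (Mul t s)"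
proof -
  let ?\<tau> = "\<lambda>i. if i = (1::nat) then t else s"
  have "\<exists>\<epsilon>. (\<forall>s. \<epsilon> s \<noteq> 0) \<and> lin (\<lambda>s. psc (\<epsilon> s) (bs (subst ?\<tau> s)))
      (bs (Mul (Leaf 2) (Leaf 1)) - bs (Mul (Leaf 1) (Leaf 2)) :: 'k comb)
    \<in> JV (\<Union>i\<in>{1..2}. lset (?\<tau> i)) (0 + (\<Sum>i\<in>{1..2}. tdeg (?\<tau> i)))"
    by (rule relation_instance[OF ideal_comm]) (use assms in \<open>auto split: if_splits\<close>)
  moreover have e: "{1..2} = {1, 2::nat}"
    by auto
  ultimately obtain \<epsilon> :: "nat tree \<Rightarrow> 'k" where "\<forall>s. \<epsilon> s \<noteq> 0"
      "psc (\<epsilon> (Mul (Leaf 2) (Leaf 1))) (bs (Mul s t)) - psc (\<epsilon> (Mul (Leaf 1) (Leaf 2))) (bs (Mul t s))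
        \<in> JV (lset t \<union> lset s) (tdeg t + tdeg s)"
    unfolding e by (auto simp: lin_diff)
  then show ?thesis
    using assms by (intro eqvI) (auto simp: Un_commute add.commute)
qed

lemma eqv_assoc:
  assumes "well s" "well t" "well u" "lset s \<inter> lset t = {}" "lset s \<inter> lset u = {}" "lset t \<inter> lset u = {}"
  shows "eqv (K :: 'k::field itself) (Mul (Mul s t) u) (Mul s (Mul t u))"
proof -
  let ?\<tau> = "\<lambda>i. if i = (1::nat) then s else if i = 2 then t else u"
  have "\<exists>\<epsilon>. (\<forall>s. \<epsilon> s \<noteq> 0) \<and> lin (\<lambda>s. psc (\<epsilon> s) (bs (subst ?\<tau> s)))
      (bs (Mul (Mul (Leaf 1) (Leaf 2)) (Leaf 3)) - bs (Mul (Leaf 1) (Mul (Leaf 2) (Leaf 3))) :: 'k comb)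
    \<in> JV (\<Union>i\<in>{1..3}. lset (?\<tau> i)) (0 + (\<Sum>i\<in>{1..3}. tdeg (?\<tau> i)))"
    by (rule relation_instance[OF ideal_assoc]) (use assms in \<open>auto split: if_splits\<close>)
  moreover have e: "{1..3} = {1, 2, 3::nat}"
    by auto
  ultimately obtain \<epsilon> :: "nat tree \<Rightarrow> 'k" where \<epsilon>: "\<forall>s. \<epsilon> s \<noteq> 0"
      "psc (\<epsilon> (Mul (Mul (Leaf 1) (Leaf 2)) (Leaf 3))) (bs (Mul (Mul s t) u)) -
       psc (\<epsilon> (Mul (Leaf 1) (Mul (Leaf 2) (Leaf 3)))) (bs (Mul s (Mul t u)))
        \<in> JV (lset s \<union> (lset t \<union> lset u)) (tdeg s + (tdeg t + tdeg u))"
    unfolding e by (auto simp: lin_diff)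
  show ?thesis
    by (rule eqvI) (use \<epsilon> assms in \<open>auto simp: Un_assoc add.assoc\<close>)
qed

lemma well_sh: "well t \<Longrightarrow> pdis (sh t)"
  by (simp add: well_def pdis_sh)

lemma sh_Mul_diff:
  assumes "lset s \<inter> lset t = {}" "T |\<in>| sh s"
  shows "(sh s |\<union>| sh t) |-| {|T|} = (sh s |-| {|T|}) |\<union>| sh t"
proof -
  have "T |\<notin>| sh t"
    using dis_disjoint[OF dis_sh[OF assms(1)]] assms(2) by auto
  then show ?thesis
    by auto
qed

text \<open>Commutativity and associativity bring any chosen factor to the front. They preserve the
  size, which keeps the induction of \<open>eqv_of_sh\<close> going.\<close>

lemma eqv_split:
  assumes "well s" "T |\<in>| sh s" "sh s \<noteq> {|T|}"
  shows "\<exists>s1 s2. eqv K s (Mul s1 s2) \<and> sh s1 = {|T|} \<and> sh s2 = sh s |-| {|T|} \<and> size (Mul s1 s2) = size s"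
  using assms
proof (induction s arbitrary: T)
  case (Mul u v)
  have main: "\<exists>s1 s2. eqv K (Mul u v) (Mul s1 s2) \<and> sh s1 = {|T|} \<and> sh s2 = (sh u |\<union>| sh v) |-| {|T|} \<and>
      size (Mul s1 s2) = size (Mul u v)"
    if IH: "sh u \<noteq> {|T|} \<Longrightarrow> \<exists>s1 s2. eqv K u (Mul s1 s2) \<and> sh s1 = {|T|} \<and> sh s2 = sh u |-| {|T|} \<and> size (Mul s1 s2) = size u"
      and w: "well u" "well v" "lset u \<inter> lset v = {}" and T: "T |\<in>| sh u" for u v
  proof (cases "sh u = {|T|}")
    case True
    then show ?thesis
      using w sh_Mul_diff[OF w(3) T] by (intro exI[of _ u] exI[of _ v]) (auto intro: eqv_refl)
  next
    case False
    then obtain u1 u2 where u: "eqv K u (Mul u1 u2)" "sh u1 = {|T|}" "sh u2 = sh u |-| {|T|}" "size (Mul u1 u2) = size u"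
      using IH by blast
    then have wu: "well u1" "well u2" "lset u1 \<inter> lset u2 = {}" "lset u1 \<union> lset u2 = lset u"
      by (auto simp: eqv_def)
    have 1: "eqv K (Mul u v) (Mul (Mul u1 u2) v)"
      by (rule eqv_Mul_left[OF u(1) w(2,3)])
    have "eqv K (Mul (Mul u1 u2) v) (Mul u1 (Mul u2 v))"
      using wu w by (intro eqv_assoc) auto
    with 1 have "eqv K (Mul u v) (Mul u1 (Mul u2 v))"
      by (rule eqv_trans)
    moreover have "sh (Mul u2 v) = (sh u |\<union>| sh v) |-| {|T|}" "size (Mul u1 (Mul u2 v)) = size (Mul u v)"
      using u(3,4) sh_Mul_diff[OF w(3) T] by simp_all
    ultimately show ?thesis
      using u(2) by blast
  qed
  have w: "well u" "well v" "lset u \<inter> lset v = {}" "lset v \<inter> lset u = {}"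
    using Mul.prems(1) by auto
  show ?case
  proof (cases "T |\<in>| sh u")
    case True
    show ?thesis
      using main[OF Mul.IH(1)[OF w(1) True] w(1,2,3) True] by simp
  next
    case False
    then have T: "T |\<in>| sh v"
      using Mul.prems(2) by simp
    obtain s1 s2 where s: "eqv K (Mul v u) (Mul s1 s2)" "sh s1 = {|T|}" "sh s2 = (sh v |\<union>| sh u) |-| {|T|}"
        "size (Mul s1 s2) = size (Mul v u)"
      using main[OF Mul.IH(2)[OF w(2) T] w(2,1,4) T] by blast
    have "eqv K (Mul u v) (Mul s1 s2)"
      using eqv_trans[OF eqv_commute s(1)] w by blast
    moreover have "sh s2 = sh (Mul u v) |-| {|T|}" "size (Mul s1 s2) = size (Mul u v)"
      using s(3,4) by (simp_all add: funion_commute)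
    ultimately show ?thesis
      using s(2) by blast
  qed
qed auto

lemma sh_single_cases:
  assumes "well t" "sh t = {|T|}"
  shows "(\<exists>j. t = Leaf j) \<or> (\<exists>a s. t = Del a s)"
proof (cases t)
  case (Mul u v)
  have "sh u |\<subseteq>| {|T|}" "sh v |\<subseteq>| {|T|}"
    using assms(2) Mul by auto
  then have "sh u = {|T|}" "sh v = {|T|}"
    using sh_nonempty fsubset_fsingletonD by metis+
  moreover have "fset (sh u) \<inter> fset (sh v) = {}"
    using assms(1) Mul by (intro dis_disjoint dis_sh) simp
  ultimately show ?thesis
    by simp
qed auto

text \<open>For a product the same factor is brought to the front of both trees, and then the
  factors of equal shape are compared by induction on the size.\<close>

lemma eqv_of_sh:
  "well s \<Longrightarrow> well t \<Longrightarrow> sh s = sh t \<Longrightarrow> eqv K s t"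
proof (induction "size s" arbitrary: s t rule: less_induct)
  case less
  show ?case
  proof (cases s)
    case (Leaf j)
    then obtain i where "t = Leaf i"
      using sh_single_cases[OF less.prems(2)] less.prems(3) by fastforce
    then show ?thesis
      using Leaf less.prems by (auto intro: eqv_refl)
  next
    case (Del a s')
    then obtain t' where t': "t = Del a t'" "sh s' = sh t'"
      using sh_single_cases[OF less.prems(2)] less.prems(3) by fastforce
    then have "eqv K s' t'"
      using less Del by auto
    then show ?thesis
      using Del t' less.prems by (auto intro: eqv_Del)
  next
    case (Mul u v)
    obtain T where T: "T |\<in>| sh s"
      using sh_nonempty[of s] by (metis ex_fin_conv)
    have nT: "sh s \<noteq> {|T|}"
      using sh_single_cases[OF less.prems(1)] Mul by blast
    obtain s1 s2 where s: "eqv K s (Mul s1 s2)" "sh s1 = {|T|}" "sh s2 = sh s |-| {|T|}" "size (Mul s1 s2) = size s"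
      using eqv_split[OF less.prems(1) T nT] by blast
    obtain t1 t2 where t: "eqv K t (Mul t1 t2)" "sh t1 = {|T|}" "sh t2 = sh t |-| {|T|}" "size (Mul t1 t2) = size t"
      using eqv_split[OF less.prems(2), of T] T nT unfolding less.prems(3) by blast
    have w: "well s1" "well s2" "well t1" "well t2" "lset s1 \<inter> lset s2 = {}"
      using s t by (auto simp: eqv_def)
    have "size s1 < size s" "size s2 < size s" "sh s1 = sh t1" "sh s2 = sh t2"
      using s(2-4) t(2-4) less.prems(3) by simp_all
    then have "eqv K s1 t1" "eqv K s2 t2"
      using less.hyps w by blast+
    then have "eqv K (Mul s1 s2) (Mul t1 t2)"
      using w by (intro eqv_Mul)
    then show ?thesis
      using s(1) t(1) eqv_trans eqv_sym by metis
  qed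
qed

section \<open>Rewriting by the order relation\<close>

primrec nd :: "nat tree \<Rightarrow> nat" where
  "nd (Leaf j) = 0"
| "nd (Mul s t) = nd s + nd t"
| "nd (Del a t) = Suc (nd t)"

text \<open>All generators have the same nonzero degree here, so the degree of a tree determines how
  often Delta_a occurs in it.\<close>

lemma tdeg_nd: "deltas t \<subseteq> {a} \<Longrightarrow> tdeg t = int (nd t) * (1 - 2 * int a)"
  by (induction t) (auto simp: algebra_simps)

lemma length_leaves_subst: "length (leaves (subst \<tau> u)) = (\<Sum>j\<leftarrow>leaves u. length (leaves (\<tau> j)))"
  by (induction u) auto

lemma pm_subst_le:
  "pm (subst \<tau> u) \<le> (\<Sum>j\<leftarrow>leaves u. pm (\<tau> j)) + nd u * (\<Sum>j\<leftarrow>leaves u. length (leaves (\<tau> j)))"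
  by (induction u) (auto simp: algebra_simps length_leaves_subst)

lemma pm_subst_nd0: "nd u = 0 \<Longrightarrow> pm (subst \<tau> u) = (\<Sum>j\<leftarrow>leaves u. pm (\<tau> j))"
  by (induction u) auto

lemma length_leaves_sum_pos: "0 < (\<Sum>j\<leftarrow>leaves u. length (leaves (\<tau> j)))"
  using leaves_nonempty[of "subst \<tau> u"] by (simp flip: length_leaves_subst)

text \<open>The single Delta lies in one of the two factors and covers only the leaves below it,
  whereas the other factor has at least one leaf. So the total number of leaves is not
  attained.\<close>

lemma pm_subst_less:
  assumes "nd s + nd t = 1"
  shows "pm (subst \<tau> (Mul s t)) < (\<Sum>j\<leftarrow>leaves (Mul s t). pm (\<tau> j)) + (\<Sum>j\<leftarrow>leaves (Mul s t). length (leaves (\<tau> j)))"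
proof -
  consider "nd s = 0" "nd t = 1" | "nd s = 1" "nd t = 0"
    using assms by linarith
  then show ?thesis
    using pm_subst_le[of \<tau> s] pm_subst_le[of \<tau> t] length_leaves_sum_pos[of \<tau> s] length_leaves_sum_pos[of \<tau> t]
    by cases auto
qed

text \<open>Of the three terms of the recursion only the first, which multiplies the last two inputs
  inside, can keep Delta_a at the root; the other two have \<open>mu\<close> at the root.\<close>

lemma order_op_leading:
  assumes "1 \<le> a"
  shows "\<exists>u r. order_op (Delta a :: 'k::field comb) (Suc k) = bs (Del a u) + r \<and> u \<in> trees {1..} (Suc k) 0 \<and> nd u = 0 \<and>
     (\<forall>w\<in>keys r. \<exists>s t. w = Mul s t)"
proof (induction k)
  case 0
  show ?case
    by (intro exI[of _ "Leaf 1"] exI[of _ 0]) (simp add: Delta_def trees_def)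
next
  case (Suc k)
  define n where "n = Suc k"
  obtain u and r :: "'k comb" where u: "order_op (Delta a) n = bs (Del a u) + r" "u \<in> trees {1..} n 0" "nd u = 0"
      and r: "\<And>w. w \<in> keys r \<Longrightarrow> \<exists>s t. w = Mul s t"
    using Suc unfolding n_def by auto
  let ?m = "Mul (Leaf 1) (Leaf 2)" and ?G = "free_circ 1 mu (order_op (Delta a :: 'k comb) n)"
  have G: "\<exists>s t. w = Mul s t" if "w \<in> keys ?G" for w
  proof -
    have "\<exists>t (c :: 'k). w \<in> keys (psc c (bs (graft 1 ?m t)))"
      using that unfolding free_circ_lin mu_def lin_bs by (elim in_keys_linE) (intro exI)
    then obtain t and c :: 'k where "w \<in> keys (psc c (bs (graft 1 ?m t)))"
      by blast
    then have "w = graft 1 ?m t"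
      by (auto dest: in_keys_pscD)
    then show ?thesis
      by (simp add: graft_def)
  qed
  have G': "\<exists>s t. w = Mul s t" if w: "w \<in> keys (free_act \<sigma> ?G)" for w \<sigma>
  proof -
    obtain v where "v \<in> keys ?G" "w = map_tree (inv_into UNIV \<sigma>) v"
      using w unfolding free_act_lin by (auto elim!: in_keys_linE)
    then show ?thesis
      using G[of v] by auto
  qed
  have R: "\<exists>s t. w = Mul s t" if w: "w \<in> keys (free_circ n r mu)" for w
  proof -
    obtain v where v: "v \<in> keys r" "w = graft n v ?m"
      using w unfolding free_circ_lin mu_def lin_bs by (auto elim!: in_keys_linE dest!: in_keys_pscD)
    obtain s t where "v = Mul s t"
      using r[OF v(1)] by blast
    then show ?thesis
      using v(2) by (simp add: graft_def)
  qed
  have "free_circ n (bs (Del a u)) mu = (bs (Del a (graft n u ?m)) :: 'k comb)"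
    by (simp add: mu_def free_circ_bs graft_def)
  then have "order_op (Delta a :: 'k comb) (Suc n) = bs (Del a (graft n u ?m)) +
      (free_circ n r mu - ?G - free_act (transpose n (n + 1)) ?G)"
    unfolding n_def by (simp add: Let_def u(1)[unfolded n_def] plinear_add[OF pl_circ_left])
  moreover have "graft n u ?m \<in> trees {1..} (Suc n) 0"
  proof -
    have "?m \<in> trees {1..} 2 0"
      by (auto simp: trees_def)
    from graft_in_trees[OF u(2) this, of n] show ?thesis
      by (simp add: n_def)
  qed
  moreover have "nd (graft n u ?m) = 0"
  proof -
    have "(\<And>j. nd (f j) = 0) \<Longrightarrow> nd (subst f u) = 0" for f
      using u(3) by (induction u) auto
    then show ?thesis
      unfolding graft_def by (auto simp: map_tree_subst)
  qed
  ultimately show ?case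
    using G G' R unfolding n_def by (blast dest: keys_minusE)
qed

lemma ex_subtree_of_sh: "well w \<Longrightarrow> u |\<in>| sh w \<Longrightarrow> \<exists>t. sh t = {|u|} \<and> distinct (leaves t)"
proof (induction w)
  case (Leaf j)
  then show ?case
    by (intro exI[of _ "Leaf j"]) simp
next
  case (Del a w)
  then show ?case
    by (intro exI[of _ "Del a w"]) (auto simp: well_def)
qed auto

lemma ex_tree_of_subshape:
  assumes "well w" "F |\<subseteq>| sh w" "F \<noteq> {||}"
  shows "\<exists>t. sh t = F \<and> well t"
proof -
  have "\<exists>t. sh t = F \<and> distinct (leaves t)"
    by (rule ex_tree_of_forest) (use assms pdis_mono[OF assms(2) well_sh] ex_subtree_of_sh[OF assms(1)] in auto)
  then obtain t where t: "sh t = F" "distinct (leaves t)"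
    by blast
  have "deltas t \<subseteq> deltas w"
    using dlf_mono[OF assms(2)] t(1) dlf_sh by metis
  then show ?thesis
    using t assms(1) by (auto simp: well_def)
qed

lemma sh_subst: "nd u = 0 \<Longrightarrow> fset (sh (subst \<tau> u)) = (\<Union>j\<in>lset u. fset (sh (\<tau> j)))"
  by (induction u) auto

lemma inj_int_image: "int ` A \<inter> int ` B = {} \<Longrightarrow> A \<inter> B = {}"
  by auto

text \<open>
  The order relation rewrites \<open>\<Delta>\<^sub>a\<close> of a product with at least \<open>a + 2\<close> factors into trees in which
  \<open>\<Delta>\<^sub>a\<close> is applied to fewer leaves.
\<close>

lemma order_reduction:
  assumes w: "well w" and a: "1 \<le> a" and c: "a + 2 \<le> fcard (sh w)"
  shows "\<exists>y :: 'k::field comb. keys y \<subseteq> ptrees (lset w) (tdeg (Del a w)) \<and>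
    (\<forall>u\<in>keys y. pm u < pm (Del a w)) \<and> bs (Del a w) - y \<in> JV (lset w) (tdeg (Del a w))"
proof -
  note order_op.simps(3) [simp del]
  let ?n = "a + 2"
  obtain f where f: "bij_betw f {1..fcard (sh w)} (fset (sh w))"
    using ex_bij_betw_nat_finite_1[of "fset (sh w)"] by (auto simp: fcard.rep_eq)
  \<comment> \<open>The first \<open>a + 1\<close> factors are taken singly and all remaining ones,
    of which there is at least one, fill the last of the \<open>a + 2\<close> inputs of the order
    relation.\<close>
  define F where "F j = (if j \<le> a + 1 then {|f j|} else sh w |-| (f |`| fset_of_list [1..<a + 2]))" for j
  have fmem: "f j |\<in>| sh w" if "j \<in> {1..?n}" for j
    using f that c by (auto simp: bij_betw_def)
  have finj: "\<lbrakk>f i = f j; i \<in> {1..?n}; j \<in> {1..?n}\<rbrakk> \<Longrightarrow> i = j" for i j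
    using f c by (auto simp: bij_betw_def dest: inj_onD)
  have Fset: "fset (F j) = (if j \<le> a + 1 then {f j} else fset (sh w) - f ` {1..<a + 2})" for j
    unfolding F_def by (simp add: fset_of_list.rep_eq del: upt_Suc)
  have F: "F j |\<subseteq>| sh w" "F j \<noteq> {||}" if "j \<in> {1..?n}" for j
  proof -
    show "F j |\<subseteq>| sh w"
      using fmem[OF that] by (auto simp: F_def)
    have "f (a + 2) \<in> fset (sh w) - f ` {1..<a + 2}"
      using fmem[of "a + 2"] finj[of "a + 2"] by fastforce
    then have "fset (F j) \<noteq> {}"
      unfolding Fset by auto
    then show "F j \<noteq> {||}"
      by auto
  qed
  have Fdisj: "fset (F i) \<inter> fset (F j) = {}" if "i \<in> {1..?n}" "j \<in> {1..?n}" "i \<noteq> j" for i j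
    using that finj[of i j] unfolding Fset by auto
  have FUn: "(\<Union>j\<in>{1..?n}. fset (F j)) = fset (sh w)"
  proof
    show "(\<Union>j\<in>{1..?n}. fset (F j)) \<subseteq> fset (sh w)"
      using F(1) by fast
    show "fset (sh w) \<subseteq> (\<Union>j\<in>{1..?n}. fset (F j))"
    proof
      fix x assume x: "x \<in> fset (sh w)"
      show "x \<in> (\<Union>j\<in>{1..?n}. fset (F j))"
      proof (cases "x \<in> f ` {1..<a + 2}")
        case True
        then show ?thesis
          unfolding Fset by auto
      next
        case False
        then have "x \<in> fset (F (a + 2))"
          using x unfolding Fset by simp
        then show ?thesis
          by auto
      qed
    qed
  qed
  have "\<forall>j\<in>{1..?n}. \<exists>t. sh t = F j \<and> well t"
    using ex_tree_of_subshape[OF w] F by blast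
  then obtain \<tau> where \<tau>: "\<And>j. j \<in> {1..?n} \<Longrightarrow> sh (\<tau> j) = F j" "\<And>j. j \<in> {1..?n} \<Longrightarrow> well (\<tau> j)"
    by metis
  have disj: "lset (\<tau> i) \<inter> lset (\<tau> j) = {}" if "i \<in> {1..?n}" "j \<in> {1..?n}" "i \<noteq> j" for i j
  proof -
    have "F j |\<subseteq>| sh w |-| F i"
      using Fdisj[OF that] F(1)[OF that(2)] by auto
    then have "fl (F i) \<inter> fl (F j) = {}"
      using pdis_dis_diff[OF well_sh[OF w] F(1)[OF that(1)]] fl_mono[of "F j" "sh w |-| F i"]
      by (auto simp: dis_def)
    then show ?thesis
      using \<tau>(1) that by (metis fl_sh inj_int_image)
  qed
  obtain u and r :: "'k comb" where u: "order_op (Delta a) ?n = bs (Del a u) + r" "u \<in> trees {1..} ?n 0" "nd u = 0"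
    and r: "\<And>v. v \<in> keys r \<Longrightarrow> \<exists>s t. v = Mul s t"
    using order_op_leading[OF a, of "Suc a", where 'k = 'k] by auto
  have O: "keys (order_op (Delta a :: 'k comb) ?n) \<subseteq> trees {a} ?n (1 - 2 * int a)"
    using order_op_trees[of a "{a}" "Suc a"] by simp
  have r': "r = order_op (Delta a) ?n - bs (Del a u)"
    unfolding u(1) by simp
  have "Del a u \<in> trees {a} ?n (1 - 2 * int a)"
  proof -
    have "nd u = 0 \<Longrightarrow> deltas u = {}"
      by (induction u) auto
    then show ?thesis
      using u by (auto simp: trees_def)
  qed
  then have rt: "v \<in> trees {a} ?n (1 - 2 * int a)" if "v \<in> keys r" for v
    using that O unfolding r' by (auto dest!: keys_minusE)
  have lu: "leaves u = leaves u" "lset u = {1..?n}" "distinct (leaves u)"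
    using u(2) by (auto simp: trees_def)
  \<comment> \<open>The product of the groups has the shape of \<open>w\<close>, so Delta_a of
    \<open>w\<close> is equivalent to the leading term of the relation filled with these
    groups.\<close>
  have fsh: "sh (subst \<tau> u) = sh w"
  proof -
    have "fset (sh (subst \<tau> u)) = fset (sh w)"
      unfolding sh_subst[OF u(3)] lu(2) FUn[symmetric] using \<tau>(1) by simp
    then show ?thesis
      by (simp add: fset_inject)
  qed
  have UnL: "(\<Union>i\<in>{1..?n}. lset (\<tau> i)) = lset w"
  proof -
    have "lset (subst \<tau> u) = (\<Union>i\<in>{1..?n}. lset (\<tau> i))"
      using set_leaves_subst[of \<tau> u] lu by simp
    moreover have "int ` lset (subst \<tau> u) = int ` lset w"
      using fsh by (simp flip: fl_sh)
    ultimately show ?thesis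
      by (simp add: inj_image_eq_iff)
  qed
  have wu: "well (subst \<tau> u)"
    unfolding well_def deltas_subst
  proof
    show "distinct (leaves (subst \<tau> u))"
      using lu \<tau>(2) disj by (intro distinct_leaves_subst) (auto simp: well_def)
    show "deltas u \<union> (\<Union>j\<in>lset u. deltas (\<tau> j)) \<subseteq> {1..}"
      using u(2) lu \<tau>(2) by (fastforce simp: trees_def well_def)
  qed
  have e: "eqv K (Del a w) (Del a (subst \<tau> u))" for K :: "'k itself"
    using eqv_of_sh[OF w wu] fsh a by (intro eqv_Del) auto
  have tsum: "(\<Sum>i\<in>{1..?n}. tdeg (\<tau> i)) = tdeg w"
  proof -
    have "tdeg (subst \<tau> u) = (\<Sum>i\<in>{1..?n}. tdeg (\<tau> i))"
      using tdeg_subst[OF lu(3), of \<tau>] lu(2) u(2) by (simp add: trees_def)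
    then show ?thesis
      using e[of undefined] by (simp add: eqv_def)
  qed
  let ?d = "tdeg (Del a w)"
  have "\<exists>\<epsilon> :: nat tree \<Rightarrow> 'k. (\<forall>s. \<epsilon> s \<noteq> 0) \<and> lin (\<lambda>s. psc (\<epsilon> s) (bs (subst \<tau> s))) (order_op (Delta a) ?n)
      \<in> JV (\<Union>i\<in>{1..?n}. lset (\<tau> i)) (1 - 2 * int a + (\<Sum>i\<in>{1..?n}. tdeg (\<tau> i)))"
    by (rule relation_instance[OF ideal_order[OF a]]) (rule \<tau>(2) disj; assumption)+
  then obtain \<epsilon> :: "nat tree \<Rightarrow> 'k" where \<epsilon>: "\<forall>s. \<epsilon> s \<noteq> 0" "lin (\<lambda>s. psc (\<epsilon> s) (bs (subst \<tau> s))) (order_op (Delta a) ?n) \<in> JV (lset w) ?d"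
    unfolding UnL tsum by auto
  obtain c :: 'k where c: "c \<noteq> 0" "bs (Del a w) - psc c (bs (Del a (subst \<tau> u))) \<in> JV (lset w) ?d"
    using e unfolding eqv_def by auto
  let ?e = "\<epsilon> (Del a u)"
  let ?z = "lin (\<lambda>s. psc (\<epsilon> s) (bs (subst \<tau> s))) r"
  define y where "y = psc (- (c * inverse ?e)) ?z"
  have "(bs (Del a w) - psc c (bs (Del a (subst \<tau> u)))) + psc (c * inverse ?e) (psc ?e (bs (Del a (subst \<tau> u))) + ?z) =
      bs (Del a w) - y"
    using \<epsilon>(1) by (simp add: y_def psc_add psc_uminus mult.assoc)
  moreover have "psc ?e (bs (Del a (subst \<tau> u))) + ?z \<in> JV (lset w) ?d"
    using \<epsilon>(2) unfolding u(1) by (simp add: lin_add)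
  note JV_add[OF c(2) JV_psc[OF this, of "c * inverse ?e"]]
  ultimately have 1: "bs (Del a w) - y \<in> JV (lset w) ?d"
    by (simp only:)
  have pmw: "pm (Del a w) = (\<Sum>j\<leftarrow>leaves u. pm (\<tau> j)) + (\<Sum>j\<leftarrow>leaves u. length (leaves (\<tau> j)))"
  proof -
    have "pm (Del a w) = pm (Del a (subst \<tau> u))"
    proof -
      have "pm w = pm (subst \<tau> u)"
        using msf_sh[of w] msf_sh[of "subst \<tau> u"] w wu fsh by (simp add: well_def)
      moreover have "length (leaves w) = length (leaves (subst \<tau> u))"
      proof -
        have "lset w = lset (subst \<tau> u)"
          using e[of undefined] by (simp add: eqv_def)
        then show ?thesis
          using w wu by (simp add: well_def flip: distinct_card)
      qed
      ultimately show ?thesis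
        by simp
    qed
    then show ?thesis
      using pm_subst_nd0[OF u(3), of \<tau>] by (simp add: length_leaves_subst)
  qed
  have 2: "v \<in> ptrees (lset w) ?d \<and> pm v < pm (Del a w)" if v: "v \<in> keys y" for v
  proof -
    obtain s where s: "s \<in> keys r" "v = subst \<tau> s"
      using v unfolding y_def by (auto dest!: in_keys_pscD elim!: in_keys_linE)
    have st: "s \<in> trees {a} ?n (1 - 2 * int a)"
      by (rule rt[OF s(1)])
    then have "s \<in> ptrees {1..?n} (1 - 2 * int a)"
      using a by (auto simp: trees_on_def trees_def)
    then have "v \<in> ptrees (\<Union>j\<in>{1..?n}. lset (\<tau> j)) (1 - 2 * int a + (\<Sum>j\<in>{1..?n}. tdeg (\<tau> j)))"
      unfolding s(2) by (rule subst_in_trees_on[OF _ well_ptrees[OF \<tau>(2)] disj])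
    then have vt: "v \<in> ptrees (lset w) ?d"
      unfolding UnL tsum by simp
    obtain s1 s2 where s12: "s = Mul s1 s2"
      using r[OF s(1)] by blast
    \<comment> \<open>The degree forces each term of the relation to contain Delta_a exactly
      once.\<close>
    have "int (nd s) * (1 - 2 * int a) = 1 - 2 * int a"
      using tdeg_nd[of s a] st by (simp add: trees_def)
    then have "int (nd s) = 1"
      by (metis mult_cancel_right1 odd_la even_zero)
    then have "nd s1 + nd s2 = 1"
      using s12 by simp
    then have "pm v < (\<Sum>j\<leftarrow>leaves s. pm (\<tau> j)) + (\<Sum>j\<leftarrow>leaves s. length (leaves (\<tau> j)))"
      using pm_subst_less[of s1 s2 \<tau>] s12 s(2) by simp
    also have "\<dots> = pm (Del a w)"
      unfolding pmw using st lu by (simp add: trees_def sum_list_distinct_conv_sum_set)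
    finally show ?thesis
      using vt by blast
  qed
  show ?thesis
    using 1 2 by (intro exI[of _ y]) auto
qed

lemma JV_reduce:
  fixes x y :: "'k::field comb"
  assumes fin: "finite V" and xy: "x - y \<in> JV V d"
    and red: "\<And>u. u \<in> keys y \<Longrightarrow> \<exists>z :: 'k comb. keys z \<subseteq> G \<and> bs u - z \<in> JV V d"
  shows "\<exists>z. keys z \<subseteq> G \<and> x - z \<in> JV V d"
proof -
  obtain h :: "nat tree \<Rightarrow> 'k comb" where h: "\<And>u. u \<in> keys y \<Longrightarrow> keys (h u) \<subseteq> G" "\<And>u. u \<in> keys y \<Longrightarrow> bs u - h u \<in> JV V d"
    using red by metis
  have "lin (\<lambda>u. bs u - h u) y \<in> JV V d"
    by (rule JV_lin[OF fin h(2)])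
  moreover have "lin (\<lambda>u. bs u - h u) y = y - lin h y"
    using plinear_eq_lin[OF plinear_minus[OF plinear_id plinear_lin[of h]], of y] by simp
  ultimately have "(x - y) + (y - lin h y) \<in> JV V d"
    using JV_add[OF xy] by metis
  moreover have "keys (lin h y) \<subseteq> G"
    using h(1) by (auto elim!: in_keys_linE)
  ultimately show ?thesis
    by (intro exI[of _ "lin h y"]) simp
qed

text \<open>The bound on \<open>pm\<close> is part of the statement to be proved by induction: after
  the argument of some Delta_a has been reduced, a following use of the order relation must still go
  below the original measure.\<close>

definition nf_below :: "nat tree \<Rightarrow> nat tree set" where
  "nf_below t = {u \<in> ptrees (lset t) (tdeg t). wff (sh u) \<and> pm u \<le> pm t}"

text \<open>Induction on \<open>pm\<close> and, since a factor of a product may have the same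
  \<open>pm\<close>, then on the size. The argument of a Delta_a is reduced first; if a resulting
  term has too many factors, the order relation replaces it by trees of strictly smaller
  \<open>pm\<close>, which are reduced in turn.\<close>

lemma normal_form_bs:
  "well t \<Longrightarrow> \<exists>y :: 'k::field comb. keys y \<subseteq> nf_below t \<and> bs t - y \<in> JV (lset t) (tdeg t)"
proof (induction t rule: wf_induct_rule[OF wf_measures[of "[pm, size]"]])
  case (1 t)
  show ?case
  proof (cases t)
    case (Leaf j)
    then show ?thesis
      by (intro exI[of _ "bs t"]) (simp add: nf_below_def trees_on_def JV_zero)
  next
    case (Mul u v)
    have w: "well u" "well v" "lset u \<inter> lset v = {}"
      using "1.prems" Mul by auto
    obtain y :: "'k comb" where y: "keys y \<subseteq> nf_below u" "bs u - y \<in> JV (lset u) (tdeg u)"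
      using "1.IH"[of u] w Mul by auto
    obtain z :: "'k comb" where z: "keys z \<subseteq> nf_below v" "bs v - z \<in> JV (lset v) (tdeg v)"
      using "1.IH"[of v] w Mul by auto
    have 1: "mulc (bs u - y) (bs v) \<in> JV (lset t) (tdeg t)"
      using JV_mulc(1)[OF y(2) well_ptrees[OF w(2)] w(3)] Mul by simp
    have "mulc (bs u') (bs v - z) \<in> JV (lset t) (tdeg t)" if "u' \<in> keys y" for u'
    proof -
      have "u' \<in> ptrees (lset u) (tdeg u)"
        using y(1) that by (auto simp: nf_below_def)
      then show ?thesis
        using JV_mulc(2)[OF z(2), of u' "lset u" "tdeg u"] w(3) Mul by (simp add: Un_commute add.commute Int_commute)
    qed
    then have 2: "lin (\<lambda>u'. mulc (bs u') (bs v - z)) y \<in> JV (lset t) (tdeg t)"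
      by (intro JV_lin) auto
    have "lin (\<lambda>u'. mulc (bs u') (bs v - z)) y = mulc y (bs v - z)"
      by (rule plinear_eq_lin[symmetric, OF pl_mulc_left])
    then have "bs t - mulc y z = mulc (bs u - y) (bs v) + lin (\<lambda>u'. mulc (bs u') (bs v - z)) y"
      by (simp add: Mul plinear_diff[OF pl_mulc_left] plinear_diff[OF pl_mulc_right])
    then have "bs t - mulc y z \<in> JV (lset t) (tdeg t)"
      using JV_add[OF 1 2] by simp
    moreover have "keys (mulc y z) \<subseteq> nf_below t"
    proof
      fix k assume "k \<in> keys (mulc y z)"
      then obtain u' v' where k: "k = Mul u' v'" "u' \<in> nf_below u" "v' \<in> nf_below v"
        using keys_mulc[of y z] y(1) z(1) by blast
      then have "k \<in> ptrees (lset t) (tdeg t)"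
        using trees_on_Mul[of u' "{1..}" "lset u" "tdeg u" v' "lset v" "tdeg v"] w(3) Mul
        by (simp add: nf_below_def)
      then show "k \<in> nf_below t"
        using k Mul wff_sh_Mul[of u' v'] by (auto simp: nf_below_def trees_on_def)
    qed
    ultimately show ?thesis
      by blast
  next
    case (Del a s)
    have w: "well s" "1 \<le> a"
      using "1.prems" Del by auto
    have len: "0 < length (leaves s)"
      using leaves_nonempty[of s] by simp
    obtain y :: "'k comb" where y: "keys y \<subseteq> nf_below s" "bs s - y \<in> JV (lset s) (tdeg s)"
      using "1.IH"[of s] w Del len by auto
    have "delc a (bs s - y) \<in> JV (lset t) (tdeg t)"
      using JV_delc[OF y(2) w(2)] Del by (simp add: add.commute)
    then have 1: "bs t - delc a y \<in> JV (lset t) (tdeg t)"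
      by (simp add: Del plinear_diff[OF pl_delc])
    show ?thesis
    proof (rule JV_reduce[OF _ 1])
      fix k assume "k \<in> keys (delc a y)"
      then obtain u where u: "k = Del a u" "u \<in> nf_below s"
        using keys_delc[of a y] y(1) by blast
      have u': "well u" "lset u = lset s" "tdeg u = tdeg s" "wff (sh u)" "pm u \<le> pm s"
        using u(2) ptrees_well[of u] by (auto simp: nf_below_def)
      have "length (leaves u) = length (leaves s)"
        using u' w by (simp add: well_def flip: distinct_card)
      then have k: "well k" "lset k = lset t" "tdeg k = tdeg t" "pm k \<le> pm t"
        using u' u(1) w(2) Del by auto
      show "\<exists>z :: 'k comb. keys z \<subseteq> nf_below t \<and> bs k - z \<in> JV (lset t) (tdeg t)"
      proof (cases "fcard (sh u) \<le> a + 1")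
        case True
        then have "k \<in> nf_below t"
          using k u' u(1) well_ptrees[OF k(1)] by (simp add: nf_below_def)
        then show ?thesis
          by (intro exI[of _ "bs k"]) (simp add: JV_zero)
      next
        case False
        obtain z :: "'k comb" where z: "keys z \<subseteq> ptrees (lset u) (tdeg (Del a u))"
            "\<forall>v\<in>keys z. pm v < pm (Del a u)" "bs (Del a u) - z \<in> JV (lset u) (tdeg (Del a u))"
          using order_reduction[OF u'(1) w(2)] False by auto
        have z': "bs k - z \<in> JV (lset t) (tdeg t)"
          using z(3) u(1) k by simp
        show ?thesis
        proof (rule JV_reduce[OF _ z'])
          fix v assume v: "v \<in> keys z"
          then have "v \<in> ptrees (lset t) (tdeg t)"
            using z(1) u k by auto
          then have v': "well v" "lset v = lset t" "tdeg v = tdeg t"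
            using ptrees_well[of v] by auto
          have "pm v < pm t"
            using z(2) v u(1) k(4) by fastforce
          then have "\<exists>x :: 'k comb. keys x \<subseteq> nf_below v \<and> bs v - x \<in> JV (lset v) (tdeg v)" "nf_below v \<subseteq> nf_below t"
            using "1.IH"[of v] v' by (auto simp: nf_below_def)
          then show "\<exists>x :: 'k comb. keys x \<subseteq> nf_below t \<and> bs v - x \<in> JV (lset t) (tdeg t)"
            using v' by (metis subset_trans)
        qed simp
      qed
    qed simp
  qed
qed

section \<open>The kernel of evaluation is the ideal\<close>

lemma even_forests_leaves: "even_forests (\<lambda>j. {|Lf (int j)|})"
  by (simp add: even_forests_def)

lemma EE_ideal: "x \<in> BV_inf_ideal n d \<Longrightarrow> EE x = 0"
  using BV_inf_ideal_acts_zero(2)[of x n d] even_forests_leaves unfolding acts_zero_def by blast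

text \<open>Normal forms with distinct shapes have distinct leading forests. At the shape of a tree
  of maximal measure no other tree contributes, so its coefficient cannot cancel.\<close>

lemma EE_normal_forms_inj:
  fixes w :: "'k::field comb"
  assumes nf: "\<And>u. u \<in> keys w \<Longrightarrow> distinct (leaves u) \<and> wff (sh u)" and inj: "inj_on sh (keys w)" and 0: "EE w = 0"
  shows "w = 0"
proof (rule ccontr)
  assume "w \<noteq> 0"
  then have ne: "keys w \<noteq> {}" 
    by simp
  obtain u where u: "u \<in> keys w" "\<And>v. v \<in> keys w \<Longrightarrow> pm v \<le> pm u"
    using ne obtains_MAX[of "keys w" pm] by (metis Max_ge finite_imageI finite_keys imageI)
  have lead: "\<exists>c x. c \<noteq> 0 \<and> ev vE v = psc c (bs (sh v)) + x \<and> (\<forall>K\<in>keys (x :: 'k fcomb). msf K < msf (sh v))"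
    if "v \<in> keys w" for v
    using ev_leading[of v, where 'k = 'k] nf[OF that] by meson
  have other: "lkp (ev vE v :: 'k fcomb) (sh u) = 0" if v: "v \<in> keys w" "v \<noteq> u" for v
  proof -
    obtain c x where x: "ev vE v = psc c (bs (sh v)) + x" "\<forall>K\<in>keys (x :: 'k fcomb). msf K < msf (sh v)"
      using lead[OF v(1)] by blast
    have "sh v \<noteq> sh u"
      using inj u(1) v by (auto dest: inj_onD)
    moreover have "msf (sh v) \<le> msf (sh u)"
      using u nf v(1) by (simp add: msf_sh)
    then have "lkp x (sh u) = 0"
      using x(2) by (meson in_keys_iff linorder_not_less)
    ultimately show ?thesis
      unfolding x(1) by (simp add: lookup_add lookup_single)
  qed
  obtain c x where c: "c \<noteq> 0" "ev vE u = psc c (bs (sh u)) + x" "\<forall>K\<in>keys (x :: 'k fcomb). msf K < msf (sh u)"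
    using lead[OF u(1)] by blast
  have "lkp (EE w) (sh u) = (\<Sum>v\<in>keys w. lkp w v * lkp (ev vE v) (sh u))"
    by (simp add: lin_def lookup_sum)
  also have "\<dots> = lkp w u * lkp (ev vE u) (sh u)"
    using u(1) other by (subst sum.remove[of _ u]) auto
  also have "lkp (ev vE u) (sh u) = c"
  proof -
    have "lkp x (sh u) = 0"
      using c(3) by (meson in_keys_iff less_irrefl)
    then show ?thesis
      unfolding c(2) by (simp add: lookup_add)
  qed
  finally show False
    using c(1) u(1) 0 by (simp add: in_keys_iff)
qed

text \<open>Modulo the ideal the element is a combination of normal forms with one representative
  for each shape. It still evaluates to zero, so it is zero by the independence of leading terms.
  Together with \<open>EE_ideal\<close> this identifies the kernel of \<open>EE\<close>.\<close>

lemma ideal_of_EE_0: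
  fixes x :: "'k::field comb"
  assumes x: "keys x \<subseteq> trees {1..} n d" and 0: "EE x = 0"
  shows "x \<in> BV_inf_ideal n d"
proof -
  have red: "\<exists>z :: 'k comb. keys z \<subseteq> {u \<in> ptrees {1..n} d. wff (sh u)} \<and> bs u - z \<in> JV {1..n} d" if u: "u \<in> keys x" for u
  proof -
    have "u \<in> ptrees {1..n} d"
      using x u by (auto simp: trees_trees_on)
    then have u': "well u" "lset u = {1..n}" "tdeg u = d"
      using ptrees_well by blast+
    obtain y :: "'k comb" where "keys y \<subseteq> nf_below u" "bs u - y \<in> JV (lset u) (tdeg u)"
      using normal_form_bs[OF u'(1)] by blast
    then show ?thesis
      unfolding u' nf_below_def by (intro exI[of _ y]) auto
  qed
  have "x - x \<in> JV {1..n} d"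
    by (simp add: JV_zero)
  from JV_reduce[OF _ this red] obtain z where z: "keys z \<subseteq> {u \<in> ptrees {1..n} d. wff (sh u)}" "x - z \<in> JV {1..n} d"
    by auto
  \<comment> \<open>One chosen tree for each shape; on the chosen trees \<open>sh\<close> is
    injective.\<close>
  define R where "R S = (SOME t. sh t = S \<and> t \<in> ptrees {1..n} d)" for S
  have R: "sh (R (sh u)) = sh u" "R (sh u) \<in> ptrees {1..n} d" if "u \<in> ptrees {1..n} d" for u
    using someI[of "\<lambda>t. sh t = sh u \<and> t \<in> ptrees {1..n} d" u] that unfolding R_def by auto
  have "\<exists>z' :: 'k comb. keys z' \<subseteq> R ` sh ` keys z \<and> bs u - z' \<in> JV {1..n} d" if u: "u \<in> keys z" for u
  proof -
    have u': "u \<in> ptrees {1..n} d"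
      using z(1) u by auto
    have "eqv TYPE('k) u (R (sh u))"
      using ptrees_well[OF u'] ptrees_well[OF R(2)[OF u']] R(1)[OF u', symmetric] by (intro eqv_of_sh) blast+
    then obtain c :: 'k where "bs u - psc c (bs (R (sh u))) \<in> JV {1..n} d"
      using ptrees_well[OF u'] by (auto simp: eqv_def)
    then show ?thesis
      using u by (intro exI[of _ "psc c (bs (R (sh u)))"]) (auto dest: in_keys_pscD)
  qed
  from JV_reduce[OF _ z(2) this] obtain w where w: "keys w \<subseteq> R ` sh ` keys z" "x - w \<in> JV {1..n} d"
    by auto
  have "EE (x - w) = 0"
    using w(2) EE_ideal unfolding JV_ideal by blast
  then have "EE w = 0"
    using 0 by (simp add: lin_diff)
  moreover have "distinct (leaves u) \<and> wff (sh u) \<and> R (sh u) = u" if u: "u \<in> keys w" for u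
  proof -
    obtain v where v: "v \<in> keys z" "u = R (sh v)"
      using subsetD[OF w(1) u] by blast
    then have "v \<in> ptrees {1..n} d" "wff (sh v)"
      using z(1) by auto
    then show ?thesis
      using v(2) R[of v] ptrees_well[of u] by (auto simp: well_def)
  qed
  ultimately have "w = 0"
    by (intro EE_normal_forms_inj) (auto intro: inj_on_inverseI[of _ R])
  then show ?thesis
    using w(2) unfolding JV_ideal by simp
qed

text \<open>No order relation is differentiated: \<open>EE\<close> detects the ideal and carries
  \<open>delta\<close> to \<open>dN\<close>.\<close>

lemma delta_BV_inf_ideal:
  fixes x :: "'k::field_char_0 comb"
  assumes "x \<in> BV_inf_ideal n d"
  shows "delta x \<in> BV_inf_ideal n (d + 1)"
proof (rule ideal_of_EE_0)
  show "keys (delta x) \<subseteq> trees {1..} n (d + 1)"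
  proof
    fix s assume "s \<in> keys (delta x)"
    then obtain t where t: "t \<in> keys x" "s \<in> keys (tree_delta t :: 'k comb)"
      by (elim in_keys_linE)
    then have "t \<in> trees {1..} n d"
      using BV_inf_ideal_acts_zero(1)[OF assms] by blast
    then show "s \<in> trees {1..} n (d + 1)"
      using tree_delta_keys[OF t(2)] by (simp add: trees_def) blast
  qed
  show "EE (delta x) = 0"
    using EE_ideal[OF assms] by (simp add: EE_delta plinear_zero[OF pl_cv])
qed

section \<open>A matching on trees\<close>




lemma keys_dN_bs:
  assumes "K \<in> keys (dN (bs S) :: 'k::field fcomb)"
  obtains s s' where "s |\<in>| S" "{|s'|} \<in> keys (dt s :: 'k fcomb)" "K = finsert s' (S |-| {|s|})"
    "dis {|s'|} (S |-| {|s|})" "lv s' = lv s"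
proof -
  obtain s where s: "s |\<in>| S" "K \<in> keys (psc (sg {|s|} (S |-| {|s|})) (mlt (dt s) (bs (S |-| {|s|}))) :: 'k fcomb)"
    using assms unfolding dN_bs by (elim keys_sumE) blast
  obtain L where L: "L \<in> keys (dt s :: 'k fcomb)" "dis L (S |-| {|s|})" "K = L |\<union>| (S |-| {|s|})"
    using keys_mlt[OF in_keys_pscD[OF s(2)]] by auto
  obtain t where "L = {|t|}" "lv t = lv s"
    using dt_keys[OF L(1)] by blast
  then show thesis
    using L s(1) by (intro that[of s t]) auto
qed

lemma keys_dt_Nd:
  assumes "{|e|} \<in> keys (dt (Nd a S) :: 'k::field fcomb)"
  obtains
    (split) b I where "b \<in> {1..<a}" "I |\<subseteq>| S" "I \<noteq> {||}" "fcard I \<le> a - b + 1"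
      "e = Nd b (finsert (Nd (a - b) I) (S |-| I))" "dis {|Nd (a - b) I|} (S |-| I)"
      "fcard (finsert (Nd (a - b) I) (S |-| I)) \<le> b + 1"
  | (child) s s' where "s |\<in>| S" "{|s'|} \<in> keys (dt s :: 'k fcomb)" "e = Nd a (finsert s' (S |-| {|s|}))"
      "dis {|s'|} (S |-| {|s|})" "lv s' = lv s" "fcard (finsert s' (S |-| {|s|})) \<le> a + 1"
proof -
  have la: "e = Nd b L \<and> fcard L \<le> b + 1" if "{|e|} \<in> keys (la b L :: 'k fcomb)" for b L
    using la_keys[OF that] by auto
  have "{|e|} \<in> keys (\<Sum>b\<in>{1..<a}. lin (la b) (DD (a - b) (bs S)) :: 'k fcomb) \<or>
      {|e|} \<in> keys (lin (la a) (dN (bs S)) :: 'k fcomb)"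
    using assms unfolding dt_Nd by (rule keys_minusE)
  then show thesis
  proof
    assume "{|e|} \<in> keys (\<Sum>b\<in>{1..<a}. lin (la b) (DD (a - b) (bs S)) :: 'k fcomb)"
    then obtain b L where b: "b \<in> {1..<a}" and L: "L \<in> keys (DD (a - b) (bs S) :: 'k fcomb)" "{|e|} \<in> keys (la b L :: 'k fcomb)"
      by (elim keys_sumE in_keys_linE) blast
    obtain I where "I |\<subseteq>| S" "I \<noteq> {||}" "fcard I \<le> a - b + 1" "dis {|Nd (a - b) I|} (S |-| I)"
      "L = finsert (Nd (a - b) I) (S |-| I)"
      by (rule keys_DD_bs[OF L(1)])
    then show thesis
      using la[OF L(2)] b by (intro split) auto
  next
    assume "{|e|} \<in> keys (lin (la a) (dN (bs S)) :: 'k fcomb)"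
    then obtain L where L: "L \<in> keys (dN (bs S) :: 'k fcomb)" "{|e|} \<in> keys (la a L :: 'k fcomb)"
      by (elim in_keys_linE)
    obtain s s' where "s |\<in>| S" "{|s'|} \<in> keys (dt s :: 'k fcomb)" "L = finsert s' (S |-| {|s|})"
      "dis {|s'|} (S |-| {|s|})" "lv s' = lv s"
      by (rule keys_dN_bs[OF L(1)])
    then show thesis
      using la[OF L(2)] by (intro child[of s s']) auto
  qed
qed

lemma wff_children: "wff S \<Longrightarrow> s |\<in>| S \<Longrightarrow> wft s"
  by (simp add: wff_def)

lemma dt_wf:
  assumes "{|e|} \<in> keys (dt u :: 'k::field fcomb)" "wft u" "dl u \<subseteq> {1..}"
  shows "wft e \<and> dl e \<subseteq> {1..}"
  using assms
proof (induction u arbitrary: e)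
  case (Nd a S)
  have S: "wff S" "dlf S \<subseteq> {1..}" "1 \<le> a"
    using Nd.prems by auto
  from Nd.prems(1) show ?case
  proof (cases rule: keys_dt_Nd)
    case (split b I)
    have "S |-| I |\<subseteq>| S"
      by auto
    then show ?thesis
      using split S wff_mono[of I S] wff_mono[of "S |-| I" S] dlf_mono[of I S] dlf_mono[of "S |-| I" S]
      by (auto simp: wff_finsert)
  next
    case (child s s')
    have "S |-| {|s|} |\<subseteq>| S" "{|s|} |\<subseteq>| S"
      using child(1) by auto
    moreover from this have "wft s" "dl s \<subseteq> {1..}"
      using wff_children[OF S(1) child(1)] dlf_mono[of "{|s|}" S] S(2) by auto
    then have "wft s'" "dl s' \<subseteq> {1..}"
      using Nd.IH child(1,2) by auto
    ultimately show ?thesis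
      using child S wff_mono[of "S |-| {|s|}" S] dlf_mono[of "S |-| {|s|}" S] by (auto simp: wff_finsert)
  qed
qed simp

lemma lkp_lin_la:
  "lkp (lin (la b) x) {|Nd c F|} = (if b = c \<and> F \<noteq> {||} \<and> fcard F \<le> b + 1 \<and> \<not> inert F then lkp x F else (0 :: 'k::field))"
proof -
  have "lkp (lin (la b) x) {|Nd c F|} = (\<Sum>K\<in>keys x. lkp x K * lkp (la b K :: 'k fcomb) {|Nd c F|})"
    by (simp add: lin_def lookup_sum)
  also have "\<dots> = (\<Sum>K\<in>keys x. if K = F then (if b = c \<and> F \<noteq> {||} \<and> fcard F \<le> b + 1 \<and> \<not> inert F then lkp x F else 0) else 0)"
    by (rule sum.cong) (auto simp: la_def lookup_single when_def)
  also have "\<dots> = (if b = c \<and> F \<noteq> {||} \<and> fcard F \<le> b + 1 \<and> \<not> inert F then lkp x F else 0)"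
    by (auto simp: in_keys_iff)
  finally show ?thesis .
qed

abbreviation ml :: "tr \<Rightarrow> int" where
  "ml t \<equiv> Min (lv t)"

lemma ml_in [simp]: "ml t \<in> lv t"
  by simp

lemma not_inert_wff: "wff S \<Longrightarrow> \<not> inert S"
  by (force simp: inert_def wff_def)

text \<open>Otherwise a tree of \<open>J\<close> and the node over it would be two different members
  of \<open>S\<close> with common labels.\<close>

lemma node_notin_forest:
  assumes "pdis S" "J |\<subseteq>| S" "J \<noteq> {||}"
  shows "Nd c J |\<notin>| S"
proof
  assume n: "Nd c J |\<in>| S"
  obtain j where j: "j |\<in>| J"
    using assms(3) by auto
  then have "lv j \<inter> lv (Nd c J) \<noteq> {}"
    using lv_subset_fl[OF j] assms(3) lv_nonempty[of j] by (simp add: Int_absorb2)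
  moreover have "j \<noteq> Nd c J"
    using size_child[OF j] by auto
  ultimately show False
    using assms(1,2) n j by (meson fset_mp pdis_def)
qed

lemma lkp_mlt_bs_bs: "lkp (mlt (bs S) (bs T)) K = (if dis S T \<and> K = S |\<union>| T then sg S T else (0 :: 'k::field))"
  by (simp add: mlt_bs lookup_single when_def)

text \<open>No other \<open>J\<close> contributes to this coefficient: to produce the same forest,
  its bracket would have to be a member of \<open>S\<close> already.\<close>

lemma lkp_DD_node:
  assumes "pdis S" "I |\<subseteq>| S" "I \<noteq> {||}" "fcard I \<le> c + 1" "\<not> inert I"
  shows "lkp (DD c (bs S)) (finsert (Nd c I) (S |-| I)) \<noteq> (0 :: 'k::field)"
proof -
  let ?F = "finsert (Nd c I) (S |-| I)"
  have z: "lkp (psc (sg J (S |-| J)) (mlt (la c J) (bs (S |-| J))) :: 'k fcomb) ?F = 0" if "J |\<subseteq>| S" "J \<noteq> I" for J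
  proof (cases "?F = finsert (Nd c J) (S |-| J)")
    case True
    then have "J = {||} \<or> Nd c J |\<in>| S"
      using that by auto
    then have "J = {||}"
      using node_notin_forest[OF assms(1) that(1)] by blast
    then show ?thesis
      by (simp add: la_def)
  qed (simp add: la_def lkp_mlt_bs_bs)
  have d: "dis {|Nd c I|} (S |-| I)"
    using pdis_dis_diff[OF assms(1,2)] assms(3) by (simp add: dis_def)
  have "lkp (DD c (bs S)) ?F = lkp (psc (sg I (S |-| I)) (mlt (la c I) (bs (S |-| I))) :: 'k fcomb) ?F"
    unfolding cv_bs lookup_sum using assms(2) z by (subst sum.remove[of _ I]) auto
  also have "\<dots> \<noteq> 0"
    using assms d by (simp add: la_def lkp_mlt_bs_bs)
  finally show ?thesis .
qed

text \<open>A root of label 1 arises from a root of label \<open>a\<close>, at least 2, only by the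
  splitting with outer label 1; differentiating a child keeps the label of the root. So the
  coefficient reduces to one of \<open>DD (a - 1)\<close>.\<close>

lemma dcoef_split:
  assumes S: "wff S" and I: "I |\<subseteq>| S" "I \<noteq> {||}" "fcard I \<le> a" and a: "2 \<le> a"
    and F: "fcard (finsert (Nd (a - 1) I) (S |-| I)) \<le> 2"
  shows "lkp (dt (Nd a S)) {|Nd 1 (finsert (Nd (a - 1) I) (S |-| I))|} \<noteq> (0 :: 'k::field)"
proof -
  let ?F = "finsert (Nd (a - 1) I) (S |-| I)"
  have "wff (S |-| I)"
    using wff_mono[OF _ S, of "S |-| I"] by auto
  then have ni: "\<not> inert ?F"
    using not_inert_wff[of "S |-| I"] by (auto simp: inert_def)
  have "lkp (dt (Nd a S)) {|Nd 1 ?F|} = (\<Sum>b\<in>{1..<a}. lkp (lin (la b) (DD (a - b) (bs S)) :: 'k fcomb) {|Nd 1 ?F|})"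
    using a unfolding dt_Nd lookup_minus lookup_sum lkp_lin_la by simp
  also have "\<dots> = lkp (lin (la 1) (DD (a - 1) (bs S)) :: 'k fcomb) {|Nd 1 ?F|}"
    using a by (subst sum.remove[of _ 1]) (auto simp: lkp_lin_la intro!: sum.neutral)
  also have "\<dots> = lkp (DD (a - 1) (bs S)) ?F"
    using F ni by (simp add: lkp_lin_la)
  also have "\<dots> \<noteq> 0"
    using S I wff_mono[OF I(1) S] a by (intro lkp_DD_node) (auto simp: wff_def not_inert_wff)
  finally show ?thesis .
qed

lemma dis_notin: "dis {|u|} R \<Longrightarrow> lv v = lv u \<Longrightarrow> v |\<notin>| R"
  using lv_subset_fl[of v R] lv_nonempty[of u] by (auto simp: dis_def Int_absorb2)

text \<open>Differentiating a tree other than \<open>u\<close> leaves \<open>u\<close> in the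
  forest, while the target forest does not contain it. So only the differential of \<open>u\<close>
  contributes.\<close>

lemma lkp_dN_finsert:
  assumes d: "dis {|u|} R" and uv: "lv v = lv u" "u \<noteq> v"
    and nz: "lkp (dt u) {|v|} \<noteq> (0 :: 'k::field)"
  shows "lkp (dN (bs (finsert u R))) (finsert v R) \<noteq> (0 :: 'k)"
proof -
  let ?S = "finsert u R" and ?T = "finsert v R"
  have uR: "u |\<notin>| R" "v |\<notin>| R"
    using dis_notin[OF d] uv(1) by auto
  then have diff: "?S |-| {|u|} = R"
    by auto
  have z: "lkp (psc (sg {|s|} (?S |-| {|s|})) (mlt (dt s) (bs (?S |-| {|s|}))) :: 'k fcomb) ?T = 0" if s: "s |\<in>| R" for s
  proof (rule ccontr)
    assume "\<not> ?thesis"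
    then have "?T \<in> keys (mlt (dt s) (bs (?S |-| {|s|})) :: 'k fcomb)"
      by (auto simp: in_keys_iff)
    from keys_mlt[OF this] obtain L where L: "?T = L |\<union>| (?S |-| {|s|})"
      by auto
    have "u |\<in>| L |\<union>| (?S |-| {|s|})"
      using s uR(1) by auto
    then have "u |\<in>| ?T"
      unfolding L .
    then show False
      using uR uv(2) by auto
  qed
  have "lkp (dN (bs ?S)) ?T = lkp (psc (sg {|u|} R) (mlt (dt u) (bs R)) :: 'k fcomb) ?T"
    unfolding dN_bs lookup_sum using z diff uR by (subst sum.remove[of _ u]) auto
  also have "\<dots> = sg {|u|} R * lkp (mlt (dt u) (bs R) :: 'k fcomb) ?T"
    by simp
  also have "lkp (mlt (dt u) (bs R) :: 'k fcomb) ?T = sg {|v|} R * lkp (dt u) {|v|}"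
  proof -
    have "mlt (dt u) (bs R) = lin (\<lambda>K. mlt (bs K) (bs R)) (dt u :: 'k fcomb)"
      by (rule plinear_eq_lin[OF pl_mlt_left])
    then have "lkp (mlt (dt u) (bs R) :: 'k fcomb) ?T = (\<Sum>K\<in>keys (dt u :: 'k fcomb). lkp (dt u) K * lkp (mlt (bs K) (bs R)) ?T)"
      by (simp add: lin_def lookup_sum)
    also have "\<dots> = (\<Sum>K\<in>keys (dt u :: 'k fcomb). if K = {|v|} then lkp (dt u) {|v|} * sg {|v|} R else 0)"
    proof (rule sum.cong[OF refl])
      fix K assume "K \<in> keys (dt u :: 'k fcomb)"
      then obtain t where t: "K = {|t|}" "lv t = lv u"
        using dt_keys by blast
      then have "t |\<notin>| R" "dis {|t|} R"
        using dis_notin[OF d] d by (auto simp: dis_def)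
      then show "lkp (dt u) K * lkp (mlt (bs K) (bs R)) ?T = (if K = {|v|} then lkp (dt u) {|v|} * sg {|v|} R else 0)"
        using t(1) uR(2) by (auto simp: lkp_mlt_bs_bs)
    qed
    also have "\<dots> = sg {|v|} R * lkp (dt u) {|v|}"
      by (auto simp: in_keys_iff)
    finally show ?thesis .
  qed
  finally show ?thesis
    using nz by simp
qed

lemma ml_eqI: "\<lbrakk>m \<in> A; A \<subseteq> B; Min B = m; finite B\<rbrakk> \<Longrightarrow> Min A = (m :: int)"
  by (intro Min_eqI) (auto intro: finite_subset)

section \<open>The path to the least leaf\<close>

fun dep :: "int \<Rightarrow> tr \<Rightarrow> nat" where
  "dep m (Lf j) = 0"
| "dep m (Nd a S) = (if m \<in> lv (Nd a S) then 1 else 0) + (\<Sum>s\<in>fset S. dep m s)"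

text \<open>The number of nodes on the path to the least leaf.\<close>

definition cnt :: "tr \<Rightarrow> nat" where
  "cnt t = dep (ml t) t"

lemma dep_outside: "m \<notin> lv t \<Longrightarrow> dep m t = 0"
proof (induction t)
  case (Nd a S)
  have "m \<notin> lv s" if "s |\<in>| S" for s
    using Nd.prems that lv_subset_fl[OF that] by (cases "S = {||}") auto
  then show ?case
    using Nd by simp
qed simp

lemma cnt_child:
  assumes s: "s |\<in>| S" and m: "Min (fl S) \<in> lv s" and S: "pdis S"
  shows "cnt (Nd a S) = Suc (cnt s)"
proof -
  let ?m = "Min (fl S)"
  have ne: "S \<noteq> {||}"
    using s by auto
  have ms: "ml s = ?m"
    by (rule ml_eqI[OF m lv_subset_fl[OF s]]) auto
  have "dep ?m t = 0" if "t |\<in>| S" "t \<noteq> s" for t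
    using S s that m by (intro dep_outside) (auto simp: pdis_def)
  then have "(\<Sum>t\<in>fset S. dep ?m t) = dep ?m s"
    using s by (subst sum.remove[of _ s]) auto
  moreover have "?m \<in> fl S"
    using m lv_subset_fl[OF s] by blast
  ultimately show ?thesis
    using ne ms by (simp add: cnt_def)
qed

lemma cnt_pair:
  assumes "dis {|p|} S" "S = {||} \<or> ml p < Min (fl S)" "pdis S"
  shows "cnt (Nd a (finsert p S)) = Suc (cnt p)"
proof (rule cnt_child)
  show "Min (fl (finsert p S)) \<in> lv p"
  proof (cases "S = {||}")
    case False
    then have "Min (fl (finsert p S)) = min (ml p) (Min (fl S))"
      by (simp add: Min_Un)
    also have "\<dots> = ml p"
      using assms(2) False by (intro min_absorb1) auto
    finally show ?thesis
      by simp
  qed simp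
  show "pdis (finsert p S)"
    using assms(1,3) pdis_union[of "{|p|}" S] by (simp add: pdis_def)
qed simp

text \<open>Every node has degree \<open>1 - 2 * a\<close>, hence at most -1. Since the degree is
  fixed, this bounds the number that grows along gradient paths.\<close>

lemma dep_le: "wft t \<Longrightarrow> dl t \<subseteq> {1..} \<Longrightarrow> int (dep m t) \<le> - dg t"
proof (induction t)
  case (Nd a S)
  have "int (dep m s) \<le> - dg s" if "s |\<in>| S" for s
    using Nd that dlf_mono[of "{|s|}" S] by (intro Nd.IH) (auto simp: wff_def)
  then have "(\<Sum>s\<in>fset S. int (dep m s)) \<le> - dgf S"
    unfolding dgf_def sum_negf[symmetric] by (rule sum_mono)
  then show ?case
    using Nd.prems by auto
qed simp

lemma pdis_single [simp]: "pdis {|t|}"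
  by (simp add: pdis_def)

text \<open>A node of label 1 directly above a node with one child is itself the result of splitting
  a node with one child. The search along the path has to stop there, so these nodes are excluded
  from the last rule of the matching.\<close>

definition unary :: "tr \<Rightarrow> bool" where
  "unary t \<longleftrightarrow> (\<exists>a s. t = Nd a {|s|})"

lemma unary_simps [simp]: "unary (Nd a {|s|})" "\<not> unary (Lf j)"
  by (auto simp: unary_def)

text \<open>
  The acyclic matching. The path to the least leaf is searched for the first node which either has a
  label \<open>a \<ge> 2\<close> or results from splitting such a node.
\<close>

inductive mt :: "bool \<Rightarrow> tr \<Rightarrow> tr \<Rightarrow> bool" where
  split: "\<lbrakk>2 \<le> a; S \<noteq> {||}; dis {|p|} S; pdis S; ml p < Min (fl S)\<rbrakk> \<Longrightarrow>
    mt True (Nd a (finsert p S)) (Nd 1 {|Nd (a - 1) S, p|})"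
| unary: "2 \<le> a \<Longrightarrow> mt False (Nd a {|p|}) (Nd 1 {|Nd (a - 1) {|p|}|})"
| leaf: "\<lbrakk>mt \<tau> u d; j \<notin> lv u; ml u < j\<rbrakk> \<Longrightarrow> mt \<tau> (Nd 1 {|Lf j, u|}) (Nd 1 {|Lf j, d|})"
| single: "\<lbrakk>mt \<tau> u d; \<not> unary u\<rbrakk> \<Longrightarrow> mt \<tau> (Nd 1 {|u|}) (Nd 1 {|d|})"

lemma mt_not_Lf: "\<not> mt \<tau> (Lf j) d" "\<not> mt \<tau> u (Lf j)"
  by (auto elim: mt.cases)

lemma dis_ne: "dis {|p|} S \<Longrightarrow> p |\<notin>| S"
  using dis_notin by blast

lemma finsert_dis_ne: "dis {|p|} S \<Longrightarrow> S \<noteq> {||} \<Longrightarrow> finsert p S \<noteq> {|s|}"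
  using dis_ne[of p S] by auto

lemma split_ne:
  assumes "dis {|p|} S" "S \<noteq> {||}"
  shows "Nd c S \<noteq> p"
proof
  assume "Nd c S = p"
  then have "lv p = fl S"
    using assms(2) lv_Nd by metis
  then show False
    using assms fl_empty_iff by (simp add: dis_def)
qed

lemma mt_unary: "mt \<tau> u d \<Longrightarrow> unary u \<longleftrightarrow> unary d"
proof (induction rule: mt.induct)
  case (split a S p)
  then show ?case
    using finsert_dis_ne[OF split(3,2)] split_ne[OF split(3,2)] by (auto simp: unary_def)
next
  case (leaf \<tau> u d j)
  have "u \<noteq> Lf j" "d \<noteq> Lf j"
    using leaf(1) mt_not_Lf by auto
  then show ?case
    by (auto simp: unary_def)
qed auto

lemma mt_lv: "mt \<tau> u d \<Longrightarrow> lv d = lv u"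
  by (induction rule: mt.induct) auto

lemma dgf_finsert: "t |\<notin>| S \<Longrightarrow> dgf (finsert t S) = dg t + dgf S"
  using dgf_union[of "{|t|}" S] by simp

lemma mt_dg: "mt \<tau> u d \<Longrightarrow> dg d = dg u + 1"
proof (induction rule: mt.induct)
  case (split a S p)
  have "Nd (a - 1) S \<noteq> p"
    by (rule split_ne[OF split(3,2)])
  then show ?case
    using split dis_ne[OF split(3)] by (simp add: dgf_finsert of_nat_diff)
next
  case (leaf \<tau> u d j)
  have "u \<noteq> Lf j" "d \<noteq> Lf j"
    using leaf(1) mt_not_Lf by auto
  then show ?case
    using leaf by (simp add: dgf_finsert)
qed (auto simp: of_nat_diff)

lemma mt_into_label: "mt \<tau> u (Nd a F) \<Longrightarrow> a = 1"
  by (auto elim: mt.cases)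

lemma mt_into_single:
  assumes "mt \<tau> u (Nd 1 {|x|})"
  obtains c r where "x = Nd c {|r|}" "\<not> \<tau>" "u = Nd (Suc c) {|r|}" "1 \<le> c"
  | v where "mt \<tau> v x" "\<not> unary v" "\<not> unary x" "u = Nd 1 {|v|}"
  using assms
proof (cases rule: mt.cases)
  case (split a S p)
  have "Nd (a - 1) S \<noteq> p"
    using split by (intro split_ne) auto
  then show thesis
    using split(3) by auto
next
  case (unary a p)
  then show thesis
    using that(1)[of "a - 1" p] by auto
next
  case (leaf u d j)
  then show thesis
    using mt_not_Lf by auto
next
  case (single u d)
  then show thesis
    using that(2) mt_unary by auto
qed

lemma mt_into_pair:
  assumes "mt \<tau> u (Nd 1 {|x, p|})" and m: "ml p < ml x"
  obtains c T where "x = Nd c T" "\<tau>" "u = Nd (Suc c) (finsert p T)" "1 \<le> c" "T \<noteq> {||}" "dis {|p|} T" "pdis T"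
  | j v where "x = Lf j" "mt \<tau> v p" "u = Nd 1 {|Lf j, v|}"
proof -
  have ne: "x \<noteq> p"
    using m by auto
  from assms(1) show thesis
  proof (cases rule: mt.cases)
    case (split a S q)
    have "ml q < ml (Nd (a - 1) S)"
      using split by simp
    then have "\<not> ml (Nd (a - 1) S) < ml q"
      by linarith
    then have q: "q = p \<and> x = Nd (a - 1) S"
      using split(3) m unfolding fdoubleton_eq_iff by blast
    then show thesis
      using split by (intro that(1)[of "a - 1" S]) auto
  next
    case (unary a q)
    then show thesis
      using ne by auto
  next
    case (leaf u' d j)
    have "ml d = ml u'"
      using mt_lv[OF leaf(3)] by simp
    moreover have "ml (Lf j) = j"
      by simp
    ultimately have "\<not> ml (Lf j) < ml d"
      using leaf(5) by linarith
    then have "d = p \<and> x = Lf j"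
      using leaf(2) m unfolding fdoubleton_eq_iff by blast
    then show thesis
      using leaf that(2) by auto
  next
    case (single u' d)
    then show thesis
      using ne by auto
  qed
qed

lemma mt_pair_dis:
  assumes "mt \<tau> u d" "j \<notin> lv u"
  shows "dis {|d|} {|Lf j|}" "dis {|u|} {|Lf j|}"
  using assms mt_lv[OF assms(1)] by (auto simp: dis_def)

text \<open>The root of a target reveals the rule. With two children, the child without the least
  leaf is a node for a split and a leaf for a descent; with one child, that child has itself one
  child or not.\<close>

lemma mt_inj:
  assumes "mt \<tau> u d" "mt \<tau>' u' d"
  shows "u' = u \<and> \<tau>' = \<tau>"
  using assms
proof (induction arbitrary: u' \<tau>' rule: mt.induct)
  case (split a S p)
  then have "ml p < ml (Nd (a - 1) S)"
    by simp
  from split.prems this show ?case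
    by (rule mt_into_pair) (use split.hyps in auto)
next
  case (unary a p)
  from unary.prems show ?case
    by (rule mt_into_single) (use unary.hyps in auto)
next
  case (leaf \<tau> u d j)
  have "ml d < ml (Lf j)"
    using leaf.hyps mt_lv[OF leaf.hyps(1)] by simp
  from leaf.prems this show ?case
    by (rule mt_into_pair) (use leaf.IH in auto)
next
  case (single \<tau> u d)
  have "\<not> unary d"
    using single.hyps mt_unary by blast
  from single.prems show ?case
    by (rule mt_into_single) (use single.IH \<open>\<not> unary d\<close> in auto)
qed

text \<open>Roots of targets have label 1, so a source with greater root label is no target. For the
  two descending rules the question is passed on to the next tree of the path.\<close>

lemma mt_disjoint:
  assumes "mt \<tau> u d" "mt \<tau>' u' u"
  shows False
  using assms
proof (induction arbitrary: u' \<tau>' rule: mt.induct)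
  case (split a S p)
  then show ?case
    using mt_into_label by fastforce
next
  case (unary a p)
  then show ?case
    using mt_into_label by fastforce
next
  case (leaf \<tau> u d j)
  have "ml u < ml (Lf j)"
    using leaf.hyps by simp
  from leaf.prems this show ?case
    by (rule mt_into_pair) (use leaf.IH in auto)
next
  case (single \<tau> u d)
  from single.prems show ?case
    by (rule mt_into_single) (use single.IH single.hyps in auto)
qed

text \<open>The new node of a split collects the children beside the path to the least leaf, so the
  number of nodes on the path stays the same. Splitting a node with one child would add a node to
  the path.\<close>

lemma mt_cnt:
  assumes "mt \<tau> u d" "\<tau>"
  shows "cnt d = cnt u"
  using assms
proof (induction rule: mt.induct)
  case (split a S p)
  have "cnt (Nd a (finsert p S)) = Suc (cnt p)"
    using split by (intro cnt_pair) auto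
  moreover have "cnt (Nd 1 (finsert p {|Nd (a - 1) S|})) = Suc (cnt p)"
    using split by (intro cnt_pair) (auto simp: dis_def)
  ultimately show ?case
    by (simp add: finsert_commute)
next
  case (leaf \<tau> u d j)
  have "cnt (Nd 1 (finsert x {|Lf j|})) = Suc (cnt x)" if "x = u \<or> x = d" for x
    using leaf that mt_lv[OF leaf.hyps(1)] by (intro cnt_pair) (auto simp: dis_def)
  then show ?case
    using leaf by (simp add: finsert_commute)
next
  case (single \<tau> u d)
  have "cnt (Nd 1 (finsert x {||})) = Suc (cnt x)" for x
    by (intro cnt_pair) (auto simp: pdis_def)
  then show ?case
    using single by simp
qed simp

lemma mt_wf:
  assumes "mt \<tau> u d" "wft d" "dl d \<subseteq> {1..}"
  shows "wft u \<and> dl u \<subseteq> {1..}"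
  using assms
proof (induction rule: mt.induct)
  case (split a S p)
  have "dis {|Nd (a - 1) S|} {|p|}"
    using split by (auto simp: dis_def)
  moreover have "fcard (finsert p S) = Suc (fcard S)"
    using dis_ne[OF split(3)] by (rule fcard_finsert_disjoint)
  ultimately show ?case
    using split by (auto simp: wff_finsert)
next
  case (leaf \<tau> u d j)
  have "fcard {|Lf j, u|} \<le> 2"
    by (simp add: fcard.rep_eq card_insert_if)
  then show ?case
    using leaf mt_pair_dis[OF leaf(1,2)] by (auto simp: wff_finsert dis_commute)
qed auto

lemma mt_label2: "\<lbrakk>mt \<tau> (Nd a S) d; 2 \<le> a; \<not> unary (Nd a S)\<rbrakk> \<Longrightarrow> \<tau>"
  by (auto elim: mt.cases)

lemma mt_root2:
  assumes "wft (Nd a S)" "2 \<le> a"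
  shows "\<exists>\<tau> d. mt \<tau> (Nd a S) d"
proof -
  have S: "S \<noteq> {||}" "wff S"
    using assms by auto
  then have "Min (fl S) \<in> fl S"
    by (intro Min_in) auto
  then obtain p where p: "p |\<in>| S" "Min (fl S) \<in> lv p"
    by (auto simp: fl_def)
  then have pS: "finsert p (S |-| {|p|}) = S"
    by auto
  have d: "dis {|p|} (S |-| {|p|})"
    using wff_dis_diff[OF S(2), of "{|p|}"] p by auto
  have mp: "ml p = Min (fl S)"
    by (rule ml_eqI[OF p(2) lv_subset_fl[OF p(1)]]) auto
  show ?thesis
  proof (cases "S |-| {|p|} = {||}")
    case True
    then have "S = {|p|}"
      using pS by metis
    then show ?thesis
      using mt.unary[OF assms(2), of p] by blast
  next
    case False
    have "Min (fl (S |-| {|p|})) \<in> fl (S |-| {|p|})"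
      using False by (intro Min_in) auto
    moreover from this have "Min (fl (S |-| {|p|})) \<noteq> ml p"
      using d ml_in[of p] unfolding dis_def by (metis IntI empty_iff fl_single)
    moreover have "Min (fl S) \<le> Min (fl (S |-| {|p|}))"
      using False by (intro Min_antimono fl_mono) auto
    ultimately have "ml p < Min (fl (S |-| {|p|}))"
      using mp by simp
    moreover have "pdis (S |-| {|p|})"
      using S(2) pdis_mono[of "S |-| {|p|}" S] by (auto simp: wff_def)
    ultimately show ?thesis
      using mt.split[OF assms(2) False d] unfolding pS by blast
  qed
qed

lemma dt_Nd1_coeff:
  assumes "lkp (dN (bs S)) F \<noteq> (0 :: 'k::field)" "F \<noteq> {||}" "fcard F \<le> 2" "\<not> inert F"
  shows "lkp (dt (Nd 1 S)) {|Nd 1 F|} \<noteq> (0 :: 'k)"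
  unfolding dt_Nd lookup_minus lkp_lin_la using assms by simp

lemma mt_coeff:
  assumes "mt \<tau> u d" "wft u" "wft d"
  shows "lkp (dt u) {|d|} \<noteq> (0 :: 'k::field)"
  using assms
proof (induction rule: mt.induct)
  case (split a S p)
  have e: "finsert p S |-| S = {|p|}"
    using dis_ne[OF split(3)] by auto
  have "fcard (finsert p S) = Suc (fcard S)"
    using dis_ne[OF split(3)] by (rule fcard_finsert_disjoint)
  then show ?case
    using dcoef_split[of "finsert p S" S a, where 'k = 'k] split unfolding e
    by (auto simp: finsert_commute)
next
  case (unary a p)
  have e: "{|p|} |-| {|p|} = {||}"
    by auto
  show ?case
    using dcoef_split[of "{|p|}" "{|p|}" a, where 'k = 'k] unary unfolding e by auto
next
  case (leaf \<tau> u d j)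
  have d: "dis {|u|} {|Lf j|}" "dis {|d|} {|Lf j|}"
    using mt_pair_dis[OF leaf(1,2)] by auto
  have w: "wft u" "wft d"
    using leaf.prems d wff_finsert[OF d(1)] wff_finsert[OF d(2)] by (auto simp: finsert_commute)
  have "u \<noteq> d"
    using mt_dg[OF leaf(1)] by auto
  then have "lkp (dN (bs (finsert u {|Lf j|}))) (finsert d {|Lf j|}) \<noteq> (0 :: 'k)"
    using leaf.IH w d mt_lv[OF leaf(1)] by (intro lkp_dN_finsert) auto
  moreover have "fcard {|d, Lf j|} \<le> 2" "\<not> inert {|d, Lf j|}"
    using leaf.prems not_inert_wff by (auto simp: finsert_commute)
  ultimately show ?case
    using dt_Nd1_coeff[of "{|u, Lf j|}" "{|d, Lf j|}", where 'k = 'k] by (simp add: finsert_commute)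
next
  case (single \<tau> u d)
  have "u \<noteq> d"
    using mt_dg[OF single(1)] by auto
  then have "lkp (dN (bs (finsert u {||}))) (finsert d {||}) \<noteq> (0 :: 'k)"
    using single mt_lv[OF single(1)] by (intro lkp_dN_finsert) auto
  moreover have "\<not> inert {|d|}"
    using single.prems not_inert_wff by auto
  ultimately show ?case
    using dt_Nd1_coeff[of "{|u|}" "{|d|}", where 'k = 'k] by simp
qed

text \<open>Splitting writes a label as a sum of two positive ones, which is impossible for
  1.\<close>

lemma dt_labels_1: "dl u \<subseteq> {1} \<Longrightarrow> dt u = (0 :: 'k::field fcomb)"
proof (rule ccontr)
  assume "dl u \<subseteq> {1}" "dt u \<noteq> (0 :: 'k fcomb)"
  moreover have "dl u \<subseteq> {1} \<Longrightarrow> keys (dt u :: 'k fcomb) = {}"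
  proof (induction u)
    case (Nd a S)
    have "False" if K: "K \<in> keys (dt (Nd a S) :: 'k fcomb)" for K
    proof -
      obtain e where e: "K = {|e|}"
        using dt_keys[OF K] by blast
      from K[unfolded e] show False
      proof (cases rule: keys_dt_Nd)
        case (child s s')
        then show False
          using Nd dlf_mono[of "{|s|}" S] by auto
      qed (use Nd.prems in auto)
    qed
    then show ?case
      by blast
  qed simp
  ultimately show False
    by simp
qed

definition up :: "tr \<Rightarrow> bool" where
  "up t \<longleftrightarrow> (\<exists>\<tau> d. mt \<tau> t d)"

lemma upI: "mt \<tau> t d \<Longrightarrow> up t"
  by (auto simp: up_def)

text \<open>Acyclicity of the matching.\<close>

lemma mt_rank:
  assumes "mt \<tau> u d" "wft u" "dl u \<subseteq> {1..}" "{|e|} \<in> keys (dt u :: 'k::field fcomb)" "e \<noteq> d" "\<not> up e"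
  shows "\<tau> \<and> (cnt u < cnt e \<or> (\<exists>u'. mt False u' e))"
  using assms
proof (induction arbitrary: e rule: mt.induct)
  case (split a S p)
  let ?U = "finsert p S"
  have we: "wft e"
    using dt_wf[OF split.prems(3,1,2)] by blast
  \<comment> \<open>A root with label at least 2 makes a tree a source of the matching; so the root
    of \<open>e\<close> has a smaller label.\<close>
  have ne2: "\<not> 2 \<le> b" if "e = Nd b F" for b F
    using mt_root2 we that split.prems(5) by (auto simp: up_def)
  have le: "lv e = fl ?U"
    using dt_keys[OF split.prems(3)] by auto
  have m: "Min (fl ?U) = ml p" "ml p \<in> fl ?U"
  proof -
    have "Min (fl ?U) = min (ml p) (Min (fl S))"
      using split.hyps by (simp add: Min_Un)
    then show "Min (fl ?U) = ml p"
      using split.hyps by simp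
  qed simp
  have pU: "pdis ?U"
    using split.prems(1) by (simp add: wff_def)
  have cu: "cnt (Nd a ?U) = Suc (cnt p)"
    using pU m by (intro cnt_child) auto
  from split.prems(3) show ?case
  proof (cases rule: keys_dt_Nd)
    case (split b I)
    note sp = this
    have b: "b = 1"
      using sp(1) ne2[OF sp(5)] by auto
    let ?q = "Nd (a - 1) I" and ?R = "?U |-| I"
    have e: "e = Nd 1 (finsert ?q ?R)"
      using sp(5) b by simp
    \<comment> \<open>A root of label 1 has at most two children. If the new node missed
      \<open>p\<close>, the only tree beside it would be \<open>p\<close>, and \<open>e\<close>
      would be the partner of the source.\<close>
    have pI: "p |\<in>| I"
    proof (rule ccontr)
      assume "p |\<notin>| I"
      have "?q |\<notin>| ?R"
        using dis_ne[OF sp(6)] b by simp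
      then have "fcard ?R \<le> 1"
        using sp(7) b by (simp add: fcard_finsert_disjoint)
      moreover have pR: "p |\<in>| ?R"
        using \<open>p |\<notin>| I\<close> by auto
      ultimately have "?R = {|p|}"
        by (metis fcard_seteq fcard_single fempty_fsubsetI finsert_fsubset)
      then have "I = S"
        using sp(2) \<open>p |\<notin>| I\<close> dis_ne[OF split.hyps(3)] by (auto simp: fset_eq_iff)
      then show False
        using split.prems(4) e \<open>?R = {|p|}\<close> by simp
    qed
    have I: "I |\<subseteq>| ?U" "I \<noteq> {||}"
      using sp by auto
    have "Min (fl I) = ml p"
      by (rule ml_eqI[of _ _ "fl ?U"]) (use pI m lv_subset_fl[OF pI] fl_mono[OF I(1)] in auto)
    then have cq: "cnt ?q = Suc (cnt p)"
      using pI pdis_mono[OF I(1) pU] by (intro cnt_child) auto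
    \<comment> \<open>Here the new node lies on the path to the least leaf, so the path is longer by
      one than before the splitting.\<close>
    have "cnt e = Suc (cnt ?q)"
      unfolding e
    proof (rule cnt_child)
      have "fl (finsert ?q ?R) = fl ?U"
        using le e by simp
      moreover have "ml p \<in> lv ?q"
        using lv_subset_fl[OF pI] I(2) ml_in[of p] by (simp add: subset_iff del: ml_in)
      ultimately show "Min (fl (finsert ?q ?R)) \<in> lv ?q"
        using m(1) by simp
      show "pdis (finsert ?q ?R)"
        using we e by (simp add: wff_def)
    qed simp
    then show ?thesis
      using cq cu by simp
  next
    case (child s s')
    then show ?thesis
      using ne2 split.hyps(1) by blast
  qed
next
  case (unary a p)
  have we: "wft e"
    using dt_wf[OF unary.prems(3,1,2)] by blast
  have ne2: "\<not> 2 \<le> b" if "e = Nd b F" for b F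
    using mt_root2 we that unary.prems(5) by (auto simp: up_def)
  from unary.prems(3) show ?case
  proof (cases rule: keys_dt_Nd)
    case (split b I)
    \<comment> \<open>With one child there is only one splitting with root label 1, and it gives the
      partner.\<close>
    have "b = 1"
      using split(1) ne2[OF split(5)] by auto
    moreover have "I = {|p|}"
      using split(2,3) by (metis fsubset_fsingletonD)
    ultimately show ?thesis
      using split(5) unary.prems(4) by auto
  next
    case (child s s')
    then show ?thesis
      using ne2 unary.hyps(1) by blast
  qed
next
  case (leaf \<tau> u d j)
  have d: "dis {|u|} {|Lf j|}"
    using mt_pair_dis[OF leaf(1,2)] by auto
  have w: "wft u" "dl u \<subseteq> {1..}"
    using leaf.prems wff_finsert[OF d] by (auto simp: finsert_commute)
  from leaf.prems(3) show ?case
  proof (cases rule: keys_dt_Nd)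
    case (child s s')
    have "s = u"
      using child by auto
    moreover have "u \<noteq> Lf j"
      using leaf.hyps(1) mt_not_Lf by auto
    ultimately have e: "e = Nd 1 {|Lf j, s'|}" and s': "{|s'|} \<in> keys (dt u :: 'k fcomb)" "lv s' = lv u"
      using child by (auto simp: finsert_commute)
    have "s' \<noteq> d"
      using e leaf.prems(4) by auto
    moreover have "\<not> up s'"
    proof
      assume "up s'"
      then obtain \<tau>' d' where m: "mt \<tau>' s' d'"
        by (auto simp: up_def)
      have "up e"
        unfolding e by (rule upI[OF mt.leaf[OF m]]) (use leaf.hyps s'(2) in auto)
      then show False
        using leaf.prems(5) by simp
    qed
    ultimately have IH: "\<tau> \<and> (cnt u < cnt s' \<or> (\<exists>u'. mt False u' s'))"
      using leaf.IH w s' by blast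
    have c: "cnt (Nd 1 {|Lf j, x|}) = Suc (cnt x)" if "lv x = lv u" for x
      using that leaf.hyps cnt_pair[of x "{|Lf j|}" 1] by (simp add: dis_def finsert_commute)
    have "mt False (Nd 1 {|Lf j, u'|}) e" if "mt False u' s'" for u'
      unfolding e using that leaf.hyps s'(2) mt_lv[OF that] by (intro mt.leaf) auto
    then show ?thesis
      using IH c[of u] c[of s'] s'(2) e by auto
  qed auto
next
  case (single \<tau> u d)
  have w: "wft u" "dl u \<subseteq> {1..}"
    using single.prems by auto
  from single.prems(3) show ?case
  proof (cases rule: keys_dt_Nd)
    case (child s s')
    then have e: "e = Nd 1 {|s'|}" and s': "{|s'|} \<in> keys (dt u :: 'k fcomb)" "lv s' = lv u"
      by auto
    have c: "cnt (Nd 1 {|x|}) = Suc (cnt x)" for x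
      by (rule cnt_child) auto
    show ?thesis
    proof (cases "unary s'")
      case True
      then obtain c r where cr: "s' = Nd c {|r|}"
        by (auto simp: unary_def)
      have "1 \<le> c"
        using dt_wf[OF s'(1) w] cr by auto
      then have "mt False (Nd (Suc c) {|r|}) e"
        using mt.unary[of "Suc c" r] e cr by simp
      \<comment> \<open>Differentiating a child keeps the number of children of the root. So a tree
        with one child arises from one with several only by splitting the root, whose label is then
        at least 2; such a root is matched by a split.\<close>
      moreover have \<tau>
      proof -
        obtain a S where u: "u = Nd a S"
          using s'(1) by (cases u) auto
        from s'(1)[unfolded u] have "2 \<le> a"
        proof (cases rule: keys_dt_Nd)
          case (child t t')
          then have "S |-| {|t|} = {||}"
            using cr finsert_dis_ne[OF child(4), of r] by auto
          then have "S = {|t|}"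
            using child(1) by (metis finsert_fminus)
          then show ?thesis
            using u single.hyps(2) by simp
        qed auto
        then show ?thesis
          using mt_label2 single.hyps u by blast
      qed
      ultimately show ?thesis
        by blast
    next
      case False
      have "s' \<noteq> d"
        using e single.prems(4) by auto
      moreover have "\<not> up s'"
      proof
        assume "up s'"
        then obtain \<tau>' d' where m: "mt \<tau>' s' d'"
          by (auto simp: up_def)
        have "up e"
          unfolding e by (rule upI[OF mt.single[OF m False]])
        then show False
          using single.prems(5) by simp
      qed
      ultimately have IH: "\<tau> \<and> (cnt u < cnt s' \<or> (\<exists>u'. mt False u' s'))"
        using single.IH w s' by blast
      have "mt False (Nd 1 {|u'|}) e" if "mt False u' s'" for u'
        unfolding e using that False mt_unary[OF that] by (intro mt.single) auto
      then show ?thesis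
        using IH c[of u] c[of s'] e by auto
    qed
  qed auto
qed

text \<open>Descent along the path to the least leaf. A root of label at least 2 is a source. A root
  of label 1 is a target if beside the path there is a node, or if its only child again has one
  child; otherwise one of the descending rules applies, and the greater label lies further along the
  path.\<close>

lemma mt_exhaust:
  assumes "wft t" "dl t \<subseteq> {1..}" "\<not> dl t \<subseteq> {1}"
  shows "up t \<or> (\<exists>\<tau> u. mt \<tau> u t)"
  using assms
proof (induction t)
  case (Nd a S)
  show ?case
  proof (cases "2 \<le> a")
    case True
    then show ?thesis
      using mt_root2[OF Nd.prems(1)] by (simp add: up_def)
  next
    case False
    then have a: "a = 1"
      using Nd.prems(2) by auto
    have S: "S \<noteq> {||}" "wff S" "fcard S \<le> 2" "dlf S \<subseteq> {1..}"
      using Nd.prems a by auto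
    have "Min (fl S) \<in> fl S"
      using S by (intro Min_in) auto
    then obtain p where p: "p |\<in>| S" "Min (fl S) \<in> lv p"
      by (auto simp: fl_def)
    have wp: "wft p" "dl p \<subseteq> {1..}"
      using wff_children[OF S(2) p(1)] S(4) dlf_mono[of "{|p|}" S] p(1) by auto
    have mp: "ml p = Min (fl S)"
      by (rule ml_eqI[OF p(2) lv_subset_fl[OF p(1)]]) auto
    have d: "dis {|p|} (S |-| {|p|})"
      using wff_dis_diff[OF S(2), of "{|p|}"] p by auto
    have "fcard S = Suc (fcard (S |-| {|p|}))"
      using p(1) by (metis fcard_Suc_fminus1)
    then have "fcard (S |-| {|p|}) \<le> 1"
      using S(3) by simp
    then consider "S |-| {|p|} = {||}" | q where "S |-| {|p|} = {|q|}"
      by (metis fcard_1E fcard_0_eq le_Suc_eq le_zero_eq One_nat_def)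
    then show ?thesis
    proof cases
      case 1
      then have Sp: "S = {|p|}"
        using p(1) by (metis finsert_fminus)
      show ?thesis
      proof (cases p)
        case (Lf j)
        then show ?thesis
          using Nd.prems Sp a by simp
      next
        case (Nd c T)
        show ?thesis
        proof (cases "unary p")
          case True
          then obtain r where r: "p = Nd c {|r|}"
            using Nd by (auto simp: unary_def)
          have "mt False (Nd (Suc c) {|r|}) (Nd 1 {|Nd (Suc c - 1) {|r|}|})"
            using wp(2) Nd by (intro mt.unary) auto
          then show ?thesis
            using r Sp a by auto
        next
          case False
          have "up p \<or> (\<exists>\<tau> u. mt \<tau> u p)"
            using Nd.IH[of p] p(1) wp Nd.prems(3) Sp a by auto
          then show ?thesis
            unfolding up_def Sp a using False mt_unary mt.single by metis
        qed
      qed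
    next
      case (2 q)
      then have pq: "dis {|p|} {|q|}"
        using d by simp
      have Sp: "S = {|q, p|}"
        using finsert_fminus[OF p(1)] 2 by (metis finsert_commute)
      have "Min (fl S) \<le> ml q"
        using Sp by (intro Min_antimono) auto
      moreover have "ml q \<noteq> ml p"
        using pq ml_in[of p] ml_in[of q] unfolding dis_def by (metis IntI empty_iff fl_single)
      ultimately have mpq: "ml p < ml q"
        using mp by linarith
      show ?thesis
      proof (cases q)
        case (Lf j)
        have "up p \<or> (\<exists>\<tau> u. mt \<tau> u p)"
          using Nd.IH[of p] p(1) wp Nd.prems(3) Sp a Lf by auto
        moreover have "j \<notin> lv p" "ml p < j"
          using pq mpq Lf by (auto simp: dis_def)
        ultimately show ?thesis
          unfolding up_def Sp a Lf using mt_lv mt.leaf by metis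
      next
        case (Nd c T)
        have T: "T \<noteq> {||}" "wff T" "1 \<le> c"
          using wff_children[OF S(2), of q] Sp Nd S(4) by auto
        have "mt True (Nd (Suc c) (finsert p T)) (Nd 1 {|Nd (Suc c - 1) T, p|})"
          using T pq mpq Nd by (intro mt.split) (auto simp: dis_def wff_def)
        then show ?thesis
          using Sp a Nd by auto
      qed
    qed
  qed
qed simp

section \<open>Algebraic discrete Morse theory\<close>

lemma lin_decompose:
  fixes x :: "'a \<Rightarrow>\<^sub>0 'k::field" and D :: "('b \<Rightarrow>\<^sub>0 'k) \<Rightarrow> ('a \<Rightarrow>\<^sub>0 'k)"
  assumes D: "plinear D"
    and e: "\<And>e. e \<in> keys x \<Longrightarrow> \<exists>y w. keys y \<subseteq> B \<and> keys w \<subseteq> W \<and> bs e = D y + w"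
  shows "\<exists>y w. keys y \<subseteq> B \<and> keys w \<subseteq> W \<and> x = D y + w"
proof -
  have "\<forall>e\<in>keys x. \<exists>y w. keys y \<subseteq> B \<and> keys w \<subseteq> W \<and> bs e = D y + w"
    using e by blast
  then obtain f g where fg: "\<And>e. e \<in> keys x \<Longrightarrow> keys (f e) \<subseteq> B \<and> keys (g e) \<subseteq> W \<and> bs e = D (f e) + g e"
    by metis
  have "x = lin bs x"
    using plinear_eq_lin[OF plinear_id] by blast
  also have "\<dots> = lin (\<lambda>e. D (f e) + g e) x"
    using fg by (intro lin_cong) auto
  also have "\<dots> = D (lin f x) + lin g x"
    unfolding lin_plus_fun using plinear_eqI[OF plinear_lin plinear_comp[OF D plinear_lin], of x "\<lambda>e. D (f e)" f] by simp
  finally have "x = D (lin f x) + lin g x" .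
  moreover have "keys (lin f x) \<subseteq> B" "keys (lin g x) \<subseteq> W"
    using fg by (auto elim!: in_keys_linE)
  ultimately show ?thesis
    by blast
qed

text \<open>\<open>m r u d\<close> stands for a pair with source \<open>u\<close>, target
  \<open>d\<close> and rank \<open>r\<close>. Targets are eliminated by subtracting multiples of
  boundaries of their sources; the new targets that appear have sources of smaller rank, so this
  terminates. In the cycle that remains, a source of maximal rank outside \<open>C\<close> is
  impossible: nothing could cancel the coefficient at its partner.\<close>

lemma morse_cycle:
  fixes D :: "('a \<Rightarrow>\<^sub>0 'k::field) \<Rightarrow> ('a \<Rightarrow>\<^sub>0 'k)" and m :: "nat \<Rightarrow> 'a \<Rightarrow> 'a \<Rightarrow> bool"
  assumes D: "plinear D"
    and B: "\<And>u e. \<lbrakk>u \<in> B'; e \<in> keys (D (bs u))\<rbrakk> \<Longrightarrow> e \<in> B"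
    and DD: "\<And>y. keys y \<subseteq> B' \<Longrightarrow> D (D y) = 0"
    and nz: "\<And>r u d. \<lbrakk>m r u d; u \<in> B \<union> B'\<rbrakk> \<Longrightarrow> lkp (D (bs u)) d \<noteq> 0"
    and rank: "\<And>r u d r' u' e. \<lbrakk>m r u d; u \<in> B \<union> B'; m r' u' e; e \<in> keys (D (bs u)); e \<noteq> d\<rbrakk> \<Longrightarrow> r' < r"
    and inj: "\<And>r u d r' u'. \<lbrakk>m r u d; m r' u' d\<rbrakk> \<Longrightarrow> u' = u"
    and exh: "\<And>f. f \<in> B \<Longrightarrow> f \<in> C \<or> (\<exists>r d. m r f d) \<or> (\<exists>r. \<exists>u\<in>B'. m r u f)"
    and C: "\<And>f. f \<in> C \<Longrightarrow> D (bs f) = 0"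
    and z: "keys z \<subseteq> B" "D z = 0"
  shows "\<exists>y c. keys y \<subseteq> B' \<and> keys c \<subseteq> B \<inter> C \<and> z = D y + c"
proof -
  let ?W = "{f \<in> B. \<not> (\<exists>r. \<exists>u\<in>B'. m r u f)}"
  have down: "\<exists>y w. keys y \<subseteq> B' \<and> keys w \<subseteq> ?W \<and> bs d = D y + w" if "m r u d" "u \<in> B'" "d \<in> B" for r u d
    using that
  proof (induction r arbitrary: u d rule: less_induct)
    case (less r)
    define k where "k = lkp (D (bs u)) d"
    have k: "k \<noteq> 0"
      unfolding k_def using less.prems nz by blast
    \<comment> \<open>Modulo a boundary the target is replaced by the other terms in the boundary of
      its source.\<close>
    define x where "x = bs d - psc (inverse k) (D (bs u))"
    have "e \<noteq> d \<and> e \<in> keys (D (bs u)) \<and> e \<in> B" if e: "e \<in> keys x" for e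
    proof -
      have "lkp x d = 0"
        using k by (simp add: x_def k_def lookup_minus)
      then have "e \<noteq> d"
        using e by (auto simp: in_keys_iff)
      moreover from this have "e \<in> keys (D (bs u))"
        using e by (auto simp: x_def in_keys_iff lookup_minus lookup_single)
      ultimately show ?thesis
        using B[OF less.prems(2)] by blast
    qed
    then have "\<exists>y w. keys y \<subseteq> B' \<and> keys w \<subseteq> ?W \<and> bs e = D y + w" if e: "e \<in> keys x" for e
    proof (cases "\<exists>r. \<exists>u\<in>B'. m r u e")
      case True
      then obtain r' u' where "m r' u' e" "u' \<in> B'"
        by blast
      then show ?thesis
        using less.IH[of r' u' e] rank[OF less.prems(1)] less.prems(2) e
          \<open>\<And>e. e \<in> keys x \<Longrightarrow> e \<noteq> d \<and> e \<in> keys (D (bs u)) \<and> e \<in> B\<close> by blast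
    next
      case False
      then show ?thesis
        using e \<open>\<And>e. e \<in> keys x \<Longrightarrow> e \<noteq> d \<and> e \<in> keys (D (bs u)) \<and> e \<in> B\<close>
        by (intro exI[of _ 0] exI[of _ "bs e"]) (auto simp: plinear_zero[OF D])
    qed
    from lin_decompose[OF D this] obtain y w where y: "keys y \<subseteq> B'" "keys w \<subseteq> ?W" "x = D y + w"
      by blast
    have "bs d = D (y + psc (inverse k) (bs u)) + w"
      using y(3) by (simp add: x_def plinear_add[OF D] plinear_psc[OF D] algebra_simps)
    moreover have "keys (y + psc (inverse k) (bs u)) \<subseteq> B'"
      using y(1) less.prems(2) by (auto dest!: keys_plusE in_keys_pscD)
    ultimately show ?case
      using y(2) by blast
  qed
  have "\<exists>y w. keys y \<subseteq> B' \<and> keys w \<subseteq> ?W \<and> bs f = D y + w" if f: "f \<in> keys z" for f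
  proof (cases "\<exists>r. \<exists>u\<in>B'. m r u f")
    case True
    then show ?thesis
      using down z(1) f by blast
  next
    case False
    then show ?thesis
      using f z(1) by (intro exI[of _ 0] exI[of _ "bs f"]) (auto simp: plinear_zero[OF D])
  qed
  from lin_decompose[OF D this] obtain y w where y: "keys y \<subseteq> B'" "keys w \<subseteq> ?W" "z = D y + w"
    by blast
  have Dw: "D w = 0"
    using z(2) DD[OF y(1)] by (simp add: y(3) plinear_add[OF D])
  have "keys w \<subseteq> C"
  proof (rule ccontr)
    assume "\<not> keys w \<subseteq> C"
    define A where "A = keys w - C"
    have A: "finite A" "A \<noteq> {}"
      using \<open>\<not> keys w \<subseteq> C\<close> by (auto simp: A_def)
    have "\<exists>r d. m r f d" if "f \<in> A" for f
    proof -
      have "f \<in> ?W" "f \<notin> C"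
        using that y(2) by (auto simp: A_def)
      then show ?thesis
        using exh[of f] by blast
    qed
    then obtain \<rho> \<delta> where m: "\<And>f. f \<in> A \<Longrightarrow> m (\<rho> f) f (\<delta> f)"
      by metis
    \<comment> \<open>Maximality of the rank excludes that the partner of \<open>f\<close> occurs in
      the boundary of another source, since that source would have greater rank.\<close>
    obtain f where f: "f \<in> A" "\<And>g. g \<in> A \<Longrightarrow> \<rho> g \<le> \<rho> f"
      using A obtains_MAX[of A \<rho>] by (metis Max_ge finite_imageI imageI)
    have 0: "lkp (D (bs g)) (\<delta> f) = 0" if g: "g \<in> keys w" "g \<noteq> f" for g
    proof (cases "g \<in> C")
      case True
      then show ?thesis
        by (simp add: C)
    next
      case False
      then have gA: "g \<in> A" "g \<in> B"
        using g y(2) by (auto simp: A_def)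
      show ?thesis
      proof (rule ccontr)
        assume "\<not> ?thesis"
        then have "\<delta> f \<in> keys (D (bs g))"
          by (simp add: in_keys_iff)
        moreover have "\<delta> f \<noteq> \<delta> g"
          using inj m f(1) gA(1) g(2) by metis
        ultimately have "\<rho> f < \<rho> g"
          using rank[OF m[OF gA(1)] _ m[OF f(1)]] gA(2) by blast
        then show False
          using f(2)[OF gA(1)] by simp
      qed
    qed
    have fw: "f \<in> keys w" "f \<in> B"
      using f(1) y(2) by (auto simp: A_def)
    have "lkp (D w) (\<delta> f) = (\<Sum>g\<in>keys w. lkp w g * lkp (D (bs g)) (\<delta> f))"
      unfolding plinear_eq_lin[OF D, of w] by (simp add: lin_def lookup_sum)
    also have "\<dots> = lkp w f * lkp (D (bs f)) (\<delta> f)"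
      using 0 fw(1) by (subst sum.remove[of _ f]) auto
    also have "\<dots> \<noteq> 0"
      using nz[OF m[OF f(1)]] fw by (simp add: in_keys_iff)
    finally show False
      using Dw by simp
  qed
  then show ?thesis
    using y by blast
qed

section \<open>The matching of forests\<close>

definition matched :: "tr \<Rightarrow> bool" where
  "matched t \<longleftrightarrow> up t \<or> (\<exists>\<tau> u. mt \<tau> u t)"

lemma matchedI: "mt \<tau> u d \<Longrightarrow> matched u" "mt \<tau> u d \<Longrightarrow> matched d"
  by (auto simp: matched_def up_def)

text \<open>In a forest, the matching changes the first matched tree.\<close>

definition mf :: "bool \<Rightarrow> forest \<Rightarrow> forest \<Rightarrow> bool" where
  "mf \<tau> f g \<longleftrightarrow> (\<exists>u d R. f = finsert u R \<and> g = finsert d R \<and> mt \<tau> u d \<and> dis {|u|} R \<and>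
     (\<forall>r. r |\<in>| R \<longrightarrow> matched r \<longrightarrow> ml u < ml r))"

definition cntf :: "forest \<Rightarrow> nat" where
  "cntf f = (\<Sum>t\<in>fset f. cnt t)"

lemma cntf_finsert: "t |\<notin>| S \<Longrightarrow> cntf (finsert t S) = cnt t + cntf S"
  by (simp add: cntf_def)

lemma mfE:
  assumes "mf \<tau> f g"
  obtains u d R where "f = finsert u R" "g = finsert d R" "mt \<tau> u d" "dis {|u|} R" "dis {|d|} R" "ml d = ml u"
    "u |\<notin>| R" "d |\<notin>| R" "\<And>r. r |\<in>| R \<Longrightarrow> matched r \<Longrightarrow> ml u < ml r"
proof -
  obtain u d R where *: "f = finsert u R" "g = finsert d R" "mt \<tau> u d" "dis {|u|} R"
    "\<forall>r. r |\<in>| R \<longrightarrow> matched r \<longrightarrow> ml u < ml r"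
    using assms unfolding mf_def by blast
  have "lv d = lv u"
    by (rule mt_lv[OF *(3)])
  then have d: "dis {|d|} R" "ml d = ml u"
    using *(4) by (auto simp: dis_def)
  show thesis
    by (rule that[OF *(1-4) d dis_ne[OF *(4)] dis_ne[OF d(1)]]) (use *(5) in blast)
qed

lemma finsert_eq_cases:
  assumes "finsert d R = finsert d' R'" "d |\<notin>| R" "d' |\<notin>| R'"
  shows "d' = d \<and> R' = R \<or> d' |\<in>| R \<and> d |\<in>| R'"
  using assms by (metis finsert_iff finsert_ident)

text \<open>A matched pair of trees has the same least label, so the tree changed in the source is
  also the first matched tree of the target. Two different choices would each have to come
  first.\<close>

lemma mf_inj:
  assumes "mf \<tau> f g" "mf \<tau>' f' g"
  shows "f' = f \<and> \<tau>' = \<tau>"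
proof -
  obtain u d R where 1: "f = finsert u R" "g = finsert d R" "mt \<tau> u d" "dis {|u|} R" "dis {|d|} R" "ml d = ml u"
    "u |\<notin>| R" "d |\<notin>| R" "\<And>r. r |\<in>| R \<Longrightarrow> matched r \<Longrightarrow> ml u < ml r"
    using assms(1) by (rule mfE) (rule that)
  obtain u' d' R' where 2: "f' = finsert u' R'" "g = finsert d' R'" "mt \<tau>' u' d'" "dis {|u'|} R'" "dis {|d'|} R'" "ml d' = ml u'"
    "u' |\<notin>| R'" "d' |\<notin>| R'" "\<And>r. r |\<in>| R' \<Longrightarrow> matched r \<Longrightarrow> ml u' < ml r"
    using assms(2) by (rule mfE) (rule that)
  have "d' = d \<and> R' = R \<or> d' |\<in>| R \<and> d |\<in>| R'"
    using finsert_eq_cases[of d R d' R'] 1 2 by metis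
  then show ?thesis
  proof
    assume "d' |\<in>| R \<and> d |\<in>| R'"
    then have "ml u < ml d'" "ml u' < ml d"
      using 1(9) 2(9) matchedI(2)[OF 1(3)] matchedI(2)[OF 2(3)] by blast+
    then show ?thesis
      using 1(6) 2(6) by linarith
  next
    assume "d' = d \<and> R' = R"
    then show ?thesis
      using mt_inj[OF 1(3), of \<tau>' u'] 1 2 by auto
  qed
qed

lemma mf_cnt: 
  assumes "mf True f g"
  shows "cntf g = cntf f"
proof -
  obtain u d R where "f = finsert u R" "g = finsert d R" "mt True u d" "u |\<notin>| R" "d |\<notin>| R"
    using assms by (rule mfE)
  then show ?thesis
    using mt_cnt[of True u d] by (simp add: cntf_finsert)
qed

text \<open>If the differential acts on the first matched tree, \<open>mt_rank\<close> applies. If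
  it acts on another tree \<open>v\<close>, the first matched tree of \<open>e\<close> must be the
  new one and must precede \<open>u\<close>; then \<open>v\<close> also precedes \<open>u\<close>,
  is unmatched, has only the label 1, and its differential is zero, a contradiction.\<close>

lemma mf_rank:
  assumes f: "mf \<tau> f g" "wff f" "dlf f \<subseteq> {1..}" and e: "mf \<tau>' f' e" "e \<in> keys (dN (bs f) :: 'k::field fcomb)" "e \<noteq> g"
  shows "\<tau> \<and> (\<tau>' \<longrightarrow> cntf f < cntf f')"
proof -
  obtain u d R where u: "f = finsert u R" "g = finsert d R" "mt \<tau> u d" "dis {|u|} R" "dis {|d|} R" "ml d = ml u"
    "u |\<notin>| R" "d |\<notin>| R" and R: "\<And>r. r |\<in>| R \<Longrightarrow> matched r \<Longrightarrow> ml u < ml r"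
    using f(1) by (rule mfE) (rule that)
  obtain u2 d2 R2 where u2: "f' = finsert u2 R2" "e = finsert d2 R2" "mt \<tau>' u2 d2" "dis {|u2|} R2" "dis {|d2|} R2" "ml d2 = ml u2"
    "u2 |\<notin>| R2" "d2 |\<notin>| R2" and R2: "\<And>r. r |\<in>| R2 \<Longrightarrow> matched r \<Longrightarrow> ml u2 < ml r"
    using e(1) by (rule mfE) (rule that)
  obtain v v' where v: "v |\<in>| f" "{|v'|} \<in> keys (dt v :: 'k fcomb)" "e = finsert v' (f |-| {|v|})"
    "dis {|v'|} (f |-| {|v|})" "lv v' = lv v"
    by (rule keys_dN_bs[OF e(2)])
  have w: "wft v" "dl v \<subseteq> {1..}"
    using wff_children[OF f(2) v(1)] f(3) dlf_mono[of "{|v|}" f] v(1) by auto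
  have d2: "matched d2"
    by (rule matchedI(2)[OF u2(3)])
  have first: "matched r \<Longrightarrow> r |\<in>| e \<Longrightarrow> r = d2 \<or> ml d2 < ml r" for r
    using R2 u2(2,6) by auto
  show ?thesis
  proof (cases "v = u")
    case True
    then have fR: "f |-| {|v|} = R"
      using u by auto
    then have eR: "e = finsert v' R" "v' |\<notin>| R"
      using v dis_ne by auto
    have m: "d2 = v'" if "matched v'"
    proof (rule ccontr)
      assume ne: "d2 \<noteq> v'"
      then have "d2 |\<in>| R"
        using eR u2(2) by auto
      then have "ml u < ml d2"
        using R d2 by blast
      moreover have "ml d2 < ml v'"
        using first[OF that] eR ne by auto
      moreover have "ml v' = ml u"
        using v(5) True by simp
      ultimately show False
        by linarith
    qed
    have nu: "\<not> up v'"
    proof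
      assume "up v'"
      moreover from this have "d2 = v'"
        using m by (simp add: matched_def)
      ultimately show False
        using mt_disjoint u2(3) by (auto simp: up_def)
    qed
    have ne: "v' \<noteq> d"
      using e(3) eR u(2) by auto
    have r: "\<tau> \<and> (cnt u < cnt v' \<or> (\<exists>u'. mt False u' v'))"
      using mt_rank[OF u(3)] w v(2) True ne nu by blast
    have "cntf f < cntf f'" if \<tau>': \<tau>'
    proof -
      have "\<not> mt False u' v'" for u'
      proof
        assume m': "mt False u' v'"
        then have "d2 = v'"
          using m matchedI(2) by blast
        then show False
          using mt_inj[OF m', of \<tau>' u2] u2(3) \<tau>' by auto
      qed
      then have "cnt u < cnt v'"
        using r by blast
      moreover have "cntf f' = cntf e"
        using mf_cnt[of f' e] e(1) \<tau>' by simp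
      ultimately show ?thesis
        using eR u by (simp add: cntf_finsert)
    qed
    then show ?thesis
      using r by blast
  next
    case False
    then have vR: "v |\<in>| R"
      using v(1) u(1) by auto
    have "u |\<in>| e"
      using False v(3) u(1) by auto
    moreover have "u \<noteq> d2"
      using mt_disjoint[OF u(3)] u2(3) by blast
    ultimately have lt: "ml d2 < ml u"
      using first[OF matchedI(1)[OF u(3)]] by blast
    have "d2 |\<in>| e"
      using u2(2) by simp
    then have "d2 = v' \<or> d2 |\<in>| f"
      using v(3) by auto
    moreover have "d2 |\<notin>| f"
    proof
      assume "d2 |\<in>| f"
      then have "d2 |\<in>| R"
        using u(1) \<open>u \<noteq> d2\<close> by simp
      then have "ml u < ml d2"
        using R d2 by blast
      then show False
        using lt by linarith
    qed
    ultimately have "ml v < ml u"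
      using lt v(5) by simp
    then have "\<not> matched v"
      using R[OF vR] by (meson order_less_asym)
    then have "dl v \<subseteq> {1}"
      using mt_exhaust[OF w] by (auto simp: matched_def)
    then show ?thesis
      using v(2) dt_labels_1[of v, where 'k = 'k] by simp
  qed
qed

lemma pdis_ml_eq: "pdis f \<Longrightarrow> s |\<in>| f \<Longrightarrow> t |\<in>| f \<Longrightarrow> ml s = ml t \<Longrightarrow> s = t"
  using ml_in[of s] ml_in[of t] unfolding pdis_def by (metis IntI empty_iff)

lemma forests_replace:
  assumes "finsert t R \<in> forests A V d" "dis {|t|} R" "lv s = lv t" "wft s" "dl s \<subseteq> A" "dg s = dg t + c"
  shows "finsert s R \<in> forests A V (d + c)"
proof -
  have "dis {|s|} R"
    using assms(2,3) by (simp add: dis_def)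
  then show ?thesis
    using assms dis_ne[OF assms(2)] dis_ne[of s R] by (auto simp: forests_def wff_finsert dgf_finsert)
qed

lemma mf_exhaust:
  assumes f: "f \<in> forests {1..} V d"
  shows "dlf f \<subseteq> {1} \<or> (\<exists>\<tau> g. mf \<tau> f g) \<or> (\<exists>\<tau>. \<exists>u\<in>forests {1..} V (d - 1). mf \<tau> u f)"
proof (cases "dlf f \<subseteq> {1}")
  case False
  have w: "wff f" "dlf f \<subseteq> {1..}"
    using f by (auto simp: forests_def)
  then have pd: "pdis f"
    by (simp add: wff_def)
  obtain t0 where t0: "t0 |\<in>| f" "\<not> dl t0 \<subseteq> {1}"
    using False by (auto simp: dlf_def)
  have wt: "wft t" "dl t \<subseteq> {1..}" if "t |\<in>| f" for t
    using wff_children[OF w(1) that] w(2) dlf_mono[of "{|t|}" f] that by auto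
  define M where "M = {t \<in> fset f. matched t}"
  have "t0 \<in> M"
    using mt_exhaust[of t0] t0 wt by (auto simp: M_def matched_def)
  moreover have "finite M"
    by (simp add: M_def)
  ultimately obtain t where t: "t \<in> M" "\<And>s. s \<in> M \<Longrightarrow> ml t \<le> ml s"
    using obtains_MIN[of M ml] by (metis Min_le empty_iff finite_imageI imageI)
  define R where "R = f |-| {|t|}"
  have tf: "t |\<in>| f" "matched t" and fR: "f = finsert t R"
    using t(1) by (auto simp: M_def R_def)
  have d: "dis {|t|} R"
    unfolding R_def by (rule pdis_dis_diff[OF pd]) (use tf in auto)
  have R: "ml t < ml r" if "r |\<in>| R" "matched r" for r
  proof -
    have "ml t \<le> ml r" "r \<noteq> t" "r |\<in>| f"
      using that t(2)[of r] by (auto simp: M_def R_def)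
    then show ?thesis
      using pdis_ml_eq[OF pd tf(1), of r] by (metis order_le_less)
  qed
  from tf(2) consider \<tau> g where "mt \<tau> t g" | \<tau> u where "mt \<tau> u t"
    by (auto simp: matched_def up_def)
  then show ?thesis
  proof cases
    case 1
    then have "mf \<tau> f (finsert g R)"
      unfolding mf_def using fR d R by blast
    then show ?thesis
      by blast
  next
    case 2
    have lv: "lv t = lv u"
      by (rule mt_lv[OF 2])
    then have "mf \<tau> (finsert u R) f"
      unfolding mf_def using fR d R 2 by (intro exI[of _ u] exI[of _ t] exI[of _ R]) (auto simp: dis_def)
    moreover have "finsert u R \<in> forests {1..} V (d + - 1)"
      using f mt_wf[OF 2 wt[OF tf(1)]] mt_dg[OF 2] lv d unfolding fR by (intro forests_replace[of t]) auto
    ultimately show ?thesis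
      by auto
  qed
qed simp

lemma cntf_le: "f \<in> forests {1..} V d \<Longrightarrow> int (cntf f) \<le> - d"
proof -
  assume f: "f \<in> forests {1..} V d"
  have "int (cnt t) \<le> - dg t" if "t |\<in>| f" for t
    unfolding cnt_def using f that dlf_mono[of "{|t|}" f] wff_children[of f t]
    by (intro dep_le) (auto simp: forests_def)
  then have "(\<Sum>t\<in>fset f. int (cnt t)) \<le> - dgf f"
    unfolding dgf_def sum_negf[symmetric] by (rule sum_mono)
  then show ?thesis
    using f by (simp add: cntf_def forests_def)
qed

lemma dN_forests:
  assumes "f \<in> forests {1..} V d" "K \<in> keys (dN (bs f) :: 'k::field fcomb)"
  shows "K \<in> forests {1..} V (d + 1)"
proof -
  obtain s s' where s: "s |\<in>| f" "{|s'|} \<in> keys (dt s :: 'k fcomb)" "K = finsert s' (f |-| {|s|})"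
    "dis {|s'|} (f |-| {|s|})" "lv s' = lv s"
    by (rule keys_dN_bs[OF assms(2)])
  have w: "wft s" "dl s \<subseteq> {1..}"
    using assms(1) wff_children[of f s] dlf_mono[of "{|s|}" f] s(1) by (auto simp: forests_def)
  have "finsert s (f |-| {|s|}) = f"
    using s(1) by auto
  then show ?thesis
    unfolding s(3) using assms(1) dt_wf[OF s(2) w] dt_keys[OF s(2)] s(4,5)
    by (intro forests_replace[of s]) (auto simp: dis_def)
qed

lemma fcard_pair: "fcard {|x, y|} \<le> 2"
  by (simp add: fcard.rep_eq card_insert_if)

lemma mt_wf_up: "mt \<tau> u d \<Longrightarrow> wft u \<Longrightarrow> wft d"
proof (induction rule: mt.induct)
  case (split a S p)
  have d: "dis {|Nd (a - 1) S|} {|p|}"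
    using split by (auto simp: dis_def)
  have "fcard (finsert p S) = Suc (fcard S)"
    using dis_ne[OF split(3)] by (rule fcard_finsert_disjoint)
  moreover have "wff S" "wft p" "fcard (finsert p S) \<le> a + 1"
    using split.prems wff_finsert[OF split(3)] by auto
  ultimately have "wff {|Nd (a - 1) S, p|}"
    unfolding wff_finsert[OF d] using split.hyps by simp
  then show ?case
    using fcard_pair[of "Nd (a - 1) S" p] by simp
next
  case (leaf \<tau> u d j)
  then show ?case
    using mt_pair_dis[OF leaf(1,2)] fcard_pair[of "Lf j" d] by (auto simp: wff_finsert dis_commute)
qed auto

lemma mf_wf: "mf \<tau> f g \<Longrightarrow> wff f \<Longrightarrow> wff g"
  by (auto elim!: mfE simp: wff_finsert mt_wf_up)

lemma mf_coeff:
  assumes "mf \<tau> f g" "wff f"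
  shows "lkp (dN (bs f)) g \<noteq> (0 :: 'k::field)"
proof -
  obtain u d R where u: "f = finsert u R" "g = finsert d R" "mt \<tau> u d" "dis {|u|} R" "dis {|d|} R"
    using assms(1) by (rule mfE)
  have "wft u" "wft d"
    using assms(2) mf_wf[OF assms] u by (auto simp: wff_finsert)
  then have "lkp (dt u) {|d|} \<noteq> (0 :: 'k)"
    by (rule mt_coeff[OF u(3)])
  moreover have "u \<noteq> d" "lv d = lv u"
    using mt_dg[OF u(3)] mt_lv[OF u(3)] by auto
  ultimately show ?thesis
    unfolding u(1,2) using u(4) by (intro lkp_dN_finsert)
qed

text \<open>Transported from the free operad along the surjection \<open>EE\<close> instead of being
  computed on forests.\<close>

lemma dN_dN:
  fixes y :: "'k::field_char_0 fcomb"
  assumes "keys y \<subseteq> forests {1..} (int ` {1..n}) d" "n \<noteq> 0"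
  shows "dN (dN y) = 0"
proof -
  obtain x :: "'k comb" where "keys x \<subseteq> trees {1..} n d" "EE x = y"
    using EE_surj[OF assms] by blast
  then have "dN (dN y) = EE (delta (delta x))"
    by (simp add: EE_delta)
  then show ?thesis
    by (simp add: delta_delta)
qed

lemma forest_cycle:
  fixes z :: "'k::field_char_0 fcomb"
  assumes z: "keys z \<subseteq> forests {1..} (int ` {1..n}) d" "dN z = 0" and n: "n \<noteq> 0"
  shows "\<exists>y c. keys y \<subseteq> forests {1..} (int ` {1..n}) (d - 1) \<and> keys c \<subseteq> forests {1} (int ` {1..n}) d \<and> z = dN y + c"
proof -
  let ?V = "int ` {1..n}"
  let ?B = "forests {1..} ?V d" and ?B' = "forests {1..} ?V (d - 1)"
  \<comment> \<open>Bounds \<open>cntf\<close> on forests of degree \<open>d\<close> and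
    \<open>d - 1\<close> at once. The rank of a split pair is therefore positive and drops as
    \<open>cntf\<close> grows, while pairs that end a gradient path get rank 0.\<close>
  define K where "K = nat (1 - d)"
  define m where "m r f g \<longleftrightarrow> (\<exists>\<tau>. mf \<tau> f g \<and> r = (if \<tau> then Suc K - cntf f else 0))" for r f g
  have K: "cntf f \<le> K" if "f \<in> ?B \<union> ?B'" for f
    using cntf_le[of f ?V d] cntf_le[of f ?V "d - 1"] that by (auto simp: K_def)
  have wf: "wff f" "dlf f \<subseteq> {1..}" if "f \<in> ?B \<union> ?B'" for f
    using that by (auto simp: forests_def)
  have "\<exists>y c. keys y \<subseteq> ?B' \<and> keys c \<subseteq> ?B \<inter> {f. dlf f \<subseteq> {1}} \<and> z = dN y + c"
  proof (rule morse_cycle[where m = m])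
    show "plinear (dN :: 'k fcomb \<Rightarrow> 'k fcomb)"
      by (rule pl_cv)
    show "e \<in> ?B" if "u \<in> ?B'" "e \<in> keys (dN (bs u) :: 'k fcomb)" for u e
      using dN_forests[OF that] by simp
    show "dN (dN y) = 0" if "keys y \<subseteq> ?B'" for y :: "'k fcomb"
      by (rule dN_dN[OF that n])
    show "lkp (dN (bs u)) e \<noteq> (0 :: 'k)" if "m r u e" "u \<in> ?B \<union> ?B'" for r u e
      using that mf_coeff wf[OF that(2)] by (auto simp: m_def)
    show "r' < r" if *: "m r u g" "u \<in> ?B \<union> ?B'" "m r' u' e" "e \<in> keys (dN (bs u) :: 'k fcomb)" "e \<noteq> g" for r u g r' u' e
    proof -
      obtain \<tau> \<tau>' where \<tau>: "mf \<tau> u g" "r = (if \<tau> then Suc K - cntf u else 0)" "mf \<tau>' u' e" "r' = (if \<tau>' then Suc K - cntf u' else 0)"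
        using * by (auto simp: m_def)
      have "\<tau> \<and> (\<tau>' \<longrightarrow> cntf u < cntf u')"
        by (rule mf_rank[OF \<tau>(1) wf[OF *(2)] \<tau>(3) *(4,5)])
      then show ?thesis
        using K[OF *(2)] \<tau> by auto
    qed
    show "u' = u" if "m r u e" "m r' u' e" for r u e r' u'
      using that mf_inj unfolding m_def by blast
    show "f \<in> {f. dlf f \<subseteq> {1}} \<or> (\<exists>r g. m r f g) \<or> (\<exists>r. \<exists>u\<in>?B'. m r u f)" if "f \<in> ?B" for f
    proof -
      have "\<exists>r. m r f g" if "mf \<tau> f g" for \<tau> f g
        unfolding m_def by (intro exI conjI) (rule that, rule refl)
      then show ?thesis
        using mf_exhaust[OF that] by blast
    qed
    show "dN (bs f) = (0 :: 'k fcomb)" if "f \<in> {f. dlf f \<subseteq> {1}}" for f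
    proof -
      have "dt s = (0 :: 'k fcomb)" if "s |\<in>| f" for s
        using \<open>f \<in> _\<close> that dlf_mono[of "{|s|}" f] by (intro dt_labels_1) auto
      then show ?thesis
        by (simp add: dN_bs)
    qed
  qed (rule z)+
  then obtain y c where y: "keys y \<subseteq> ?B'" "keys c \<subseteq> ?B \<inter> {f. dlf f \<subseteq> {1}}" "z = dN y + c"
    by blast
  have "?B \<inter> {f. dlf f \<subseteq> {1}} \<subseteq> forests {1} ?V d"
    by (auto simp: forests_def)
  then have "keys c \<subseteq> forests {1} ?V d"
    using y(2) by (rule subset_trans[rotated])
  then show ?thesis
    using y by (intro exI conjI)
qed

section \<open>The projection to BV\<close>

lemma size_map_tree [simp]: "size (map_tree g t) = size t"
  by (induction t) auto

text \<open>For a product both factors are renumbered to initial segments and inserted into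
  \<open>mu\<close>, the second factor first; this gives the tree up to sign and relabelling. The
  sign is undone by closure under scalars, the relabelling by a permutation built from the two
  numberings.\<close>

lemma free_induct_tree:
  fixes Pr :: "nat \<Rightarrow> int \<Rightarrow> 'k::field comb \<Rightarrow> bool"
  assumes psc: "\<And>n d c x. Pr n d x \<Longrightarrow> Pr n d (psc c x)"
    and ident: "Pr 1 0 (bs (Leaf 1))" and mu: "Pr 2 0 mu" and Delta: "\<And>a. a \<in> A \<Longrightarrow> Pr 1 (1 - 2 * int a) (Delta a)"
    and circ: "\<And>m d n e i x y. \<lbrakk>keys x \<subseteq> trees A m d; keys y \<subseteq> trees A n e; i \<in> {1..m}; Pr m d x; Pr n e y\<rbrakk> \<Longrightarrow>
      Pr (m + n - 1) (d + e) (free_circ i x y)"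
    and act: "\<And>n d \<sigma> x. \<lbrakk>keys x \<subseteq> trees A n d; \<sigma> permutes {1..n}; Pr n d x\<rbrakk> \<Longrightarrow> Pr n d (free_act \<sigma> x)"
    and t: "t \<in> trees A n d"
  shows "Pr n d (bs t)"
  using t
proof (induction "size t" arbitrary: t n d rule: less_induct)
  case less
  note One_nat_def [simp del]
  show ?case
  proof (cases t)
    case (Leaf j)
    have "{j} = {1..n}"
      using less.prems Leaf by (simp add: trees_def)
    then have "n = 1" "j = 1"
      by (metis card_atLeastAtMost card.empty card_insert_disjoint diff_Suc_1 empty_iff finite.emptyI One_nat_def,
          metis atLeastAtMost_iff empty_iff insert_iff le_refl order_trans singletonI)
    moreover have "d = 0"
      using less.prems Leaf by (simp add: trees_def)
    ultimately show ?thesis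
      using ident Leaf by simp
  next
    case (Del a s)
    have a: "a \<in> A" and s: "s \<in> trees A n (d - (1 - 2 * int a))"
      using less.prems Del by (auto simp: trees_def)
    have "free_circ 1 (Delta a) (bs s) = (bs t :: 'k comb)"
      by (simp add: Delta_def free_circ_bs graft_def Del map_tree_ident')
    moreover have "Pr (1 + n - 1) (1 - 2 * int a + (d - (1 - 2 * int a))) (free_circ 1 (Delta a) (bs s))"
      using less.hyps[OF _ s] s a Del Delta Delta_trees[OF a, where 'k = 'k] by (intro circ) auto
    ultimately show ?thesis
      by simp
  next
    case (Mul s u)
    let ?V = "lset s" and ?W = "lset u"
    define p where "p = card ?V"
    define q where "q = card ?W"
    have VW: "?V \<inter> ?W = {}" "?V \<union> ?W = {1..n}" and ds: "distinct (leaves s)" "distinct (leaves u)"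
      using less.prems Mul by (auto simp: trees_def)
    have n: "p + q = n"
      using card_Un_disjoint[of ?V ?W] VW by (simp add: p_def q_def)
    obtain \<beta> where \<beta>: "bij_betw \<beta> {1..p} ?V"
      using ex_bij_betw_nat_finite_1[of ?V] by (auto simp: p_def)
    obtain \<gamma> where \<gamma>: "bij_betw \<gamma> {1..q} ?W"
      using ex_bij_betw_nat_finite_1[of ?W] by (auto simp: q_def)
    define s' where "s' = map_tree (inv_into {1..p} \<beta>) s"
    define u' where "u' = map_tree (inv_into {1..q} \<gamma>) u"
    have "s \<in> trees_on A ?V (tdeg s)" "u \<in> trees_on A ?W (tdeg u)"
      using less.prems Mul by (auto simp: trees_def trees_on_def)
    then have s': "s' \<in> trees A p (tdeg s)" and u': "u' \<in> trees A q (tdeg u)"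
      using map_tree_in_trees_on[of s A ?V "tdeg s" "inv_into {1..p} \<beta>"] bij_betw_inv_into[OF \<beta>]
        map_tree_in_trees_on[of u A ?W "tdeg u" "inv_into {1..q} \<gamma>"] bij_betw_inv_into[OF \<gamma>]
      by (auto simp: s'_def u'_def trees_trees_on bij_betw_def)
    have size: "size s' < size t" "size u' < size t"
      by (simp_all add: s'_def u'_def Mul)
    have IH: "Pr p (tdeg s) (bs s')" "Pr q (tdeg u) (bs u')"
      using less.hyps size s' u' by auto
    let ?w = "Mul (Leaf 1) (map_tree (\<lambda>l. 2 + l - 1) u')"
    have w: "free_circ 2 mu (bs u') = (bs ?w :: 'k comb)"
      by (simp add: mu_def free_circ_bs graft_def)
    have "Pr (2 + q - 1) (0 + tdeg u) (free_circ 2 mu (bs u'))"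
      using IH u' mu mu_trees[of A, where 'k = 'k] by (intro circ) auto
    moreover have "keys (free_circ 2 mu (bs u') :: 'k comb) \<subseteq> trees A (2 + q - 1) (0 + tdeg u)"
      using u' mu_trees[of A, where 'k = 'k] by (intro free_circ_closed) auto
    ultimately have pw: "Pr (2 + q - 1) (tdeg u) (bs ?w)" "?w \<in> trees A (2 + q - 1) (tdeg u)"
      unfolding w by simp_all
    let ?v = "Mul s' (map_tree (\<lambda>l. p + l) u')"
    have v: "graft 1 ?w s' = ?v"
      using u' by (simp add: graft_subst[OF s'] subst_map_tree map_tree_ident')
        (auto simp: map_tree_subst trees_def intro!: subst_cong)
    define c :: 'k where "c = ep (deg_right 1 ?w * tdeg s')"
    have "free_circ 1 (bs ?w) (bs s') = psc c (bs ?v)"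
      unfolding c_def free_circ_bs v ..
    moreover have "Pr (2 + q - 1 + p - 1) (tdeg u + tdeg s) (free_circ 1 (bs ?w) (bs s'))"
      using pw IH s' by (intro circ) auto
    moreover have "2 + q - 1 + p - 1 = n"
      using n by simp
    ultimately have "Pr n (tdeg u + tdeg s) (psc c (bs ?v))"
      by metis
    then have "Pr n (tdeg u + tdeg s) (psc (inverse c) (psc c (bs ?v)))"
      by (rule psc)
    moreover have "c \<noteq> 0"
      by (simp add: c_def)
    ultimately have pv: "Pr n d (bs ?v)"
      using less.prems Mul by (simp add: trees_def add.commute)
    have "?v \<in> trees A (2 + q - 1 + p - 1) (tdeg u + tdeg s)"
      unfolding v[symmetric] by (rule graft_in_trees[OF pw(2) s']) simp
    then have vt: "?v \<in> trees A n d"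
      using n less.prems Mul by (simp add: trees_def add.commute)
    define g where "g k = (if k \<in> {1..p} then \<beta> k else if k \<in> {p + 1..n} then \<gamma> (k - p) else k)" for k
    have g: "g permutes {1..n}"
    proof (rule bij_imp_permutes)
      have "bij_betw g {1..p} ?V"
        using \<beta> by (rule bij_betw_cong[THEN iffD1, rotated]) (simp add: g_def)
      moreover have "bij_betw g {p + 1..n} ?W"
      proof -
        have "bij_betw (\<lambda>k. k - p) {p + 1..n} {1..q}"
          using n by (intro bij_betw_byWitness[where f' = "\<lambda>k. k + p"]) auto
        from bij_betw_trans[OF this \<gamma>] show ?thesis
          by (rule bij_betw_cong[THEN iffD1, rotated]) (auto simp: g_def)
      qed
      ultimately have "bij_betw g ({1..p} \<union> {p + 1..n}) (?V \<union> ?W)"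
        using VW(1) by (rule bij_betw_combine)
      moreover have "{1..p} \<union> {p + 1..n} = {1..n}"
        using n by auto
      ultimately show "bij_betw g {1..n} {1..n}"
        using VW(2) by simp
    qed (use n in \<open>auto simp: g_def\<close>)
    have "map_tree g ?v = t"
    proof -
      have "map_tree g s' = s"
        unfolding s'_def map_tree_map_tree
      proof (rule map_tree_ident')
        fix j assume "j \<in> ?V"
        then have "j \<in> \<beta> ` {1..p}"
          using \<beta> by (simp add: bij_betw_def)
        then have "inv_into {1..p} \<beta> j \<in> {1..p}" "\<beta> (inv_into {1..p} \<beta> j) = j"
          by (rule inv_into_into, rule f_inv_into_f)
        then show "g (inv_into {1..p} \<beta> j) = j"
          by (simp add: g_def)
      qed
      moreover have "map_tree g (map_tree (\<lambda>l. p + l) u') = u"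
        unfolding u'_def map_tree_map_tree
      proof (rule map_tree_ident')
        fix j assume "j \<in> ?W"
        then have "j \<in> \<gamma> ` {1..q}"
          using \<gamma> by (simp add: bij_betw_def)
        then have "inv_into {1..q} \<gamma> j \<in> {1..q}" "\<gamma> (inv_into {1..q} \<gamma> j) = j"
          by (rule inv_into_into, rule f_inv_into_f)
        then show "g (p + inv_into {1..q} \<gamma> j) = j"
          using n by (simp add: g_def)
      qed
      ultimately show ?thesis
        by (simp add: Mul)
    qed
    moreover have "inv_into UNIV (inv_into UNIV g) = g"
      by (rule inv_inv_eq[OF permutes_bij[OF g]])
    ultimately have "free_act (inv_into UNIV g) (bs ?v) = (bs t :: 'k comb)"
      by (simp add: free_act_bs)
    moreover have "Pr n d (free_act (inv_into UNIV g) (bs ?v))"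
      using vt pv permutes_inv[OF g] by (intro act) auto
    ultimately show ?thesis
      by simp
  qed
qed

lemma free_induct [consumes 1, case_names zero add psc ident mu Delta circ act]:
  fixes Pr :: "nat \<Rightarrow> int \<Rightarrow> 'k::field comb \<Rightarrow> bool"
  assumes x: "keys x \<subseteq> trees A n d"
    and zero: "\<And>n d. Pr n d 0"
    and add: "\<And>n d x y. \<lbrakk>keys x \<subseteq> trees A n d; keys y \<subseteq> trees A n d; Pr n d x; Pr n d y\<rbrakk> \<Longrightarrow> Pr n d (x + y)"
    and psc: "\<And>n d c x. \<lbrakk>keys x \<subseteq> trees A n d; Pr n d x\<rbrakk> \<Longrightarrow> Pr n d (psc c x)"
    and ident: "Pr 1 0 (bs (Leaf 1))" and mu: "Pr 2 0 mu" and Delta: "\<And>a. a \<in> A \<Longrightarrow> Pr 1 (1 - 2 * int a) (Delta a)"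
    and circ: "\<And>m d n e i x y. \<lbrakk>keys x \<subseteq> trees A m d; keys y \<subseteq> trees A n e; i \<in> {1..m}; Pr m d x; Pr n e y\<rbrakk> \<Longrightarrow>
      Pr (m + n - 1) (d + e) (free_circ i x y)"
    and act: "\<And>n d \<sigma> x. \<lbrakk>keys x \<subseteq> trees A n d; \<sigma> permutes {1..n}; Pr n d x\<rbrakk> \<Longrightarrow> Pr n d (free_act \<sigma> x)"
  shows "Pr n d x"
proof -
  let ?P = "\<lambda>n d x. keys x \<subseteq> trees A n d \<and> Pr n d x"
  have t: "?P n d (bs t)" if "t \<in> trees A n d" for t
  proof (rule free_induct_tree[where Pr = ?P, OF _ _ _ _ _ _ that])
    show "?P n d (psc c x)" if "?P n d x" for n d c x
      using that psc by (auto dest: in_keys_pscD)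
    show "?P 1 0 (bs (Leaf 1))"
      using ident by (simp add: trees_def)
    show "?P 2 0 mu"
      using mu mu_trees by blast
    show "?P 1 (1 - 2 * int a) (Delta a)" if "a \<in> A" for a
      using Delta Delta_trees that by blast
    show "?P (m + n - 1) (d + e) (free_circ i x y)"
      if "keys x \<subseteq> trees A m d" "keys y \<subseteq> trees A n e" "i \<in> {1..m}" "?P m d x" "?P n e y" for m d n e i x y
      using that circ free_circ_closed by blast
    show "?P n d (free_act \<sigma> x)" if "keys x \<subseteq> trees A n d" "\<sigma> permutes {1..n}" "?P n d x" for n d \<sigma> x
      using that act free_act_trees by blast
  qed
  have "?P n d (\<Sum>t\<in>S. psc (lkp x t) (bs t))" if "finite S" "S \<subseteq> keys x" for S
    using that
  proof (induction S)
    case (insert s S)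
    have "?P n d (bs s)"
      using t insert.prems x by auto
    then have "?P n d (psc (lkp x s) (bs s))"
      using psc by (auto dest: in_keys_pscD)
    then show ?case
      using insert add by (auto dest!: keys_plusE)
  qed (simp add: zero)
  from this[of "keys x"] show ?thesis
    using poly_mapping_expand[of x] by simp
qed

section \<open>The ideals of the two operads\<close>

lemma ideal_gen_ideal:
  assumes "dg_operad P" and R: "\<And>n d r. (n, d, r) \<in> R \<Longrightarrow> r \<in> elts P n d"
    and dif: "\<And>n d x. op_ideal P R n d x \<Longrightarrow> op_ideal P R n (d + 1) (dif P n d x)"
  shows "dg_operad_ideal P (ideal_gen P R)"
proof -
  interpret dg_operad P
    by (rule assms)
  have c: "x \<in> elts P n d" if "op_ideal P R n d x" for n d x
    using that
    by (induction rule: op_ideal.induct)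
      (auto simp: R vect_facts[OF vect_space] act_closed simp del: One_nat_def intro: circ_closed)
  show ?thesis
    by unfold_locales (auto simp: ideal_gen_def vsub_def dif simp del: One_nat_def intro: op_ideal.intros c)
qed

abbreviation BV_inf_relations :: "(nat \<times> int \<times> 'k::field comb) set" where
  "BV_inf_relations \<equiv> com_relations \<union> order_relation ` {1..}"

abbreviation BV_relations :: "(nat \<times> int \<times> 'k::field comb) set" where
  "BV_relations \<equiv> com_relations \<union> {order_relation 1, (1, -2, free_circ 1 (Delta 1) (Delta 1))}"

lemma BV_ideal_iff: "x \<in> BV_ideal n d \<longleftrightarrow> op_ideal (free_operad {1} (\<lambda>_. 0)) BV_relations n d x"
  by (simp add: BV_ideal_def ideal_gen_def BV_free_def)

lemma order_relation_keys:
  "order_relation a = (n, d, r) \<Longrightarrow> a \<in> A \<Longrightarrow> keys (r :: 'k::field comb) \<subseteq> trees A n d"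
  using order_op_trees[of a A "Suc a", where 'k = 'k] by (auto simp: order_relation_def)

lemma Delta_Delta_trees: "keys (free_circ 1 (Delta 1) (Delta 1) :: 'k::field comb) \<subseteq> trees {1} 1 (- 2)"
  using free_circ_closed[OF Delta_trees Delta_trees, of 1 "{1}" 1 1, where 'a = 'k] by simp

lemma BV_relations_keys: "(n, d, r) \<in> BV_relations \<Longrightarrow> keys (r :: 'k::field comb) \<subseteq> trees {1} n d"
  using com_relations_acts_zero[of n d r "{1}"] order_relation_keys[of 1 n d r "{1}"] Delta_Delta_trees by auto

lemma BV_ideal_ideal: "dg_operad_ideal (BV_free :: ('k::field, 'k comb) operad) BV_ideal"
  unfolding BV_ideal_def
proof (rule ideal_gen_ideal[OF dg_operad_BV_free])
  show "op_ideal BV_free BV_relations n (d + 1) (dif BV_free n d x)" for n d and x :: "'k comb"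
    using op_ideal.zero[of BV_free BV_relations n "d + 1"] by (simp add: BV_free_def)
qed (use BV_relations_keys in \<open>auto simp: BV_free_def\<close>)

lemma BV_inf_ideal_ideal: "dg_operad_ideal (BV_inf_free :: ('k::field_char_0, 'k comb) operad) BV_inf_ideal"
  unfolding BV_inf_ideal_def
proof (rule ideal_gen_ideal[OF dg_operad_BV_inf_free])
  show "op_ideal BV_inf_free BV_inf_relations n (d + 1) (dif BV_inf_free n d x)"
    if "op_ideal BV_inf_free BV_inf_relations n d x" for n d and x :: "'k comb"
    using delta_BV_inf_ideal[of x n d] that by (simp add: BV_inf_ideal_def ideal_gen_def BV_inf_free_def lin_ext_lin)
  show "r \<in> elts BV_inf_free n d" if "(n, d, r) \<in> BV_inf_relations" for n d and r :: "'k comb"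
  proof -
    from that consider "(n, d, r) \<in> com_relations" | a where "a \<in> {1..}" "order_relation a = (n, d, r)"
      by (metis UnE imageE)
    then have "keys r \<subseteq> trees {1..} n d"
      using com_relations_acts_zero[of n d r "{1..}"] order_relation_keys[of _ n d r "{1..}"] by cases blast+
    then show ?thesis
      by (simp add: BV_inf_free_def)
  qed
qed

text \<open>Discards every tree containing some Delta_a with \<open>a\<close> at least 2. It is
  compatible with composition and permutations on the free operads, but with the differentials only
  modulo the ideal of BV.\<close>

definition bvp :: "'k::field comb \<Rightarrow> 'k comb" where
  "bvp = lin (\<lambda>t. if deltas t \<subseteq> {1} then bs t else 0)"

lemma pl_bvp: "plinear bvp"
  unfolding bvp_def by (rule plinear_lin)

lemma bvp_bs: "bvp (bs t) = (if deltas t \<subseteq> {1} then bs t else 0)"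
  by (simp add: bvp_def)

lemma bvp_ident: "(\<And>t. t \<in> keys x \<Longrightarrow> deltas t \<subseteq> {1}) \<Longrightarrow> bvp x = x"
  by (rule plinear_eqI[OF pl_bvp plinear_id]) (simp add: bvp_bs)

lemma bvp_trees: "keys x \<subseteq> trees {1} n d \<Longrightarrow> bvp x = x"
  by (rule bvp_ident) (auto simp: trees_def)

lemma bvp_0: "(\<And>t. t \<in> keys x \<Longrightarrow> \<not> deltas t \<subseteq> {1}) \<Longrightarrow> bvp x = 0"
  by (rule plinear_eqI[OF pl_bvp plinear_const0]) (simp add: bvp_bs)

lemma bvp_keys: "keys x \<subseteq> trees A n d \<Longrightarrow> keys (bvp x) \<subseteq> trees {1} n d"
  unfolding bvp_def by (auto simp: trees_def elim!: in_keys_linE split: if_splits)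

text \<open>The degree \<open>1 - 2 * a\<close> is nonzero, so each tree contains Delta_a. Hence
  Delta_a and the relation for its order are discarded, and the remaining relations hold in
  BV.\<close>

lemma bvp_higher:
  assumes "keys x \<subseteq> trees {a} n (1 - 2 * int a)" "2 \<le> a"
  shows "bvp x = 0"
proof (rule bvp_0)
  fix t assume "t \<in> keys x"
  then have t: "deltas t \<subseteq> {a}" "tdeg t = 1 - 2 * int a"
    using assms(1) by (auto simp: trees_def)
  have "deltas t \<noteq> {}"
  proof
    assume "deltas t = {}"
    moreover have "deltas t = {} \<Longrightarrow> tdeg t = 0"
      by (induction t) auto
    ultimately have "1 = 2 * int a"
      using t(2) by simp
    then show False
      by presburger
  qed
  then show "\<not> deltas t \<subseteq> {1}"
    using t(1) assms(2) by auto
qed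

lemma deltas_graft: "i \<in> lset s \<Longrightarrow> deltas (graft i s t) = deltas s \<union> deltas t"
  unfolding graft_def deltas_subst by (auto split: if_splits)

lemma bvp_circ:
  assumes "keys x \<subseteq> trees A m d" "i \<in> {1..m}"
  shows "bvp (free_circ i x y) = free_circ i (bvp x) (bvp y)"
proof (rule plinear2_eqI[where f = "\<lambda>x y. bvp (free_circ i x y)" and g = "\<lambda>x y. free_circ i (bvp x) (bvp y)"])
  show "bvp (free_circ i (bs s) (bs t)) = free_circ i (bvp (bs s)) (bvp (bs t))" if "s \<in> keys x" for s t
  proof -
    have "i \<in> lset s"
      using assms that by (auto simp: trees_def)
    then show ?thesis
      by (auto simp: bvp_bs free_circ_bs plinear_psc[OF pl_bvp] deltas_graft
          plinear_zero[OF pl_circ_left] plinear_zero[OF pl_circ_right])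
  qed
qed (auto intro!: plinear_comp[OF pl_bvp] plinear_free_circ_left plinear_free_circ_right pl_bvp plinear_id)

lemma bvp_act: "bvp (free_act \<sigma> x) = free_act \<sigma> (bvp x)"
  by (rule plinear_eqI[where f = "\<lambda>x. bvp (free_act \<sigma> x)" and g = "\<lambda>x. free_act \<sigma> (bvp x)"])
    (auto intro!: plinear_comp[OF pl_bvp] plinear_free_act plinear_id pl_bvp
      simp: bvp_bs free_act_bs plinear_zero[OF pl_act])

lemmas BV_ideal_closed =
  free_ideal_closed[where A = "{1}" and D = "\<lambda>_. 0" and R = BV_relations, folded BV_ideal_iff]
lemmas bv_add = BV_ideal_closed(1) and bv_psc = BV_ideal_closed(2) and bv_zero = BV_ideal_closed(3)
  and bv_act = BV_ideal_closed(4) and bv_circ_left = BV_ideal_closed(5) and bv_circ_right = BV_ideal_closed(6)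

lemma bv_diff: "\<lbrakk>x \<in> BV_ideal n d; y \<in> BV_ideal n d\<rbrakk> \<Longrightarrow> x - y \<in> BV_ideal n d"
  using bv_add[of x n d "psc (- 1) y"] bv_psc[of y n d "- 1"] by (simp add: psc_minus_1)

lemma bvp_ideal:
  assumes "x \<in> BV_inf_ideal n d"
  shows "bvp x \<in> BV_ideal n d"
proof -
  have "op_ideal (free_operad {1..} delta) BV_inf_relations n d x"
    using assms by (simp add: BV_inf_ideal_iff)
  then have "keys x \<subseteq> trees {1..} n d \<and> bvp x \<in> BV_ideal n d"
  proof (induction rule: op_ideal.induct)
    case (gen n d r)
    then have "r \<in> BV_inf_ideal n d"
      unfolding BV_inf_ideal_iff by (rule op_ideal.gen)
    then have r: "keys r \<subseteq> trees {1..} n d"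
      by (rule BV_inf_ideal_acts_zero(1))
    have g: "r \<in> BV_ideal n d" if "(n, d, r) \<in> BV_relations"
      unfolding BV_ideal_iff using that by (rule op_ideal.gen)
    from gen consider "(n, d, r) \<in> com_relations \<union> {order_relation 1}"
      | a where "2 \<le> a" "order_relation a = (n, d, r)"
      by (auto simp: le_Suc_eq numeral_2_eq_2) (metis Suc_leI le_neq_implies_less)
    then show ?case
    proof cases
      case 1
      then have 1: "(n, d, r) \<in> BV_relations"
        by blast
      show ?thesis
        using r g[OF 1] bvp_trees[OF BV_relations_keys[OF 1]] by simp
    next
      case 2
      then have "keys r \<subseteq> trees {a} n d" "d = 1 - 2 * int a"
        using order_relation_keys[of a n d r "{a}"] by (auto simp: order_relation_def)
      then show ?thesis
        using r bvp_higher[of r a n] 2(1) by (simp add: bv_zero)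
    qed
  next
    case (zero n d)
    then show ?case
      by (simp add: plinear_zero[OF pl_bvp] bv_zero)
  next
    case (add n d x y)
    then show ?case
      by (auto simp: plinear_add[OF pl_bvp] intro: bv_add dest!: keys_plusE)
  next
    case (smult n d x c)
    then show ?case
      by (auto simp: plinear_psc[OF pl_bvp] intro: bv_psc dest!: in_keys_pscD)
  next
    case (act n d x \<sigma>)
    then show ?case
      using bv_act[of "bvp x" n d \<sigma>] free_act_trees[of x "{1..}" n d \<sigma>] by (simp add: bvp_act)
  next
    case (circ_left m d x y n e i)
    then show ?case
      using bv_circ_left[of "bvp x" m d "bvp y" n e i] free_circ_closed[of x "{1..}" m d y n e i]
        bvp_keys[of y "{1..}" n e] bvp_circ[of x "{1..}" m d i y] by simp
  next
    case (circ_right x m d n e y i)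
    then show ?case
      using bv_circ_right[of "bvp x" m d "bvp y" n e i] free_circ_closed[of x "{1..}" m d y n e i]
        bvp_keys[of x "{1..}" m d] bvp_circ[of x "{1..}" m d i y] by simp
  qed
  then show ?thesis ..
qed

lemma delta_trees: "keys x \<subseteq> trees {1..} n d \<Longrightarrow> keys (delta x :: 'k::field comb) \<subseteq> trees {1..} n (d + 1)"
  using lin_mapD(1)[OF dg_operad.dif_linear[OF dg_operad_BV_inf_free], of x n d]
  by (simp add: BV_inf_free_def lin_ext_lin)

lemma delta_circ:
  "\<lbrakk>keys x \<subseteq> trees {1..} m d; keys y \<subseteq> trees {1..} n e; i \<in> {1..m}\<rbrakk> \<Longrightarrow>
    delta (free_circ i x y :: 'k::field comb) = free_circ i (delta x) y + psc (ep d) (free_circ i x (delta y))"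
  using dg_operad.dif_circ[OF dg_operad_BV_inf_free, of x m d y n e i]
  by (simp add: BV_inf_free_def lin_ext_lin powi_ep)

lemma delta_act: "delta (free_act \<sigma> x) = free_act \<sigma> (delta x)"
  by (simp add: free_act_relc delta_relc)

lemma delta_labels_1:
  assumes "keys x \<subseteq> trees {1} n d"
  shows "delta x = (0 :: 'k::field comb)"
proof -
  have "deltas t \<subseteq> {1} \<Longrightarrow> tree_delta t = (0 :: 'k comb)" for t
    by (induction t) (auto simp: tree_delta_Mul tree_delta_Del plinear_zero[OF pl_mulc_left]
        plinear_zero[OF pl_mulc_right] plinear_zero[OF pl_delc])
  then have "tree_delta t = (0 :: 'k comb)" if "t \<in> keys x" for t
    using assms that by (auto simp: trees_def)
  then show ?thesis
    by (simp add: lin_def)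
qed

lemma delta_Delta: "delta (Delta a) = (\<Sum>b\<in>{1..<a}. bs (Del b (Del (a - b) (Leaf 1))))"
  by (simp add: Delta_def tree_delta_Del plinear_zero[OF pl_delc])

lemma Delta_Delta: "free_circ 1 (Delta 1) (Delta 1) = bs (Del 1 (Del 1 (Leaf 1)))"
  by (simp add: Delta_def free_circ_bs graft_def)

lemma Delta_Delta_ideal: "free_circ 1 (Delta 1) (Delta 1) \<in> BV_ideal 1 (- 2)"
  unfolding BV_ideal_iff by (rule op_ideal.gen) simp

text \<open>The projection is compatible with the differentials since \<open>\<delta> \<Delta>\<^sub>2 = \<Delta>\<^sub>1 \<circ> \<Delta>\<^sub>1\<close> is zero in BV.\<close>

lemma bvp_delta:
  assumes "keys x \<subseteq> trees {1..} n d"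
  shows "bvp (delta x) \<in> BV_ideal n (d + 1)"
  using assms
proof (induction rule: free_induct)
  case (zero n d)
  then show ?case
    by (simp add: plinear_zero[OF pl_bvp] bv_zero)
next
  case (add n d x y)
  then show ?case
    by (simp add: lin_add plinear_add[OF pl_bvp] bv_add)
next
  case (psc n d c x)
  then show ?case
    by (simp add: lin_psc plinear_psc[OF pl_bvp] bv_psc)
next
  case ident
  then show ?case
    by (simp add: plinear_zero[OF pl_bvp] bv_zero)
next
  case mu
  have "delta mu = (0 :: 'a comb)"
    using mu_trees by (rule delta_labels_1)
  then show ?case
    by (simp add: plinear_zero[OF pl_bvp] bv_zero)
next
  case (Delta a)
  have "bvp (delta (Delta a)) = (\<Sum>b\<in>{1..<a}. if a = 2 then bs (Del 1 (Del 1 (Leaf 1))) else 0 :: 'a comb)"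
    unfolding delta_Delta plinear_sum[OF pl_bvp] by (rule sum.cong) (auto simp: bvp_bs)
  moreover have "{1..<2} = {1::nat}"
    by auto
  ultimately have "bvp (delta (Delta a)) = (if a = 2 then bs (Del 1 (Del 1 (Leaf 1))) else 0 :: 'a comb)"
    by simp
  then show ?case
    using Delta_Delta_ideal[where 'a = 'a] unfolding Delta_Delta by (simp add: bv_zero)
next
  case (circ m d n e i x y)
  have "free_circ i (bvp (delta x)) (bvp y) \<in> BV_ideal (m + n - 1) (d + 1 + e)"
    using circ bvp_keys[of y "{1..}" n e] by (intro bv_circ_left)
  moreover have "free_circ i (bvp x) (bvp (delta y)) \<in> BV_ideal (m + n - 1) (d + (e + 1))"
    using circ bvp_keys[of x "{1..}" m d] by (intro bv_circ_right)
  ultimately show ?case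
    using circ delta_trees[of x m d] delta_circ[of x m d y n e i]
      bvp_circ[of "delta x" "{1..}" m "d + 1" i y] bvp_circ[of x "{1..}" m d i "delta y"]
    by (simp add: plinear_add[OF pl_bvp] plinear_psc[OF pl_bvp] bv_add bv_psc add_ac)
next
  case (act n d \<sigma> x)
  then show ?case
    by (simp add: delta_act bvp_act bv_act)
qed

section \<open>Injectivity on cohomology\<close>

lemma BV_ideal_boundary:
  assumes "x \<in> BV_ideal n d"
  shows "\<exists>w v. w \<in> BV_inf_ideal n d \<and> keys v \<subseteq> trees {1..} n (d - 1) \<and> x = w + delta (v :: 'k::field comb)"
proof -
  have mono: "trees {1} n d \<subseteq> trees {1..} n d" for n d
    by (auto simp: trees_def)
  have "op_ideal (free_operad {1} (\<lambda>_. 0)) BV_relations n d x"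
    using assms by (simp add: BV_ideal_iff)
  then show ?thesis
  proof (induction rule: op_ideal.induct)
    case (gen n d r)
    have g: "\<exists>w v. w \<in> BV_inf_ideal n d \<and> keys v \<subseteq> trees {1..} n (d - 1) \<and> r = w + delta v"
      if "r \<in> BV_inf_ideal n d"
      using that by (intro exI[of _ r] exI[of _ 0]) simp
    from gen consider "(n, d, r) \<in> BV_inf_relations" | "(n, d, r) = (1, - 2, free_circ 1 (Delta 1) (Delta 1))"
      by blast
    then show ?case
    proof cases
      case 1
      then have "r \<in> BV_inf_ideal n d"
        unfolding BV_inf_ideal_iff by (rule op_ideal.gen)
      then show ?thesis
        by (rule g)
    next
      case 2
      have "{1..<2} = {1::nat}"
        by auto
      then have "delta (Delta 2) = (bs (Del 1 (Del 1 (Leaf 1))) :: 'k comb)"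
        unfolding delta_Delta by simp
      then show ?thesis
        using 2 Delta_trees[of 2 "{1..}", where 'k = 'k] unfolding Delta_Delta
        by (intro exI[of _ 0] exI[of _ "Delta 2"]) (simp add: ideal_zero)
    qed
  next
    case (zero n d)
    show ?case
      by (intro exI[of _ 0]) (simp add: ideal_zero)
  next
    case (add n d x y)
    then obtain w v w' v' where "w \<in> BV_inf_ideal n d" "keys v \<subseteq> trees {1..} n (d - 1)" "x = w + delta v"
      "w' \<in> BV_inf_ideal n d" "keys v' \<subseteq> trees {1..} n (d - 1)" "y = w' + delta v'"
      by blast
    then show ?case
      by (intro exI[of _ "w + w'"] exI[of _ "v + v'"]) (auto simp: ideal_add lin_add dest!: keys_plusE)
  next
    case (smult n d x c)
    then obtain w v where "w \<in> BV_inf_ideal n d" "keys v \<subseteq> trees {1..} n (d - 1)" "x = w + delta v"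
      by blast
    then show ?case
      by (intro exI[of _ "psc c w"] exI[of _ "psc c v"]) (auto simp: ideal_psc lin_psc psc_add dest!: in_keys_pscD)
  next
    case (act n d x \<sigma>)
    then obtain w v where "w \<in> BV_inf_ideal n d" "keys v \<subseteq> trees {1..} n (d - 1)" "x = w + delta v"
      by blast
    then show ?case
      using act(2) by (intro exI[of _ "free_act \<sigma> w"] exI[of _ "free_act \<sigma> v"])
        (auto simp: ideal_act delta_act free_act_trees plinear_add[OF pl_act] simp del: One_nat_def)
  next
    case (circ_left m d x y n e i)
    then obtain w v where wv: "w \<in> BV_inf_ideal m d" "keys v \<subseteq> trees {1..} m (d - 1)" "x = w + delta v"
      by blast
    have y: "keys y \<subseteq> trees {1} n e"
      using circ_left by simp
    then have y': "keys y \<subseteq> trees {1..} n e"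
      using mono by blast
    have "delta (free_circ i v y) = free_circ i (delta v) y"
      using delta_circ[OF wv(2) y' circ_left(3)] delta_labels_1[OF y]
      by (simp add: plinear_zero[OF pl_circ_right])
    moreover have "keys (free_circ i v y) \<subseteq> trees {1..} (m + n - 1) (d - 1 + e)"
      by (rule free_circ_closed[OF wv(2) y' circ_left(3)])
    moreover have "free_circ i w y \<in> BV_inf_ideal (m + n - 1) (d + e)"
      by (rule ideal_circ_left[OF wv(1) y' circ_left(3)])
    ultimately show ?case
      by (intro exI[of _ "free_circ i w y"] exI[of _ "free_circ i v y"])
        (simp add: wv(3) plinear_add[OF pl_circ_left] algebra_simps)
  next
    case (circ_right x m d n e y i)
    then obtain w v where wv: "w \<in> BV_inf_ideal n e" "keys v \<subseteq> trees {1..} n (e - 1)" "y = w + delta v"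
      by blast
    have x: "keys x \<subseteq> trees {1} m d"
      using circ_right by simp
    then have x': "keys x \<subseteq> trees {1..} m d"
      using mono by blast
    \<comment> \<open>The factor undoes the sign that the differential acquires in passing
      \<open>x\<close>. As \<open>x\<close> involves only the label 1, its own differential is
      zero.\<close>
    let ?v = "psc (ep d) (free_circ i x v)"
    have "delta ?v = free_circ i x (delta v)"
      using delta_circ[OF x' wv(2) circ_right(3)] delta_labels_1[OF x]
      by (simp add: lin_psc plinear_zero[OF pl_circ_left])
    moreover have "keys ?v \<subseteq> trees {1..} (m + n - 1) (d + (e - 1))"
      using free_circ_closed[OF x' wv(2) circ_right(3)] by (auto dest: in_keys_pscD)
    moreover have "free_circ i x w \<in> BV_inf_ideal (m + n - 1) (d + e)"
      by (rule ideal_circ_right[OF x' wv(1) circ_right(3)])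
    ultimately show ?case
      by (intro exI[of _ "free_circ i x w"] exI[of _ ?v])
        (simp add: wv(3) plinear_add[OF pl_circ_right] algebra_simps)
  qed
qed

text \<open>The decomposition of cycles of forests is lifted along \<open>EE\<close>; the error
  \<open>w\<close> lies in the kernel, that is, in the ideal. The remaining part \<open>c'\<close>
  is unchanged by \<open>bvp\<close>, so it differs from \<open>bvp z\<close> by elements of the
  ideal of BV and lies in that ideal itself; \<open>BV_ideal_boundary\<close> then makes it a
  boundary modulo the ideal.\<close>

lemma cycle_decomposition:
  fixes z :: "'k::field_char_0 comb"
  assumes z: "keys z \<subseteq> trees {1..} n d" and dz: "delta z \<in> BV_inf_ideal n (d + 1)" and pz: "bvp z \<in> BV_ideal n d"
  shows "\<exists>w y. w \<in> BV_inf_ideal n d \<and> keys y \<subseteq> trees {1..} n (d - 1) \<and> z = w + delta y"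
proof (cases "n = 0")
  case True
  \<comment> \<open>Every tree has a leaf, so there are no operations of arity 0.\<close>
  then have "keys z = {}"
    using z trees_pos by fastforce
  then have "z = 0"
    by simp
  then show ?thesis
    by (intro exI[of _ 0]) (simp add: ideal_zero)
next
  case False
  have "dN (EE z) = 0"
    using EE_ideal[OF dz] by (simp add: EE_delta)
  from forest_cycle[OF EE_forests[OF z] this False] obtain y c where
    y: "keys y \<subseteq> forests {1..} (int ` {1..n}) (d - 1)" and c: "keys c \<subseteq> forests {1} (int ` {1..n}) d"
    and zyc: "EE z = dN y + c"
    by blast
  obtain y' where y': "keys y' \<subseteq> trees {1..} n (d - 1)" "EE y' = y"
    using EE_surj[OF y False] by blast
  obtain c' where c': "keys c' \<subseteq> trees {1} n d" "EE c' = c"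
    using EE_surj[OF c False] by blast
  have c1: "keys c' \<subseteq> trees {1..} n d"
    using c'(1) by (auto simp: trees_def)
  define w where "w = z - delta y' - c'"
  have wt: "keys w \<subseteq> trees {1..} n d"
    using z c1 delta_trees[OF y'(1)] by (auto simp: w_def dest!: keys_minusE)
  have "EE w = 0"
    using zyc y'(2) c'(2) by (simp add: w_def lin_diff EE_delta)
  then have w: "w \<in> BV_inf_ideal n d"
    by (rule ideal_of_EE_0[OF wt])
  have "c' = bvp z - bvp (delta y') - bvp w"
    using bvp_trees[OF c'(1)] by (simp add: w_def plinear_diff[OF pl_bvp])
  moreover have "bvp (delta y') \<in> BV_ideal n d"
    using bvp_delta[OF y'(1)] by simp
  ultimately have "c' \<in> BV_ideal n d"
    using pz bvp_ideal[OF w] by (simp add: bv_diff)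
  then obtain w' v where v: "w' \<in> BV_inf_ideal n d" "keys v \<subseteq> trees {1..} n (d - 1)" "c' = w' + delta v"
    using BV_ideal_boundary by blast
  have "z = (w + w') + delta (y' + v)"
    using v(3) by (simp add: w_def lin_add)
  then show ?thesis
    using w v y'(1) ideal_add[OF w v(1)] by (intro exI[of _ "w + w'"] exI[of _ "y' + v"]) (auto dest!: keys_plusE)
qed

section \<open>The canonical map on the quotients\<close>

lemma BV_free_simps [simp]:
  "elts BV_free n d = {x :: 'k::field comb. keys x \<subseteq> trees {1} n d}"
  "x \<oplus>\<^bsub>space BV_free n d\<^esub> y = x + y" "c \<odot>\<^bsub>space BV_free n d\<^esub> x = psc c x" "\<zero>\<^bsub>space BV_free n d\<^esub> = (0 :: 'k comb)"
  "ident BV_free = (bs (Leaf 1) :: 'k comb)" "circ BV_free m d n e i x y = free_circ i x y"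
  "act BV_free n d \<sigma> x = free_act \<sigma> x" "dif BV_free n d x = 0"
  by (simp_all add: BV_free_def)

lemma BV_inf_free_simps [simp]:
  "elts BV_inf_free n d = {x :: 'k::field comb. keys x \<subseteq> trees {1..} n d}"
  "x \<oplus>\<^bsub>space BV_inf_free n d\<^esub> y = x + y" "c \<odot>\<^bsub>space BV_inf_free n d\<^esub> x = psc c x" "\<zero>\<^bsub>space BV_inf_free n d\<^esub> = (0 :: 'k comb)"
  "ident BV_inf_free = (bs (Leaf 1) :: 'k comb)" "circ BV_inf_free m d n e i x y = free_circ i x y"
  "act BV_inf_free n d \<sigma> x = free_act \<sigma> x" "dif BV_inf_free n d x = delta x"
  by (simp_all add: BV_inf_free_def lin_ext_lin)

definition bv_proj :: "nat \<Rightarrow> int \<Rightarrow> 'k::field comb \<Rightarrow> 'k comb set" where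
  "bv_proj n d x = coset BV_free BV_ideal n d (bvp x)"

lemma bv_proj_hom: "dg_operad_hom (BV_inf_free :: ('k::field, 'k comb) operad) BV bv_proj"
proof -
  note One_nat_def [simp del]
  interpret B: dg_operad_ideal BV_free "BV_ideal :: nat \<Rightarrow> int \<Rightarrow> 'k comb set"
    by (rule BV_ideal_ideal)
  interpret c: dg_operad_hom BV_free "quot_operad BV_free (BV_ideal :: nat \<Rightarrow> int \<Rightarrow> 'k comb set)" "coset BV_free BV_ideal"
    by (rule B.quot_hom)
  have k: "bvp x \<in> elts BV_free n d" if "x \<in> elts BV_inf_free n d" for n d and x :: "'k comb"
    using bvp_keys[of x "{1..}" n d] that by simp
  show ?thesis
    unfolding BV_def
  proof (intro dg_operad_hom.intro dg_operad_hom_axioms.intro dg_operad_BV_inf_free B.dg_operad_quot, goal_cases)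
    case (1 n d)
    show ?case
    proof (rule lin_mapI)
      show "bv_proj n d x \<in> elts (quot_operad BV_free BV_ideal) n d" if "x \<in> elts BV_inf_free n d" for x :: "'k comb"
        unfolding bv_proj_def by (rule c.hom_closed[OF k[OF that]])
      show "bv_proj n d (x \<oplus>\<^bsub>space BV_inf_free n d\<^esub> y) = bv_proj n d x \<oplus>\<^bsub>space (quot_operad BV_free BV_ideal) n d\<^esub> bv_proj n d y"
        if "x \<in> elts BV_inf_free n d" "y \<in> elts BV_inf_free n d" for x y :: "'k comb"
        using lin_mapD(2)[OF c.hom_linear k[OF that(1)] k[OF that(2)]] by (simp add: bv_proj_def plinear_add[OF pl_bvp])
      show "bv_proj n d (a \<odot>\<^bsub>space BV_inf_free n d\<^esub> x) = a \<odot>\<^bsub>space (quot_operad BV_free BV_ideal) n d\<^esub> bv_proj n d x"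
        if "x \<in> elts BV_inf_free n d" for a and x :: "'k comb"
        using lin_mapD(3)[OF c.hom_linear k[OF that]] by (simp add: bv_proj_def plinear_psc[OF pl_bvp])
    qed
  next
    case 2
    show ?case
      using c.hom_ident by (simp add: bv_proj_def bvp_bs)
  next
    case (3 x m d y n e i)
    then show ?case
      using c.hom_circ[OF k[OF 3(1)] k[OF 3(2)] 3(3)] bvp_circ[of x "{1..}" m d i y] by (simp add: bv_proj_def)
  next
    case (4 x n d \<sigma>)
    then show ?case
      using c.hom_act[OF k[OF 4(1)] 4(2)] by (simp add: bv_proj_def bvp_act)
  next
    case (5 x n d)
    have "coset BV_free BV_ideal n (d + 1) (bvp (delta x)) = \<zero>\<^bsub>space (quot_operad BV_free BV_ideal) n (d + 1)\<^esub>"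
      using bvp_delta[of x n d] k[of "delta x" n "d + 1"] delta_trees[of x n d] 5 by (subst B.coset_zero_iff) auto
    moreover have "coset BV_free BV_ideal n (d + 1) (0 :: 'k comb) = \<zero>\<^bsub>space (quot_operad BV_free BV_ideal) n (d + 1)\<^esub>"
      by (subst B.coset_zero_iff) (auto simp: bv_zero)
    ultimately show ?case
      using c.hom_dif[OF k[OF 5]] by (simp add: bv_proj_def)
  qed
qed

lemma bv_proj_ideal:
  assumes "x \<in> BV_inf_ideal n d"
  shows "bv_proj n d (x :: 'k::field comb) = \<zero>\<^bsub>space BV n d\<^esub>"
proof -
  have "bvp x \<in> elts BV_free n d"
    using bvp_keys[OF BV_inf_ideal_acts_zero(1)[OF assms]] by simp
  then show ?thesis
    unfolding bv_proj_def BV_def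
    using dg_operad_ideal.coset_zero_iff[OF BV_ideal_ideal] bvp_ideal[OF assms] by blast
qed

abbreviation bv_map :: "nat \<Rightarrow> int \<Rightarrow> 'k::field_char_0 comb set \<Rightarrow> 'k comb set" where
  "bv_map \<equiv> induced bv_proj"

lemma bv_map_coset:
  "keys x \<subseteq> trees {1..} n d \<Longrightarrow> bv_map n d (coset BV_inf_free BV_inf_ideal n d x) = bv_proj n d (x :: 'k::field_char_0 comb)"
  by (rule induced_coset[OF BV_inf_ideal_ideal bv_proj_hom]) (simp_all add: bv_proj_ideal)

lemma bv_map_hom: "dg_operad_hom (BV_inf_com :: ('k::field_char_0, 'k comb set) operad) BV bv_map"
  unfolding BV_inf_com_def by (rule induced_hom[OF BV_inf_ideal_ideal bv_proj_hom]) (rule bv_proj_ideal)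

lemma BV_inf_elts: "elts BV_inf_com n d = coset BV_inf_free BV_inf_ideal n d ` {x :: 'k::field_char_0 comb. keys x \<subseteq> trees {1..} n d}"
  unfolding BV_inf_com_def dg_operad_ideal.elts_quot[OF BV_inf_ideal_ideal] by simp

lemma BV_elts: "elts BV n d = coset BV_free BV_ideal n d ` {x :: 'k::field comb. keys x \<subseteq> trees {1} n d}"
  unfolding BV_def dg_operad_ideal.elts_quot[OF BV_ideal_ideal] by simp

lemma bv_map_surj:
  assumes "y \<in> elts BV n d"
  shows "\<exists>x. keys x \<subseteq> trees {1} n d \<and> bv_map n d (coset BV_inf_free BV_inf_ideal n d x) = (y :: 'k::field_char_0 comb set)"
proof -
  obtain x :: "'k comb" where x: "keys x \<subseteq> trees {1} n d" "y = coset BV_free BV_ideal n d x"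
    using assms unfolding BV_elts by blast
  then have "keys x \<subseteq> trees {1..} n d"
    by (auto simp: trees_def)
  then show ?thesis
    using x bvp_trees[OF x(1)] by (intro exI[of _ x]) (simp add: bv_map_coset bv_proj_def)
qed

lemma BV_inf_dif_coset:
  assumes "keys x \<subseteq> trees {1..} n d"
  shows "dif BV_inf_com n d (coset BV_inf_free BV_inf_ideal n d x) = coset BV_inf_free BV_inf_ideal n (d + 1) (delta (x :: 'k::field_char_0 comb))"
  using dg_operad_hom.hom_dif[OF dg_operad_ideal.quot_hom[OF BV_inf_ideal_ideal], of x n d] assms
  by (simp add: BV_inf_com_def)

lemma BV_inf_coset_zero_iff:
  assumes "keys x \<subseteq> trees {1..} n d"
  shows "coset BV_inf_free BV_inf_ideal n d x = \<zero>\<^bsub>space BV_inf_com n d\<^esub> \<longleftrightarrow> (x :: 'k::field_char_0 comb) \<in> BV_inf_ideal n d"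
  using dg_operad_ideal.coset_zero_iff[OF BV_inf_ideal_ideal, of x n d] assms by (simp add: BV_inf_com_def)

lemma canonical_bv_map: "canonical_on_generators (bv_map :: nat \<Rightarrow> int \<Rightarrow> 'k::field_char_0 comb set \<Rightarrow> _)"
proof -
  note One_nat_def [simp del]
  have D: "keys (Delta a :: 'k comb) \<subseteq> trees {1..} 1 (1 - 2 * int a)" if "1 \<le> a" for a
    using that by (intro Delta_trees) simp
  have "bv_map 2 0 BV_inf_mu = (BV_mu :: 'k comb set)"
    unfolding BV_inf_mu_def BV_mu_def bv_map_coset[OF mu_trees] bv_proj_def bvp_trees[OF mu_trees] ..
  moreover have "bvp (Delta 1 :: 'k comb) = Delta 1"
    by (rule bvp_trees[OF Delta_trees]) simp
  then have "bv_map 1 (- 1) (BV_inf_Delta 1) = (BV_Delta :: 'k comb set)"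
    using bv_map_coset[OF D[of 1]] unfolding BV_inf_Delta_def BV_Delta_def bv_proj_def by simp
  moreover have "bv_map 1 (1 - 2 * int a) (BV_inf_Delta a) = \<zero>\<^bsub>space (BV :: ('k, 'k comb set) operad) 1 (1 - 2 * int a)\<^esub>"
    if "2 \<le> a" for a
  proof -
    have "bvp (Delta a :: 'k comb) = 0"
      using bvp_higher[OF Delta_trees that] by simp
    then have "bv_map 1 (1 - 2 * int a) (BV_inf_Delta a) = coset BV_free BV_ideal 1 (1 - 2 * int a) (0 :: 'k comb)"
      unfolding BV_inf_Delta_def using bv_map_coset[OF D[of a]] that by (simp add: bv_proj_def)
    also have "\<dots> = \<zero>\<^bsub>space BV 1 (1 - 2 * int a)\<^esub>"
      unfolding BV_def by (subst dg_operad_ideal.coset_zero_iff[OF BV_ideal_ideal]) (simp_all add: bv_zero)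
    finally show ?thesis .
  qed
  ultimately show ?thesis
    by (simp add: canonical_on_generators_def)
qed

text \<open>The classes of the generators generate the quotient under composition, permutations and
  linear combinations, which is seen by induction over the free operad above it.\<close>

lemma canonical_unique:
  fixes \<rho> \<rho>' :: "nat \<Rightarrow> int \<Rightarrow> 'k::field_char_0 comb set \<Rightarrow> 'k comb set"
  assumes "dg_operad_hom BV_inf_com BV \<rho>" "canonical_on_generators \<rho>"
    and "dg_operad_hom BV_inf_com BV \<rho>'" "canonical_on_generators \<rho>'"
    and Y: "Y \<in> elts BV_inf_com n d"
  shows "\<rho> n d Y = \<rho>' n d Y"
proof -
  note One_nat_def [simp del]
  let ?c = "coset BV_inf_free (BV_inf_ideal :: nat \<Rightarrow> int \<Rightarrow> 'k comb set)"
  interpret r: dg_operad_hom BV_inf_com BV \<rho>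
    by (rule assms)
  interpret r': dg_operad_hom BV_inf_com BV \<rho>'
    by (rule assms)
  interpret c: dg_operad_hom BV_inf_free BV_inf_com ?c
    unfolding BV_inf_com_def by (rule dg_operad_ideal.quot_hom[OF BV_inf_ideal_ideal])
  have cl: "?c n d x \<in> elts BV_inf_com n d" if "keys x \<subseteq> trees {1..} n d" for n d x
    using c.hom_closed[of x n d] that by simp
  obtain x where x: "keys x \<subseteq> trees {1..} n d" "Y = ?c n d x"
    using Y unfolding BV_inf_elts by blast
  from x(1) have "\<rho> n d (?c n d x) = \<rho>' n d (?c n d x)"
  proof (induction rule: free_induct)
    case (zero n d)
    then show ?case
      using c.hom_zero[of n d] r.hom_zero[of n d] r'.hom_zero[of n d] by simp
  next
    case (add n d x y)
    then show ?case
      using lin_mapD(2)[OF c.hom_linear, of x n d y] lin_mapD(2)[OF r.hom_linear cl cl, of x n d y]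
        lin_mapD(2)[OF r'.hom_linear cl cl, of x n d y] by simp
  next
    case (psc n d a x)
    then show ?case
      using lin_mapD(3)[OF c.hom_linear, of x n d a] lin_mapD(3)[OF r.hom_linear cl, of x n d a]
        lin_mapD(3)[OF r'.hom_linear cl, of x n d a] by simp
  next
    case ident
    then show ?case
      using c.hom_ident r.hom_ident r'.hom_ident by simp
  next
    case mu
    then show ?case
      using assms(2,4) unfolding canonical_on_generators_def BV_inf_mu_def by simp
  next
    case (Delta a)
    then consider "a = 1" | "2 \<le> a"
      by fastforce
    then show ?case
      using assms(2,4) unfolding canonical_on_generators_def BV_inf_Delta_def by cases auto
  next
    case (circ m d n e i x y)
    then show ?case
      using c.hom_circ[of x m d y n e i] r.hom_circ[OF cl cl, of x m d y n e i] r'.hom_circ[OF cl cl, of x m d y n e i]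
      by simp
  next
    case (act n d \<sigma> x)
    then show ?case
      using c.hom_act[of x n d \<sigma>] r.hom_act[OF cl, of x n d \<sigma>] r'.hom_act[OF cl, of x n d \<sigma>] by simp
  qed
  then show ?thesis
    by (simp add: x(2))
qed

theorem theorem5p3p1:
  shows "formal (BV_inf_com :: ('k::field_char_0, 'k comb set) operad) \<and>
    (\<exists>\<psi>. operad_iso (cohomology (BV_inf_com :: ('k, 'k comb set) operad))
           (BV :: ('k, 'k comb set) operad) \<psi>) \<and>
    (\<exists>\<pi>. quasi_iso (BV_inf_com :: ('k, 'k comb set) operad) (BV :: ('k, 'k comb set) operad) \<pi> \<and>
      surjective_hom BV_inf_com BV \<pi> \<and>
      canonical_on_generators \<pi> \<and>
      (\<forall>\<rho>. dg_operad_hom BV_inf_com BV \<rho> \<and> canonical_on_generators \<rho> \<longrightarrow>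
        (\<forall>n d. \<forall>x\<in>elts BV_inf_com n d. \<rho> n d x = \<pi> n d x)))"
proof -
  let ?P = "BV_inf_com :: ('k, 'k comb set) operad" and ?Q = "BV :: ('k, 'k comb set) operad"
  let ?c = "coset BV_inf_free (BV_inf_ideal :: nat \<Rightarrow> int \<Rightarrow> 'k comb set)"
  interpret h: dg_operad_hom ?P ?Q bv_map
    by (rule bv_map_hom)
  have Q: "dif ?Q n d y = \<zero>\<^bsub>space ?Q n (d + 1)\<^esub>" if y: "y \<in> elts ?Q n d" for n d y
  proof -
    obtain x :: "'k comb" where x: "keys x \<subseteq> trees {1} n d" "y = coset BV_free BV_ideal n d x"
      using y unfolding BV_elts by blast
    have "dif ?Q n d y = coset BV_free BV_ideal n (d + 1) 0"
      using dg_operad_hom.hom_dif[OF dg_operad_ideal.quot_hom[OF BV_ideal_ideal], of x n d] x by (simp add: BV_def)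
    also have "\<dots> = \<zero>\<^bsub>space ?Q n (d + 1)\<^esub>"
      unfolding BV_def by (subst dg_operad_ideal.coset_zero_iff[OF BV_ideal_ideal]) (simp_all add: bv_zero)
    finally show ?thesis .
  qed
  \<comment> \<open>A representative of a cycle of the quotient need not be a cycle; its
    differential merely lies in the ideal, which is the form that \<open>cycle_decomposition\<close>
    expects.\<close>
  have inj: "Y \<in> boundaries ?P n d" if Y: "Y \<in> elts (cycles ?P) n d" "bv_map n d Y = \<zero>\<^bsub>space ?Q n d\<^esub>" for n d Y
  proof -
    obtain z where z: "keys z \<subseteq> trees {1..} n d" "Y = ?c n d z"
      using Y(1) by (auto simp: BV_inf_elts)
    have "?c n (d + 1) (delta z) = \<zero>\<^bsub>space ?P n (d + 1)\<^esub>"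
      using Y(1) z BV_inf_dif_coset[OF z(1)] by simp
    then have dz: "delta z \<in> BV_inf_ideal n (d + 1)"
      using BV_inf_coset_zero_iff[OF delta_trees[OF z(1)]] by simp
    have "coset BV_free BV_ideal n d (bvp z) = \<zero>\<^bsub>space ?Q n d\<^esub>"
      using Y(2) bv_map_coset[OF z(1)] by (simp add: z(2) bv_proj_def)
    then have "bvp z \<in> BV_ideal n d"
      unfolding BV_def using dg_operad_ideal.coset_zero_iff[OF BV_ideal_ideal, of "bvp z" n d] bvp_keys[OF z(1)] by simp
    from cycle_decomposition[OF z(1) dz this] obtain w y where
      w: "w \<in> BV_inf_ideal n d" and y: "keys y \<subseteq> trees {1..} n (d - 1)" and zwy: "z = w + delta y"
      by blast
    have dy: "keys (delta y) \<subseteq> trees {1..} n d"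
      using delta_trees[OF y] by simp
    have "Y = ?c n d (delta y)"
      using dg_operad_ideal.coset_absorb[OF BV_inf_ideal_ideal, of "delta y" n d w] w dy by (simp add: z(2) zwy)
    also have "\<dots> = dif ?P n (d - 1) (?c n (d - 1) y)"
      using BV_inf_dif_coset[OF y] by simp
    finally show ?thesis
      unfolding boundaries_def BV_inf_elts using y by blast
  qed
  \<comment> \<open>An element of BV has a representative without higher generators, whose
    differential vanishes already in the free operad.\<close>
  have surj: "\<exists>Y\<in>elts (cycles ?P) n d. bv_map n d Y = y" if y: "y \<in> elts ?Q n d" for n d y
  proof -
    obtain x where x: "keys x \<subseteq> trees {1} n d" "bv_map n d (?c n d x) = y"
      using bv_map_surj[OF y] by blast
    have x': "keys x \<subseteq> trees {1..} n d"
      using x(1) by (auto simp: trees_def)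
    have "dif ?P n d (?c n d x) = \<zero>\<^bsub>space ?P n (d + 1)\<^esub>"
      using BV_inf_dif_coset[OF x'] delta_labels_1[OF x(1)] BV_inf_coset_zero_iff[of 0 n "d + 1"]
      by (simp add: ideal_zero)
    then have "?c n d x \<in> elts (cycles ?P) n d"
      using x' by (auto simp: BV_inf_elts)
    then show ?thesis
      using x(2) by blast
  qed
  note F = formality_criterion[OF bv_map_hom Q inj surj]
  have "surjective_hom ?P ?Q bv_map"
    unfolding surjective_hom_def
  proof (intro conjI allI bv_map_hom equalityI subsetI)
    show "y \<in> elts ?Q n d" if "y \<in> bv_map n d ` elts ?P n d" for n d y
      using that h.hom_closed by blast
    show "y \<in> bv_map n d ` elts ?P n d" if "y \<in> elts ?Q n d" for n d y
      using surj[OF that] by auto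
  qed
  then show ?thesis
    using F canonical_bv_map canonical_unique[OF _ _ bv_map_hom canonical_bv_map] by blast
qed

end
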